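(* For all $a,r>0$ (arbitrarily small) there exist constants $0<\alpha,\mu,\delta,R<\infty$ with $\delta\le R$ such that the Poisson-Poisson cluster point process with annular clusters $\Phi_\alpha^{R,\delta,\mu}$ on $\mathbb{R}^2$ has intensity $\alpha\mu=a$ and critical radius for percolation $r_c(\Phi_\alpha^{R,\delta,\mu})\le r$. Moreover, for every $a>0$ there exists a point process $\Phi$ on $\mathbb{R}^2$ of intensity $a$ such that $\Phi_a\le_{dcx}\Phi$, where $\Phi_a$ is the homogeneous Poisson point process of intensity $a$, and such that the Boolean model $C(\Phi,r)$ percolates for every $r>0$, i.e. $r_c(\Phi)=0$.
   Context: A point process on $\mathbb{R}^2$ is a random element of the space of Radon (locally finite) counting measures; it has intensity $a$ if its mean measure $B\mapsto\mathsf{E}(\Phi(B))$ is $a$ times Lebesgue measure. The process $\Phi_\alpha^{R,\delta,\mu}$: let $\Phi_\alpha$ be the homogeneous Poisson point process of intensity $\alpha$ on $\mathbb{R}^2$ (cluster centres), and let $0<\delta\le R<\infty$, $0<\mu<\infty$. $\Phi_\alpha^{R,\delta,\mu}$ is the Cox (doubly stochastic Poisson) point process with random intensity measure $\Lambda(\cdot):=\mu\sum_{X\in\Phi_\alpha}U_X(\cdot)$, where $U_X$ is the uniform distribution on the annulus centred at $X$ with inner radius $R-\delta$ and outer radius $R$. Boolean model: $C(\Phi,r):=\bigcup_{X\in\Phi}B_r(X)$ with $B_r(x)$ the Euclidean ball of radius $r$ centred at $x$. It percolates if it contains an unbounded connected subset; $r_c(\Phi):=\inf\{r:\mathsf{P}(C(\Phi,r)\text{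 percolates})>0\}$. Directionally convex order: for $f:\mathbb{R}^k\to\mathbb{R}$ let $\Delta_\epsilon^i f(x):=f(x+\epsilon e_i)-f(x)$ for $\epsilon>0$, $1\le i\le k$, with $e_i$ the canonical basis vectors. A Lebesgue-measurable $f$ is directionally convex (dcx) if $\Delta_\epsilon^i\Delta_\delta^j f(x)\ge0$ for all $x\in\mathbb{R}^k$, $\epsilon,\delta>0$ and $i,j\in\{1,\dots,k\}$. For random vectors $X,Y$ in $\mathbb{R}^k$, $X\le_{dcx}Y$ means $\mathsf{E}(f(X))\le\mathsf{E}(f(Y))$ for all dcx $f$ for which both expectations are finite. For point processes with Radon mean measures, $\Phi_1\le_{dcx}\Phi_2$ means $(\Phi_1(B_1),\dots,\Phi_1(B_k))\le_{dcx}(\Phi_2(B_1),\dots,\Phi_2(B_k))$ for every $k\ge1$ and all bounded Borel sets $B_1,\dots,B_k$. *)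

theory Defs
  imports "HOL-Probability.Probability"
begin

text \<open>
  Configurations on the plane are locally finite measures with values in \<open>{0, 1, 2, \<dots>, \<infinity>}\<close>
  (a point may have a multiplicity).  The sigma-algebra on configurations is generated by the
  evaluations \<open>N \<mapsto> N(B)\<close>, \<open>B\<close> Borel, as in the definition of \<open>subprob_algebra\<close>.

  A point process is represented by its law, a probability measure on \<open>counting_space\<close>;
  equivalently, it is taken in canonical form, as the identity map on the probability space
  \<open>P\<close>.  Intensity, the dcx order and the critical radius depend on the law only.
\<close>

type_synonym plane = "real ^ 2"

definition counting_measures :: "plane measure set" where
  "counting_measures =
     {N. sets N = sets borel \<and> (\<forall>B\<in>sets borel. bounded B \<longrightarrow> emeasure N B \<in> range of_nat)}"

definition counting_space :: "plane measure measure" where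
  "counting_space =
     (SUP B \<in> sets borel. vimage_algebra counting_measures (\<lambda>N. emeasure N B) borel)"

definition point_process :: "plane measure measure \<Rightarrow> bool" where
  "point_process P \<longleftrightarrow> prob_space P \<and> sets P = sets counting_space"

definition has_intensity :: "plane measure measure \<Rightarrow> real \<Rightarrow> bool" where
  "has_intensity P a \<longleftrightarrow>
     (\<forall>B\<in>sets borel. (\<integral>\<^sup>+ N. emeasure N B \<partial>P) = ennreal a * emeasure lborel B)"

text \<open>
  The Poisson probabilities are written out, since \<open>poisson_pmf\<close> requires a positive rate
  and \<open>\<Lambda>(B)\<close> may be \<open>0\<close>.
\<close>

definition poisson_process :: "plane measure \<Rightarrow> plane measure measure \<Rightarrow> bool" where
  "poisson_process \<Lambda> P \<longleftrightarrow>
     sets \<Lambda> = sets borel \<and> (\<forall>B\<in>sets borel. bounded B \<longrightarrow> emeasure \<Lambda> B < \<infinity>) \<and>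
     point_process P \<and>
     (\<forall>B\<in>sets borel. bounded B \<longrightarrow>
        (\<forall>k::nat. measure P {N \<in> space P. emeasure N B = of_nat k} =
           measure \<Lambda> B ^ k / fact k * exp (- measure \<Lambda> B))) \<and>
     (\<forall>(n::nat) B. (\<forall>i<n. B i \<in> sets borel \<and> bounded (B i)) \<longrightarrow> disjoint_family_on B {..<n} \<longrightarrow>
        prob_space.indep_vars P (\<lambda>_. borel) (\<lambda>i N. emeasure N (B i)) {..<n})"

definition homogeneous_poisson :: "real \<Rightarrow> plane measure measure \<Rightarrow> bool" where
  "homogeneous_poisson a P \<longleftrightarrow> poisson_process (scale_measure (ennreal a) lborel) P"

text \<open>
  The Cox process directed by the random measure \<open>\<Lambda>\<close>, defined on the probability space
  \<open>M\<close>: the kernel \<open>K\<close> is the conditional law of the process given the outcome in \<open>M\<close>.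
\<close>

definition cox_process ::
  "'w measure \<Rightarrow> ('w \<Rightarrow> plane measure) \<Rightarrow> plane measure measure \<Rightarrow> bool" where
  "cox_process M \<Lambda> P \<longleftrightarrow>
     prob_space M \<and>
     (\<exists>K. K \<in> measurable M (prob_algebra counting_space) \<and>
          (AE \<omega> in M. poisson_process (\<Lambda> \<omega>) (K \<omega>)) \<and>
          P = M \<bind> K)"

definition annulus :: "real \<Rightarrow> real \<Rightarrow> plane \<Rightarrow> plane set" where
  "annulus R \<delta> x = {y. R - \<delta> \<le> dist x y \<and> dist x y \<le> R}"

text \<open>
  Integration against a configuration \<open>N\<close> is summation over its points, so this is the measure
  \<open>\<mu> \<Sum>\<^bsub>X\<^esub> U\<^bsub>X\<^esub>\<close>, with \<open>U\<^bsub>X\<^esub>\<close> uniform on the annulus centred at \<open>X\<close>.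
\<close>

definition annular_intensity :: "real \<Rightarrow> real \<Rightarrow> real \<Rightarrow> plane measure \<Rightarrow> plane measure" where
  "annular_intensity R \<delta> \<mu> N =
     measure_of UNIV (sets borel)
       (\<lambda>B. ennreal \<mu> * (\<integral>\<^sup>+ x. emeasure (uniform_measure lborel (annulus R \<delta> x)) B \<partial>N))"

lemma emeasure_annular_intensity:
  assumes N: "N \<in> counting_measures" and B: "B \<in> sets borel"
  shows "emeasure (annular_intensity R \<delta> \<mu> N) B =
    ennreal \<mu> * (\<integral>\<^sup>+ x. emeasure (uniform_measure lborel (annulus R \<delta> x)) B \<partial>N)"
proof -
  let ?U = "\<lambda>x. uniform_measure lborel (annulus R \<delta> x)"
  have sN [measurable_cong]: "sets N = sets borel"
    using N by (simp add: counting_measures_def)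
  have rel: "{p::plane \<times> plane. snd p \<in> A \<and> R - \<delta> \<le> dist (fst p) (snd p) \<and> dist (fst p) (snd p) \<le> R}
      \<in> sets (borel \<Otimes>\<^sub>M lborel)" if "A \<in> sets borel" for A
  proof -
    have [measurable]: "A \<in> sets borel" by fact
    have "Measurable.pred (borel \<Otimes>\<^sub>M lborel)
        (\<lambda>p::plane \<times> plane. snd p \<in> A \<and> R - \<delta> \<le> dist (fst p) (snd p) \<and> dist (fst p) (snd p) \<le> R)"
      by measurable
    then show ?thesis by (simp add: pred_def space_pair_measure)
  qed
  have an: "annulus R \<delta> x \<in> sets borel" for x
    unfolding annulus_def by measurable
  have "(\<lambda>x. emeasure lborel (annulus R \<delta> x \<inter> A)) \<in> borel_measurable borel"
    if "A \<in> sets borel" for A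
    using lborel.measurable_emeasure_Pair[OF rel[OF that]]
    by (simp add: annulus_def vimage_def Int_def conj_ac)
  from this this[of UNIV]
  have [measurable]: "(\<lambda>x. emeasure (?U x) A) \<in> borel_measurable borel" if "A \<in> sets borel" for A
    using that an by (simp cong: measurable_cong)
  show ?thesis unfolding annular_intensity_def
  proof (rule emeasure_measure_of_sigma)
    show "sigma_algebra UNIV (sets (borel :: plane measure))"
      using sets.sigma_algebra_axioms[of "borel :: plane measure"] by simp
    show "positive (sets borel) (\<lambda>B. ennreal \<mu> * (\<integral>\<^sup>+ x. emeasure (?U x) B \<partial>N))"
      by (simp add: positive_def)
    show "countably_additive (sets borel) (\<lambda>B. ennreal \<mu> * (\<integral>\<^sup>+ x. emeasure (?U x) B \<partial>N))"
    proof (rule countably_additiveI)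
      fix A :: "nat \<Rightarrow> plane set"
      assume A: "range A \<subseteq> sets borel" "disjoint_family A" "\<Union> (range A) \<in> sets borel"
      have "(\<integral>\<^sup>+ x. emeasure (?U x) (\<Union> (range A)) \<partial>N) = (\<integral>\<^sup>+ x. (\<Sum>i. emeasure (?U x) (A i)) \<partial>N)"
        using A by (intro nn_integral_cong) (simp add: suminf_emeasure)
      also have "\<dots> = (\<Sum>i. \<integral>\<^sup>+ x. emeasure (?U x) (A i) \<partial>N)"
        using A by (intro nn_integral_suminf) (auto intro: measurable_sets_borel)
      finally show "(\<Sum>i. ennreal \<mu> * (\<integral>\<^sup>+ x. emeasure (?U x) (A i) \<partial>N)) =
          ennreal \<mu> * (\<integral>\<^sup>+ x. emeasure (?U x) (\<Union> (range A)) \<partial>N)"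
        by simp
    qed
  qed (use B in auto)
qed

definition annular_cluster_process ::
  "real \<Rightarrow> real \<Rightarrow> real \<Rightarrow> real \<Rightarrow> plane measure measure \<Rightarrow> bool" where
  "annular_cluster_process \<alpha> R \<delta> \<mu> P \<longleftrightarrow>
     (\<exists>C. homogeneous_poisson \<alpha> C \<and> cox_process C (annular_intensity R \<delta> \<mu>) P)"

definition boolean_model :: "plane measure \<Rightarrow> real \<Rightarrow> plane set" where
  "boolean_model N r = (\<Union>x\<in>{x. emeasure N {x} \<noteq> 0}. cball x r)"

definition percolates :: "plane set \<Rightarrow> bool" where
  "percolates S \<longleftrightarrow> (\<exists>T\<subseteq>S. connected T \<and> \<not> bounded T)"

text \<open>Extended-real valued: the infimum of the empty set is \<open>\<infinity>\<close>.\<close>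

definition critical_radius :: "plane measure measure \<Rightarrow> ereal" where
  "critical_radius P =
     Inf {ereal r | r. measure P {N \<in> space P. percolates (boolean_model N r)} > 0}"

text \<open>
  Vectors of length \<open>k\<close> are extensional functions on \<open>{..<k}\<close>, as \<open>k\<close> is a bound variable in
  the dcx order; the completion of the product Borel measure gives Lebesgue measurability.
\<close>

definition increment ::
  "nat \<Rightarrow> real \<Rightarrow> ((nat \<Rightarrow> real) \<Rightarrow> real) \<Rightarrow> (nat \<Rightarrow> real) \<Rightarrow> real" where
  "increment i \<epsilon> f x = f (x(i := x i + \<epsilon>)) - f x"

definition directionally_convex :: "nat \<Rightarrow> ((nat \<Rightarrow> real) \<Rightarrow> real) \<Rightarrow> bool" where
  "directionally_convex k f \<longleftrightarrow>
     f \<in> borel_measurable (completion (Pi\<^sub>M {..<k} (\<lambda>_. lborel))) \<and>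
     (\<forall>x \<in> {..<k} \<rightarrow>\<^sub>E UNIV. \<forall>\<epsilon>>0. \<forall>\<delta>>0. \<forall>i<k. \<forall>j<k. increment i \<epsilon> (increment j \<delta> f) x \<ge> 0)"

definition count_vector :: "nat \<Rightarrow> (nat \<Rightarrow> plane set) \<Rightarrow> plane measure \<Rightarrow> nat \<Rightarrow> real" where
  "count_vector k B N = (\<lambda>i\<in>{..<k}. measure N (B i))"

definition dcx_le :: "plane measure measure \<Rightarrow> plane measure measure \<Rightarrow> bool" where
  "dcx_le P Q \<longleftrightarrow>
     (\<forall>k\<ge>1. \<forall>B. (\<forall>i<k. B i \<in> sets borel \<and> bounded (B i)) \<longrightarrow>
        (\<forall>f. directionally_convex k f \<longrightarrow>
             integrable P (\<lambda>N. f (count_vector k B N)) \<longrightarrow>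
             integrable Q (\<lambda>N. f (count_vector k B N)) \<longrightarrow>
             (\<integral>N. f (count_vector k B N) \<partial>P) \<le> (\<integral>N. f (count_vector k B N) \<partial>Q)))"

end

theory Submission
  imports Defs "HOL-Real_Asymp.Real_Asymp"
begin

text \<open>
  For the clusters let \<open>\<delta> = r / 2\<close>, let \<open>R\<close> be large and \<open>\<alpha>\<close> of order \<open>1 / R\<^sup>2\<close>: a square of side of order
  \<open>R\<close> contains a centre with high probability, and every point of a circle around it has points of the
  process within \<open>r / 2\<close> with high probability, so the Boolean model contains a circle around some
  centre in the square.  The circles of neighbouring squares meet.  Squares at a distance are
  independent, and a multi-scale argument replaces the uniqueness of an infinite cluster: a block of
  squares is bad if it contains two distant bad sub-blocks, so the probabilities of bad blocks decay
  doubly exponentially, and good blocks of all scales form one unbounded connected set.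

  For the second claim each strip \<open>i \<le> y\<^sub>1 < i + 1\<close> and \<open>i \<le> y\<^sub>2 < i + 1\<close> is kept with probability
  \<open>p\<^sub>i\<close>, both strips together and independently over \<open>i\<close>, and the kept strips carry the intensity
  \<open>a / (2 p\<^sub>i)\<close>.  The mean of the intensity is the Lebesgue measure times \<open>a\<close>; replacing a random
  intensity by its mean lowers a process in the dcx order, since a Poisson variable with mean \<open>c\<close> is a
  thinning of one with mean \<open>c / p\<close>.  With \<open>p\<^sub>i = (n + 1)\<^sup>-\<^sup>2\<close> for \<open>2\<^sup>n \<le> i < 2\<^sup>n\<^sup>+\<^sup>1\<close> some strip of each
  large level \<open>n\<close> is kept, and it is so dense that its part of length \<open>2\<^sup>n\<^sup>+\<^sup>2\<close> is covered by balls.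
\<close>

section \<open>Poisson processes with a density\<close>

text \<open>Independence of distant squares is never stated as such. What travels between the scales
  is the bound \<epsilon> ^ card S for every finite family S of pairwise far squares; it keeps its
  form and its distance from one scale to the next, provided that \<epsilon> beats the fourth power
  of the block size. Given the centres, it follows from void probabilities of disjoint unions alone.
  As \<alpha> * \<mu> = a is fixed, a cluster has of order R^2 points in mean but only of order R
  boxes along its circle to hit, so a large R makes \<epsilon> small at any intensity.

  In the dcx comparison the obstacle is integrability of signed test functions. Both processes have
  intensity a, so an affine part has the same mean under both and can be removed; nonnegative
  functions of the counts in disjoint sets remain, and these are integrated in
  \<open>ennreal\<close>. One switch governs both strips of an index because these two cross on the
  diagonal: every kept index then gives a connected set, and arms that are long enough meet the next
  one whichever index is kept there.\<close>

lemma sums_powser_eq_0: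
  fixes c :: "nat \<Rightarrow> real"
  assumes c: "summable (\<lambda>k. \<bar>c k\<bar>)" and 0: "\<And>z. 0 < z \<Longrightarrow> z < 1 \<Longrightarrow> (\<Sum>k. c k * z ^ k) = 0"
  shows "c n = 0"
proof (induction n rule: less_induct)
  case (less n)
  let ?S = "\<Sum>k. \<bar>c k\<bar>"
  \<comment> \<open>The coefficients below n vanish by induction, so dividing the equation by z ^ n
    leaves c n plus z times a series that the absolute sum bounds. The limit z to 0 from the right
    then finishes.\<close>
  have "\<bar>c n\<bar> \<le> z * ?S" if z: "0 < z" "z < 1" for z
  proof -
    have zk: "z ^ k \<le> 1" "0 \<le> z ^ k" for k using z by (auto intro: power_le_one)
    have s: "summable (\<lambda>k. c k * z ^ k)"
      using zk by (intro summable_comparison_test[OF _ c] exI[of _ 0]) (auto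
          simp: abs_mult mult_left_le)
    have s': "summable (\<lambda>k. \<bar>c (k + Suc n)\<bar>)" using c by (rule summable_ignore_initial_segment)
    have s'': "summable (\<lambda>k. \<bar>c (k + Suc n) * z ^ k\<bar>)"
      using zk by (intro summable_comparison_test[OF _ s'] exI[of _ 0]) (auto
          simp: abs_mult mult_left_le)
    have "0 = (\<Sum>k. c (k + Suc n) * z ^ (k + Suc n)) + (\<Sum>k<Suc n. c k * z ^ k)"
      using 0[OF z] suminf_split_initial_segment[OF s, of "Suc n"] by simp
    also have "(\<Sum>k<Suc n. c k * z ^ k) = c n * z ^ n" using less by simp
    also have "(\<Sum>k. c (k + Suc n) * z ^ (k + Suc n)) = (\<Sum>k. (c (k + Suc n) * z ^ k) * z ^ Suc n)"
      by (simp add: power_add mult_ac)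
    also have "\<dots> = (\<Sum>k. c (k + Suc n) * z ^ k) * z ^ Suc n"
      by (rule suminf_mult2[OF summable_rabs_cancel[OF s''], symmetric])
    finally have "c n * z ^ n = - ((\<Sum>k. c (k + Suc n) * z ^ k) * z ^ Suc n)" by linarith
    then have "c n * z ^ n = (- (z * (\<Sum>k. c (k + Suc n) * z ^ k))) * z ^ n" by (simp add: mult_ac)
    moreover have "z ^ n \<noteq> 0" using z by simp
    ultimately have "c n = - (z * (\<Sum>k. c (k + Suc n) * z ^ k))" using mult_right_cancel by blast
    then have "\<bar>c n\<bar> = z * \<bar>\<Sum>k. c (k + Suc n) * z ^ k\<bar>" using z
        by (simp only: abs_minus_cancel abs_mult abs_of_pos)
    also have "\<bar>\<Sum>k. c (k + Suc n) * z ^ k\<bar> \<le> (\<Sum>k. \<bar>c (k + Suc n) * z ^ k\<bar>)"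
      by (rule summable_rabs[OF s''])
    also have "\<dots> \<le> (\<Sum>k. \<bar>c (k + Suc n)\<bar>)"
      using zk by (intro suminf_le s' s'') (auto simp: abs_mult mult_left_le)
    also have "\<dots> \<le> ?S"
      using suminf_split_initial_segment[OF c, of "Suc n"] by (simp add: sum_nonneg)
    finally show ?thesis using z by simp
  qed
  then have "eventually (\<lambda>z. \<bar>c n\<bar> \<le> z * ?S) (at_right 0)"
    unfolding eventually_at_right_field by (intro exI[of _ 1]) simp
  moreover have "((\<lambda>z. z * ?S) \<longlongrightarrow> 0 * ?S) (at_right 0)" by (intro tendsto_intros)
  ultimately have "\<bar>c n\<bar> \<le> 0 * ?S"
    by (intro tendsto_lowerbound) (auto simp: trivial_limit_at_right_real)
  then show ?case by simp
qed

lemma nn_integral_nat_finite: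
  fixes z :: real
  assumes M: "finite_measure M" "sets M = UNIV" and z: "0 \<le> z" "z \<le> 1"
  shows "(\<integral>\<^sup>+k. ennreal z ^ k \<partial>M) = ennreal (\<Sum>k::nat. measure M {k} * z ^ k)"
    and "summable (\<lambda>k. measure M {k})"
proof -
  interpret finite_measure M by fact
  have M': "sets M = sets (count_space UNIV)" using M(2) by simp
  have "(\<lambda>k. measure M {k}) sums measure M (\<Union>k. {k})"
    using M(2) by (intro finite_measure_UNION) (auto simp: disjoint_family_on_def)
  then show s: "summable (\<lambda>k. measure M {k})" by (simp add: sums_iff)
  have M_eq: "M = density (count_space UNIV) (\<lambda>k. emeasure M {k})"
    by (rule measure_eqI_countable[of _ UNIV])
        (use M' in \<open>auto simp: emeasure_density nn_integral_count_space_indicator\<close>)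
  have "(\<integral>\<^sup>+k. ennreal z ^ k \<partial>M) = (\<integral>\<^sup>+k. ennreal z ^ k \<partial>density (count_space UNIV) (\<lambda>k.
      emeasure M {k}))"
    using M_eq by simp
  also have "\<dots> = (\<Sum>k. emeasure M {k} * ennreal z ^ k)"
    by (simp add: nn_integral_density nn_integral_count_space_nat)
  also have "\<dots> = (\<Sum>k. ennreal (measure M {k} * z ^ k))"
    using z by (simp add: emeasure_eq_measure ennreal_mult ennreal_power)
  also have "\<dots> = ennreal (\<Sum>k. measure M {k} * z ^ k)"
    using z by (intro suminf_ennreal2 summable_comparison_test[OF _ s] exI[of _ 0])
      (auto intro!: mult_left_le power_le_one)
  finally show "(\<integral>\<^sup>+k. ennreal z ^ k \<partial>M) = ennreal (\<Sum>k. measure M {k} * z ^ k)" .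
qed

text \<open>The differences of the point masses are the coefficients of a power series that vanishes
  on (0, 1). Finite measures rather than laws are compared, because in the joint identification
  below a law is weighted by a density.\<close>

lemma measure_eqI_pgf:
  fixes M N :: "nat measure"
  assumes M: "finite_measure M" "sets M = UNIV" and N: "finite_measure N" "sets N = UNIV"
    and eq: "\<And>z::real. 0 < z \<Longrightarrow> z < 1 \<Longrightarrow> (\<integral>\<^sup>+k. ennreal z ^ k \<partial>M) = (\<integral>\<^sup>+k. ennreal z ^ k \<partial>N)"
  shows "M = N"
proof -
  interpret M: finite_measure M by fact
  interpret N: finite_measure N by fact
  note sM = nn_integral_nat_finite(2)[OF M, of 0, simplified]
  note sN = nn_integral_nat_finite(2)[OF N, of 0, simplified]
  have "measure M {n} - measure N {n} = 0" for n
  proof (rule sums_powser_eq_0[of "\<lambda>n. measure M {n} - measure N {n}"])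
    show "summable (\<lambda>k. \<bar>measure M {k} - measure N {k}\<bar>)"
    proof (rule summable_comparison_test[OF _ summable_add[OF sM sN]], intro exI[of _ 0] allI impI)
      have "\<bar>a - b\<bar> \<le> a + b" if "0 \<le> a" "0 \<le> b" for a b :: real using that by linarith
      then show "norm \<bar>measure M {k} - measure N {k}\<bar> \<le> measure M {k} + measure N {k}" for k by simp
    qed
    fix z :: real assume z: "0 < z" "z < 1"
    have s: "summable (\<lambda>k. measure M {k} * z ^ k)"
      using z by (intro summable_comparison_test[OF _ sM] exI[of _ 0]) (auto
          intro!: mult_left_le power_le_one)
    have s': "summable (\<lambda>k. measure N {k} * z ^ k)"
      using z by (intro summable_comparison_test[OF _ sN] exI[of _ 0]) (auto
          intro!: mult_left_le power_le_one)
    have "(\<Sum>k. measure M {k} * z ^ k) = (\<Sum>k. measure N {k} * z ^ k)"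
      using eq[OF z] z s s' by (simp add: nn_integral_nat_finite(1)[OF M]
          nn_integral_nat_finite(1)[OF N] suminf_nonneg)
    then show "(\<Sum>k. (measure M {k} - measure N {k}) * z ^ k) = 0"
      using suminf_diff[OF s s'] by (simp add: algebra_simps)
  qed
  then show ?thesis
    using M N by (intro measure_eqI_countable[of _ UNIV])
      (auto simp: M.emeasure_eq_measure N.emeasure_eq_measure)
qed

text \<open>The rate 0 has to be included: it occurs for null sets and for regions that only meet
  strips which are switched off.\<close>

definition pois :: "real \<Rightarrow> nat pmf" where
  "pois l = (if l \<le> 0 then return_pmf 0 else poisson_pmf l)"

lemma pmf_pois: "0 \<le> l \<Longrightarrow> pmf (pois l) k = l ^ k / fact k * exp (- l)"
  by (cases "l = 0"; cases k) (auto simp: pois_def)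

lemma pgf_pois:
  assumes l: "0 \<le> l" and z: "0 \<le> z" "z \<le> 1"
  shows "(\<integral>\<^sup>+k. ennreal z ^ k \<partial>measure_pmf (pois l)) = ennreal (exp (- (l * (1 - z))))"
proof -
  have "(\<integral>\<^sup>+k. ennreal z ^ k \<partial>measure_pmf (pois l)) = ennreal (\<Sum>k. measure (pois l) {k} * z ^ k)"
    using z by (intro nn_integral_nat_finite) (auto
        intro: prob_space.finite_measure measure_pmf.prob_space_axioms)
  also have "(\<lambda>k. measure (pois l) {k} * z ^ k) = (\<lambda>k. exp (- l) * ((l * z) ^ k /\<^sub>R fact k))"
    using l by (simp add: measure_pmf_single pmf_pois power_mult_distrib field_simps fun_eq_iff)
  also have "(\<Sum>k. exp (- l) * ((l * z) ^ k /\<^sub>R fact k)) = exp (- l) * exp (l * z)"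
    unfolding exp_def by (intro suminf_mult summable_exp_generic)
  also have "\<dots> = exp (- (l * (1 - z)))" by (simp add: exp_add[symmetric] algebra_simps)
  finally show ?thesis .
qed

lemma nn_integral_pois:
  assumes l: "0 \<le> l"
  shows "(\<integral>\<^sup>+k. of_nat k \<partial>measure_pmf (pois l)) = ennreal l"
proof -
  have "(\<integral>\<^sup>+k. of_nat k \<partial>measure_pmf (pois l)) = (\<Sum>k. of_nat k * ennreal (pmf (pois l) k))"
    by (simp add: nn_integral_measure_pmf nn_integral_count_space_nat mult.commute)
  also have "\<dots> = (\<Sum>k. of_nat (Suc k) * ennreal (pmf (pois l) (Suc k)))"
    by (subst suminf_offset[where i=1]) auto
  also have "\<dots> = (\<Sum>k. ennreal l * ennreal (pmf (pois l) k))"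
  proof (intro suminf_cong)
    fix k
    have "real (Suc k) * pmf (pois l) (Suc k) = l * pmf (pois l) k"
      using l by (simp add: pmf_pois field_simps del: of_nat_Suc)
    then show "of_nat (Suc k) * ennreal (pmf (pois l) (Suc k)) =
        ennreal l * ennreal (pmf (pois l) k)"
      using l by (metis ennreal_mult ennreal_of_nat_eq_real_of_nat of_nat_0_le_iff pmf_nonneg)
  qed
  also have "\<dots> = ennreal l * (\<integral>\<^sup>+k. ennreal (pmf (pois l) k) \<partial>count_space UNIV)"
    by (simp add: nn_integral_count_space_nat)
  also have "\<dots> = ennreal l" by (simp add: nn_integral_pmf)
  finally show ?thesis .
qed

text \<open>The coordinates are identified one at a time, the others being kept as a density.\<close>

lemma joint_pois_of_pgf:
  fixes X :: "'i \<Rightarrow> 'a \<Rightarrow> nat"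
  assumes M: "prob_space M" and fin: "finite J" "finite T" "J \<inter> T = {}"
    and X: "\<And>l. l \<in> J \<union> T \<Longrightarrow> X l \<in> measurable M (count_space UNIV)"
    and lam: "\<And>l. l \<in> J \<union> T \<Longrightarrow> 0 \<le> la l"
    and pgf: "\<And>z. (\<And>l. 0 \<le> z l \<and> z l \<le> (1::real)) \<Longrightarrow>
      (\<integral>\<^sup>+\<omega>. (\<Prod>l\<in>J \<union> T. ennreal (z l) ^ X l \<omega>) \<partial>M) =
          (\<Prod>l\<in>J \<union> T. ennreal (exp (- (la l * (1 - z l)))))"
    and z: "\<And>l. 0 \<le> z l \<and> z l \<le> (1::real)"
  shows "(\<integral>\<^sup>+\<omega>. (\<Prod>l\<in>J. indicator (A l) (X l \<omega>)) * (\<Prod>l\<in>T. ennreal (z l) ^ X l \<omega>) \<partial>M) =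
    (\<Prod>l\<in>J. emeasure (pois (la l)) (A l)) * (\<Prod>l\<in>T. ennreal (exp (- (la l * (1 - z l)))))"
  using fin X lam pgf z
proof (induction J arbitrary: T z rule: finite_induct)
  case empty
  then show ?case by simp
next
  case (insert j J T z)
  interpret prob_space M by fact
  have [measurable]: "\<And>l. l \<in> J \<union> T \<Longrightarrow> X l \<in> measurable M (count_space UNIV)"
    "X j \<in> measurable M (count_space UNIV)"
    using insert.prems(3) by auto
  have eqU: "J \<union> insert j T = insert j J \<union> T" by auto
  \<comment> \<open>V collects the coordinates other than j: those already identified enter through
    indicators, those still to come through powers. Both V and the constant c are at most 1, which
    keeps the two measures on the values of \<open>X j\<close> finite.\<close>
  define V where "V \<omega> = (\<Prod>l\<in>J. indicator (A l) (X l \<omega>)) * (\<Prod>l\<in>T. ennreal (z l) ^ X l \<omega>)" for \<omega>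
  define c where "c = (\<Prod>l\<in>J. emeasure (pois (la l)) (A l)) * (\<Prod>l\<in>T. ennreal (exp (- (la l *
      (1 - z l)))))"
  have [measurable]: "V \<in> borel_measurable M" unfolding V_def by measurable
  have "V \<omega> \<le> 1 * 1" for \<omega> unfolding V_def
    using insert.prems(6) by (intro mult_mono prod_le_1)
      (auto simp: ennreal_power ennreal_le_1 indicator_def intro!: power_le_one)
  then have V1: "V \<omega> \<le> 1" for \<omega> by simp
  have "c \<le> 1 * 1" unfolding c_def
    using insert.prems(6,4) by (intro mult_mono prod_le_1)
      (auto simp: ennreal_le_1 measure_pmf.emeasure_eq_measure)
  then have c1: "c \<le> 1" by simp
  define M1 where "M1 = distr (density M V) (count_space UNIV) (X j)"
  have VX: "X j \<in> measurable (density M V) (count_space UNIV)" by simp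
  have "emeasure M1 UNIV = (\<integral>\<^sup>+\<omega>. V \<omega> \<partial>M)"
    unfolding M1_def by (subst emeasure_distr[OF VX]) (auto simp: emeasure_density
        intro!: nn_integral_cong)
  also have "\<dots> \<le> (\<integral>\<^sup>+\<omega>. 1 \<partial>M)" using V1 by (intro nn_integral_mono) auto
  also have "\<dots> < \<infinity>" by (simp add: emeasure_space_1)
  finally have M1: "finite_measure M1" "sets M1 = UNIV"
    by (auto intro!: finite_measureI simp: M1_def)
  define M2 where "M2 = scale_measure c (measure_pmf (pois (la j)))"
  have "emeasure M2 UNIV < \<infinity>" using c1
    by (simp add: M2_def space_scale_measure) (metis ennreal_one_less_top le_less_trans
        measure_pmf.emeasure_space_1 mult.right_neutral space_measure_pmf)
  then have M2: "finite_measure M2" "sets M2 = UNIV"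
    by (auto intro!: finite_measureI simp: M2_def space_scale_measure)
  \<comment> \<open>The induction hypothesis with j moved from J to T and its variable set to u
    computes the generating function of the weighted law of \<open>X j\<close>: it is c times that
    of a Poisson variable.\<close>
  have "M1 = M2"
  proof (rule measure_eqI_pgf[OF M1 M2])
    fix u :: real assume u: "0 < u" "u < 1"
    define z' where "z' = z(j := u)"
    have jT: "j \<notin> T" using insert.prems by auto
    have z': "(\<Prod>l\<in>T. ennreal (z' l) ^ X l \<omega>) = (\<Prod>l\<in>T. ennreal (z l) ^ X l \<omega>)"
       "(\<Prod>l\<in>T. ennreal (exp (- (la l * (1 - z' l))))) =
           (\<Prod>l\<in>T. ennreal (exp (- (la l * (1 - z l)))))" for \<omega>
      using jT by (auto intro!: prod.cong simp: z'_def)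
    have "(\<integral>\<^sup>+k. ennreal u ^ k \<partial>M1) = (\<integral>\<^sup>+\<omega>. V \<omega> * ennreal u ^ X j \<omega> \<partial>M)"
      unfolding M1_def by (subst nn_integral_distr[OF VX]) (auto simp: nn_integral_density)
    also have "\<dots> = (\<integral>\<^sup>+\<omega>. (\<Prod>l\<in>J. indicator (A l) (X l \<omega>)) * (\<Prod>l\<in>insert j T.
        ennreal (z' l) ^ X l \<omega>) \<partial>M)"
      using jT insert.prems(1) by (simp add: z' V_def mult_ac) (simp add: z'_def)
    also have "\<dots> = (\<Prod>l\<in>J. emeasure (pois (la l)) (A l)) * (\<Prod>l\<in>insert j T. ennreal (exp (- (la l *
        (1 - z' l)))))"
      using insert.prems insert.hyps u unfolding eqU[symmetric]
      by (intro insert.IH) (auto simp: z'_def)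
    also have "\<dots> = c * ennreal (exp (- (la j * (1 - u))))"
      using jT insert.prems(1) by (simp add: z' c_def mult_ac) (simp add: z'_def)
    also have "\<dots> = (\<integral>\<^sup>+k. ennreal u ^ k \<partial>M2)"
      unfolding M2_def using u insert.prems(4)[of j]
          by (simp add: nn_integral_scale_measure pgf_pois)
    finally show "(\<integral>\<^sup>+k. ennreal u ^ k \<partial>M1) = (\<integral>\<^sup>+k. ennreal u ^ k \<partial>M2)" .
  qed
  have "(\<integral>\<^sup>+\<omega>. (\<Prod>l\<in>insert j J. indicator (A l) (X l \<omega>)) * (\<Prod>l\<in>T. ennreal (z l) ^ X l \<omega>) \<partial>M)
      = (\<integral>\<^sup>+\<omega>. V \<omega> * indicator (A j) (X j \<omega>) \<partial>M)"
    using insert.hyps by (simp add: V_def mult_ac)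
  also have "\<dots> = (\<integral>\<^sup>+\<omega>. V \<omega> * indicator (X j -` A j \<inter> space M) \<omega> \<partial>M)"
    by (intro nn_integral_cong) (auto simp: indicator_def)
  also have "\<dots> = emeasure (density M V) (X j -` A j \<inter> space M)"
    by (subst emeasure_density) auto
  also have "\<dots> = emeasure M1 (A j)"
    unfolding M1_def by (subst emeasure_distr[OF VX]) auto
  also have "\<dots> = c * emeasure (pois (la j)) (A j)" by (simp add: \<open>M1 = M2\<close> M2_def)
  finally show ?case using insert.hyps by (simp add: c_def mult_ac)
qed

section \<open>Poisson numbers of independent points\<close>

lemma nn_integral_PiM_prod:
  fixes M :: "'i \<Rightarrow> 'a measure"
  assumes M: "\<And>i. prob_space (M i)" and J: "finite J"
    and f: "\<And>i. i \<in> J \<Longrightarrow> f i \<in> borel_measurable (M i)"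
  shows "(\<integral>\<^sup>+x. (\<Prod>i\<in>J. f i (x i)) \<partial>PiM UNIV M) = (\<Prod>i\<in>J. \<integral>\<^sup>+x. f i x \<partial>M i)"
proof -
  interpret product_prob_space M UNIV by (rule product_prob_spaceI) (rule M)
  have "(\<integral>\<^sup>+x. (\<Prod>i\<in>J. f i (x i)) \<partial>PiM UNIV M) = (\<integral>\<^sup>+x. (\<Prod>i\<in>J. f i (restrict x J i)) \<partial>PiM UNIV M)"
    by (intro nn_integral_cong prod.cong) auto
  also have "\<dots> = (\<integral>\<^sup>+x. (\<Prod>i\<in>J. f i (x i)) \<partial>distr (PiM UNIV M) (PiM J M) (\<lambda>x. restrict x J))"
    using f by (intro nn_integral_distr[symmetric] measurable_restrict_subset
        borel_measurable_prod_ennreal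
      measurable_compose[OF measurable_component_singleton]) auto
  also have "\<dots> = (\<integral>\<^sup>+x. (\<Prod>i\<in>J. f i (x i)) \<partial>PiM J M)"
    using distr_PiM_restrict_finite[OF J] by simp
  also have "\<dots> = (\<Prod>i\<in>J. \<integral>\<^sup>+x. f i x \<partial>M i)" by (rule product_nn_integral_prod[OF J f])
  finally show ?thesis .
qed

text \<open>
  A Poisson number of independent points is drawn in each of countably many blocks: an outcome
  \<open>w\<close> gives for the block \<open>i\<close> the number \<open>fst (w i)\<close> of points and a sequence \<open>snd (w i)\<close>, of which
  only that many members count.
\<close>

definition points_block :: "real \<Rightarrow> 'x measure \<Rightarrow> (nat \<times> (nat \<Rightarrow> 'x)) measure" where
  "points_block \<kappa> \<nu> = measure_pmf (pois \<kappa>) \<Otimes>\<^sub>M PiM (UNIV :: nat set) (\<lambda>_. \<nu>)"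

definition points_space :: "(nat \<Rightarrow> real) \<Rightarrow> (nat \<Rightarrow> 'x measure) \<Rightarrow> (nat \<Rightarrow> nat \<times> (nat \<Rightarrow> 'x)) measure"
    where
  "points_space \<kappa> \<nu> = PiM (UNIV :: nat set) (\<lambda>i. points_block (\<kappa> i) (\<nu> i))"

text \<open>Extended values, since infinitely many blocks may put points into E. The truncation
  \<open>partial_count\<close> to n blocks stays a natural number, as an exponent in a generating
  function must be.\<close>

definition points_count :: "'x set \<Rightarrow> (nat \<Rightarrow> nat \<times> (nat \<Rightarrow> 'x)) \<Rightarrow> ennreal" where
  "points_count E w = (\<Sum>i. \<Sum>j. if j < fst (w i) \<and> snd (w i) j \<in> E then 1 else 0)"

definition partial_count :: "nat \<Rightarrow> 'x set \<Rightarrow> (nat \<Rightarrow> nat \<times> (nat \<Rightarrow> 'x)) \<Rightarrow> nat" where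
  "partial_count n E w = (\<Sum>i<n. \<Sum>j<fst (w i). of_bool (snd (w i) j \<in> E))"

lemma points_count_eq_SUP: "points_count E w = (SUP n. of_nat (partial_count n E w))"
proof -
  have "(\<Sum>j. if j < fst (w i) \<and> snd (w i) j \<in> E then 1 else 0) =
      (of_nat (\<Sum>j<fst (w i). of_bool (snd (w i) j \<in> E)) :: ennreal)" for i
    by (subst suminf_finite[of "{..<fst (w i)}"]) (auto simp: of_bool_def intro!: sum.cong)
  then show ?thesis by (simp add: points_count_def partial_count_def suminf_eq_SUP)
qed

lemma incseq_partial_count: "incseq (\<lambda>n. partial_count n E w)"
  by (rule incseq_SucI) (simp add: partial_count_def)

text \<open>An increasing bounded sequence of natural numbers is eventually constant. Hence powers
  of the partial counts converge to powers of the count for every base in [0, 1], the base 0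
  included.\<close>

lemma points_count_finite_iff:
  "points_count E w < \<infinity> \<longleftrightarrow> (\<exists>k. points_count E w = of_nat k \<and> eventually (\<lambda>n. partial_count n E w =
      k) sequentially)"
proof
  assume "points_count E w < \<infinity>"
  then obtain b where b: "points_count E w = ennreal b" "0 \<le> b" by (cases "points_count E w") auto
  have le: "real (partial_count n E w) \<le> b" for n
  proof -
    have "of_nat (partial_count n E w) \<le> points_count E w"
      unfolding points_count_eq_SUP by (rule SUP_upper) simp
    then show ?thesis using b by (simp add: ennreal_of_nat_eq_real_of_nat)
  qed
  define k where "k = Max (range (\<lambda>n. partial_count n E w))"
  have fin: "finite (range (\<lambda>n. partial_count n E w))"
  proof (rule finite_subset)
    show "range (\<lambda>n. partial_count n E w) \<subseteq> {..nat \<lceil>b\<rceil>}"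
      using order_trans[OF le real_nat_ceiling_ge] by (auto simp del: of_nat_nat)
  qed simp
  have "k \<in> range (\<lambda>n. partial_count n E w)" unfolding k_def by (rule Max_in[OF fin]) simp
  then obtain n0 where n0: "k = partial_count n0 E w" by auto
  have kub: "partial_count n E w \<le> k" for n unfolding k_def by (rule Max_ge[OF fin]) simp
  have ev: "partial_count n E w = k" if "n \<ge> n0" for n
    using incseqD[OF incseq_partial_count that, of E w] kub[of n] n0 by simp
  have "points_count E w = of_nat k"
    unfolding points_count_eq_SUP
  proof (rule antisym)
    show "(SUP n. of_nat (partial_count n E w)) \<le> (of_nat k :: ennreal)"
      using kub by (intro SUP_least) simp
    show "(of_nat k :: ennreal) \<le> (SUP n. of_nat (partial_count n E w))"
      using n0 by (intro SUP_upper2[of n0]) auto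
  qed
  then show "\<exists>k. points_count E w = of_nat k \<and> eventually (\<lambda>n. partial_count n E w =
      k) sequentially"
    using ev by (auto simp: eventually_sequentially)
qed (auto simp: of_nat_less_top)

context
  fixes \<kappa> :: "nat \<Rightarrow> real" and \<nu> :: "nat \<Rightarrow> 'x measure" and X :: "'x measure"
  assumes \<kappa>: "\<And>i. 0 \<le> \<kappa> i" and \<nu>: "\<And>i. prob_space (\<nu> i)" and sets_\<nu>[measurable_cong]:
      "\<And>i. sets (\<nu> i) = sets X"
begin

lemma prob_space_points_block: "prob_space (points_block (\<kappa> i) (\<nu> i))"
proof -
  show ?thesis unfolding points_block_def
    by (intro prob_space_pair prob_space_PiM measure_pmf.prob_space_axioms \<nu>)
qed

lemma prob_space_points_space: "prob_space (points_space \<kappa> \<nu>)"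
  unfolding points_space_def by (rule prob_space_PiM) (rule prob_space_points_block)

lemma measurable_points [measurable]:
  "(\<lambda>w. fst (w i)) \<in> measurable (points_space \<kappa> \<nu>) (count_space UNIV)"
  "(\<lambda>w. snd (w i) j) \<in> measurable (points_space \<kappa> \<nu>) X"
proof -
  have 1: "(\<lambda>w. w i) \<in> measurable (points_space \<kappa> \<nu>) (points_block (\<kappa> i) (\<nu> i))"
    unfolding points_space_def by simp
  show "(\<lambda>w. fst (w i)) \<in> measurable (points_space \<kappa> \<nu>) (count_space UNIV)"
    by (rule measurable_compose[OF 1]) (simp add: points_block_def measurable_fst'')
  have "(\<lambda>b. snd b j) \<in> measurable (points_block (\<kappa> i) (\<nu> i)) X"
    unfolding points_block_def measurable_cong_sets[OF refl sets_\<nu>[of i], symmetric] by measurable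
  then show "(\<lambda>w. snd (w i) j) \<in> measurable (points_space \<kappa> \<nu>) X"
    by (rule measurable_compose[OF 1])
qed

lemma measurable_points_count [measurable]:
  assumes [measurable]: "E \<in> sets X"
  shows "points_count E \<in> borel_measurable (points_space \<kappa> \<nu>)"
  unfolding points_count_def[abs_def] by measurable

lemma measurable_partial_count [measurable]:
  assumes [measurable]: "E \<in> sets X"
  shows "partial_count n E \<in> measurable (points_space \<kappa> \<nu>) (count_space UNIV)"
proof -
  have "(\<lambda>w. \<Sum>j<fst (w i). of_bool (snd (w i) j \<in> E) :: nat) \<in> measurable (points_space \<kappa> \<nu>)
      (count_space UNIV)" for i
    by (rule measurable_compose_countable[where g="\<lambda>w. fst (w i)"
        and f="\<lambda>k w. \<Sum>j<k. of_bool (snd (w i) j \<in> E)"])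
       measurable
  then show ?thesis unfolding partial_count_def[abs_def] by measurable
qed

text \<open>Conditionally on k points the mean is the k-th power of the mean of g, so the result is
  the Poisson generating function at that mean: the Laplace functional of a single block.\<close>

lemma nn_integral_points_block:
  assumes [measurable]: "g \<in> borel_measurable X" and g: "\<And>x. 0 \<le> g x \<and> g x \<le> (1::real)"
  shows "(\<integral>\<^sup>+b. (\<Prod>j<fst b. ennreal (g (snd b j))) \<partial>points_block (\<kappa> i) (\<nu> i)) =
    ennreal (exp (- (\<kappa> i * (1 - (\<integral>x. g x \<partial>\<nu> i)))))"
proof -
  interpret nu: prob_space "\<nu> i" by (rule \<nu>)
  interpret P: prob_space "PiM (UNIV :: nat set) (\<lambda>_. \<nu> i)" by (intro prob_space_PiM \<nu>)
  have [measurable]: "(\<lambda>b. \<Prod>j<fst b. ennreal (g (snd b j))) \<in>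
      borel_measurable (measure_pmf (pois (\<kappa> i)) \<Otimes>\<^sub>M PiM (UNIV :: nat set) (\<lambda>_. \<nu> i))"
    by (rule measurable_compose_countable[where g=fst and f="\<lambda>k b. \<Prod>j<k. ennreal (g (snd b j))"])
       measurable
  have int: "integrable (\<nu> i) g" using g by (intro nu.integrable_const_bound[of _ 1]) auto
  define q where "q = (\<integral>x. g x \<partial>\<nu> i)"
  have q: "0 \<le> q" "q \<le> 1" unfolding q_def
    using g int nu.prob_space by (auto intro!: integral_nonneg_AE nu.integral_le_const)
  have "(\<integral>\<^sup>+b. (\<Prod>j<fst b. ennreal (g (snd b j))) \<partial>points_block (\<kappa> i) (\<nu> i)) =
      (\<integral>\<^sup>+k. \<integral>\<^sup>+z. (\<Prod>j<k. ennreal (g (z j))) \<partial>PiM (UNIV :: nat set) (\<lambda>_.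
          \<nu> i) \<partial>measure_pmf (pois (\<kappa> i)))"
    unfolding points_block_def by (subst P.nn_integral_fst[symmetric]) auto
  also have "\<dots> = (\<integral>\<^sup>+k. ennreal q ^ k \<partial>measure_pmf (pois (\<kappa> i)))"
  proof (intro nn_integral_cong)
    fix k
    have "(\<integral>\<^sup>+z. (\<Prod>j<k. ennreal (g (z j))) \<partial>PiM (UNIV :: nat set) (\<lambda>_. \<nu> i)) =
        (\<Prod>j<k. \<integral>\<^sup>+x. ennreal (g x) \<partial>\<nu> i)"
      by (rule nn_integral_PiM_prod) (auto intro: \<nu>)
    also have "(\<integral>\<^sup>+x. ennreal (g x) \<partial>\<nu> i) = ennreal q"
      unfolding q_def using g int by (intro nn_integral_eq_integral) auto
    finally show "(\<integral>\<^sup>+z. (\<Prod>j<k. ennreal (g (z j))) \<partial>PiM (UNIV :: nat set) (\<lambda>_. \<nu> i)) =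
        ennreal q ^ k" by simp
  qed
  also have "\<dots> = ennreal (exp (- (\<kappa> i * (1 - q))))" by (rule pgf_pois[OF \<kappa> q])
  finally show ?thesis by (simp add: q_def)
qed

text \<open>A point lies in at most one of the sets, so at most one factor differs from 1. The right
  side is affine in the indicators, so that it can be integrated term by term.\<close>

lemma prod_power_disjoint:
  fixes z :: "'l \<Rightarrow> real"
  assumes "finite L" "disjoint_family_on E L"
  shows "(\<Prod>l\<in>L. z l ^ of_bool (x \<in> E l)) = 1 - (\<Sum>l\<in>L. (1 - z l) * indicator (E l) x)"
  using assms
proof (induction L)
  case (insert l L)
  have IH: "(\<Prod>l\<in>L. z l ^ of_bool (x \<in> E l)) = 1 - (\<Sum>l\<in>L. (1 - z l) * indicator (E l) x)"
    using insert by (intro insert.IH) (simp add: disjoint_family_on_def)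
  show ?case unfolding prod.insert[OF insert.hyps] sum.insert[OF insert.hyps] IH
  proof (cases "x \<in> E l")
    case True
    then have "x \<notin> E l'" if "l' \<in> L" for l'
      using insert that by (auto simp: disjoint_family_on_def)
    then have "(\<Sum>l\<in>L. (1 - z l) * indicator (E l) x) = 0" by (intro sum.neutral) simp
    then show "z l ^ of_bool (x \<in> E l) * (1 - (\<Sum>l\<in>L. (1 - z l) * indicator (E l) x)) =
        1 - ((1 - z l) * indicator (E l) x + (\<Sum>l\<in>L. (1 - z l) * indicator (E l) x))"
      unfolding \<open>_ = 0\<close> using True by simp
  qed simp
qed simp

text \<open>Reordering the products makes the integrand a product over blocks, which are
  independent. The exponents then add up over the blocks and split over the disjoint sets E l; this
  splitting is the independence of the counts, and its factors are Poisson.\<close>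

lemma pgf_partial_count:
  fixes z :: "'l \<Rightarrow> real"
  assumes L: "finite L" "disjoint_family_on E L" and [measurable]: "\<And>l. l \<in> L \<Longrightarrow> E l \<in> sets X"
    and z: "\<And>l. 0 \<le> z l \<and> z l \<le> 1"
  shows "(\<integral>\<^sup>+w. (\<Prod>l\<in>L. ennreal (z l) ^ partial_count n (E l) w) \<partial>points_space \<kappa> \<nu>) =
    (\<Prod>l\<in>L. ennreal (exp (- ((\<Sum>i<n. \<kappa> i * measure (\<nu> i) (E l)) * (1 - z l)))))"
proof -
  define g where "g x = (\<Prod>l\<in>L. z l ^ of_bool (x \<in> E l))" for x
  have [measurable]: "g \<in> borel_measurable X" unfolding g_def[abs_def] by measurable
  have g: "0 \<le> g x \<and> g x \<le> 1" for x
    unfolding g_def using z by (auto intro!: prod_nonneg prod_le_1 simp: of_bool_def)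
  have int: "1 - (\<integral>x. g x \<partial>\<nu> i) = (\<Sum>l\<in>L. (1 - z l) * measure (\<nu> i) (E l))" for i
  proof -
    interpret nu: prob_space "\<nu> i" by (rule \<nu>)
    have sE: "E l \<in> sets (\<nu> i)" if "l \<in> L" for l using that by simp
    have i1: "integrable (\<nu> i) (\<lambda>x. (1 - z l) * indicator (E l) x :: real)" if "l \<in> L" for l
      using sE[OF that] by (intro integrable_mult_right integrable_real_indicator) (auto
          simp: nu.emeasure_eq_measure)
    have "(\<integral>x. g x \<partial>\<nu> i) = (\<integral>x. 1 - (\<Sum>l\<in>L. (1 - z l) * indicator (E l) x) \<partial>\<nu> i)"
      unfolding g_def using prod_power_disjoint[OF L] by simp
    also have "\<dots> = 1 - (\<Sum>l\<in>L. (1 - z l) * measure (\<nu> i) (E l))"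
      using i1 sE by (subst Bochner_Integration.integral_diff)
        (auto simp: nu.prob_space Bochner_Integration.integral_sum)
    finally show ?thesis by simp
  qed
  have "(\<integral>\<^sup>+w. (\<Prod>l\<in>L. ennreal (z l) ^ partial_count n (E l) w) \<partial>points_space \<kappa> \<nu>) =
      (\<integral>\<^sup>+w. (\<Prod>i<n. \<Prod>j<fst (w i). ennreal (g (snd (w i) j))) \<partial>points_space \<kappa> \<nu>)"
  proof (intro nn_integral_cong)
    fix w
    have "(\<Prod>l\<in>L. ennreal (z l) ^ partial_count n (E l) w) =
        (\<Prod>l\<in>L. \<Prod>i<n. \<Prod>j<fst (w i). ennreal (z l) ^ of_bool (snd (w i) j \<in> E l))"
      by (simp only: partial_count_def power_sum)
    also have "\<dots> = (\<Prod>i<n. \<Prod>l\<in>L. \<Prod>j<fst (w i). ennreal (z l) ^ of_bool (snd (w i) j \<in> E l))"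
      by (rule prod.swap)
    also have "\<dots> = (\<Prod>i<n. \<Prod>j<fst (w i). \<Prod>l\<in>L. ennreal (z l) ^ of_bool (snd (w i) j \<in> E l))"
      by (intro prod.cong prod.swap refl)
    also have "\<dots> = (\<Prod>i<n. \<Prod>j<fst (w i). ennreal (g (snd (w i) j)))"
      unfolding g_def using z by (intro prod.cong refl) (simp add: prod_ennreal ennreal_power del:
          of_bool_eq_iff)
    finally show "(\<Prod>l\<in>L. ennreal (z l) ^ partial_count n (E l) w) =
        (\<Prod>i<n. \<Prod>j<fst (w i). ennreal (g (snd (w i) j)))" .
  qed
  also have "\<dots> = (\<Prod>i<n. \<integral>\<^sup>+b. (\<Prod>j<fst b. ennreal (g (snd b j))) \<partial>points_block (\<kappa> i) (\<nu> i))"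
    unfolding points_space_def
  proof (rule nn_integral_PiM_prod[where f="\<lambda>i b. \<Prod>j<fst b. ennreal (g (snd b j))"])
    fix i
    show "prob_space (points_block (\<kappa> i) (\<nu> i))" by (rule prob_space_points_block)
    have "(\<lambda>b. \<Prod>j<fst b. ennreal (g (snd b j))) \<in>
      borel_measurable (measure_pmf (pois (\<kappa> i)) \<Otimes>\<^sub>M PiM (UNIV :: nat set) (\<lambda>_. \<nu> i))"
      by (rule measurable_compose_countable[where g=fst and f="\<lambda>k b. \<Prod>j<k. ennreal (g (snd b j))"])
         measurable
    then show "(\<lambda>b. \<Prod>j<fst b. ennreal (g (snd b j))) \<in> borel_measurable (points_block (\<kappa> i) (\<nu> i))"
      by (simp add: points_block_def)
  qed simp
  also have "\<dots> = (\<Prod>i<n. ennreal (exp (- (\<kappa> i * (\<Sum>l\<in>L. (1 - z l) * measure (\<nu> i) (E l))))))"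
    using g by (simp add: nn_integral_points_block int)
  also have "\<dots> = ennreal (\<Prod>i<n. exp (- (\<kappa> i * (\<Sum>l\<in>L. (1 - z l) * measure (\<nu> i) (E l)))))"
    by (simp add: prod_ennreal)
  also have "(\<Prod>i<n. exp (- (\<kappa> i * (\<Sum>l\<in>L. (1 - z l) * measure (\<nu> i) (E l))))) =
      exp (\<Sum>i<n. - (\<kappa> i * (\<Sum>l\<in>L. (1 - z l) * measure (\<nu> i) (E l))))" by (simp add: exp_sum)
  also have "(\<Sum>i<n. - (\<kappa> i * (\<Sum>l\<in>L. (1 - z l) * measure (\<nu> i) (E l)))) =
      (\<Sum>i<n. \<Sum>l\<in>L. - (\<kappa> i * measure (\<nu> i) (E l) * (1 - z l)))"
    by (simp add: sum_distrib_left sum_negf mult_ac)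
  also have "\<dots> = (\<Sum>l\<in>L. - ((\<Sum>i<n. \<kappa> i * measure (\<nu> i) (E l)) * (1 - z l)))"
    by (subst sum.swap) (simp add: sum_distrib_right sum_negf)
  also have "exp \<dots> = (\<Prod>l\<in>L. exp (- ((\<Sum>i<n. \<kappa> i * measure (\<nu> i) (E l)) * (1 - z l))))"
    using L(1) by (rule exp_sum)
  finally show ?thesis by (simp add: prod_ennreal)
qed

end

context
  fixes \<kappa> :: "nat \<Rightarrow> real" and \<nu> :: "nat \<Rightarrow> 'x measure" and X :: "'x measure"
  assumes \<kappa>: "\<And>i. 0 \<le> \<kappa> i" and \<nu>: "\<And>i. prob_space (\<nu> i)" and sets_\<nu>[measurable_cong]:
      "\<And>i. sets (\<nu> i) = sets X"
begin

lemmas [measurable] = measurable_points[OF \<kappa> \<nu> sets_\<nu>] measurable_points_count[OF \<kappa> \<nu> sets_\<nu>]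
  measurable_partial_count[OF \<kappa> \<nu> sets_\<nu>]

lemma nn_integral_partial_count:
  assumes [measurable]: "E \<in> sets X"
  shows "(\<integral>\<^sup>+w. of_nat (partial_count n E w) \<partial>points_space \<kappa> \<nu>) =
      ennreal (\<Sum>i<n. \<kappa> i * measure (\<nu> i) E)"
proof -
  interpret prob_space "points_space \<kappa> \<nu>" by (rule prob_space_points_space[OF \<kappa> \<nu> sets_\<nu>])
  let ?m = "\<Sum>i<n. \<kappa> i * measure (\<nu> i) E"
  have m: "0 \<le> ?m" using \<kappa> by (intro sum_nonneg) simp
  \<comment> \<open>A one-point index set turns the joint generating function into that of a single
    count.\<close>
  have "distr (points_space \<kappa> \<nu>) (count_space UNIV) (partial_count n E) = measure_pmf (pois ?m)"
  proof (rule measure_eqI_pgf)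
    show "finite_measure (distr (points_space \<kappa> \<nu>) (count_space UNIV) (partial_count n E))"
      by (intro prob_space.finite_measure prob_space_distr) measurable
    fix z :: real assume z: "0 < z" "z < 1"
    have "(\<integral>\<^sup>+k. ennreal z ^ k \<partial>distr (points_space \<kappa> \<nu>) (count_space UNIV) (partial_count n E)) =
        (\<integral>\<^sup>+w. (\<Prod>l\<in>{()}. ennreal z ^ partial_count n E w) \<partial>points_space \<kappa> \<nu>)"
      by (subst nn_integral_distr) auto
    also have "\<dots> = (\<Prod>l\<in>{()}. ennreal (exp (- (?m * (1 - z)))))"
      using z by (intro pgf_partial_count[OF \<kappa> \<nu> sets_\<nu>]) (auto simp: disjoint_family_on_def)
    also have "\<dots> = (\<integral>\<^sup>+k. ennreal z ^ k \<partial>measure_pmf (pois ?m))"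
      using z m by (simp add: pgf_pois)
    finally show "(\<integral>\<^sup>+k. ennreal z ^ k \<partial>distr (points_space \<kappa> \<nu>) (count_space UNIV) (partial_count
        n E)) =
        (\<integral>\<^sup>+k. ennreal z ^ k \<partial>measure_pmf (pois ?m))" .
  qed (auto intro: prob_space.finite_measure measure_pmf.prob_space_axioms)
  then have "(\<integral>\<^sup>+k. of_nat k \<partial>measure_pmf (pois ?m)) =
      (\<integral>\<^sup>+k. of_nat k \<partial>distr (points_space \<kappa> \<nu>) (count_space UNIV) (partial_count n E))" by simp
  also have "\<dots> = (\<integral>\<^sup>+w. of_nat (partial_count n E w) \<partial>points_space \<kappa> \<nu>)"
    by (subst nn_integral_distr) auto
  finally show ?thesis using m by (simp add: nn_integral_pois)
qed

lemma nn_integral_points_count: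
  assumes [measurable]: "E \<in> sets X"
  shows "(\<integral>\<^sup>+w. points_count E w \<partial>points_space \<kappa> \<nu>) = (\<Sum>i. ennreal (\<kappa> i * measure (\<nu> i) E))"
proof -
  have "(\<integral>\<^sup>+w. points_count E w \<partial>points_space \<kappa> \<nu>) =
      (\<integral>\<^sup>+w. (SUP n. of_nat (partial_count n E w)) \<partial>points_space \<kappa> \<nu>)"
          by (simp add: points_count_eq_SUP)
  also have "\<dots> = (SUP n. \<integral>\<^sup>+w. of_nat (partial_count n E w) \<partial>points_space \<kappa> \<nu>)"
    using incseq_partial_count[of E]
    by (intro nn_integral_monotone_convergence_SUP) (auto simp: incseq_def le_fun_def)
  also have "\<dots> = (SUP n. \<Sum>i<n. ennreal (\<kappa> i * measure (\<nu> i) E))"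
    using \<kappa> by (simp add: nn_integral_partial_count)
  finally show ?thesis by (simp add: suminf_eq_SUP)
qed

lemma AE_points_count_finite:
  assumes "E \<in> sets X" "(\<Sum>i. ennreal (\<kappa> i * measure (\<nu> i) E)) < \<infinity>"
  shows "AE w in points_space \<kappa> \<nu>. points_count E w < \<infinity>"
  using nn_integral_PInf_AE[of "points_count E" "points_space \<kappa> \<nu>"] assms
  by (auto simp: nn_integral_points_count less_top)

text \<open>Independence and Poisson laws of the full counts in one formula: the generating
  functions of the partial counts pass to the limit, and \<open>joint_pois_of_pgf\<close> reads off
  the joint law.\<close>

lemma points_count_joint:
  fixes m :: "'l \<Rightarrow> real"
  assumes L: "finite L" "disjoint_family_on E L" and E[measurable]: "\<And>l. l \<in> L \<Longrightarrow> E l \<in> sets X"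
    and m: "\<And>l. l \<in> L \<Longrightarrow> 0 \<le> m l" "\<And>l. l \<in> L \<Longrightarrow> (\<Sum>i. ennreal (\<kappa> i * measure (\<nu> i) (E l))) =
        ennreal (m l)"
  shows "emeasure (points_space \<kappa> \<nu>) {w \<in> space (points_space \<kappa> \<nu>). \<forall>l\<in>L. \<exists>k\<in>A l.
      points_count (E l) w = of_nat k} =
    (\<Prod>l\<in>L. emeasure (pois (m l)) (A l))"
proof -
  let ?P = "points_space \<kappa> \<nu>"
  interpret prob_space ?P by (rule prob_space_points_space[OF \<kappa> \<nu> sets_\<nu>])
  \<comment> \<open>\<open>enn2real\<close> sends an infinite count to 0; as the mean m l is finite,
    this happens with probability 0.\<close>
  define Y where "Y l w = nat \<lfloor>enn2real (points_count (E l) w)\<rfloor>" for l w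
  have [measurable]: "Y l \<in> measurable ?P (count_space UNIV)" if "l \<in> L" for l
    unfolding Y_def[abs_def] using E[OF that] by measurable
  have "AE w in ?P. points_count (E l) w < \<infinity>" if "l \<in> L" for l
    using that m by (intro AE_points_count_finite) auto
  then have fin: "AE w in ?P. \<forall>l\<in>L. points_count (E l) w < \<infinity>"
    using L(1) by (simp add: AE_finite_all)
  have Yk: "points_count (E l) w = of_nat (Y l w)" "eventually (\<lambda>n. partial_count n (E l) w =
      Y l w) sequentially"
    if "points_count (E l) w < \<infinity>" for l w
  proof -
    from that obtain k where "points_count (E l) w =
        of_nat k" "eventually (\<lambda>n. partial_count n (E l) w = k) sequentially"
      unfolding points_count_finite_iff by blast
    moreover from this(1) have "Y l w = k" by (simp add: Y_def)
    ultimately show "points_count (E l) w = of_nat (Y l w)"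
        "eventually (\<lambda>n. partial_count n (E l) w = Y l w) sequentially"
      by simp_all
  qed
  \<comment> \<open>Dominated convergence with the bound 1, the integrands being eventually constant
    almost surely; on the other side the partial sums of the intensities converge to m l.\<close>
  have pgf: "(\<integral>\<^sup>+w. (\<Prod>l\<in>L \<union> {}. ennreal (z l) ^ Y l w) \<partial>?P) =
      (\<Prod>l\<in>L \<union> {}. ennreal (exp (- (m l * (1 - z l)))))"
    if z: "\<And>l. 0 \<le> z l \<and> z l \<le> (1::real)" for z
  proof (rule LIMSEQ_unique)
    let ?u = "\<lambda>n w. \<Prod>l\<in>L. ennreal (z l) ^ partial_count n (E l) w"
    show "(\<lambda>n. \<integral>\<^sup>+w. ?u n w \<partial>?P) \<longlonglongrightarrow> (\<integral>\<^sup>+w. (\<Prod>l\<in>L \<union> {}. ennreal (z l) ^ Y l w) \<partial>?P)"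
    proof (rule nn_integral_dominated_convergence[where w="\<lambda>_. 1"])
      show "AE w in ?P. ?u n w \<le> 1" for n
        using z by (intro AE_I2 prod_le_1) (auto simp: ennreal_power intro!: power_le_one)
      show "AE w in ?P. (\<lambda>n. ?u n w) \<longlonglongrightarrow> (\<Prod>l\<in>L \<union> {}. ennreal (z l) ^ Y l w)"
        using fin
      proof eventually_elim
        fix w assume "\<forall>l\<in>L. points_count (E l) w < \<infinity>"
        then have "eventually (\<lambda>n. \<forall>l\<in>L. partial_count n (E l) w = Y l w) sequentially"
          using L(1) Yk(2) by (intro eventually_ball_finite) auto
        then have "eventually (\<lambda>n. ?u n w = (\<Prod>l\<in>L \<union> {}. ennreal (z l) ^ Y l w)) sequentially"
          by eventually_elim simp
        then show "(\<lambda>n. ?u n w) \<longlonglongrightarrow> (\<Prod>l\<in>L \<union> {}. ennreal (z l) ^ Y l w)"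
          by (rule tendsto_eventually)
      qed
    qed (simp_all add: emeasure_space_1)
    have "(\<lambda>n. \<Sum>i<n. \<kappa> i * measure (\<nu> i) (E l)) \<longlonglongrightarrow> m l" if "l \<in> L" for l
    proof -
      have "(\<lambda>i. ennreal (\<kappa> i * measure (\<nu> i) (E l))) sums ennreal (m l)"
        using m(2)[OF that] by (metis summableI summable_sums)
      then have "(\<lambda>i. \<kappa> i * measure (\<nu> i) (E l)) sums m l"
        using \<kappa> m(1)[OF that] by (subst (asm) sums_ennreal) auto
      then show ?thesis by (simp add: sums_def)
    qed
    then have "(\<lambda>n. \<Prod>l\<in>L. exp (- ((\<Sum>i<n. \<kappa> i * measure (\<nu> i) (E l)) * (1 - z l))))
        \<longlonglongrightarrow> (\<Prod>l\<in>L. exp (- (m l * (1 - z l))))"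
      by (intro tendsto_prod tendsto_exp tendsto_minus tendsto_mult tendsto_const)
    then have "(\<lambda>n. ennreal (\<Prod>l\<in>L. exp (- ((\<Sum>i<n. \<kappa> i * measure (\<nu> i) (E l)) * (1 - z l)))))
        \<longlonglongrightarrow> ennreal (\<Prod>l\<in>L. exp (- (m l * (1 - z l))))"
      by (rule tendsto_ennrealI)
    then show "(\<lambda>n. \<integral>\<^sup>+w. ?u n w \<partial>?P) \<longlonglongrightarrow> (\<Prod>l\<in>L \<union> {}. ennreal (exp (- (m l * (1 - z l)))))"
      using z by (simp add: pgf_partial_count[OF \<kappa> \<nu> sets_\<nu> L E] prod_ennreal)
  qed
  have "emeasure ?P {w \<in> space ?P. \<forall>l\<in>L. \<exists>k\<in>A l. points_count (E l) w = of_nat k} =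
      emeasure ?P {w \<in> space ?P. \<forall>l\<in>L. Y l w \<in> A l}"
  proof (rule emeasure_eq_AE)
    show "AE w in ?P. (w \<in> {w \<in> space ?P. \<forall>l\<in>L. \<exists>k\<in>A l. points_count (E l) w = of_nat k}) =
        (w \<in> {w \<in> space ?P. \<forall>l\<in>L. Y l w \<in> A l})"
      using fin by eventually_elim (auto simp: Yk(1))
    have "{w \<in> space ?P. points_count (E l) w \<in> of_nat ` A l} \<in> sets ?P" if "l \<in> L" for l
    proof -
      have "countable (of_nat ` A l :: ennreal set)" by simp
      then have "of_nat ` A l \<in> sets (borel :: ennreal measure)"
          by (rule sets.countable[rotated]) auto
      then show ?thesis using E[OF that] by measurable
    qed
    then have "{w \<in> space ?P. \<forall>l\<in>L. points_count (E l) w \<in> of_nat ` A l} \<in> sets ?P"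
      using L(1) by (intro sets.sets_Collect_finite_All) auto
    then show "{w \<in> space ?P. \<forall>l\<in>L. \<exists>k\<in>A l. points_count (E l) w = of_nat k} \<in> sets ?P"
      by (simp add: image_iff)
    show "{w \<in> space ?P. \<forall>l\<in>L. Y l w \<in> A l} \<in> sets ?P"
      using L(1) by (intro sets.sets_Collect_finite_All) auto
  qed
  also have "\<dots> = (\<integral>\<^sup>+w. indicator {w \<in> space ?P. \<forall>l\<in>L. Y l w \<in> A l} w \<partial>?P)"
    using L(1) by (intro nn_integral_indicator[symmetric] sets.sets_Collect_finite_All) auto
  \<comment> \<open>The empty product brings the integrand into the form of
    \<open>joint_pois_of_pgf\<close> with T empty, all coordinates being identified.\<close>
  also have "\<dots> = (\<integral>\<^sup>+w. (\<Prod>l\<in>L. indicator (A l) (Y l w)) * (\<Prod>l\<in>{}. ennreal 1 ^ Y l w) \<partial>?P)"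
  proof (intro nn_integral_cong)
    fix w assume w: "w \<in> space ?P"
    show "indicator {w \<in> space ?P. \<forall>l\<in>L. Y l w \<in> A l} w =
        (\<Prod>l\<in>L. indicator (A l) (Y l w)) * (\<Prod>l\<in>{}. ennreal 1 ^ Y l w)"
    proof (cases "\<forall>l\<in>L. Y l w \<in> A l")
      case False
      then have "(\<Prod>l\<in>L. indicator (A l) (Y l w) :: ennreal) = 0"
        using L(1) by (intro prod_zero) (auto simp: indicator_def)
      then show ?thesis using False by simp
    qed (use w in simp)
  qed
  also have "\<dots> = (\<Prod>l\<in>L. emeasure (pois (m l)) (A l)) * (\<Prod>l\<in>{}. ennreal (exp (- (m l * (1 - 1)))))"
    using L(1) m(1) by (intro joint_pois_of_pgf[where z="\<lambda>_. 1"] pgf prob_space_axioms) auto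
  finally show ?thesis by simp
qed

end

text \<open>The blocks are the sets of a countable partition into sets of finite measure: block i
  receives a Poisson number of rate measure M (A i) of points that are uniform on A i.\<close>

lemma (in sigma_finite_measure) points_space_intensity_exists:
  assumes "space M \<noteq> {}"
  shows "\<exists>\<kappa> \<nu>. (\<forall>i::nat. 0 \<le> \<kappa> i) \<and> (\<forall>i. prob_space (\<nu> i)) \<and> (\<forall>i. sets (\<nu> i) = sets M) \<and>
    (\<forall>E\<in>sets M. (\<Sum>i. ennreal (\<kappa> i * measure (\<nu> i) E)) = emeasure M E)"
proof -
  obtain A :: "nat \<Rightarrow> 'a set" where A: "range A \<subseteq> sets M" "(\<Union>i. A i) = space M"
      "\<And>i. emeasure M (A i) \<noteq> \<infinity>" "disjoint_family A"
    using sigma_finite_disjoint by blast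
  obtain x0 where x0: "x0 \<in> space M" using assms by auto
  \<comment> \<open>On a null set there is no uniform distribution. The point mass at x0 merely
    keeps \<nu> i a probability measure, as the rate of this block is 0.\<close>
  define \<nu> where "\<nu> i = (if emeasure M (A i) =
      0 then return M x0 else uniform_measure M (A i))" for i
  define \<kappa> where "\<kappa> i = measure M (A i)" for i
  have As: "A i \<in> sets M" for i using A(1) by auto
  have "prob_space (\<nu> i)" for i
    using A(3)[of i] x0 As by (auto simp: \<nu>_def
        intro!: prob_space_return prob_space_uniform_measure)
  moreover have "sets (\<nu> i) = sets M" for i by (simp add: \<nu>_def)
  moreover have "(\<Sum>i. ennreal (\<kappa> i * measure (\<nu> i) E)) = emeasure M E" if E: "E \<in> sets M" for E
  proof -
    have "ennreal (\<kappa> i * measure (\<nu> i) E) = emeasure M (A i \<inter> E)" for i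
    proof (cases "emeasure M (A i) = 0")
      case True
      moreover have "emeasure M (A i \<inter> E) = 0" using True E As
          by (intro emeasure_eq_0[OF _ True]) auto
      ultimately show ?thesis by (simp add: \<kappa>_def measure_def)
    next
      case False
      have fin: "emeasure M (A i) < \<infinity>" using A(3)[of i] by (simp add: less_top)
      have 1: "emeasure M (A i \<inter> E) \<le> emeasure M (A i)" using As E by (intro emeasure_mono) auto
      have fin2: "emeasure M (A i \<inter> E) < \<infinity>" using 1 fin by (rule le_less_trans)
      have pos: "0 < measure M (A i)" using False fin
        by (metis emeasure_eq_ennreal_measure ennreal_0 less_irrefl measure_nonneg order_le_less
            infinity_ennreal_def)
      have "measure (\<nu> i) E = measure M (A i \<inter> E) / measure M (A i)"
        using False A(3)[of i] As E by (simp add: \<nu>_def measure_uniform_measure)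
      then show ?thesis using pos fin2 by (simp add: \<kappa>_def emeasure_eq_ennreal_measure)
    qed
    then have "(\<Sum>i. ennreal (\<kappa> i * measure (\<nu> i) E)) = (\<Sum>i. emeasure M (A i \<inter> E))" by simp
    also have "\<dots> = emeasure M (\<Union>i. A i \<inter> E)"
      using As E A(4) by (intro suminf_emeasure) (auto simp: disjoint_family_on_def)
    also have "(\<Union>i. A i \<inter> E) = E" using A(2) sets.sets_into_space[OF E] by auto
    finally show ?thesis .
  qed
  ultimately show ?thesis by (intro exI[of _ \<kappa>] exI[of _ \<nu>]) (auto simp: \<kappa>_def)
qed

section \<open>Configurations, their atoms and the measurability of percolation\<close>

lemma space_counting_space [simp]: "space counting_space = counting_measures"
proof -
  have "(\<Union>B\<in>sets borel. space (vimage_algebra counting_measures (\<lambda>N. emeasure N B) borel)) =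
      counting_measures"
    by (auto simp del: sets.empty_sets intro!: exI[of _ "{}"])
  then show ?thesis
    unfolding counting_space_def
    by (subst space_Sup_eq_UN) auto
qed

lemma measurable_emeasure_counting [measurable (raw)]:
  assumes [measurable]: "f \<in> measurable M counting_space" and B: "B \<in> sets borel"
  shows "(\<lambda>x. emeasure (f x) B) \<in> borel_measurable M"
proof -
  have "(\<lambda>N. emeasure N B) \<in> borel_measurable counting_space"
    unfolding counting_space_def by (auto intro!: measurable_SUP1 measurable_vimage_algebra1 B)
  then show ?thesis by measurable
qed

lemma measurable_counting_spaceI:
  assumes 1: "\<And>x. x \<in> space M \<Longrightarrow> f x \<in> counting_measures"
    and 2: "\<And>B. B \<in> sets borel \<Longrightarrow> (\<lambda>x. emeasure (f x) B) \<in> borel_measurable M"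
  shows "f \<in> measurable M counting_space"
  unfolding counting_space_def
  by (intro measurable_SUP2 measurable_vimage_algebra2) (use 1 2 in auto)

lemma counting_measuresD:
  assumes "N \<in> counting_measures"
  shows "sets N = sets borel" "space N = UNIV"
    "B \<in> sets borel \<Longrightarrow> bounded B \<Longrightarrow> emeasure N B < \<infinity>"
    "B \<in> sets borel \<Longrightarrow> bounded B \<Longrightarrow> \<exists>k::nat. emeasure N B = of_nat k"
    "B \<in> sets borel \<Longrightarrow> bounded B \<Longrightarrow> emeasure N B \<noteq> 0 \<Longrightarrow> 1 \<le> emeasure N B"
    "B \<in> sets borel \<Longrightarrow> bounded B \<Longrightarrow> emeasure N B < 1 \<Longrightarrow> emeasure N B = 0"
proof -
  show 1: "sets N = sets borel" using assms by (simp add: counting_measures_def)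
  show "space N = UNIV" using sets_eq_imp_space_eq[OF 1] by simp
  show 2: "B \<in> sets borel \<Longrightarrow> bounded B \<Longrightarrow> \<exists>k::nat. emeasure N B = of_nat k"
    using assms by (auto simp: counting_measures_def)
  show "B \<in> sets borel \<Longrightarrow> bounded B \<Longrightarrow> emeasure N B < \<infinity>"
    using 2 by (auto simp: of_nat_less_top)
  show 3: "B \<in> sets borel \<Longrightarrow> bounded B \<Longrightarrow> emeasure N B \<noteq> 0 \<Longrightarrow> 1 \<le> emeasure N B"
    using 2 by (metis One_nat_def Suc_leI bot_nat_0.not_eq_extremum of_nat_0 of_nat_1 of_nat_le_iff)
  show "B \<in> sets borel \<Longrightarrow> bounded B \<Longrightarrow> emeasure N B < 1 \<Longrightarrow> emeasure N B = 0"
    using 3 by (meson leD)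
qed

definition atoms :: "plane measure \<Rightarrow> plane set" where
  "atoms N = {x. emeasure N {x} \<noteq> 0}"

lemma boolean_model_atoms: "boolean_model N r = (\<Union>x\<in>atoms N. cball x r)"
  by (simp add: boolean_model_def atoms_def)

text \<open>Each atom has mass at least 1, so a ball of mass k cannot contain k + 1 of them.\<close>

lemma finite_atoms:
  assumes N: "N \<in> counting_measures" and "bounded B"
  shows "finite (atoms N \<inter> B)"
proof -
  obtain m where m: "B \<subseteq> ball 0 m" using bounded_subset_ballD[OF \<open>bounded B\<close>, of 0] by blast
  obtain k where k: "emeasure N (ball 0 m) = of_nat k"
    using counting_measuresD(4)[OF N, of "ball 0 m"] by auto
  show ?thesis
  proof (rule ccontr)
    assume "infinite (atoms N \<inter> B)"
    then obtain F where F: "F \<subseteq> atoms N \<inter> B" "finite F" "card F = Suc k"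
      using infinite_arbitrarily_large by blast
    have "of_nat (Suc k) = (\<Sum>x\<in>F. 1::ennreal)" using F by simp
    also have "\<dots> \<le> (\<Sum>x\<in>F. emeasure N {x})"
      using F counting_measuresD(5)[OF N, of "{_}"] by (intro sum_mono) (auto simp: atoms_def)
    also have "\<dots> = emeasure N F"
      using F counting_measuresD(1)[OF N] by (intro emeasure_eq_sum_singleton[symmetric]) auto
    also have "\<dots> \<le> emeasure N (ball 0 m)"
      using F m counting_measuresD(1)[OF N] by (intro emeasure_mono) auto
    finally show False using k by (metis Suc_n_not_le_n of_nat_le_iff)
  qed
qed

text \<open>Configurations are measures, so points have to be recovered from mass. If no point of B
  were an atom, the masses of shrinking balls around any x, cut with B, would tend to 0 and, being
  integers, vanish from some radius on; finitely many such balls cover the compact closure of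
  B.\<close>

lemma atom_exists:
  assumes N: "N \<in> counting_measures" and B: "B \<in> sets borel" "bounded B" and pos: "emeasure N B \<noteq> 0"
  shows "\<exists>x\<in>B. x \<in> atoms N"
proof (rule ccontr)
  assume no: "\<not> ?thesis"
  have sN: "sets N = sets borel" using counting_measuresD(1)[OF N] .
  have "\<exists>e>0. emeasure N (ball x e \<inter> B) = 0" for x
  proof -
    define C where "C n = cball x (inverse (real (Suc n))) \<inter> B" for n
    have C: "C n \<in> sets borel" "bounded (C n)" for n using B by (auto simp: C_def)
    have "(\<lambda>n. emeasure N (C n)) \<longlonglongrightarrow> emeasure N (\<Inter>n. C n)"
    proof (rule Lim_emeasure_decseq)
      show "range C \<subseteq> sets N" using C sN by blast
      show "decseq C" unfolding C_def
        by (intro decseq_SucI Int_mono subset_cball subset_refl) (simp add: le_imp_inverse_le)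
      show "emeasure N (C i) \<noteq> \<infinity>" for i
        using counting_measuresD(3)[OF N C, of i] by (simp add: less_top)
    qed
    moreover have "(\<Inter>n. C n) = {x} \<inter> B"
    proof -
      have "y = x" if "\<forall>n. dist x y \<le> inverse (real (Suc n))" for y
      proof (rule ccontr)
        assume "y \<noteq> x"
        then have "dist x y > 0" by simp
        then obtain n where "inverse (real (Suc n)) < dist x y"
          using reals_Archimedean by blast
        moreover have "dist x y \<le> inverse (real (Suc n))" using that by blast
        ultimately show False by linarith
      qed
      then have "y = x" if "\<forall>n. y \<in> C n" for y using that by (auto simp: C_def)
      moreover have "x \<in> C n" if "x \<in> B" for n using that by (simp add: C_def)
      moreover have "C 0 \<subseteq> B" by (auto simp: C_def)
      ultimately show ?thesis by blast
    qed
    moreover have "emeasure N ({x} \<inter> B) = 0"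
      using no by (cases "x \<in> B") (simp_all add: atoms_def)
    ultimately have "(\<lambda>n. emeasure N (C n)) \<longlonglongrightarrow> 0" by (simp only:)
    then have "eventually (\<lambda>n. emeasure N (C n) < 1) sequentially"
      by (rule order_tendstoD(2)) simp
    then obtain n where n: "emeasure N (C n) < 1"
      by (meson eventually_sequentially order_refl)
    then have "emeasure N (C n) = 0" using counting_measuresD(6)[OF N C] by blast
    moreover have "ball x (inverse (real (Suc n))) \<inter> B \<subseteq> C n" unfolding C_def by fastforce
    ultimately have "emeasure N (ball x (inverse (real (Suc n))) \<inter> B) = 0"
      using C sN by (metis emeasure_eq_0)
    moreover have "0 < inverse (real (Suc n))" by simp
    ultimately show ?thesis by blast
  qed
  then obtain e where e: "\<And>x. e x > 0" "\<And>x. emeasure N (ball x (e x) \<inter> B) = 0" by metis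
  have "compact (closure B)" using B by auto
  then obtain D where D: "D \<subseteq> closure B" "finite D" "closure B \<subseteq> (\<Union>x\<in>D. ball x (e x))"
    by (rule compactE_image[of _ "closure B" "\<lambda>x. ball x (e x)"]) (use e(1) in auto)
  have "emeasure N B \<le> emeasure N (\<Union>x\<in>D. ball x (e x) \<inter> B)"
  proof (rule emeasure_mono)
    show "B \<subseteq> (\<Union>x\<in>D. ball x (e x) \<inter> B)" using D(3) closure_subset[of B] by blast
    show "(\<Union>x\<in>D. ball x (e x) \<inter> B) \<in> sets N"
      using B(1) D(2) sN by (intro sets.finite_UN) simp_all
  qed
  also have "\<dots> \<le> (\<Sum>x\<in>D. emeasure N (ball x (e x) \<inter> B))"
  proof (rule emeasure_subadditive_finite[OF D(2)])
    show "(\<lambda>x. ball x (e x) \<inter> B) ` D \<subseteq> sets N"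
      unfolding sN image_subset_iff using B(1) by (intro ballI sets.Int) simp_all
  qed
  also have "\<dots> = 0" using e(2) by simp
  finally show False using pos by simp
qed

text \<open>A finite witness for a crossing from the ball of radius m to distance n: closed balls of
  radius r in the plane meet iff their centres are at most 2 * r apart.\<close>

definition atom_chain :: "plane measure \<Rightarrow> real \<Rightarrow> nat \<Rightarrow> real \<Rightarrow> real \<Rightarrow> (nat \<Rightarrow> plane) \<Rightarrow> bool" where
  "atom_chain N r k m n x \<longleftrightarrow> (\<forall>i\<le>k. x i \<in> atoms N) \<and> norm (x 0) \<le> m \<and> n \<le> norm (x k) \<and>
     (\<forall>i<k. dist (x i) (x (Suc i)) \<le> 2 * r)"

lemma connected_chain_cballs:
  fixes x :: "nat \<Rightarrow> plane"
  assumes "0 \<le> r" "\<And>i. i < k \<Longrightarrow> dist (x i) (x (Suc i)) \<le> 2 * r"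
  shows "connected (\<Union>i\<le>k. cball (x i) r)"
  using assms(2)
proof (induction k)
  case (Suc k)
  define z where "z = midpoint (x k) (x (Suc k))"
  have "z \<in> cball (x k) r \<inter> cball (x (Suc k)) r"
    using Suc.prems[of k] by (simp add: z_def dist_midpoint)
  then have "(\<Union>i\<le>k. cball (x i) r) \<inter> cball (x (Suc k)) r \<noteq> {}" by blast
  then have "connected ((\<Union>i\<le>k. cball (x i) r) \<union> cball (x (Suc k)) r)"
    using Suc by (intro connected_Un) auto
  also have "((\<Union>i\<le>k. cball (x i) r) \<union> cball (x (Suc k)) r) = (\<Union>i\<le>Suc k. cball (x i) r)"
    by (auto simp: atMost_Suc)
  finally show ?case .
qed simp

text \<open>Within distance 1 of a point p only the balls around atoms within 1 + r of p are
  visible, and these are finitely many. Closedness is a local property.\<close>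

lemma closed_Union_cballs:
  assumes N: "N \<in> counting_measures" and A: "A \<subseteq> atoms N"
  shows "closed (\<Union>x\<in>A. cball x r)"
proof -
  have "closed (cball p 1 \<inter> (\<Union>x\<in>A. cball x r))" for p
  proof -
    have "cball p 1 \<inter> (\<Union>x\<in>A. cball x r) = cball p 1 \<inter> (\<Union>x\<in>A \<inter> cball p (1 + r). cball x r)"
    proof (intro equalityI subsetI)
      fix y assume "y \<in> cball p 1 \<inter> (\<Union>x\<in>A. cball x r)"
      then obtain x where x: "x \<in> A" "dist x y \<le> r" "dist p y \<le> 1" by auto
      then have "dist p x \<le> 1 + r" by (metis add_mono dist_commute dist_triangle_le)
      with x show "y \<in> cball p 1 \<inter> (\<Union>x\<in>A \<inter> cball p (1 + r). cball x r)" by auto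
    qed auto
    moreover have "finite (A \<inter> cball p (1 + r))"
      using finite_atoms[OF N, of "cball p (1 + r)"] A by (rule_tac finite_subset) auto
    ultimately show ?thesis by auto
  qed
  then have *: "closed (cball p 1 \<inter> (\<Union>x\<in>A. cball x r))" for p by blast
  show ?thesis
  proof (unfold closed_def open_contains_ball, intro ballI)
    fix p assume p: "p \<in> - (\<Union>x\<in>A. cball x r)"
    have "open (- (cball p 1 \<inter> (\<Union>x\<in>A. cball x r)))" using * open_Compl by blast
    moreover have "p \<in> - (cball p 1 \<inter> (\<Union>x\<in>A. cball x r))" using p by auto
    ultimately obtain e where e: "e > 0" "ball p e \<subseteq> - (cball p 1 \<inter> (\<Union>x\<in>A. cball x r))"
      using open_contains_ball by metis
    then have "ball p (min e 1) \<subseteq> - (\<Union>x\<in>A. cball x r)" by auto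
    then show "\<exists>e>0. ball p e \<subseteq> - (\<Union>x\<in>A. cball x r)" using e(1) by (intro exI[of _ "min e 1"]) auto
  qed
qed

text \<open>Reduces unbounded connected sets to a countable combination of conditions on finite
  chains, which is what makes percolation measurable.\<close>

lemma percolates_iff_chains:
  assumes N: "N \<in> counting_measures" and r: "0 \<le> r"
  shows "percolates (boolean_model N r) \<longleftrightarrow> (\<exists>m::nat. \<forall>n::nat. \<exists>k x.
      atom_chain N r k (real m) (real n) x)"
proof
  assume "percolates (boolean_model N r)"
  then obtain T where T: "T \<subseteq> boolean_model N r" "connected T" "\<not> bounded T"
    by (auto simp: percolates_def)
  from T(3) obtain t where "t \<in> T" by fastforce
  with T(1) obtain x0 where x0: "x0 \<in> atoms N" "t \<in> cball x0 r" by (auto simp: boolean_model_atoms)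
  define E where "E = {(x, y). x \<in> atoms N \<and> y \<in> atoms N \<and> dist x y \<le> 2 * r}"
  define Cl where "Cl = {y. (x0, y) \<in> E\<^sup>*}"
  have ClA: "Cl \<subseteq> atoms N"
  proof
    fix y assume "y \<in> Cl"
    then have "(x0, y) \<in> E\<^sup>*" by (simp add: Cl_def)
    then show "y \<in> atoms N" using x0(1) by (cases rule: rtranclE) (auto simp: E_def)
  qed
  \<comment> \<open>The balls reachable from x0 and the remaining balls form two disjoint closed
    sets that cover T. As T is connected and meets the first, it lies in it, so the reachable atoms
    are unbounded.\<close>
  let ?U = "\<Union>x\<in>Cl. cball x r" and ?V = "\<Union>x\<in>atoms N - Cl. cball x r"
  have cl: "closed ?U" "closed ?V" using ClA by (intro closed_Union_cballs[OF N]; auto)+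
  have TUV: "T \<subseteq> ?U \<union> ?V" using T(1) ClA unfolding boolean_model_atoms by blast
  moreover have "?U \<inter> ?V = {}"
  proof (rule ccontr)
    assume "?U \<inter> ?V \<noteq> {}"
    then obtain p where "p \<in> ?U" "p \<in> ?V" by blast
    then obtain x y where p: "x \<in> Cl" "y \<in> atoms N - Cl" "dist x p \<le> r" "dist y p \<le> r"
      unfolding UN_iff mem_cball by blast
    then have "dist x y \<le> 2 * r" using dist_triangle[of x y p] by (simp add: dist_commute)
    then have "(x, y) \<in> E" using p ClA by (auto simp: E_def)
    then have "y \<in> Cl" using p(1) unfolding Cl_def by (auto intro: rtrancl_into_rtrancl)
    then show False using p by simp
  qed
  moreover have "t \<in> T \<inter> ?U" using \<open>t \<in> T\<close> x0 by (auto simp: Cl_def)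
  ultimately have "T \<inter> ?V = {}"
    using T(2) cl connected_closedD[of T ?U ?V] by blast
  then have TU: "T \<subseteq> ?U" using TUV by blast
  obtain m :: nat where m: "norm x0 \<le> real m" using real_arch_simple by blast
  have "\<exists>k x. atom_chain N r k (real m) (real n) x" for n :: nat
  proof -
    obtain p where "p \<in> T" "norm p > real n + r"
      using T(3) unfolding bounded_iff by (meson not_le)
    then obtain y where y: "y \<in> Cl" "dist y p \<le> r" using TU by auto
    have "norm p \<le> norm y + dist y p"
      by (metis dist_norm norm_minus_commute norm_triangle_sub)
    with y have ny: "real n \<le> norm y" using \<open>norm p > real n + r\<close> by linarith
    from y(1) obtain k where "(x0, y) \<in> E ^^ k" by (auto simp: Cl_def dest: rtrancl_imp_relpow)
    then obtain f where f: "f 0 = x0" "f k = y" "\<forall>i<k. (f i, f (Suc i)) \<in> E"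
      unfolding relpow_fun_conv by blast
    have "f i \<in> atoms N" if "i \<le> k" for i
      using that f x0 by (cases i) (auto simp: E_def)
    then have "atom_chain N r k (real m) (real n) f"
      using f m ny by (auto simp: atom_chain_def E_def)
    then show ?thesis by blast
  qed
  then show "\<exists>m::nat. \<forall>n::nat. \<exists>k x. atom_chain N r k (real m) (real n) x" by blast
next
  assume "\<exists>m::nat. \<forall>n::nat. \<exists>k x. atom_chain N r k (real m) (real n) x"
  then obtain m :: nat and k x where ch: "\<And>n::nat. atom_chain N r (k n) (real m) (real n) (x n)"
      by metis
  have "finite (atoms N \<inter> cball 0 (real m))" by (rule finite_atoms[OF N]) auto
  moreover have "(\<lambda>n. x n 0) ` UNIV \<subseteq> atoms N \<inter> cball 0 (real m)"
    using ch by (auto simp: atom_chain_def)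
  ultimately have "finite ((\<lambda>n. x n 0) ` UNIV)" by (rule finite_subset[rotated])
  \<comment> \<open>All chains start among the finitely many atoms of norm at most m, so infinitely
    many of them share their first atom. Their union is connected through it and unbounded.\<close>
  then obtain n0 where inf: "infinite {n. x n 0 = x n0 0}"
    using pigeonhole_infinite[of UNIV "\<lambda>n. x n 0"] by auto
  define T where "T = (\<Union>n\<in>{n. x n 0 = x n0 0}. \<Union>i\<le>k n. cball (x n i) r)"
  have "connected T" unfolding T_def
  proof (rule connected_Union, safe)
    show "connected (\<Union>i\<le>k n. cball (x n i) r)" for n
      using ch[of n] r by (intro connected_chain_cballs) (auto simp: atom_chain_def)
  next
    have "x n0 0 \<in> (\<Inter>n\<in>{n. x n 0 = x n0 0}. \<Union>i\<le>k n. cball (x n i) r)"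
      using r by (auto intro!: bexI[of _ 0])
    then show "(\<Inter>n\<in>{n. x n 0 = x n0 0}. \<Union>i\<le>k n. cball (x n i) r) = {} \<Longrightarrow> False" by blast
  qed
  moreover have "T \<subseteq> boolean_model N r"
    using ch by (fastforce simp: T_def boolean_model_atoms atom_chain_def)
  moreover have "\<not> bounded T"
  proof
    assume "bounded T"
    then obtain b where b: "\<And>y. y \<in> T \<Longrightarrow> norm y \<le> b" by (auto simp: bounded_iff)
    obtain n where n: "n \<in> {n. x n 0 = x n0 0}" "nat \<lceil>b\<rceil> < n"
      using inf unfolding infinite_nat_iff_unbounded by blast
    then have "x n (k n) \<in> T" using r unfolding T_def by (intro UN_I[of n] UN_I[of "k n"]) auto
    then have "norm (x n (k n)) \<le> b" by (rule b)
    moreover have "real n \<le> norm (x n (k n))" using ch by (simp add: atom_chain_def)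
    ultimately show False using n(2) by linarith
  qed
  ultimately show "percolates (boolean_model N r)" by (auto simp: percolates_def)
qed

lemma dist_triangle4:
  fixes a b c e :: "'a::metric_space"
  shows "dist a e \<le> dist a b + dist b c + dist c e"
  using dist_triangle[of a e b] dist_triangle[of b e c] by linarith

lemma emeasure_cball_atom:
  assumes N: "N \<in> counting_measures" and x: "x \<in> atoms N" "dist y x \<le> e"
  shows "emeasure N (cball y e) \<noteq> 0"
proof -
  have "emeasure N {x} \<le> emeasure N (cball y e)"
    using x(2) counting_measuresD(1)[OF N] by (intro emeasure_mono) simp_all
  then show ?thesis using x(1) by (auto simp: atoms_def)
qed

lemma dense_sequence_plane: "\<exists>d :: nat \<Rightarrow> plane. \<forall>x. \<forall>e>0. \<exists>i. dist x (d i) < e"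
proof -
  obtain D :: "plane set" where D: "countable D" "\<And>X. open X \<Longrightarrow> X \<noteq> {} \<Longrightarrow> \<exists>d\<in>D. d \<in> X"
    using countable_dense_exists by blast
  have "D \<noteq> {}" using D(2)[of UNIV] by auto
  have "\<exists>i. dist x (from_nat_into D i) < e" if e: "e > 0" for x :: plane and e :: real
  proof -
    obtain p where "p \<in> D" "p \<in> ball x e" using D(2)[of "ball x e"] e by auto
    then show ?thesis using from_nat_into_surj[OF D(1)] by (metis mem_ball)
  qed
  then show ?thesis by blast
qed

text \<open>
  Closed conditions on finitely many atoms can be checked on a dense sequence up to every error:
  only finitely many atoms are involved, so one chain serves infinitely many error bounds.
\<close>

lemma atom_chain_approx_iff:
  fixes d :: "nat \<Rightarrow> plane"
  assumes N: "N \<in> counting_measures" and d: "\<And>x e. e > 0 \<Longrightarrow> \<exists>i. dist x (d i) < e"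
  shows "(\<exists>x. atom_chain N r k m n x) \<longleftrightarrow>
    (\<forall>j::nat. \<exists>l::nat list. (\<forall>i\<le>k. emeasure N (cball (d (l ! i)) (1 / Suc j)) \<noteq> 0) \<and>
       norm (d (l ! 0)) \<le> m + 1 / Suc j \<and> n \<le> norm (d (l ! k)) + 1 / Suc j \<and>
       (\<forall>i<k. dist (d (l ! i)) (d (l ! Suc i)) \<le> 2 * r + 2 / Suc j))" (is "?L \<longleftrightarrow> (\<forall>j. ?R j)")
proof
  assume ?L
  then obtain x where x: "atom_chain N r k m n x" by blast
  show "\<forall>j. ?R j"
  proof
    fix j
    define e where "e = 1 / real (Suc j)"
    have "e > 0" by (simp add: e_def)
    then obtain q where q: "\<And>y. dist y (d (q y)) < e" using d by metis
    define l where "l = map (\<lambda>i. q (x i)) [0..<Suc k]"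
    have l: "l ! i = q (x i)" if "i \<le> k" for i using that by (simp add: l_def nth_append)
    have 1: "emeasure N (cball (d (l ! i)) e) \<noteq> 0" if "i \<le> k" for i
      using x that q[of "x i"] by (intro emeasure_cball_atom[OF N, of "x i"])
        (simp_all add: atom_chain_def l dist_commute)
    have ln: "\<bar>norm (d (l ! i)) - norm (x i)\<bar> \<le> e" if "i \<le> k" for i
      using q[of "x i"] norm_triangle_ineq3[of "d (l ! i)" "x i"] that
          by (simp add: l dist_norm norm_minus_commute)
    have 2: "norm (d (l ! 0)) \<le> m + e" "n \<le> norm (d (l ! k)) + e"
      using ln[of 0] ln[of k] x by (auto simp: atom_chain_def)
    have 3: "dist (d (l ! i)) (d (l ! Suc i)) \<le> 2 * r + 2 * e" if "i < k" for i
    proof -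
      have "dist (d (l ! i)) (d (l ! Suc i)) \<le> dist (d (l ! i)) (x i) + dist (x i) (x (Suc i)) +
          dist (x (Suc i)) (d (l ! Suc i))"
        by (rule dist_triangle4)
      moreover have "dist (x i) (x (Suc i)) \<le> 2 * r" using x that by (simp add: atom_chain_def)
      ultimately show ?thesis using q[of "x i"] q[of "x (Suc i)"] that by (simp add: l dist_commute)
    qed
    show "?R j" using 1 2 3 by (intro exI[of _ l]) (simp add: e_def)
  qed
next
  assume R: "\<forall>j. ?R j"
  then obtain l where l: "\<And>j i. i \<le> k \<Longrightarrow> emeasure N (cball (d (l j ! i)) (1 / Suc j)) \<noteq> 0"
    "\<And>j. norm (d (l j ! 0)) \<le> m + 1 / Suc j" "\<And>j. n \<le> norm (d (l j ! k)) + 1 / Suc j"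
    "\<And>j i. i < k \<Longrightarrow> dist (d (l j ! i)) (d (l j ! Suc i)) \<le> 2 * r + 2 / Suc j" by metis
  \<comment> \<open>True atoms near the dense points. They satisfy the conditions of the chain up to
    errors of order 1 / Suc j.\<close>
  define y where "y j i = (SOME p. p \<in> cball (d (l j ! i)) (1 / Suc j) \<and> p \<in> atoms N)" for j i
  have "y j i \<in> cball (d (l j ! i)) (1 / Suc j) \<and> y j i \<in> atoms N" if "i \<le> k" for i j
    unfolding y_def
  proof (rule someI_ex)
    show "\<exists>p. p \<in> cball (d (l j ! i)) (1 / Suc j) \<and> p \<in> atoms N"
      using atom_exists[OF N _ _ l(1)[OF that, of j]] unfolding Bex_def by simp
  qed
  then have y: "\<And>i j. i \<le> k \<Longrightarrow> dist (d (l j ! i)) (y j i) \<le> 1 / Suc j"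
    "\<And>i j. i \<le> k \<Longrightarrow> y j i \<in> atoms N" by (simp_all only: mem_cball)
  have ey: "\<bar>norm (d (l j ! i)) - norm (y j i)\<bar> \<le> 1 / Suc j" if "i \<le> k" for i j
    using y(1)[OF that, of j] norm_triangle_ineq3[of "d (l j ! i)" "y j i"] by (simp add: dist_norm)
  have two: "2 / real (Suc j) = 1 / Suc j + 1 / Suc j" for j by (simp add: field_simps)
  have y0: "norm (y j 0) \<le> m + 2 / Suc j" for j
    using ey[of 0 j] l(2)[of j] two[of j] unfolding abs_le_iff by linarith
  have yk: "n \<le> norm (y j k) + 2 / Suc j" for j
    using ey[of k j] l(3)[of j] two[of j] unfolding abs_le_iff by linarith
  have yd: "dist (y j i) (y j (Suc i)) \<le> 2 * r + 4 / Suc j" if "i < k" for i j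
  proof -
    have "dist (y j i) (y j (Suc i)) \<le> dist (y j i) (d (l j ! i)) +
        dist (d (l j ! i)) (d (l j ! Suc i)) + dist (d (l j ! Suc i)) (y j (Suc i))"
      by (rule dist_triangle4)
    moreover have "4 / real (Suc j) = 1 / Suc j + 2 / Suc j + 1 / Suc j" by (simp add: field_simps)
    ultimately show ?thesis using y(1)[of i j] y(1)[of "Suc i" j] l(4)[OF that, of j] that
      by (simp add: dist_commute)
  qed
  \<comment> \<open>The start has norm at most m + 2 and every hop has length at most 2 * r + 4,
    uniformly in j. So all these chains live on the finitely many atoms of one ball.\<close>
  have yb: "norm (y j i) \<le> m + 2 + real i * (2 * r + 4)" if "i \<le> k" for i j
    using that
  proof (induction i)
    case 0
    have "2 / real (Suc j) \<le> 2" by (simp add: field_simps)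
    then show ?case using y0[of j] by simp
  next
    case (Suc i)
    have "norm (y j (Suc i)) \<le> norm (y j i) + dist (y j i) (y j (Suc i))"
      by (metis dist_norm norm_minus_commute norm_triangle_sub)
    moreover have "4 / real (Suc j) \<le> 4" by (simp add: field_simps)
    ultimately show ?case using Suc yd[of i j] by (simp add: algebra_simps)
  qed
  define b where "b = m + 2 + real k * (2 * \<bar>r\<bar> + 4)"
  have "norm (y j i) \<le> b" if "i \<le> k" for i j
  proof -
    have "real i * (2 * r + 4) \<le> real k * (2 * \<bar>r\<bar> + 4)"
    proof (rule order_trans)
      show "real i * (2 * r + 4) \<le> real i * (2 * \<bar>r\<bar> + 4)" by (intro mult_left_mono) auto
      show "real i * (2 * \<bar>r\<bar> + 4) \<le> real k * (2 * \<bar>r\<bar> + 4)" using that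
          by (intro mult_right_mono) auto
    qed
    then show ?thesis using yb[OF that, of j] by (simp add: b_def)
  qed
  then have "(\<lambda>i\<in>{..k}. y j i) \<in> ({..k} \<rightarrow>\<^sub>E (atoms N \<inter> cball 0 b))" for j
    using y(2) by auto
  moreover have "finite ({..k} \<rightarrow>\<^sub>E (atoms N \<inter> cball 0 b))"
    by (intro finite_PiE finite_atoms[OF N]) auto
  ultimately have "finite (range (\<lambda>j. \<lambda>i\<in>{..k}. y j i))"
    by (metis (no_types, lifting) finite_subset image_subset_iff)
  \<comment> \<open>Only finitely many tuples of atoms are possible, so one tuple serves arbitrarily
    large j and thus satisfies the conditions without error.\<close>
  then obtain j0 where inf: "infinite {j. (\<lambda>i\<in>{..k}. y j i) = (\<lambda>i\<in>{..k}. y j0 i)}"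
    using pigeonhole_infinite[of UNIV "\<lambda>j. \<lambda>i\<in>{..k}. y j i"] by auto
  have small: "\<exists>j. c / Suc j < e \<and> (\<forall>i\<le>k. y j i = y j0 i)" if "e > 0" for c e :: real
  proof -
    obtain j where j: "(\<lambda>i\<in>{..k}. y j i) = (\<lambda>i\<in>{..k}. y j0 i)" "nat \<lceil>\<bar>c\<bar> / e\<rceil> < j"
      using inf unfolding infinite_nat_iff_unbounded by blast
    have "\<bar>c\<bar> / e < Suc j" using j(2) by linarith
    then have "\<bar>c\<bar> / Suc j < e" using that by (simp add: field_simps)
    moreover have "c / Suc j \<le> \<bar>c\<bar> / Suc j" by (intro divide_right_mono) auto
    moreover have "\<forall>i\<le>k. y j i = y j0 i" using fun_cong[OF j(1)]
        by (metis atMost_iff restrict_apply')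
    ultimately show ?thesis by (intro exI[of _ j]) auto
  qed
  have "norm (y j0 0) \<le> m"
  proof (rule field_le_epsilon)
    fix e :: real assume "e > 0"
    from small[OF this, of 2] obtain j where "2 / Suc j < e" "\<forall>i\<le>k. y j i = y j0 i" by blast
    then show "norm (y j0 0) \<le> m + e" using y0[of j] by simp
  qed
  moreover have "n \<le> norm (y j0 k)"
  proof (rule field_le_epsilon)
    fix e :: real assume "e > 0"
    from small[OF this, of 2] obtain j where "2 / Suc j < e" "\<forall>i\<le>k. y j i = y j0 i" by blast
    then show "n \<le> norm (y j0 k) + e" using yk[of j] by simp
  qed
  moreover have "dist (y j0 i) (y j0 (Suc i)) \<le> 2 * r" if "i < k" for i
  proof (rule field_le_epsilon)
    fix e :: real assume "e > 0"
    from small[OF this, of 4] obtain j where "4 / Suc j < e" "\<forall>i\<le>k. y j i = y j0 i" by blast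
    then show "dist (y j0 i) (y j0 (Suc i)) \<le> 2 * r + e" using yd[OF that, of j] that by simp
  qed
  ultimately have "atom_chain N r k m n (y j0)" using y(2) by (auto simp: atom_chain_def)
  then show ?L by blast
qed

text \<open>\<open>measure\<close> is 0 outside the sigma-algebra, so the positive probabilities in
  \<open>critical_radius\<close> are meaningful, and monotonicity of the measure applies, only with
  this.\<close>

lemma percolates_measurable:
  assumes "0 \<le> r"
  shows "{N \<in> counting_measures. percolates (boolean_model N r)} \<in> sets counting_space"
proof -
  obtain d :: "nat \<Rightarrow> plane" where d: "\<And>x e. e > 0 \<Longrightarrow> \<exists>i. dist x (d i) < e"
    using dense_sequence_plane by blast
  have "{N \<in> counting_measures. percolates (boolean_model N r)} =
    {N \<in> space counting_space. \<exists>m::nat. \<forall>n::nat. \<exists>k. \<forall>j::nat. \<exists>l::nat list.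
       (\<forall>i\<in>{..k}. emeasure N (cball (d (l ! i)) (1 / Suc j)) \<noteq> 0) \<and>
       norm (d (l ! 0)) \<le> real m + 1 / Suc j \<and> real n \<le> norm (d (l ! k)) + 1 / Suc j \<and>
       (\<forall>i<k. dist (d (l ! i)) (d (l ! Suc i)) \<le> 2 * r + 2 / Suc j)}"
    using percolates_iff_chains[OF _ assms] atom_chain_approx_iff[OF _ d]
    by (intro Collect_cong conj_cong) (simp_all only: space_counting_space Ball_def atMost_iff)
  also have "\<dots> \<in> sets counting_space" by measurable
  finally show ?thesis .
qed

section \<open>Poisson kernels with a density\<close>

lemma emeasure_lborel_under_graph:
  fixes f :: "plane \<Rightarrow> real"
  assumes [measurable]: "f \<in> borel_measurable borel" "B \<in> sets borel" and f: "\<And>y. 0 \<le> f y"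
  shows "{p. fst p \<in> B \<and> 0 \<le> snd p \<and> snd p < f (fst p)} \<in> sets (borel :: (plane \<times> real) measure)"
    and "emeasure (lborel :: (plane \<times> real) measure) {p. fst p \<in> B \<and> 0 \<le>
        snd p \<and> snd p < f (fst p)} =
      emeasure (density lborel (\<lambda>y. ennreal (f y))) B"
proof -
  let ?E = "{p :: plane \<times> real. fst p \<in> B \<and> 0 \<le> snd p \<and> snd p < f (fst p)}"
  have "Measurable.pred (borel \<Otimes>\<^sub>M borel) (\<lambda>p :: plane \<times> real. fst p \<in> B \<and> 0 \<le>
      snd p \<and> snd p < f (fst p))"
    by measurable
  then show E: "?E \<in> sets borel" by (simp only: pred_def borel_prod space_borel UNIV_I simp_thms)
  then have E': "?E \<in> sets (lborel \<Otimes>\<^sub>M lborel)" by (simp only: lborel_prod sets_lborel)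
  have "emeasure lborel ?E = (\<integral>\<^sup>+y. emeasure lborel (Pair y -` ?E) \<partial>lborel)"
    using lborel.emeasure_pair_measure_alt[OF E'] by (simp only: lborel_prod)
  also have "\<dots> = (\<integral>\<^sup>+y. ennreal (f y) * indicator B y \<partial>lborel)"
  proof (intro nn_integral_cong)
    fix y
    have "Pair y -` ?E = (if y \<in> B then {0..<f y} else {})" by auto
    then show "emeasure lborel (Pair y -` ?E) = ennreal (f y) * indicator B y" using f[of y] by simp
  qed
  also have "\<dots> = emeasure (density lborel (\<lambda>y. ennreal (f y))) B"
    by (subst emeasure_density) auto
  finally show "emeasure lborel ?E = emeasure (density lborel (\<lambda>y. ennreal (f y))) B" .
qed

text \<open>
  The points of a Poisson process on \<open>plane \<times> real\<close> lying under the graph of the intensity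
  project to a Poisson process with that intensity; the process in space does not depend on the
  intensity, so the construction is measurable in parameters.
\<close>

lemma poisson_kernel_exists:
  fixes M :: "'w measure" and lam :: "'w \<Rightarrow> plane \<Rightarrow> real"
  assumes lam[measurable]: "(\<lambda>(w, y). lam w y) \<in> borel_measurable (M \<Otimes>\<^sub>M borel)"
    and lam0: "\<And>w y. 0 \<le> lam w y"
    and fin: "\<And>w B. w \<in> space M \<Longrightarrow> B \<in> sets borel \<Longrightarrow> bounded B \<Longrightarrow>
      emeasure (density lborel (\<lambda>y. ennreal (lam w y))) B < \<infinity>"
  shows "\<exists>K \<in> measurable M (prob_algebra counting_space).
    \<forall>w\<in>space M. poisson_process (density lborel (\<lambda>y. ennreal (lam w y))) (K w)"
proof -
  define X :: "(plane \<times> real) measure" where "X = lborel"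
  have "\<exists>\<kappa> \<nu>. (\<forall>i::nat. 0 \<le> \<kappa> i) \<and> (\<forall>i. prob_space (\<nu> i)) \<and> (\<forall>i. sets (\<nu> i) = sets X) \<and>
    (\<forall>E\<in>sets X. (\<Sum>i. ennreal (\<kappa> i * measure (\<nu> i) E)) = emeasure X E)"
    unfolding X_def by (rule lborel.points_space_intensity_exists) simp
  then obtain \<kappa> \<nu> where *: "(\<forall>i::nat. 0 \<le> \<kappa> i) \<and> (\<forall>i. prob_space (\<nu> i)) \<and> (\<forall>i. sets (\<nu> i) =
      sets X) \<and>
    (\<forall>E\<in>sets X. (\<Sum>i. ennreal (\<kappa> i * measure (\<nu> i) E)) = emeasure X E)" by (elim exE)
  then have \<kappa>: "\<And>i. 0 \<le> \<kappa> i" and \<nu>: "\<And>i. prob_space (\<nu> i)" and s\<nu>: "\<And>i. sets (\<nu> i) = sets X"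
    and int: "\<And>E. E \<in> sets X \<Longrightarrow> (\<Sum>i. ennreal (\<kappa> i * measure (\<nu> i) E)) = emeasure X E"
    by simp_all
  have sX [measurable_cong]: "sets X = sets (borel \<Otimes>\<^sub>M borel)"
      by (simp only: X_def borel_prod sets_lborel)
  define P where "P = points_space \<kappa> \<nu>"
  interpret P: prob_space P unfolding P_def by (rule prob_space_points_space[OF \<kappa> \<nu> s\<nu>])
  have [measurable]: "(\<lambda>w. fst (w i)) \<in> measurable P (count_space UNIV)"
     "(\<lambda>w. snd (w i) j) \<in> measurable P X" for i j
    unfolding P_def using measurable_points[OF \<kappa> \<nu> s\<nu>] by auto
  have [measurable]: "fst \<in> measurable X borel" "snd \<in> measurable X borel"
    by (simp_all add: measurable_cong_sets[OF sX refl])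
  have meas_lam: "lam w \<in> borel_measurable borel" if "w \<in> space M" for w
    using measurable_compose_Pair1[OF that lam] by simp
  define E where "E w B = {p :: plane \<times> real. fst p \<in> B \<and> 0 \<le>
      snd p \<and> snd p < lam w (fst p)}" for w B
  have E_sets: "E w B \<in> sets X" and E_int: "emeasure X (E w B) =
      emeasure (density lborel (\<lambda>y. ennreal (lam w y))) B"
    if "w \<in> space M" "B \<in> sets borel" for w B
    using emeasure_lborel_under_graph[OF meas_lam[OF that(1)] that(2) lam0]
        by (simp_all add: E_def X_def)
  \<comment> \<open>The points are indexed by pairs (i, j): pushing the counting measure on the
    indices forward keeps the multiplicity of points that project to the same place.\<close>
  define S where "S w \<omega> = {(i, j). j < fst (\<omega> i) \<and> snd (\<omega> i) j \<in> E w UNIV}"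
    for w and \<omega> :: "nat \<Rightarrow> nat \<times> (nat \<Rightarrow> plane \<times> real)"
  define lf where "lf w \<omega> \<longleftrightarrow> (\<forall>m::nat. points_count (E w (ball 0 (real m))) \<omega> < \<infinity>)"
    for w and \<omega> :: "nat \<Rightarrow> nat \<times> (nat \<Rightarrow> plane \<times> real)"
  \<comment> \<open>Outcomes that are not locally finite are sent to the empty configuration, so
    that F takes values in \<open>counting_measures\<close> everywhere. For every parameter in the
    space of M they form a null event.\<close>
  define F where "F w \<omega> = (if lf w \<omega> then distr (count_space (S w \<omega>)) borel (\<lambda>(i, j).
      fst (snd (\<omega> i) j))
      else null_measure borel)" for w \<omega>
  have count_E: "emeasure (distr (count_space (S w \<omega>)) borel (\<lambda>(i, j). fst (snd (\<omega> i) j))) B =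
      points_count (E w B) \<omega>"
    if "B \<in> sets borel" for w \<omega> B
  proof -
    let ?A = "(\<lambda>(i, j). fst (snd (\<omega> i) j)) -` B \<inter> S w \<omega>"
    have "emeasure (distr (count_space (S w \<omega>)) borel (\<lambda>(i, j). fst (snd (\<omega> i) j))) B =
        emeasure (count_space (S w \<omega>)) ?A"
      using that by (subst emeasure_distr) auto
    also have "\<dots> = emeasure (count_space UNIV) ?A" by (simp add: emeasure_count_space)
    also have "\<dots> = (\<integral>\<^sup>+p. indicator ?A p \<partial>count_space UNIV)" by simp
    also have "\<dots> = (\<integral>\<^sup>+i. \<integral>\<^sup>+j. indicator ?A (i, j) \<partial>count_space UNIV \<partial>count_space UNIV)"
      by (rule nn_integral_fst_count_space[symmetric])
    also have "\<dots> = (\<Sum>i. \<Sum>j. indicator ?A (i, j))"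
      by (simp add: nn_integral_count_space_nat)
    also have "\<dots> = points_count (E w B) \<omega>"
      unfolding points_count_def by (intro suminf_cong) (auto simp: S_def E_def indicator_def)
    finally show ?thesis .
  qed
  have F_count: "emeasure (F w \<omega>) B = (if lf w \<omega> then points_count (E w B) \<omega> else 0)"
    if "B \<in> sets borel" for w \<omega> B
    using count_E[OF that, of w \<omega>] by (simp add: F_def)
  have F_counting: "F w \<omega> \<in> counting_measures" for w \<omega>
  proof (cases "lf w \<omega>")
    case True
    have "emeasure (F w \<omega>) B \<in> range of_nat" if B: "B \<in> sets borel" "bounded B" for B
    proof -
      obtain m0 where "B \<subseteq> ball 0 m0" using bounded_subset_ballD[OF B(2), of 0] by blast
      then have "B \<subseteq> ball 0 (real (nat \<lceil>m0\<rceil>))" using real_nat_ceiling_ge[of m0] by fastforce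
      then have "emeasure (F w \<omega>) B \<le> emeasure (F w \<omega>) (ball 0 (real (nat \<lceil>m0\<rceil>)))"
        by (intro emeasure_mono) (auto simp: F_def)
      also have "\<dots> < \<infinity>" using True by (simp add: F_count) (simp add: lf_def)
      finally have "points_count (E w B) \<omega> < \<infinity>" using True B(1) by (simp add: F_count)
      then obtain k where "points_count (E w B) \<omega> = of_nat k" unfolding points_count_finite_iff
          by blast
      then show ?thesis using True B(1) by (simp add: F_count)
    qed
    then show ?thesis by (simp add: counting_measures_def F_def)
  next
    case False
    then show ?thesis by (auto simp: counting_measures_def F_def intro: range_eqI[of _ _ 0])
  qed
  have [measurable]: "(\<lambda>x. points_count (E (fst x) B) (snd x)) \<in> borel_measurable (M \<Otimes>\<^sub>M P)"
    if [measurable]: "B \<in> sets borel" for B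
    unfolding points_count_def E_def mem_Collect_eq by measurable
  have [measurable]: "Measurable.pred (M \<Otimes>\<^sub>M P) (\<lambda>x. lf (fst x) (snd x))"
    unfolding lf_def by measurable
  have F_meas: "(\<lambda>(w, \<omega>). F w \<omega>) \<in> measurable (M \<Otimes>\<^sub>M P) counting_space"
  proof (rule measurable_counting_spaceI)
    fix B :: "plane set" assume [measurable]: "B \<in> sets borel"
    show "(\<lambda>x. emeasure ((\<lambda>(w, \<omega>). F w \<omega>) x) B) \<in> borel_measurable (M \<Otimes>\<^sub>M P)"
      by (simp add: F_count split_beta)
  qed (auto simp: F_counting split_beta)
  define K where "K w = distr P counting_space (F w)" for w
  have F_w: "F w \<in> measurable P counting_space" if "w \<in> space M" for w
    using measurable_compose_Pair1[OF that F_meas] by simp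
  have K: "K \<in> measurable M (prob_algebra counting_space)"
  proof (rule measurable_prob_algebraI)
    show "prob_space (K w)" if "w \<in> space M" for w
      unfolding K_def by (rule P.prob_space_distr[OF F_w[OF that]])
    show "K \<in> measurable M (subprob_algebra counting_space)"
      unfolding K_def using F_meas by (rule measurable_distr2) simp
  qed
  moreover have "poisson_process (density lborel (\<lambda>y. ennreal (lam w y))) (K w)" if w:
      "w \<in> space M" for w
  proof -
    let ?\<Lambda> = "density lborel (\<lambda>y. ennreal (lam w y))"
    have [measurable]: "F w \<in> measurable P counting_space" by (rule F_w[OF w])
    interpret K: prob_space "K w" unfolding K_def by (rule P.prob_space_distr) measurable
    have spK: "space (K w) = counting_measures" "sets (K w) = sets counting_space"
        by (simp_all add: K_def)
    have m: "(\<Sum>i. ennreal (\<kappa> i * measure (\<nu> i) (E w B))) = ennreal (measure ?\<Lambda> B)"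
      if "B \<in> sets borel" "bounded B" for B
      using fin[OF w that] int[OF E_sets[OF w that(1)]] E_int[OF w that(1)]
      by (simp add: emeasure_eq_ennreal_measure less_top)
    have "AE \<omega> in P. points_count (E w B) \<omega> < \<infinity>" if "B \<in> sets borel" "bounded B" for B
      unfolding P_def using m[OF that] E_sets[OF w that(1)]
          by (intro AE_points_count_finite[OF \<kappa> \<nu> s\<nu>]) simp_all
    then have AE_lf: "AE \<omega> in P. lf w \<omega>" unfolding lf_def by (subst AE_all_countable) auto
    \<comment> \<open>With arbitrary Borel sets A l of values, this yields both the point
      probabilities (one index, one value) and the factorization that independence requires.\<close>
    have joint: "emeasure (K w) {N \<in> space (K w). \<forall>l\<in>L. emeasure N (B l) \<in> A l} =
        (\<Prod>l\<in>L. emeasure (pois (measure ?\<Lambda> (B l))) {k. of_nat k \<in> A l})"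
      if L: "finite L" "disjoint_family_on B L" and B: "\<And>l. l \<in> L \<Longrightarrow>
          B l \<in> sets borel \<and> bounded (B l)"
        and A: "\<And>l. l \<in> L \<Longrightarrow> A l \<in> sets borel" for L :: "nat set" and B A
    proof -
      have "{N \<in> space counting_space. \<forall>l\<in>L. emeasure N (B l) \<in> A l} \<in> sets counting_space"
        using L B A by (intro sets.sets_Collect_finite_All measurable_sets_Collect[OF
            measurable_emeasure_counting]) auto
      then have meas: "{N \<in> counting_measures. \<forall>l\<in>L.
          emeasure N (B l) \<in> A l} \<in> sets counting_space" by simp
      have "emeasure (K w) {N \<in> space (K w). \<forall>l\<in>L. emeasure N (B l) \<in> A l} =
          emeasure P (F w -` {N \<in> counting_measures. \<forall>l\<in>L. emeasure N (B l) \<in> A l} \<inter> space P)"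
        unfolding spK unfolding K_def by (rule emeasure_distr[OF F_w[OF w] meas])
      also have "F w -` {N \<in> counting_measures. \<forall>l\<in>L. emeasure N (B l) \<in> A l} \<inter> space P =
          {\<omega> \<in> space P. \<forall>l\<in>L. emeasure (F w \<omega>) (B l) \<in> A l}" using F_counting by auto

      also have "emeasure P {\<omega> \<in> space P. \<forall>l\<in>L. emeasure (F w \<omega>) (B l) \<in> A l} =
          emeasure P {\<omega> \<in> space P. \<forall>l\<in>L. \<exists>k\<in>{k. of_nat k \<in> A l}. points_count (E w (B l)) \<omega> =
          of_nat k}"
      proof (rule emeasure_eq_AE)
        have "AE \<omega> in P. \<forall>l\<in>L. points_count (E w (B l)) \<omega> < \<infinity>"
          using \<open>\<And>B. B \<in> sets borel \<Longrightarrow> bounded B \<Longrightarrow> AE \<omega> in P. points_count (E w B) \<omega> < \<infinity>\<close> L B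
          by (simp add: AE_finite_all)
        then show "AE \<omega> in P. (\<omega> \<in> {\<omega> \<in> space P. \<forall>l\<in>L. emeasure (F w \<omega>) (B l) \<in> A l}) =
            (\<omega> \<in> {\<omega> \<in> space P. \<forall>l\<in>L. \<exists>k\<in>{k. of_nat k \<in> A l}. points_count (E w (B l)) \<omega> =
                of_nat k})"
          using AE_lf
        proof eventually_elim
          fix \<omega> assume f: "\<forall>l\<in>L. points_count (E w (B l)) \<omega> < \<infinity>" and "lf w \<omega>"
          then have "emeasure (F w \<omega>) (B l) = points_count (E w (B l)) \<omega>" if "l \<in> L" for l
            using B that by (simp add: F_count)
          moreover have "(points_count (E w (B l)) \<omega> \<in> A l) =
              (\<exists>k\<in>{k. of_nat k \<in> A l}. points_count (E w (B l)) \<omega> = of_nat k)"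
            if "l \<in> L" for l
          proof -
            from f that obtain k where "points_count (E w (B l)) \<omega> = of_nat k"
              unfolding points_count_finite_iff by blast
            then show ?thesis by (auto simp: )
          qed
          ultimately show "(\<omega> \<in> {\<omega> \<in> space P. \<forall>l\<in>L. emeasure (F w \<omega>) (B l) \<in> A l}) =
            (\<omega> \<in> {\<omega> \<in> space P. \<forall>l\<in>L. \<exists>k\<in>{k. of_nat k \<in> A l}. points_count (E w (B l)) \<omega> =
                of_nat k})"
            by simp
        qed
        show "{\<omega> \<in> space P. \<forall>l\<in>L. emeasure (F w \<omega>) (B l) \<in> A l} \<in> sets P"
          using L B A
          by (intro sets.sets_Collect_finite_All measurable_sets_Collect[OF
              measurable_emeasure_counting]) auto
        have "{\<omega> \<in> space P. points_count (E w (B l)) \<omega> \<in> of_nat ` {k. of_nat k \<in> A l}} \<in> sets P"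
            if "l \<in> L" for l
        proof -
          have "countable (of_nat ` {k. of_nat k \<in> A l} :: ennreal set)" by simp
          then have [measurable]: "of_nat ` {k. of_nat k \<in> A l} \<in> sets (borel :: ennreal measure)"
            by (rule sets.countable[rotated]) auto
          have [measurable]: "points_count (E w (B l)) \<in> borel_measurable P"
            unfolding P_def using B[OF that] E_sets[OF w]
                by (intro measurable_points_count[OF \<kappa> \<nu> s\<nu>]) simp
          show ?thesis by measurable
        qed
        then have "{\<omega> \<in> space P. \<forall>l\<in>L. points_count (E w (B l)) \<omega> \<in> of_nat ` {k.
            of_nat k \<in> A l}} \<in> sets P"
          using L(1) by (intro sets.sets_Collect_finite_All) auto
        then show "{\<omega> \<in> space P. \<forall>l\<in>L. \<exists>k\<in>{k. of_nat k \<in> A l}. points_count (E w (B l)) \<omega> =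
            of_nat k} \<in> sets P"
          by (simp only: image_iff)
      qed
      also have "\<dots> = (\<Prod>l\<in>L. emeasure (pois (measure ?\<Lambda> (B l))) {k. of_nat k \<in> A l})"
        unfolding P_def
      proof (rule points_count_joint[OF \<kappa> \<nu> s\<nu> L(1)])
        show "disjoint_family_on (\<lambda>l. E w (B l)) L"
          using L(2) unfolding disjoint_family_on_def E_def by blast
        show "E w (B l) \<in> sets X" if "l \<in> L" for l using E_sets[OF w] B[OF that] by blast
        show "(\<Sum>i. ennreal (\<kappa> i * measure (\<nu> i) (E w (B l)))) = ennreal (measure ?\<Lambda> (B l))" if
            "l \<in> L" for l
          using m B[OF that] by blast
      qed simp
      finally show ?thesis .
    qed
    show ?thesis unfolding poisson_process_def
    proof (intro conjI ballI allI impI)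
      show "sets ?\<Lambda> = sets borel" by simp
      show "emeasure ?\<Lambda> B < \<infinity>" if "B \<in> sets borel" "bounded B" for B by (rule fin[OF w that])
      show "point_process (K w)" using spK K.prob_space_axioms by (simp add: point_process_def)
      show "measure (K w) {N \<in> space (K w). emeasure N B = of_nat k} =
          measure ?\<Lambda> B ^ k / fact k * exp (- measure ?\<Lambda> B)"
        if B: "B \<in> sets borel" "bounded B" for B k
      proof -
        have "emeasure (K w) {N \<in> space (K w). \<forall>l\<in>{0::nat}. emeasure N B \<in> {of_nat k}} =
            (\<Prod>l\<in>{0::nat}. emeasure (pois (measure ?\<Lambda> B)) {j. of_nat j \<in> {of_nat k :: ennreal}})"
          using B by (intro joint) (auto simp: disjoint_family_on_def)
        then have "emeasure (K w) {N \<in> space (K w). emeasure N B = of_nat k} =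
            ennreal (pmf (pois (measure ?\<Lambda> B)) k)"
          by (simp add: emeasure_pmf_single)
        then show ?thesis by (simp add: measure_def pmf_pois)
      qed
      fix n :: nat and B :: "nat \<Rightarrow> plane set"
      assume B: "\<forall>i<n. B i \<in> sets borel \<and> bounded (B i)" and dis: "disjoint_family_on B {..<n}"
      have rv: "(\<lambda>N. emeasure N (B i)) \<in> borel_measurable (K w)" if "i < n" for i
        unfolding K_def using B that by (simp add: measurable_emeasure_counting)
      show "K.indep_vars (\<lambda>_. borel) (\<lambda>i N. emeasure N (B i)) {..<n}"
      \<comment> \<open>For n = 0 the intersection over j < n is the universal set and not the space
        of configurations.\<close>
      proof (cases "n = 0")
        case True
        then show ?thesis by (simp add: K.indep_vars_def K.indep_sets_def)
      next
        case False
        show ?thesis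
        proof (subst K.indep_vars_finite[where E="\<lambda>_. sets borel"])
          show "sets borel = sigma_sets (space borel) (sets borel)"
            by (rule sets.sigma_sets_eq[symmetric])
          show "Int_stable (sets borel)" by (rule sets.Int_stable)
          show "\<forall>A\<in>{..<n} \<rightarrow> sets borel. K.prob (\<Inter>j<n. (\<lambda>N. emeasure N (B j)) -` A j \<inter> space (K w)) =
              (\<Prod>j<n. K.prob ((\<lambda>N. emeasure N (B j)) -` A j \<inter> space (K w)))"
          proof
            fix A assume A: "A \<in> {..<n} \<rightarrow> sets (borel :: ennreal measure)"
            have 1: "K.prob ((\<lambda>N. emeasure N (B j)) -` A j \<inter> space (K w)) =
                measure (pois (measure ?\<Lambda> (B j))) {k. of_nat k \<in> A j}" if "j < n" for j
            proof -
              have "emeasure (K w) {N \<in> space (K w). \<forall>l\<in>{j}. emeasure N (B l) \<in> A l} =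
                  (\<Prod>l\<in>{j}. emeasure (pois (measure ?\<Lambda> (B l))) {k. of_nat k \<in> A l})"
                using B A that by (intro joint) (auto simp: disjoint_family_on_def)
              moreover have "(\<lambda>N. emeasure N (B j)) -` A j \<inter> space (K w) =
                  {N \<in> space (K w). \<forall>l\<in>{j}. emeasure N (B l) \<in> A l}"
                by auto
              ultimately show ?thesis by (simp add: measure_def)
            qed
            have "emeasure (K w) {N \<in> space (K w). \<forall>l\<in>{..<n}. emeasure N (B l) \<in> A l} =
                (\<Prod>l\<in>{..<n}. emeasure (pois (measure ?\<Lambda> (B l))) {k. of_nat k \<in> A l})"
              using B A dis by (intro joint) auto
            moreover have "(\<Inter>j<n. (\<lambda>N. emeasure N (B j)) -` A j \<inter> space (K w)) =
                {N \<in> space (K w). \<forall>l\<in>{..<n}. emeasure N (B l) \<in> A l}"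
              using False by auto
            ultimately have "K.prob (\<Inter>j<n. (\<lambda>N. emeasure N (B j)) -` A j \<inter> space (K w)) =
                enn2real (\<Prod>l<n. emeasure (pois (measure ?\<Lambda> (B l))) {k. of_nat k \<in> A l})"
              by (simp add: measure_def)
            also have "\<dots> = (\<Prod>l<n. measure (pois (measure ?\<Lambda> (B l))) {k. of_nat k \<in> A l})"
              by (simp add: measure_pmf.emeasure_eq_measure prod_ennreal prod_nonneg)
            also have "\<dots> = (\<Prod>j<n. K.prob ((\<lambda>N. emeasure N (B j)) -` A j \<inter> space (K w)))"
              using 1 by simp
            finally show "K.prob (\<Inter>j<n. (\<lambda>N. emeasure N (B j)) -` A j \<inter> space (K w)) =
              (\<Prod>j<n. K.prob ((\<lambda>N. emeasure N (B j)) -` A j \<inter> space (K w)))" .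
          qed
        qed (use False rv in auto)
      qed
    qed
  qed
  ultimately show ?thesis by blast
qed

lemma homogeneous_poisson_exists:
  assumes "0 < a"
  shows "\<exists>P. homogeneous_poisson a P"
proof -
  have eq: "density lborel (\<lambda>y. ennreal a) = scale_measure (ennreal a) (lborel :: plane measure)"
    by (rule measure_eqI) (auto simp: emeasure_density_const)
  have "\<exists>K \<in> measurable (count_space (UNIV :: unit set)) (prob_algebra counting_space).
    \<forall>w\<in>space (count_space (UNIV :: unit set)). poisson_process (density lborel (\<lambda>y.
        ennreal a)) (K w)"
  proof (rule poisson_kernel_exists[of "\<lambda>_ _. a"])
    show "emeasure (density lborel (\<lambda>y. ennreal a)) B < \<infinity>"
      if "B \<in> sets borel" "bounded B" for B :: "plane set"
      using that emeasure_bounded_finite[OF that(2)]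
          by (simp add: emeasure_density_const ennreal_mult_less_top)
  qed (use assms in auto)
  then show ?thesis by (auto simp: homogeneous_poisson_def eq)
qed

section \<open>Counts, means and void probabilities of a Poisson process\<close>

lemma countable_PiE_dflt:
  assumes "finite A" "\<And>x. x \<in> A \<Longrightarrow> countable (B x)"
  shows "countable (PiE_dflt A d B)"
  unfolding dflt_image_PiE[symmetric] using assms by (intro countable_image countable_PiE) auto

context
  fixes \<Lambda> P assumes poi: "poisson_process \<Lambda> P"
begin

interpretation prob_space P
  using poi by (simp add: poisson_process_def point_process_def)

lemma poisson_process_sets: "sets P = sets counting_space" "space P = counting_measures"
proof -
  show *: "sets P = sets counting_space" using poi
      by (simp add: poisson_process_def point_process_def)
  show "space P = counting_measures" using sets_eq_imp_space_eq[OF *] by simp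
qed

lemma measurable_emeasure_poisson [measurable]:
  "B \<in> sets borel \<Longrightarrow> (\<lambda>N. emeasure N B) \<in> borel_measurable P"
  by (simp add: measurable_cong_sets[OF poisson_process_sets(1) refl] measurable_emeasure_counting)

text \<open>The vector of counts has countably many values, so its law is determined by its point
  masses, which factorize by independence. This turns expectations over configurations into
  expectations under a discrete product law.\<close>

lemma poisson_process_nn_integral:
  fixes G :: "(nat \<Rightarrow> nat) \<Rightarrow> ennreal"
  assumes B: "\<And>i. i < n \<Longrightarrow> B i \<in> sets borel \<and> bounded (B i)" and dis: "disjoint_family_on B {..<n}"
  shows "(\<integral>\<^sup>+N. G (\<lambda>i. if i < n then nat \<lfloor>measure N (B i)\<rfloor> else 0) \<partial>P) =
    (\<integral>\<^sup>+x. G x \<partial>measure_pmf (Pi_pmf {..<n} 0 (\<lambda>i. pois (measure \<Lambda> (B i)))))"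
proof -
  \<comment> \<open>The floor is exact on configurations, where bounded sets have integer mass. The
    entries from n on are 0, the default value of \<open>Pi_pmf\<close>.\<close>
  define c where "c N = (\<lambda>i. if i < n then nat \<lfloor>measure N (B i)\<rfloor> else 0)" for N :: "plane measure"
  let ?p = "Pi_pmf {..<n} 0 (\<lambda>i. pois (measure \<Lambda> (B i)))"
  define S where "S = PiE_dflt {..<n} (0::nat) (\<lambda>_. UNIV :: nat set)"
  have cS: "countable S" unfolding S_def by (rule countable_PiE_dflt) auto
  have c_in: "c N \<in> S" for N by (auto simp: c_def S_def PiE_dflt_def)
  have c_iff: "c N i = k \<longleftrightarrow> emeasure N (B i) = of_nat k" if N: "N \<in> space P" "i < n" for N i k
  proof -
    have "N \<in> counting_measures" using N poisson_process_sets by simp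
    then obtain k' where "emeasure N (B i) = of_nat k'" using counting_measuresD(4) B[OF N(2)]
        by blast
    then show ?thesis using N by (simp add: c_def measure_def)
  qed
  have meas_c: "{N \<in> space P. c N = x} \<in> sets P" and em_c: "emeasure P {N \<in> space P. c N = x} =
      ennreal (pmf ?p x)" if "x \<in> S" for x
  proof -
    have eq: "{N \<in> space P. c N = x} = {N \<in> space P. \<forall>i\<in>{..<n}. emeasure N (B i) = of_nat (x i)}"
    proof (intro Collect_cong conj_cong refl)
      fix N assume N: "N \<in> space P"
      have "c N = x \<longleftrightarrow> (\<forall>i<n. c N i = x i)"
        using that by (auto simp: S_def PiE_dflt_def fun_eq_iff) (metis c_def not_less)
      then show "(c N = x) = (\<forall>i\<in>{..<n}. emeasure N (B i) = of_nat (x i))" using c_iff[OF N]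
          by (simp add: Ball_def)
    qed
    have m1: "{N \<in> space P. emeasure N (B i) = of_nat (x i)} \<in> sets P" if "i < n" for i
    proof -
      have "(\<lambda>N. emeasure N (B i)) -` {of_nat (x i)} \<inter> space P \<in> sets P"
        using B[OF that] by (intro measurable_sets[OF measurable_emeasure_poisson]) auto
      also have "(\<lambda>N. emeasure N (B i)) -` {of_nat (x i)} \<inter> space P =
          {N \<in> space P. emeasure N (B i) = of_nat (x i)}"
        by auto
      finally show ?thesis .
    qed
    then show "{N \<in> space P. c N = x} \<in> sets P" unfolding eq
        by (intro sets.sets_Collect_finite_All) auto
    have "measure P {N \<in> space P. \<forall>i\<in>{..<n}. emeasure N (B i) = of_nat (x i)} =
        (\<Prod>i<n. measure P {N \<in> space P. emeasure N (B i) = of_nat (x i)})"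
    proof (cases "n = 0")
      case True then show ?thesis by (simp add: prob_space)
    next
      case False
      have "indep_vars (\<lambda>_. borel) (\<lambda>i N. emeasure N (B i)) {..<n}"
        using poi B dis by (simp add: poisson_process_def)
      from indep_varsD[OF this, of "{..<n}" "\<lambda>i. {of_nat (x i)}"] False
      have "prob (\<Inter>i<n. (\<lambda>N. emeasure N (B i)) -` {of_nat (x i)} \<inter> space P) =
          (\<Prod>i<n. prob ((\<lambda>N. emeasure N (B i)) -` {of_nat (x i)} \<inter> space P))" by auto
      moreover have "(\<Inter>i<n. (\<lambda>N. emeasure N (B i)) -` {of_nat (x i)} \<inter> space P) =
          {N \<in> space P. \<forall>i\<in>{..<n}. emeasure N (B i) = of_nat (x i)}" using False by auto
      moreover have "(\<lambda>N. emeasure N (B i)) -` {of_nat (x i)} \<inter> space P =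
          {N \<in> space P. emeasure N (B i) = of_nat (x i)}" for i
        by auto
      ultimately show ?thesis by simp
    qed
    also have "\<dots> = (\<Prod>i<n. pmf (pois (measure \<Lambda> (B i))) (x i))"
      using poi B by (intro prod.cong) (auto simp: poisson_process_def pmf_pois)
    also have "\<dots> = pmf ?p x"
      using that by (subst pmf_Pi') (auto simp: S_def PiE_dflt_def)
    finally show "emeasure P {N \<in> space P. c N = x} = ennreal (pmf ?p x)"
      unfolding eq by (simp add: emeasure_eq_measure)
  qed
  have c: "c \<in> measurable P (count_space S)"
    unfolding measurable_count_space_eq_countable[OF cS] using meas_c c_in
        by (auto simp: vimage_def Int_def conj_commute)
  have "distr P (count_space S) c = density (count_space S) (\<lambda>x. ennreal (pmf ?p x))"
  proof (rule measure_eqI_countable[OF _ _ cS])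
    fix x assume x: "x \<in> S"
    have "emeasure (distr P (count_space S) c) {x} = emeasure P {N \<in> space P. c N = x}"
      using x by (subst emeasure_distr[OF c]) (auto intro!: arg_cong[where f="emeasure P"])
    also have "\<dots> = ennreal (pmf ?p x)" by (rule em_c[OF x])
    also have "\<dots> = emeasure (density (count_space S) (\<lambda>x. ennreal (pmf ?p x))) {x}"
      using x by (subst emeasure_density) (auto simp: nn_integral_count_space_indicator)
    finally show "emeasure (distr P (count_space S) c) {x} =
        emeasure (density (count_space S) (\<lambda>x. ennreal (pmf ?p x))) {x}" .
  qed auto
  then have "(\<integral>\<^sup>+N. G (c N) \<partial>P) = (\<integral>\<^sup>+x. G x \<partial>density (count_space S) (\<lambda>x. ennreal (pmf ?p x)))"
    by (subst nn_integral_distr[OF c, symmetric]) auto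
  also have "\<dots> = (\<integral>\<^sup>+x. ennreal (pmf ?p x) * G x \<partial>count_space S)" by (simp add: nn_integral_density)
  also have "\<dots> = (\<integral>\<^sup>+x. ennreal (pmf ?p x) * G x \<partial>count_space UNIV)"
  proof (subst nn_integral_count_space_indicator, simp, intro nn_integral_cong)
    fix x
    show "ennreal (pmf ?p x) * G x * indicator S x = ennreal (pmf ?p x) * G x"
    proof (cases "x \<in> S")
      case False
      then have "pmf ?p x = 0" by (intro pmf_Pi_outside) (auto simp: S_def PiE_dflt_def)
      then show ?thesis by simp
    qed simp
  qed
  also have "\<dots> = (\<integral>\<^sup>+x. G x \<partial>measure_pmf ?p)" by (simp add: nn_integral_measure_pmf)
  finally show ?thesis by (simp add: c_def)
qed

lemma poisson_process_mean_bounded: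
  assumes B: "B \<in> sets borel" "bounded B"
  shows "(\<integral>\<^sup>+N. emeasure N B \<partial>P) = emeasure \<Lambda> B"
proof -
  have "(\<integral>\<^sup>+N. emeasure N B \<partial>P) = (\<integral>\<^sup>+N. of_nat ((\<lambda>i.
      if i < (1::nat) then nat \<lfloor>measure N B\<rfloor> else 0) 0) \<partial>P)"
  proof (rule nn_integral_cong)
    fix N assume "N \<in> space P"
    then obtain k where "emeasure N B = of_nat k"
        using counting_measuresD(4)[OF _ B] poisson_process_sets by blast
    then show "emeasure N B = of_nat ((\<lambda>i. if i < (1::nat) then nat \<lfloor>measure N B\<rfloor> else 0) 0)"
      by (simp add: measure_def)
  qed
  also have "\<dots> = (\<integral>\<^sup>+x. of_nat (x (0::nat)) \<partial>measure_pmf (Pi_pmf {..<1::nat} 0 (\<lambda>i.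
      pois (measure \<Lambda> B))))"
    using poisson_process_nn_integral[where B="\<lambda>_. B" and G="\<lambda>x. of_nat (x 0)" and n=1] B
    by (simp add: disjoint_family_on_def del: One_nat_def)
  also have "\<dots> = (\<integral>\<^sup>+k. of_nat k \<partial>measure_pmf (map_pmf (\<lambda>x. x 0) (Pi_pmf {..<1::nat} 0 (\<lambda>i.
      pois (measure \<Lambda> B)))))"
    by simp
  also have "\<dots> = (\<integral>\<^sup>+k. of_nat k \<partial>measure_pmf (pois (measure \<Lambda> B)))"
    by (subst Pi_pmf_component) auto
  also have "\<dots> = emeasure \<Lambda> B"
    using poi B by (simp add: nn_integral_pois poisson_process_def emeasure_eq_ennreal_measure
        less_top)
  finally show ?thesis .
qed

lemma poisson_process_mean:
  assumes B: "B \<in> sets borel"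
  shows "(\<integral>\<^sup>+N. emeasure N B \<partial>P) = emeasure \<Lambda> B"
proof -
  define C where "C m = B \<inter> ball 0 (real m)" for m :: nat
  have C: "C m \<in> sets borel" "bounded (C m)" for m using B by (auto simp: C_def)
  have inc: "incseq C" by (auto simp: C_def incseq_def)
  have UC: "(\<Union>m. C m) = B" by (auto simp: C_def reals_Archimedean2)
  have s\<Lambda>: "sets \<Lambda> = sets borel" using poi by (simp add: poisson_process_def)
  have "(\<integral>\<^sup>+N. emeasure N B \<partial>P) = (\<integral>\<^sup>+N. (SUP m. emeasure N (C m)) \<partial>P)"
  proof (rule nn_integral_cong)
    fix N assume "N \<in> space P"
    then have "sets N = sets borel" using counting_measuresD(1) poisson_process_sets by blast
    then show "emeasure N B = (SUP m. emeasure N (C m))"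
      using SUP_emeasure_incseq[of C N] C inc UC by (metis image_subset_iff)
  qed
  also have "\<dots> = (SUP m. \<integral>\<^sup>+N. emeasure N (C m) \<partial>P)"
  proof (rule nn_integral_monotone_convergence_SUP_AE)
    show "(\<lambda>N. emeasure N (C m)) \<in> borel_measurable P" for m using C by simp
    show "AE N in P. emeasure N (C m) \<le> emeasure N (C (Suc m))" for m
    proof (rule AE_I2)
      fix N assume "N \<in> space P"
      then have "sets N = sets borel" using counting_measuresD(1) poisson_process_sets by blast
      then show "emeasure N (C m) \<le> emeasure N (C (Suc m))"
        using incseq_SucD[OF inc] C(1) by (intro emeasure_mono) simp_all
    qed
  qed
  also have "\<dots> = (SUP m. emeasure \<Lambda> (C m))" using C by (simp add: poisson_process_mean_bounded)
  also have "\<dots> = emeasure \<Lambda> B" using SUP_emeasure_incseq[of C \<Lambda>] C inc UC s\<Lambda>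
      by (metis image_subset_iff)
  finally show ?thesis .
qed

lemma poisson_process_void:
  assumes B: "B \<in> sets borel" "bounded B"
  shows "emeasure P {N \<in> space P. emeasure N B = 0} = ennreal (exp (- measure \<Lambda> B))"
proof -
  have "measure P {N \<in> space P. emeasure N B = of_nat 0} =
      measure \<Lambda> B ^ 0 / fact 0 * exp (- measure \<Lambda> B)"
    using poi B unfolding poisson_process_def by blast
  then show ?thesis by (simp add: emeasure_eq_measure)
qed

end

section \<open>Clusters and Cox processes\<close>

lemma UN_balls: "(\<Union>m::nat. ball (0 :: 'a::real_normed_vector) (real m)) = UNIV"
proof -
  have "\<exists>m::nat. y \<in> ball 0 (real m)" for y :: 'a by (simp add: reals_Archimedean2)
  then show ?thesis by blast
qed

text \<open>The set varies with y while N is random, as in the number of centres in the annulus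
  about y. The Dynkin argument subtracts masses in its complement step and so needs them finite:
  sections are first cut with a bounded b, and balls exhaust the plane afterwards.\<close>

lemma measurable_emeasure_section:
  assumes "E \<in> sets (borel \<Otimes>\<^sub>M borel)"
  shows "(\<lambda>(N, y). emeasure N (Pair y -` E)) \<in> borel_measurable (counting_space \<Otimes>\<^sub>M (borel ::
      plane measure))"
proof -
  have sec: "Pair y -` E \<in> sets (borel :: plane measure)" if "E \<in> sets (borel \<Otimes>\<^sub>M borel)" for E
      and y :: plane
    by (rule sets_Pair1[OF that])
  have bdd: "(\<lambda>p. emeasure (fst p) (Pair (snd p) -` E \<inter> b)) \<in> borel_measurable (counting_space \<Otimes>\<^sub>M
      (borel :: plane measure))"
    if E: "E \<in> sets (borel \<Otimes>\<^sub>M borel)" and b: "b \<in> sets borel" "bounded b" for E b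
  proof -
    have fin: "emeasure N b < \<infinity>" "sets N = sets borel" if "N \<in> counting_measures" for N
      using counting_measuresD[OF that] b by auto
    let ?G = "{A \<times> C | A C. A \<in> sets (borel :: plane measure) \<and> C \<in> sets (borel :: plane measure)}"
    have E': "E \<in> sigma_sets UNIV ?G" using E by (simp add: sets_pair_measure)
    show ?thesis
    proof (rule sigma_sets_induct_disjoint[where G="?G" and \<Omega>=UNIV and A=E
        and P="\<lambda>E. (\<lambda>p. emeasure (fst p) (Pair (snd p) -` E \<inter> b)) \<in> borel_measurable
            (counting_space \<Otimes>\<^sub>M (borel :: plane measure))"])
      show "E \<in> sigma_sets UNIV ?G" by (rule E')
      show "Int_stable ?G" by (rule Int_stable_pair_measure_generator)
      show "?G \<subseteq> Pow UNIV" by simp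
    next
      fix A assume "A \<in> ?G"
      then obtain A1 A2 where A: "A = A1 \<times> A2" and [measurable]: "A1 \<in> sets borel"
          "A2 \<in> sets borel" by auto
      have [measurable]: "A2 \<inter> b \<in> sets borel" using b by simp
      have "(\<lambda>p. emeasure (fst p) (Pair (snd p) -` A \<inter> b)) =
          (\<lambda>p. indicator A1 (snd p) * emeasure (fst p) (A2 \<inter> b))"
        by (auto simp: A indicator_def fun_eq_iff)
      also have "\<dots> \<in> borel_measurable (counting_space \<Otimes>\<^sub>M borel)" by measurable
      finally show "(\<lambda>p. emeasure (fst p) (Pair (snd p) -` A \<inter> b)) \<in> borel_measurable
          (counting_space \<Otimes>\<^sub>M borel)" .
    next
      show "(\<lambda>p. emeasure (fst p) (Pair (snd p) -` {} \<inter> b)) \<in> borel_measurable (counting_space \<Otimes>\<^sub>M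
          (borel :: plane measure))"
        by simp
    next
      fix A assume A: "A \<in> sigma_sets UNIV ?G"
        and IH [measurable]: "(\<lambda>p. emeasure (fst p) (Pair (snd p) -` A \<inter> b)) \<in> borel_measurable
            (counting_space \<Otimes>\<^sub>M (borel :: plane measure))"
      have A': "A \<in> sets (borel \<Otimes>\<^sub>M borel)" using A by (simp add: sets_pair_measure)
      have [measurable]: "b \<in> sets borel" by (rule b)
      have eq: "emeasure (fst p) (Pair (snd p) -` (UNIV - A) \<inter> b) =
          emeasure (fst p) b - emeasure (fst p) (Pair (snd p) -` A \<inter> b)"
        if "p \<in> space (counting_space \<Otimes>\<^sub>M (borel :: plane measure))" for p
      proof -
        have p: "fst p \<in> counting_measures" using that by (auto simp: space_pair_measure)
        have "Pair (snd p) -` (UNIV - A) \<inter> b = b - (Pair (snd p) -` A \<inter> b)" by auto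
        moreover have "emeasure (fst p) (Pair (snd p) -` A \<inter> b) \<le> emeasure (fst p) b"
          using fin[OF p] b by (intro emeasure_mono) auto
        ultimately show ?thesis using fin[OF p] sec[OF A', of "snd p"] b
          by (simp add: emeasure_Diff top_unique less_top)
      qed
      show "(\<lambda>p. emeasure (fst p) (Pair (snd p) -` (UNIV - A) \<inter> b)) \<in> borel_measurable
          (counting_space \<Otimes>\<^sub>M (borel :: plane measure))"
        by (subst measurable_cong[OF eq]) measurable
    next
      fix A :: "nat \<Rightarrow> (plane \<times> plane) set"
      assume A: "disjoint_family A" "range A \<subseteq> sigma_sets UNIV ?G"
        and IH [measurable]: "\<And>i. (\<lambda>p. emeasure (fst p) (Pair (snd p) -` A i \<inter> b))
            \<in> borel_measurable (counting_space \<Otimes>\<^sub>M (borel :: plane measure))"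
      have A': "A i \<in> sets (borel \<Otimes>\<^sub>M borel)" for i using A(2) by (auto simp: sets_pair_measure)
      have eq: "emeasure (fst p) (Pair (snd p) -` (\<Union>i. A i) \<inter> b) =
          (\<Sum>i. emeasure (fst p) (Pair (snd p) -` A i \<inter> b))"
        if "p \<in> space (counting_space \<Otimes>\<^sub>M (borel :: plane measure))" for p
      proof -
        have p: "fst p \<in> counting_measures" using that by (auto simp: space_pair_measure)
        have "Pair (snd p) -` (\<Union>i. A i) \<inter> b = (\<Union>i. Pair (snd p) -` A i \<inter> b)" by auto
        moreover have "(\<Sum>i. emeasure (fst p) (Pair (snd p) -` A i \<inter> b)) =
            emeasure (fst p) (\<Union>i. Pair (snd p) -` A i \<inter> b)"
        proof (rule suminf_emeasure)
          show "range (\<lambda>i. Pair (snd p) -` A i \<inter> b) \<subseteq> sets (fst p)"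
            unfolding fin(2)[OF p] image_subset_iff using sec[OF A'] b by (intro ballI sets.Int)
          show "disjoint_family (\<lambda>i. Pair (snd p) -` A i \<inter> b)"
            using A(1) unfolding disjoint_family_on_def by blast
        qed
        ultimately show ?thesis by (simp only:)
      qed
      show "(\<lambda>p. emeasure (fst p) (Pair (snd p) -` (\<Union>i.
          A i) \<inter> b)) \<in> borel_measurable (counting_space \<Otimes>\<^sub>M (borel :: plane measure))"
        by (subst measurable_cong[OF eq]) measurable
    qed
  qed
  have eq: "emeasure (fst p) (Pair (snd p) -` E) =
      (SUP m::nat. emeasure (fst p) (Pair (snd p) -` E \<inter> ball 0 (real m)))"
    if "p \<in> space (counting_space \<Otimes>\<^sub>M (borel :: plane measure))" for p
  proof -
    have p: "fst p \<in> counting_measures" using that by (auto simp: space_pair_measure)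
    have "(SUP m::nat. emeasure (fst p) (Pair (snd p) -` E \<inter> ball 0 (real m))) =
        emeasure (fst p) (\<Union>m::nat. Pair (snd p) -` E \<inter> ball 0 (real m))"
    proof (rule SUP_emeasure_incseq)
      show "range (\<lambda>m. Pair (snd p) -` E \<inter> ball 0 (real m)) \<subseteq> sets (fst p)"
        unfolding counting_measuresD(1)[OF p] image_subset_iff using sec[OF assms]
            by (intro ballI sets.Int) auto
      show "incseq (\<lambda>m. Pair (snd p) -` E \<inter> ball 0 (real m))"
        by (intro incseq_SucI Int_mono subset_refl subset_ball) simp
    qed
    also have "(\<Union>m::nat. Pair (snd p) -` E \<inter> ball 0 (real m)) = Pair (snd p) -` E"
      using UN_balls by blast
    finally show ?thesis by (rule sym)
  qed
  have "(\<lambda>p. emeasure (fst p) (Pair (snd p) -` E)) \<in> borel_measurable (counting_space \<Otimes>\<^sub>M (borel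
      :: plane measure))"
    by (subst measurable_cong[OF eq], assumption, intro borel_measurable_SUP bdd assms) auto
  then show ?thesis by (simp add: split_beta)
qed

lemma counting_measures_sigma_finite:
  assumes N: "N \<in> counting_measures"
  shows "sigma_finite_measure N"
proof -
  let ?A = "range (\<lambda>m::nat. ball (0::plane) (real m))"
  have "countable ?A" by simp
  moreover have "?A \<subseteq> sets N" unfolding counting_measuresD(1)[OF N] by (simp add: image_subset_iff)
  moreover have "\<Union> ?A = space N" unfolding counting_measuresD(2)[OF N] by (rule UN_balls)
  moreover have "\<forall>a\<in>?A. emeasure N a \<noteq> \<infinity>"
    using counting_measuresD(3)[OF N, of "ball _ _"] by (simp add: less_top)
  ultimately show ?thesis unfolding sigma_finite_measure_def by blast
qed

lemma annulus_eq: "annulus R \<delta> x = cball x R - ball x (R - \<delta>)"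
  by (auto simp: annulus_def)

lemma annulus_sets [measurable]: "annulus R \<delta> x \<in> sets borel"
  by (simp add: annulus_eq)

lemma bounded_annulus: "bounded (annulus R \<delta> x)"
  by (rule bounded_subset[OF bounded_cball[of x R]]) (auto simp: annulus_eq)

lemma mem_annulus_commute: "y \<in> annulus R \<delta> x \<longleftrightarrow> x \<in> annulus R \<delta> y"
  by (simp add: annulus_def dist_commute)

definition annulus_area :: "real \<Rightarrow> real \<Rightarrow> real" where
  "annulus_area R \<delta> = pi * (R\<^sup>2 - (R - \<delta>)\<^sup>2)"

lemma emeasure_annulus:
  assumes "0 < \<delta>" "\<delta> \<le> R"
  shows "emeasure lborel (annulus R \<delta> x) = ennreal (annulus_area R \<delta>)" and "0 < annulus_area R \<delta>"
proof -
  have 1: "emeasure lborel (cball x R) = ennreal (pi * R\<^sup>2)" "emeasure lborel (ball x (R - \<delta>)) =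
      ennreal (pi * (R - \<delta>)\<^sup>2)"
    using assms by (auto simp: emeasure_cball emeasure_ball unit_ball_vol_2)
  have "emeasure lborel (annulus R \<delta> x) = emeasure lborel (cball x R) - emeasure lborel (ball x (R
      - \<delta>))"
    unfolding annulus_eq using assms 1 by (intro emeasure_Diff) (auto simp: subset_iff)
  also have "\<dots> = ennreal (annulus_area R \<delta>)"
    unfolding 1 annulus_area_def using assms by (simp add: ennreal_minus right_diff_distrib)
  finally show "emeasure lborel (annulus R \<delta> x) = ennreal (annulus_area R \<delta>)" .
  have "(R - \<delta>)\<^sup>2 < R\<^sup>2" using assms by (intro power_strict_mono) auto
  then show "0 < annulus_area R \<delta>" by (simp add: annulus_area_def)
qed

text \<open>A centre X contributes at y iff y lies in the annulus about X, equivalently iff X lies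
  in the annulus about y. So the density of \<Lambda> at y is a multiple of the number of centres in
  the annulus about y itself.\<close>

definition annular_density :: "real \<Rightarrow> real \<Rightarrow> real \<Rightarrow> plane measure \<Rightarrow> plane \<Rightarrow> real" where
  "annular_density R \<delta> \<mu> N y = \<mu> / annulus_area R \<delta> * measure N (annulus R \<delta> y)"

lemma annular_density_nonneg:
  assumes "0 < \<delta>" "\<delta> \<le> R" "0 \<le> \<mu>"
  shows "0 \<le> annular_density R \<delta> \<mu> N y"
  using assms emeasure_annulus(2)[OF assms(1,2)] by (simp add: annular_density_def)

lemma measurable_annulus_count [measurable]:
  "(\<lambda>(N, y). emeasure N (annulus R \<delta> y)) \<in> borel_measurable (counting_space \<Otimes>\<^sub>M borel)"
proof -
  have "Measurable.pred (borel \<Otimes>\<^sub>M borel) (\<lambda>p::plane \<times> plane. R - \<delta> \<le> dist (fst p) (snd p) \<and>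
      dist (fst p) (snd p) \<le> R)"
    by measurable
  then have "{p::plane \<times> plane. R - \<delta> \<le> dist (fst p) (snd p) \<and> dist (fst p) (snd p) \<le>
      R} \<in> sets (borel \<Otimes>\<^sub>M borel)"
    by (simp add: pred_def space_pair_measure)
  from measurable_emeasure_section[OF this] show ?thesis by (simp add: annulus_def vimage_def)
qed

lemma measurable_annular_density [measurable]:
  "(\<lambda>(N, y). annular_density R \<delta> \<mu> N y) \<in> borel_measurable (counting_space \<Otimes>\<^sub>M borel)"
  unfolding annular_density_def measure_def by measurable

text \<open>Fubini for N and Lebesgue measure, with the symmetry of the annulus exchanging centre
  and point. In this form the random intensity can be passed to
  \<open>poisson_kernel_exists\<close>.\<close>

lemma annular_intensity_eq_density:
  assumes N: "N \<in> counting_measures" and R: "0 < \<delta>" "\<delta> \<le> R" "0 \<le> \<mu>"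
  shows "annular_intensity R \<delta> \<mu> N = density lborel (\<lambda>y. ennreal (annular_density R \<delta> \<mu> N y))"
proof (rule measure_eqI)
  show "sets (annular_intensity R \<delta> \<mu> N) = sets (density lborel (\<lambda>y.
      ennreal (annular_density R \<delta> \<mu> N y)))"
    using sets.sigma_sets_eq[of "borel :: plane measure"] by (simp add: annular_intensity_def)
next
  fix B assume "B \<in> sets (annular_intensity R \<delta> \<mu> N)"
  then have [measurable]: "B \<in> sets borel"
    using sets.sigma_sets_eq[of "borel :: plane measure"] by (simp add: annular_intensity_def)
  interpret N: sigma_finite_measure N by (rule counting_measures_sigma_finite[OF N])
  interpret pair_sigma_finite N lborel ..
  have sN [measurable_cong]: "sets N = sets borel" by (rule counting_measuresD(1)[OF N])
  let ?v = "annulus_area R \<delta>"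
  have v: "0 < ?v" by (rule emeasure_annulus(2)[OF R(1,2)])
  have N_meas: "N \<in> space counting_space" using N by simp
  have dens: "annular_density R \<delta> \<mu> N \<in> borel_measurable borel"
    using measurable_compose_Pair1[OF N_meas measurable_annular_density] by simp
  have ind [measurable]: "(\<lambda>(x, y). indicator (annulus R \<delta> x) y *
      indicator B y :: ennreal) \<in> borel_measurable (N \<Otimes>\<^sub>M lborel)"
  proof -
    have "(\<lambda>(x, y). indicator (annulus R \<delta> x) y * indicator B y :: ennreal) =
      (\<lambda>p. if R - \<delta> \<le> dist (fst p) (snd p) \<and> dist (fst p) (snd p) \<le> R \<and> snd p \<in> B then 1 else 0)"
      by (auto simp: fun_eq_iff indicator_def annulus_def)
    also have "\<dots> \<in> borel_measurable (N \<Otimes>\<^sub>M lborel)" by measurable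
    finally show ?thesis .
  qed
  have "emeasure (annular_intensity R \<delta> \<mu> N) B =
      ennreal \<mu> * (\<integral>\<^sup>+ x. emeasure (uniform_measure lborel (annulus R \<delta> x)) B \<partial>N)"
    by (rule emeasure_annular_intensity[OF N]) simp
  also have "(\<integral>\<^sup>+ x. emeasure (uniform_measure lborel (annulus R \<delta> x)) B \<partial>N) =
      (\<integral>\<^sup>+ x. (\<integral>\<^sup>+ y. indicator (annulus R \<delta> x) y * indicator B y \<partial>lborel) * ennreal (1 / ?v) \<partial>N)"
  proof (rule nn_integral_cong)
    fix x
    have "emeasure (uniform_measure lborel (annulus R \<delta> x)) B =
        emeasure lborel (annulus R \<delta> x \<inter> B) / ennreal ?v"
      by (simp add: emeasure_annulus[OF R(1,2)])
    also have "emeasure lborel (annulus R \<delta> x \<inter> B) =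
        (\<integral>\<^sup>+ y. indicator (annulus R \<delta> x \<inter> B) y \<partial>lborel)"
      by simp
    also have "\<dots> = (\<integral>\<^sup>+ y. indicator (annulus R \<delta> x) y * indicator B y \<partial>lborel)"
      by (intro nn_integral_cong) (simp add: indicator_inter_arith)
    finally show "emeasure (uniform_measure lborel (annulus R \<delta> x)) B =
        (\<integral>\<^sup>+ y. indicator (annulus R \<delta> x) y * indicator B y \<partial>lborel) * ennreal (1 / ?v)"
      using v by (simp add: divide_ennreal_def inverse_ennreal inverse_eq_divide)
  qed
  also have "\<dots> = (\<integral>\<^sup>+ x. (\<integral>\<^sup>+ y. indicator (annulus R \<delta> x) y * indicator B y \<partial>lborel) \<partial>N) *
      ennreal (1 / ?v)"
    by (rule nn_integral_multc) (use lborel.borel_measurable_nn_integral_fst[OF ind] in simp)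
  also have "(\<integral>\<^sup>+ x. (\<integral>\<^sup>+ y. indicator (annulus R \<delta> x) y * indicator B y \<partial>lborel) \<partial>N) =
      (\<integral>\<^sup>+ y. (\<integral>\<^sup>+ x. indicator (annulus R \<delta> x) y * indicator B y \<partial>N) \<partial>lborel)"
    by (rule Fubini'[OF ind, symmetric])
  also have "\<dots> = (\<integral>\<^sup>+ y. emeasure N (annulus R \<delta> y) * indicator B y \<partial>lborel)"
  proof (rule nn_integral_cong)
    fix y
    have "(\<integral>\<^sup>+ x. indicator (annulus R \<delta> x) y * indicator B y \<partial>N) =
        (\<integral>\<^sup>+ x. indicator (annulus R \<delta> y) x * indicator B y \<partial>N)"
      by (intro nn_integral_cong) (simp add: indicator_def mem_annulus_commute[of y])
    also have "\<dots> = emeasure N (annulus R \<delta> y) * indicator B y"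
      by (subst nn_integral_multc) (simp_all add: sN)
    finally show "(\<integral>\<^sup>+ x. indicator (annulus R \<delta> x) y * indicator B y \<partial>N) =
        emeasure N (annulus R \<delta> y) * indicator B y" .
  qed
  also have "ennreal \<mu> * ((\<integral>\<^sup>+ y. emeasure N (annulus R \<delta> y) * indicator B y \<partial>lborel) *
      ennreal (1 / ?v)) =
      (\<integral>\<^sup>+ y. ennreal (\<mu> / ?v) * (emeasure N (annulus R \<delta> y) * indicator B y) \<partial>lborel)"
  proof -
    have m: "(\<lambda>y. emeasure N (annulus R \<delta> y) * indicator B y) \<in> borel_measurable lborel"
      using measurable_compose_Pair1[OF N_meas measurable_annulus_count] by simp
    have "ennreal \<mu> * ennreal (1 / ?v) = ennreal (\<mu> / ?v)" using R v
        by (simp add: ennreal_mult[symmetric])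
    then show ?thesis unfolding nn_integral_cmult[OF m]
        by (simp only: mult_ac flip: \<open>_ = ennreal (\<mu> / _)\<close>)
  qed
  also have "\<dots> = (\<integral>\<^sup>+ y. ennreal (annular_density R \<delta> \<mu> N y) * indicator B y \<partial>lborel)"
  proof (rule nn_integral_cong)
    fix y
    have "emeasure N (annulus R \<delta> y) = ennreal (measure N (annulus R \<delta> y))"
      using counting_measuresD(3)[OF N annulus_sets bounded_annulus, of R \<delta> y]
      by (simp add: emeasure_eq_ennreal_measure less_top)
    then show "ennreal (\<mu> / ?v) * (emeasure N (annulus R \<delta> y) * indicator B y) =
        ennreal (annular_density R \<delta> \<mu> N y) * indicator B y"
      unfolding annular_density_def using R v by (subst ennreal_mult) (simp_all add: mult.assoc)
  qed
  also have "\<dots> = emeasure (density lborel (\<lambda>y. ennreal (annular_density R \<delta> \<mu> N y))) B"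
    using dens by (subst emeasure_density) auto
  finally show "emeasure (annular_intensity R \<delta> \<mu> N) B =
      emeasure (density lborel (\<lambda>y. ennreal (annular_density R \<delta> \<mu> N y))) B" .
qed

lemma annular_cluster_process_exists:
  assumes R: "0 < \<delta>" "\<delta> \<le> R" "0 < \<mu>" and \<alpha>: "0 < \<alpha>"
  shows "\<exists>P. annular_cluster_process \<alpha> R \<delta> \<mu> P"
proof -
  obtain C where C: "homogeneous_poisson \<alpha> C" using homogeneous_poisson_exists[OF \<alpha>] by blast
  have sC: "sets C = sets counting_space" and pC: "prob_space C"
    using C by (auto simp: homogeneous_poisson_def poisson_process_def point_process_def)
  have "\<exists>K \<in> measurable counting_space (prob_algebra counting_space).
    \<forall>N\<in>space counting_space. poisson_process (density lborel (\<lambda>y.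
        ennreal (annular_density R \<delta> \<mu> N y))) (K N)"
  proof (rule poisson_kernel_exists)
    show "0 \<le> annular_density R \<delta> \<mu> N y" for N y using R by (intro annular_density_nonneg) auto
    fix N B assume "N \<in> space counting_space" and B: "B \<in> sets borel" "bounded (B :: plane set)"
    then have N: "N \<in> counting_measures" by simp
    obtain m where m: "B \<subseteq> ball 0 m" using bounded_subset_ballD[OF B(2), of 0] by blast
    \<comment> \<open>Annuli about points of B lie in a fixed ball of radius m + R, whose number of
      centres bounds the density on B. This gives local finiteness of the intensity.\<close>
    have bnd: "annular_density R \<delta> \<mu> N y \<le> \<mu> / annulus_area R \<delta> * measure N (cball 0 (m + R))" if
        "y \<in> B" for y
    proof -
      have "norm z \<le> m + R" if z: "z \<in> annulus R \<delta> y" for z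
      proof -
        have "dist 0 z \<le> dist 0 y + dist y z" by (rule dist_triangle)
        moreover have "norm y < m" using m \<open>y \<in> B\<close> by (auto simp: subset_iff)
        ultimately show ?thesis using z by (auto simp: annulus_def)
      qed
      then have "annulus R \<delta> y \<subseteq> cball 0 (m + R)" by auto
      then have "measure N (annulus R \<delta> y) \<le> measure N (cball 0 (m + R))"
        using counting_measuresD(1)[OF N] counting_measuresD(3)[OF N, of "cball 0 (m + R)"]
        by (intro measure_mono_fmeasurable) (auto simp: fmeasurable_def)
      then show ?thesis unfolding annular_density_def
        using emeasure_annulus(2)[OF R(1,2)] R(3) by (intro mult_left_mono) auto
    qed
    have "(\<lambda>y. annular_density R \<delta> \<mu> N y) \<in> borel_measurable borel"
      using measurable_compose_Pair1[OF \<open>N \<in> space counting_space\<close> measurable_annular_density]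
          by simp
    then have "emeasure (density lborel (\<lambda>y. ennreal (annular_density R \<delta> \<mu> N y))) B =
        (\<integral>\<^sup>+ y. ennreal (annular_density R \<delta> \<mu> N y) * indicator B y \<partial>lborel)"
      using B by (subst emeasure_density) auto
    also have "\<dots> \<le> (\<integral>\<^sup>+ y. ennreal (\<mu> / annulus_area R \<delta> * measure N (cball 0 (m +
        R))) * indicator B y \<partial>lborel)"
      using bnd by (intro nn_integral_mono) (auto simp: indicator_def intro!: ennreal_leI)
    also have "\<dots> < \<infinity>" using B emeasure_bounded_finite[OF B(2)]
      by (simp add: nn_integral_cmult_indicator ennreal_mult_less_top)
    finally show "emeasure (density lborel (\<lambda>y. ennreal (annular_density R \<delta> \<mu> N y))) B < \<infinity>" .
  qed (rule measurable_annular_density)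
  then obtain K where K: "K \<in> measurable counting_space (prob_algebra counting_space)"
    "\<And>N. N \<in> counting_measures \<Longrightarrow> poisson_process (density lborel (\<lambda>y.
        ennreal (annular_density R \<delta> \<mu> N y))) (K N)"
    unfolding space_counting_space by blast
  have "cox_process C (annular_intensity R \<delta> \<mu>) (C \<bind> K)" unfolding cox_process_def
  proof (intro conjI exI[of _ K] pC refl)
    show "K \<in> measurable C (prob_algebra counting_space)"
      using K(1) by (simp add: measurable_cong_sets[OF sC refl])
    show "AE N in C. poisson_process (annular_intensity R \<delta> \<mu> N) (K N)"
      using K(2) R sets_eq_imp_space_eq[OF sC]
          by (intro AE_I2) (simp add: annular_intensity_eq_density)
  qed
  then show ?thesis using C by (auto simp: annular_cluster_process_def)
qed

lemma cox_process_point_process: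
  assumes "cox_process M \<Lambda> P"
  shows "point_process P"
proof -
  obtain K where K: "prob_space M" "K \<in> measurable M (prob_algebra counting_space)" "P = M \<bind> K"
    using assms unfolding cox_process_def by blast
  have M: "M \<in> space (prob_algebra M)" using K(1) by (simp add: space_prob_algebra)
  show ?thesis using prob_space_bind'[OF M K(2)] sets_bind'[OF M K(2)] K(3)
      by (simp add: point_process_def)
qed

lemma cox_process_nn_integral:
  assumes M: "prob_space M" and K: "K \<in> measurable M (prob_algebra counting_space)"
    and f: "f \<in> borel_measurable counting_space"
  shows "(\<integral>\<^sup>+N. f N \<partial>(M \<bind> K)) = (\<integral>\<^sup>+\<omega>. (\<integral>\<^sup>+N. f N \<partial>K \<omega>) \<partial>M)"
  by (rule nn_integral_bind[OF f measurable_prob_algebraD[OF K]])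

lemma cox_process_mean:
  assumes "cox_process M \<Lambda> P" and B: "B \<in> sets borel"
  shows "(\<integral>\<^sup>+N. emeasure N B \<partial>P) = (\<integral>\<^sup>+\<omega>. emeasure (\<Lambda> \<omega>) B \<partial>M)"
proof -
  obtain K where K: "prob_space M" "K \<in> measurable M (prob_algebra counting_space)" "P = M \<bind> K"
    and poi: "AE \<omega> in M. poisson_process (\<Lambda> \<omega>) (K \<omega>)"
    using assms(1) unfolding cox_process_def by blast
  have "(\<integral>\<^sup>+N. emeasure N B \<partial>P) = (\<integral>\<^sup>+\<omega>. (\<integral>\<^sup>+N. emeasure N B \<partial>K \<omega>) \<partial>M)"
    unfolding K(3)
    by (rule cox_process_nn_integral[OF K(1,2) measurable_emeasure_counting[OF measurable_ident B,
        simplified]])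
  also have "\<dots> = (\<integral>\<^sup>+\<omega>. emeasure (\<Lambda> \<omega>) B \<partial>M)"
  proof (rule nn_integral_cong_AE)
    show "AE \<omega> in M. (\<integral>\<^sup>+N. emeasure N B \<partial>K \<omega>) = emeasure (\<Lambda> \<omega>) B"
      using poi by eventually_elim (rule poisson_process_mean[OF _ B])
  qed
  finally show ?thesis .
qed

lemma annular_cluster_process_intensity:
  assumes R: "0 < \<delta>" "\<delta> \<le> R" "0 < \<mu>" and \<alpha>: "0 < \<alpha>"
    and P: "annular_cluster_process \<alpha> R \<delta> \<mu> P"
  shows "has_intensity P (\<alpha> * \<mu>)"
  unfolding has_intensity_def
proof
  fix B :: "plane set" assume B[measurable]: "B \<in> sets borel"
  obtain C where C: "homogeneous_poisson \<alpha> C" and cox: "cox_process C (annular_intensity R \<delta> \<mu>) P"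
    using P unfolding annular_cluster_process_def by blast
  have poi: "poisson_process (scale_measure (ennreal \<alpha>) lborel) C" using C
      by (simp add: homogeneous_poisson_def)
  have sC[measurable_cong]: "sets C = sets counting_space" and spC: "space C = counting_measures"
    by (rule poisson_process_sets[OF poi])+
  interpret C: prob_space C using poi by (simp add: poisson_process_def point_process_def)
  interpret pair_sigma_finite C "lborel :: plane measure" ..
  let ?v = "annulus_area R \<delta>"
  have v: "0 < ?v" by (rule emeasure_annulus(2)[OF R(1,2)])
  have dens: "annular_density R \<delta> \<mu> N \<in> borel_measurable borel" if "N \<in> counting_measures" for N
    using measurable_compose_Pair1[OF _ measurable_annular_density, of N R \<delta> \<mu>] that by simp
  have m: "(\<lambda>(N, y). ennreal (annular_density R \<delta> \<mu> N y) *
      indicator B y) \<in> borel_measurable (C \<Otimes>\<^sub>M lborel)"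
    by measurable
  have "(\<integral>\<^sup>+N. emeasure N B \<partial>P) = (\<integral>\<^sup>+N. emeasure (annular_intensity R \<delta> \<mu> N) B \<partial>C)"
    by (rule cox_process_mean[OF cox B])
  also have "\<dots> = (\<integral>\<^sup>+N. (\<integral>\<^sup>+y. ennreal (annular_density R \<delta> \<mu> N y) * indicator B y \<partial>lborel) \<partial>C)"
    using R dens spC by (intro nn_integral_cong) (simp add: annular_intensity_eq_density
        emeasure_density)
  also have "\<dots> = (\<integral>\<^sup>+y. (\<integral>\<^sup>+N. ennreal (annular_density R \<delta> \<mu> N y) * indicator B y \<partial>C) \<partial>lborel)"
    by (rule Fubini'[OF m, symmetric])
  also have "\<dots> = (\<integral>\<^sup>+y. ennreal (\<alpha> * \<mu>) * indicator B y \<partial>lborel)"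
  proof (rule nn_integral_cong)
    fix y
    have "(\<integral>\<^sup>+N. ennreal (annular_density R \<delta> \<mu> N y) * indicator B y \<partial>C) =
        (\<integral>\<^sup>+N. ennreal (\<mu> / ?v) * indicator B y * emeasure N (annulus R \<delta> y) \<partial>C)"
    proof (rule nn_integral_cong)
      fix N assume "N \<in> space C"
      then have N: "N \<in> counting_measures" using spC by simp
      have "emeasure N (annulus R \<delta> y) = ennreal (measure N (annulus R \<delta> y))"
        using counting_measuresD(3)[OF N annulus_sets bounded_annulus, of R \<delta> y]
        by (simp add: emeasure_eq_ennreal_measure less_top)
      then show "ennreal (annular_density R \<delta> \<mu> N y) * indicator B y =
          ennreal (\<mu> / ?v) * indicator B y * emeasure N (annulus R \<delta> y)"
        unfolding annular_density_def using R v by (subst ennreal_mult) (simp_all add: mult_ac)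
    qed
    also have "\<dots> = ennreal (\<mu> / ?v) * indicator B y * (\<integral>\<^sup>+N. emeasure N (annulus R \<delta> y) \<partial>C)"
      by (rule nn_integral_cmult) measurable
    \<comment> \<open>The mean number of centres in the annulus about y is \<alpha> times its area,
      whatever y is; the area cancels against the normalization of the clusters.\<close>
    also have "(\<integral>\<^sup>+N. emeasure N (annulus R \<delta> y) \<partial>C) = ennreal (\<alpha> * ?v)"
      using \<alpha> v by (simp add: poisson_process_mean[OF poi] emeasure_annulus[OF R(1,2)]
          ennreal_mult less_imp_le)
    also have "ennreal (\<mu> / ?v) * indicator B y * ennreal (\<alpha> * ?v) =
        ennreal (\<alpha> * \<mu>) * indicator B y"
    proof -
      have "ennreal (\<mu> / ?v) * ennreal (\<alpha> * ?v) = ennreal (\<alpha> * \<mu>)"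
        using R \<alpha> v by (simp add: ennreal_mult[symmetric] mult.commute)
      then show ?thesis by (simp add: indicator_def)
    qed
    finally show "(\<integral>\<^sup>+N. ennreal (annular_density R \<delta> \<mu> N y) * indicator B y \<partial>C) =
        ennreal (\<alpha> * \<mu>) * indicator B y" .
  qed
  also have "\<dots> = ennreal (\<alpha> * \<mu>) * emeasure lborel B" by (simp add: nn_integral_cmult_indicator)
  finally show "(\<integral>\<^sup>+N. emeasure N B \<partial>P) = ennreal (\<alpha> * \<mu>) * emeasure lborel B" .
qed

section \<open>Percolation of dependent random sites\<close>

type_synonym site = "int \<times> int"

definition subsites :: "int \<Rightarrow> site \<Rightarrow> site set" where
  "subsites n v = {n * fst v..<n * fst v + n} \<times> {n * snd v..<n * snd v + n}"

definition far :: "int \<Rightarrow> site \<Rightarrow> site \<Rightarrow> bool" where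
  "far d v w \<longleftrightarrow> d \<le> \<bar>fst v - fst w\<bar> \<or> d \<le> \<bar>snd v - snd w\<bar>"

text \<open>Bad sub-blocks that are all close to each other are tolerated, since few rows and
  columns are lost to them. Requiring two far ones squares the probability at each scale.\<close>

primrec bad_block :: "int \<Rightarrow> int \<Rightarrow> (site \<Rightarrow> bool) \<Rightarrow> nat \<Rightarrow> site \<Rightarrow> bool" where
  "bad_block n d b 0 v = b v"
| "bad_block n d b (Suc k) v = (\<exists>w\<in>subsites n v. \<exists>w'\<in>subsites n v. far d w w' \<and>
    bad_block n d b k w \<and> bad_block n d b k w')"

lemma finite_subsites [simp]: "finite (subsites n v)"
  by (simp add: subsites_def)

lemma card_subsites: "0 \<le> n \<Longrightarrow> card (subsites n v) = nat n ^ 2"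
  by (simp add: subsites_def card_cartesian_product power2_eq_square)

text \<open>Coordinates of sub-blocks of far blocks differ by at least n * d - (n - 1), which is at
  least d. Hence one distance d serves at all scales.\<close>

lemma far_subsites:
  assumes "far d v v'" "w \<in> subsites n v" "w' \<in> subsites n v'" "1 \<le> d" "1 \<le> n"
  shows "far d w w'"
proof -
  have key: "d \<le> \<bar>x - x'\<bar>" if "d \<le> \<bar>a - a'\<bar>" "n * a \<le> x" "x < n * a + n" "n * a' \<le>
      x'" "x' < n * a' + n" for a a' x x' :: int
  proof -
    have nd: "n - 1 + d \<le> n * d" using mult_nonneg_nonneg[of "n - 1" "d - 1"] assms(4,5)
        by (simp add: algebra_simps)
    show ?thesis
    proof (cases "a \<ge> a'")
      case True
      then have "n * d \<le> n * (a - a')" using that(1) assms(5) by (intro mult_left_mono) auto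
      then show ?thesis using that nd by (simp add: right_diff_distrib)
    next
      case False
      then have "n * d \<le> n * (a' - a)" using that(1) assms(5) by (intro mult_left_mono) auto
      then show ?thesis using that nd by (simp add: right_diff_distrib)
    qed
  qed
  show ?thesis using assms key unfolding far_def subsites_def by (cases w; cases w') auto
qed

definition far_pairs :: "int \<Rightarrow> int \<Rightarrow> site \<Rightarrow> (site \<times> site) set" where
  "far_pairs n d v = {(w, w') \<in> subsites n v \<times> subsites n v. far d w w'}"

lemma finite_far_pairs [simp]: "finite (far_pairs n d v)"
  unfolding far_pairs_def by (rule finite_subset[of _ "subsites n v \<times> subsites n v"]) auto

lemma card_far_pairs: "0 \<le> n \<Longrightarrow> card (far_pairs n d v) \<le> nat n ^ 4"
proof -
  assume "0 \<le> n"
  have "card (far_pairs n d v) \<le> card (subsites n v \<times> subsites n v)"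
    unfolding far_pairs_def by (intro card_mono) auto
  also have "\<dots> = nat n ^ 4" using \<open>0 \<le> n\<close> by (simp add: card_cartesian_product card_subsites flip:
      power_add)
  finally show ?thesis .
qed

text \<open>There are at most n ^ 4 far pairs in each block, so at most (n ^ 4) ^ card S choices of
  one pair per block. For each choice the 2 * card S chosen sites are pairwise far, and the bound of
  the finer scale applies to them.\<close>

lemma (in prob_space) bad_block_bound_step:
  assumes nd: "1 \<le> d" "1 \<le> n" and \<epsilon>: "0 \<le> \<epsilon>"
    and meas: "\<And>v. {\<omega> \<in> space M. b \<omega> v} \<in> sets M"
    and bound: "\<And>S. finite S \<Longrightarrow> pairwise (far d) S \<Longrightarrow> prob {\<omega> \<in> space M. \<forall>v\<in>S. b \<omega> v} \<le> \<epsilon> ^ card S"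
    and S: "finite S" "pairwise (far d) S"
  shows "prob {\<omega> \<in> space M. \<forall>v\<in>S. \<exists>(w, w')\<in>far_pairs n d v. b \<omega> w \<and> b \<omega> w'} \<le>
      (of_int n ^ 4 * \<epsilon>\<^sup>2) ^ card S"
proof -
  let ?\<Phi> = "PiE S (far_pairs n d)"
  have meas': "{\<omega> \<in> space M. \<forall>v\<in>S. b \<omega> (fst (\<phi> v)) \<and> b \<omega> (snd (\<phi> v))} \<in> sets M" for \<phi> ::
      "site \<Rightarrow> site \<times> site"
    using S(1) meas by (intro sets.sets_Collect_finite_All sets.sets_Collect_conj) auto
  have fin\<Phi>: "finite ?\<Phi>" using S(1) by (intro finite_PiE) auto
  have sub: "{\<omega> \<in> space M. \<forall>v\<in>S. \<exists>(w, w')\<in>far_pairs n d v. b \<omega> w \<and> b \<omega> w'} \<subseteq>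
      (\<Union>\<phi>\<in>?\<Phi>. {\<omega> \<in> space M. \<forall>v\<in>S. b \<omega> (fst (\<phi> v)) \<and> b \<omega> (snd (\<phi> v))})"
  proof
    fix \<omega> assume "\<omega> \<in> {\<omega> \<in> space M. \<forall>v\<in>S. \<exists>(w, w')\<in>far_pairs n d v. b \<omega> w \<and> b \<omega> w'}"
    then have \<omega>: "\<omega> \<in> space M" "\<forall>v\<in>S. \<exists>p. p \<in> far_pairs n d v \<and> b \<omega> (fst p) \<and> b \<omega> (snd p)"
        by fastforce+
    from bchoice[OF \<omega>(2)] obtain \<phi> where \<phi>: "\<forall>v\<in>S. \<phi> v \<in> far_pairs n d v \<and> b \<omega> (fst (\<phi> v)) \<and>
        b \<omega> (snd (\<phi> v))" by blast
    then have "restrict \<phi> S \<in> ?\<Phi>" by auto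
    moreover have "\<omega> \<in> {\<omega> \<in> space M. \<forall>v\<in>S. b \<omega> (fst (restrict \<phi> S v)) \<and>
        b \<omega> (snd (restrict \<phi> S v))}" using \<omega>(1) \<phi> by simp
    ultimately show "\<omega> \<in> (\<Union>\<phi>\<in>?\<Phi>. {\<omega> \<in> space M. \<forall>v\<in>S. b \<omega> (fst (\<phi> v)) \<and> b \<omega> (snd (\<phi> v))})" by blast
  qed
  have each: "prob {\<omega> \<in> space M. \<forall>v\<in>S. b \<omega> (fst (\<phi> v)) \<and> b \<omega> (snd (\<phi> v))} \<le> (\<epsilon>\<^sup>2) ^ card S" if \<phi>:
      "\<phi> \<in> ?\<Phi>" for \<phi>
  proof -
    \<comment> \<open>The two members of the chosen pairs, indexed by a block and a truth value.
      Within a block they are far by choice, across blocks by \<open>far_subsites\<close>; in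
      particular h is injective.\<close>
    define h where "h p = (if snd p then fst (\<phi> (fst p)) else snd (\<phi> (fst p)))" for p ::
        "site \<times> bool"
    have pf: "fst (\<phi> v) \<in> subsites n v" "snd (\<phi> v) \<in> subsites n v" "far d (fst (\<phi> v)) (snd (\<phi> v))"
        if "v \<in> S" for v
      using PiE_mem[OF \<phi> that] by (simp_all add: far_pairs_def case_prod_unfold)
    have sym: "far d x y \<Longrightarrow> far d y x" for x y by (simp add: far_def abs_minus_commute)
    have hs: "h p \<in> subsites n (fst p)" if "fst p \<in> S" for p using pf that by (simp add: h_def)
    have hfar: "far d (h p) (h q)" if p: "p \<in> S \<times> UNIV" "q \<in> S \<times> UNIV" "p \<noteq> q" for p q
    proof (cases "fst p = fst q")
      case True
      then have "snd p \<noteq> snd q" using p(3) by (auto simp: prod_eq_iff)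
      moreover have "far d (fst (\<phi> (fst q))) (snd (\<phi> (fst q)))" using p(2) by (intro pf) auto
      moreover from this have "far d (snd (\<phi> (fst q))) (fst (\<phi> (fst q)))" by (rule sym)
      ultimately show ?thesis using True by (simp add: h_def)
    next
      case False
      then have "far d (fst p) (fst q)" using S(2) p by (simp add: pairwise_def mem_Times_iff)
      moreover have "h p \<in> subsites n (fst p)" "h q \<in> subsites n (fst q)"
        using p by (simp_all add: hs mem_Times_iff)
      ultimately show ?thesis by (rule far_subsites[OF _ _ _ nd])
    qed
    have ne: "\<not> far d x x" for x using nd by (simp add: far_def)
    have inj: "inj_on h (S \<times> UNIV)"
    proof (rule inj_onI, rule ccontr)
      fix p q assume pq: "p \<in> S \<times> UNIV" "q \<in> S \<times> UNIV" "h p = h q" "p \<noteq> q"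
      then have "far d (h p) (h q)" by (intro hfar)
      then show False using pq(3) ne by simp
    qed
    have pw: "pairwise (far d) (h ` (S \<times> UNIV))"
      unfolding pairwise_image pairwise_def using hfar by blast
    have card: "card (h ` (S \<times> UNIV)) = 2 * card S" using inj
        by (simp add: card_image card_cartesian_product)
    have "{\<omega> \<in> space M. \<forall>v\<in>S. b \<omega> (fst (\<phi> v)) \<and> b \<omega> (snd (\<phi> v))} =
        {\<omega> \<in> space M. \<forall>v\<in>h ` (S \<times> UNIV). b \<omega> v}"
    proof (intro Collect_cong conj_cong refl)
      fix \<omega>
      have "(\<forall>v\<in>h ` (S \<times> UNIV). b \<omega> v) \<longleftrightarrow> (\<forall>v\<in>S. \<forall>c. b \<omega> (h (v, c)))" by blast
      also have "\<dots> \<longleftrightarrow> (\<forall>v\<in>S. b \<omega> (fst (\<phi> v)) \<and> b \<omega> (snd (\<phi> v)))" by (simp add: h_def all_bool_eq)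
      finally show "(\<forall>v\<in>S. b \<omega> (fst (\<phi> v)) \<and> b \<omega> (snd (\<phi> v))) = (\<forall>v\<in>h ` (S \<times> UNIV). b \<omega> v)"
          by (simp only:)
    qed
    then have "prob {\<omega> \<in> space M. \<forall>v\<in>S. b \<omega> (fst (\<phi> v)) \<and> b \<omega> (snd (\<phi> v))} \<le>
        \<epsilon> ^ card (h ` (S \<times> UNIV))"
      using bound[OF _ pw] S(1) by simp
    then show ?thesis unfolding card by (simp add: power_mult)
  qed
  have "prob {\<omega> \<in> space M. \<forall>v\<in>S. \<exists>(w, w')\<in>far_pairs n d v. b \<omega> w \<and> b \<omega> w'} \<le>
      prob (\<Union>\<phi>\<in>?\<Phi>. {\<omega> \<in> space M. \<forall>v\<in>S. b \<omega> (fst (\<phi> v)) \<and> b \<omega> (snd (\<phi> v))})"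
    using sub fin\<Phi> meas' by (intro finite_measure_mono sets.finite_UN) auto
  also have "\<dots> \<le> (\<Sum>\<phi>\<in>?\<Phi>. prob {\<omega> \<in> space M. \<forall>v\<in>S. b \<omega> (fst (\<phi> v)) \<and> b \<omega> (snd (\<phi> v))})"
    using fin\<Phi> meas' by (intro finite_measure_subadditive_finite) auto
  also have "\<dots> \<le> (\<Sum>\<phi>\<in>?\<Phi>. (\<epsilon>\<^sup>2) ^ card S)" by (intro sum_mono each)
  also have "\<dots> = real (card ?\<Phi>) * (\<epsilon>\<^sup>2) ^ card S" by simp
  also have "\<dots> \<le> (of_int n ^ 4) ^ card S * (\<epsilon>\<^sup>2) ^ card S"
  proof (intro mult_right_mono)
    have "card ?\<Phi> = (\<Prod>v\<in>S. card (far_pairs n d v))" using S(1) by (rule card_PiE)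
    also have "\<dots> \<le> (\<Prod>v\<in>S. nat n ^ 4)" using nd by (intro prod_mono) (auto intro: card_far_pairs)
    finally have "real (card ?\<Phi>) \<le> real ((nat n ^ 4) ^ card S)"
        by (simp only: of_nat_le_iff prod_constant)
    then show "real (card ?\<Phi>) \<le> (of_int n ^ 4) ^ card S" using nd by simp
  qed simp
  finally show ?thesis by (simp add: power_mult_distrib)
qed

text \<open>The recursion gives n ^ 4 * (\<epsilon> / 2 ^ k)^2, and one factor n ^ 4 * \<epsilon> is
  at most 1 / 2. The geometric rate is cruder than what the squaring yields, but summable over the
  scales.\<close>

lemma (in prob_space) bad_block_bound:
  assumes nd: "1 \<le> d" "1 \<le> n" and \<epsilon>: "0 \<le> \<epsilon>" "of_int n ^ 4 * \<epsilon> \<le> 1 / 2"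
    and meas: "\<And>v. {\<omega> \<in> space M. b \<omega> v} \<in> sets M"
    and bound: "\<And>S. finite S \<Longrightarrow> pairwise (far d) S \<Longrightarrow> prob {\<omega> \<in> space M. \<forall>v\<in>S. b \<omega> v} \<le> \<epsilon> ^ card S"
  shows "{\<omega> \<in> space M. bad_block n d (b \<omega>) k v} \<in> sets M"
    and "finite S \<Longrightarrow> pairwise (far d) S \<Longrightarrow> prob {\<omega> \<in> space M. \<forall>v\<in>S. bad_block n d (b \<omega>) k v} \<le>
        (\<epsilon> / 2 ^ k) ^ card S"
proof (induction k arbitrary: v S)
  case 0
  {
    case 1 show ?case using meas by simp
  next
    case 2 then show ?case using bound by simp
  }
next
  case (Suc k)
  have eq: "bad_block n d c (Suc k) v \<longleftrightarrow> (\<exists>(w, w')\<in>far_pairs n d v. bad_block n d c k w \<and>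
      bad_block n d c k w')" for c v
    by (auto simp: far_pairs_def)
  {
    case 1
    have "{\<omega> \<in> space M. \<exists>p\<in>far_pairs n d v. bad_block n d (b \<omega>) k (fst p) \<and>
        bad_block n d (b \<omega>) k (snd p)} \<in> sets M"
      using Suc.IH(1) by (intro sets.sets_Collect_finite_Ex sets.sets_Collect_conj) auto
    then show ?case unfolding eq by (simp add: case_prod_unfold)
  next
    case 2
    have "prob {\<omega> \<in> space M. \<forall>v\<in>S. bad_block n d (b \<omega>) (Suc k) v} \<le>
        (of_int n ^ 4 * (\<epsilon> / 2 ^ k)\<^sup>2) ^ card S"
      unfolding eq using \<epsilon>(1) 2 nd Suc.IH by (intro bad_block_bound_step) auto
    also have "\<dots> \<le> (\<epsilon> / 2 ^ Suc k) ^ card S"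
    proof (rule power_mono)
      have "of_int n ^ 4 * (\<epsilon> / 2 ^ k)\<^sup>2 = (of_int n ^ 4 * \<epsilon>) * (\<epsilon> / 2 ^ k / 2 ^ k)"
          by (simp add: power2_eq_square)
      also have "\<dots> \<le> 1 / 2 * (\<epsilon> / 2 ^ k / 1)"
        using \<epsilon> by (intro mult_mono divide_left_mono) auto
      finally show "of_int n ^ 4 * (\<epsilon> / 2 ^ k)\<^sup>2 \<le> \<epsilon> / 2 ^ Suc k" by simp
    qed simp
    finally show ?case .
  }
qed

text \<open>At each scale only the n ^ 2 sub-blocks of the block at the origin are inspected, so the
  union bound over all scales is a geometric series with sum 2 * n ^ 2 * \<epsilon>, at most 1 / n ^
  2. A positive probability is all that the critical radius asks for.\<close>

lemma (in prob_space) no_bad_blocks: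
  assumes nd: "1 \<le> d" "2 \<le> n" and \<epsilon>: "0 \<le> \<epsilon>" "of_int n ^ 4 * \<epsilon> \<le> 1 / 2"
    and meas: "\<And>v. {\<omega> \<in> space M. b \<omega> v} \<in> sets M"
    and bound: "\<And>S. finite S \<Longrightarrow> pairwise (far d) S \<Longrightarrow> prob {\<omega> \<in> space M. \<forall>v\<in>S. b \<omega> v} \<le> \<epsilon> ^ card S"
  shows "0 < prob {\<omega> \<in> space M. \<forall>k. \<forall>w\<in>subsites n (0, 0). \<not> bad_block n d (b \<omega>) k w}"
proof -
  note bb = bad_block_bound[OF nd(1) _ \<epsilon> meas bound]
  have m: "{\<omega> \<in> space M. bad_block n d (b \<omega>) k v} \<in> sets M" for k v using bb(1) nd by simp
  define E where "E k = {\<omega> \<in> space M. \<exists>w\<in>subsites n (0, 0). bad_block n d (b \<omega>) k w}" for k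
  have E: "E k \<in> sets M" for k unfolding E_def using m by (intro sets.sets_Collect_finite_Ex) auto
  have pE: "prob (E k) \<le> of_int n ^ 2 * (\<epsilon> / 2 ^ k)" for k
  proof -
    have "prob (E k) = prob (\<Union>w\<in>subsites n (0, 0). {\<omega> \<in> space M. bad_block n d (b \<omega>) k w})"
      by (intro arg_cong[where f=prob]) (auto simp: E_def)
    also have "\<dots> \<le> (\<Sum>w\<in>subsites n (0, 0). prob {\<omega> \<in> space M. bad_block n d (b \<omega>) k w})"
      using m by (intro finite_measure_subadditive_finite) auto
    also have "\<dots> \<le> (\<Sum>w\<in>subsites n (0, 0). \<epsilon> / 2 ^ k)"
      using bb(2)[of "{_}" k] nd by (intro sum_mono) (simp add: pairwise_def)
    also have "\<dots> = of_int n ^ 2 * (\<epsilon> / 2 ^ k)" using nd by (simp add: card_subsites)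
    finally show ?thesis .
  qed
  have geo: "(\<lambda>k. of_int n ^ 2 * (\<epsilon> / 2 ^ k)) sums (of_int n ^ 2 * (\<epsilon> * 2))"
    using sums_mult[OF sums_mult[OF geometric_sums[of "1 / 2 :: real"]], of "of_int n ^ 2" \<epsilon>]
    by (simp add: power_divide)
  have sE: "summable (\<lambda>k. prob (E k))"
    by (rule summable_comparison_test[OF _ sums_summable[OF geo]]) (use pE in auto)
  have "prob (\<Union>k. E k) \<le> (\<Sum>k. prob (E k))"
    using E sE by (intro finite_measure_subadditive_countably) auto
  also have "\<dots> \<le> of_int n ^ 2 * (\<epsilon> * 2)"
    using pE sE geo by (intro sums_le[OF _ summable_sums[OF sE] geo]) auto
  also have "\<dots> < 1"
  proof -
    have "(4::real) \<le> of_int n ^ 2" using nd power_mono[of 2 "real_of_int n" 2] by simp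
    moreover have "of_int n ^ 2 * (of_int n ^ 2 * (\<epsilon> * 2)) \<le> 1" using \<epsilon>(2)
        by (simp add: flip: power_add mult.assoc)
    moreover have "0 \<le> of_int n ^ 2 * (\<epsilon> * 2)" using \<epsilon>(1) by simp
    ultimately have "4 * (of_int n ^ 2 * (\<epsilon> * 2)) \<le> 1" by (meson mult_right_mono order_trans)
    then show ?thesis by simp
  qed
  finally have "prob (\<Union>k. E k) < 1" .
  moreover have "prob (space M - (\<Union>k. E k)) = 1 - prob (\<Union>k. E k)"
    using E by (intro prob_compl) auto
  moreover have "space M - (\<Union>k. E k) = {\<omega> \<in> space M. \<forall>k. \<forall>w\<in>subsites n (0, 0).
      \<not> bad_block n d (b \<omega>) k w}"
    by (auto simp: E_def)
  ultimately show ?thesis by simp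
qed

section \<open>Connected clusters of good blocks\<close>

lemma connected_chain:
  fixes A :: "nat \<Rightarrow> 'a::topological_space set"
  assumes "\<And>i. i < m \<Longrightarrow> connected (A i)" "\<And>i. Suc i < m \<Longrightarrow> A i \<inter> A (Suc i) \<noteq> {}"
  shows "connected (\<Union>i<m. A i)"
  using assms
proof (induction m)
  case (Suc m)
  show ?case
  proof (cases "m = 0")
    case False
    then obtain m' where m: "m = Suc m'" using not0_implies_Suc by blast
    have "A m' \<inter> A m \<noteq> {}" using Suc.prems(2)[of m'] m by simp
    then have "(\<Union>i<m. A i) \<inter> A m \<noteq> {}" using m by blast
    then have "connected ((\<Union>i<m. A i) \<union> A m)" using Suc by (intro connected_Un) auto
    then show ?thesis by (simp add: lessThan_Suc Un_commute)
  qed (use Suc in \<open>simp add: lessThan_Suc\<close>)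
qed simp

lemma connected_Union_meeting:
  assumes "connected K" "K \<noteq> {}" "\<And>i. i \<in> I \<Longrightarrow> connected (F i)" "\<And>i. i \<in> I \<Longrightarrow> F i \<inter> K \<noteq> {}"
  shows "connected (K \<union> (\<Union>i\<in>I. F i))"
proof -
  obtain x where x: "x \<in> K" using assms(2) by blast
  have "connected (\<Union>(insert K ((\<lambda>i. K \<union> F i) ` I)))"
  proof (rule connected_Union)
    show "\<And>s. s \<in> insert K ((\<lambda>i. K \<union> F i) ` I) \<Longrightarrow> connected s"
      using assms by (auto intro!: connected_Un)
    show "\<Inter>(insert K ((\<lambda>i. K \<union> F i) ` I)) \<noteq> {}" using x by blast
  qed
  also have "\<Union>(insert K ((\<lambda>i. K \<union> F i) ` I)) = K \<union> (\<Union>i\<in>I. F i)" by blast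
  finally show ?thesis .
qed

text \<open>
  The bad sites of a good block fill fewer than half of its rows and columns.  The union over the
  other rows and columns is a grid, and the grids of two neighbouring blocks share a row or column.
\<close>

definition good_row :: "int \<Rightarrow> (site \<Rightarrow> bool) \<Rightarrow> site \<Rightarrow> int \<Rightarrow> bool" where
  "good_row n b v j \<longleftrightarrow> (\<forall>i\<in>{0..<n}. \<not> b (n * fst v + i, n * snd v + j))"

definition good_column :: "int \<Rightarrow> (site \<Rightarrow> bool) \<Rightarrow> site \<Rightarrow> int \<Rightarrow> bool" where
  "good_column n b v i \<longleftrightarrow> (\<forall>j\<in>{0..<n}. \<not> b (n * fst v + i, n * snd v + j))"

definition block_grid :: "int \<Rightarrow> (site \<Rightarrow> bool) \<Rightarrow> (site \<Rightarrow> 'a set) \<Rightarrow> site \<Rightarrow> 'a set" where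
  "block_grid n b C v = (\<Union>j\<in>{j\<in>{0..<n}. good_row n b v j}. \<Union>i\<in>{0..<n}. C (n * fst v +
      i, n * snd v + j)) \<union>
     (\<Union>i\<in>{i\<in>{0..<n}. good_column n b v i}. \<Union>j\<in>{0..<n}. C (n * fst v + i, n * snd v + j))"

text \<open>The invariant of the passage to blocks. It mentions no geometry beyond intersections of
  neighbouring sets, so the same statement can be repeated at every scale with unions of sets of the
  scale before.\<close>

definition good_clusters :: "(site \<Rightarrow> bool) \<Rightarrow> (site \<Rightarrow> 'a::topological_space set) \<Rightarrow> bool" where
  "good_clusters b C \<longleftrightarrow> (\<forall>v. \<not> b v \<longrightarrow> connected (C v) \<and> C v \<noteq> {}) \<and>
     (\<forall>x y. \<not> b (x, y) \<longrightarrow> \<not> b (x + 1, y) \<longrightarrow> C (x, y) \<inter> C (x + 1, y) \<noteq> {}) \<and>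
     (\<forall>x y. \<not> b (x, y) \<longrightarrow> \<not> b (x, y + 1) \<longrightarrow> C (x, y) \<inter> C (x, y + 1) \<noteq> {})"

lemma card_close_ints:
  fixes A :: "int set"
  assumes "A \<subseteq> {0..<n}" "\<And>x y. x \<in> A \<Longrightarrow> y \<in> A \<Longrightarrow> \<bar>x - y\<bar> < d" "0 \<le> d"
  shows "int (card A) \<le> d"
proof (cases "A = {}")
  case False
  have fin: "finite A" using assms(1) finite_subset by blast
  have "A \<subseteq> {Min A..<Min A + d}"
  proof
    fix x assume x: "x \<in> A"
    have "Min A \<in> A" using fin False by (rule Min_in)
    then have "\<bar>x - Min A\<bar> < d" "Min A \<le> x" using assms(2)[OF x \<open>Min A \<in> A\<close>] fin x by simp_all
    then show "x \<in> {Min A..<Min A + d}" by auto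
  qed
  then have "card A \<le> card {Min A..<Min A + d}" by (intro card_mono) auto
  then show ?thesis using assms(3) by simp
qed (use assms in simp)

text \<open>Each set misses at most d of n > 2 * d elements. Applied to two blocks it gives a shared
  good row or column; with A = B it shows that a good block has one at all.\<close>

lemma common_element_of_large:
  fixes A B :: "int set"
  assumes "A \<subseteq> {0..<n}" "B \<subseteq> {0..<n}" "int (card ({0..<n} - A)) \<le> d" "int (card ({0..<n} - B)) \<le>
      d" "2 * d < n"
  shows "A \<inter> B \<noteq> {}"
proof
  assume "A \<inter> B = {}"
  then have "{0..<n} \<subseteq> ({0..<n} - A) \<union> ({0..<n} - B)" by auto
  then have "card {0..<n} \<le> card (({0..<n} - A) \<union> ({0..<n} - B))" by (intro card_mono) auto
  also have "\<dots> \<le> card ({0..<n} - A) + card ({0..<n} - B)" by (rule card_Un_le)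
  finally show False using assms(3-5) by simp
qed

text \<open>Every excluded row contains a bad site. In a good block no two bad sites are far, so the
  excluded rows differ by less than d and number at most d; likewise for columns.\<close>

lemma good_rows_large:
  assumes "\<not> (\<exists>w\<in>subsites n v. \<exists>w'\<in>subsites n v. far d w w' \<and> b w \<and> b w')" "0 \<le> d"
  shows "int (card ({0..<n} - {j\<in>{0..<n}. good_row n b v j})) \<le> d"
    and "int (card ({0..<n} - {i\<in>{0..<n}. good_column n b v i})) \<le> d"
proof -
  have *: "\<not> far d w w'" if "w \<in> subsites n v" "w' \<in> subsites n v" "b w" "b w'" for w w'
    using assms(1) that by blast
  show "int (card ({0..<n} - {j\<in>{0..<n}. good_row n b v j})) \<le> d"
  proof (rule card_close_ints)
    fix x y assume "x \<in> {0..<n} - {j\<in>{0..<n}. good_row n b v j}" "y \<in> {0..<n} - {j\<in>{0..<n}.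
        good_row n b v j}"
    then obtain i i' where "x \<in> {0..<n}" "y \<in> {0..<n}" "i \<in> {0..<n}" "i' \<in> {0..<n}"
      "b (n * fst v + i, n * snd v + x)" "b (n * fst v + i', n * snd v + y)"
          unfolding good_row_def by blast
    then show "\<bar>x - y\<bar> < d" using *[of "(n * fst v + i, n * snd v + x)"
        "(n * fst v + i', n * snd v + y)"]
      by (auto simp: subsites_def far_def)
  qed (use assms in auto)
  show "int (card ({0..<n} - {i\<in>{0..<n}. good_column n b v i})) \<le> d"
  proof (rule card_close_ints)
    fix x y assume "x \<in> {0..<n} - {i\<in>{0..<n}. good_column n b v i}" "y \<in> {0..<n} - {i\<in>{0..<n}.
        good_column n b v i}"
    then obtain j j' where "x \<in> {0..<n}" "y \<in> {0..<n}" "j \<in> {0..<n}" "j' \<in> {0..<n}"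
      "b (n * fst v + x, n * snd v + j)" "b (n * fst v + y, n * snd v + j')"
          unfolding good_column_def by blast
    then show "\<bar>x - y\<bar> < d" using *[of "(n * fst v + x, n * snd v + j)"
        "(n * fst v + y, n * snd v + j')"]
      by (auto simp: subsites_def far_def)
  qed (use assms in auto)
qed

lemma connected_int_chain:
  fixes A :: "int \<Rightarrow> 'a::topological_space set"
  assumes "\<And>i. 0 \<le> i \<Longrightarrow> i < n \<Longrightarrow> connected (A i)" "\<And>i. 0 \<le> i \<Longrightarrow> i + 1 < n \<Longrightarrow> A i \<inter> A (i + 1) \<noteq> {}"
  shows "connected (\<Union>i\<in>{0..<n}. A i)"
proof -
  have "connected (\<Union>i<nat n. A (int i))"
    using assms(1)[of "int _"] assms(2)[of "int _"]
        by (intro connected_chain) (auto simp: add.commute)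
  also have "(\<Union>i<nat n. A (int i)) = (\<Union>i\<in>{0..<n}. A i)"
  proof -
    have "{0..<n} = int ` {..<nat n}" by (auto simp: image_iff intro!: bexI[of _ "nat _"])
    then show ?thesis by auto
  qed
  finally show ?thesis .
qed

text \<open>A row or column without bad sites is a chain of meeting connected sets, and a good row
  meets a good column in the nonempty set of their common site. This makes the grid connected, and a
  shared row or column carries it over to a neighbouring block.\<close>

lemma good_clusters_step:
  fixes C :: "site \<Rightarrow> 'a::topological_space set"
  assumes C: "good_clusters b C" and nd: "0 \<le> d" "2 * d < n"
  shows "good_clusters (\<lambda>v. \<exists>w\<in>subsites n v. \<exists>w'\<in>subsites n v. far d w w' \<and> b w \<and>
      b w') (block_grid n b C)"
proof -
  define B where "B v \<longleftrightarrow> (\<exists>w\<in>subsites n v. \<exists>w'\<in>subsites n v. far d w w' \<and> b w \<and> b w')" for v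
  define rows where "rows v = {j\<in>{0..<n}. good_row n b v j}" for v
  define cols where "cols v = {i\<in>{0..<n}. good_column n b v i}" for v
  have big: "int (card ({0..<n} - rows v)) \<le> d" "int (card ({0..<n} - cols v)) \<le> d" if "\<not> B v" for v
    using good_rows_large[of n v d b] that nd unfolding B_def rows_def cols_def by auto
  have sub: "rows v \<subseteq> {0..<n}" "cols v \<subseteq> {0..<n}" for v by (auto simp: rows_def cols_def)
  define Rw where "Rw v j = (\<Union>i\<in>{0..<n}. C (n * fst v + i, n * snd v + j))" for v j
  define Cl where "Cl v i = (\<Union>j\<in>{0..<n}. C (n * fst v + i, n * snd v + j))" for v i
  have grid: "block_grid n b C v = (\<Union>j\<in>rows v. Rw v j) \<union> (\<Union>i\<in>cols v. Cl v i)" for v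
    by (simp add: block_grid_def rows_def cols_def Rw_def Cl_def)
  have con: "\<not> b v \<Longrightarrow> connected (C v)" "\<not> b v \<Longrightarrow> C v \<noteq> {}"
    "\<not> b (x, y) \<Longrightarrow> \<not> b (x + 1, y) \<Longrightarrow> C (x, y) \<inter> C (x + 1, y) \<noteq> {}"
    "\<not> b (x, y) \<Longrightarrow> \<not> b (x, y + 1) \<Longrightarrow> C (x, y) \<inter> C (x, y + 1) \<noteq> {}" for v x y
    using C unfolding good_clusters_def by blast+
  have gr: "\<not> b (n * fst v + i, n * snd v + j)" if "j \<in> rows v" "0 \<le> i" "i < n" for v i j
    using that by (auto simp: rows_def good_row_def)
  have gc: "\<not> b (n * fst v + i, n * snd v + j)" if "i \<in> cols v" "0 \<le> j" "j < n" for v i j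
    using that by (auto simp: cols_def good_column_def)
  have conR: "connected (Rw v j)" if "j \<in> rows v" for v j
    unfolding Rw_def
  proof (rule connected_int_chain)
    show "connected (C (n * fst v + i, n * snd v + j))" if "0 \<le> i" "i < n" for i
      using con(1) gr \<open>j \<in> rows v\<close> that by blast
    show "C (n * fst v + i, n * snd v + j) \<inter> C (n * fst v + (i + 1), n * snd v + j) \<noteq> {}" if "0 \<le>
        i" "i + 1 < n" for i
      using con(3)[of "n * fst v + i" "n * snd v +
          j"] gr[OF \<open>j \<in> rows v\<close>, of i] gr[OF \<open>j \<in> rows v\<close>, of "i + 1"] that
      by (simp add: add.assoc)
  qed
  have conC: "connected (Cl v i)" if "i \<in> cols v" for v i
    unfolding Cl_def
  proof (rule connected_int_chain)
    show "connected (C (n * fst v + i, n * snd v + j))" if "0 \<le> j" "j < n" for j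
      using con(1) gc \<open>i \<in> cols v\<close> that by blast
    show "C (n * fst v + i, n * snd v + j) \<inter> C (n * fst v + i, n * snd v + (j + 1)) \<noteq> {}" if "0 \<le>
        j" "j + 1 < n" for j
      using con(4)[of "n * fst v + i" "n * snd v +
          j"] gc[OF \<open>i \<in> cols v\<close>, of j] gc[OF \<open>i \<in> cols v\<close>, of "j + 1"] that
      by (simp add: add.assoc)
  qed
  have meet: "Rw v j \<inter> Cl v i \<noteq> {}" if "j \<in> rows v" "i \<in> cols v" for v i j
  proof -
    have "i \<in> {0..<n}" "j \<in> {0..<n}"
      using subsetD[OF sub(1) that(1)] subsetD[OF sub(2) that(2)] by simp_all
    moreover from this have "C (n * fst v + i, n * snd v + j) \<noteq> {}"
        using con(2) gr[OF that(1), of i] by auto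
    ultimately show ?thesis unfolding Rw_def Cl_def by blast
  qed
  have main: "connected (block_grid n b C v) \<and> block_grid n b C v \<noteq> {}" if nb: "\<not> B v" for v
  proof -
    obtain j0 where j0: "j0 \<in> rows v" using common_element_of_large[OF sub(1)[of v] sub(1)[of v]
        big(1)[OF nb] big(1)[OF nb] nd(2)] by blast
    obtain i0 where i0: "i0 \<in> cols v" using common_element_of_large[OF sub(2)[of v] sub(2)[of v]
        big(2)[OF nb] big(2)[OF nb] nd(2)] by blast
    \<comment> \<open>A single column joins all good rows, and below a single row j0 joins all good
      columns. The two unions have the row j0 in common.\<close>
    have 1: "connected (Cl v i0 \<union> (\<Union>j\<in>rows v. Rw v j))"
    proof (rule connected_Union_meeting[OF conC[OF i0]])
      show "Cl v i0 \<noteq> {}" using meet[OF j0 i0] by blast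
      show "Rw v j \<inter> Cl v i0 \<noteq> {}" if "j \<in> rows v" for j using meet[OF that i0] by blast
    qed (rule conR)
    have 2: "connected (Rw v j0 \<union> (\<Union>i\<in>cols v. Cl v i))"
    proof (rule connected_Union_meeting[OF conR[OF j0]])
      show "Rw v j0 \<noteq> {}" using meet[OF j0 i0] by blast
      show "Cl v i \<inter> Rw v j0 \<noteq> {}" if "i \<in> cols v" for i using meet[OF j0 that] by blast
    qed (rule conC)
    have ne: "Rw v j0 \<noteq> {}" using meet[OF j0 i0] by blast
    have "connected ((Cl v i0 \<union> (\<Union>j\<in>rows v. Rw v j)) \<union> (Rw v j0 \<union> (\<Union>i\<in>cols v. Cl v i)))"
      using ne j0 by (intro connected_Un 1 2) blast
    also have "(Cl v i0 \<union> (\<Union>j\<in>rows v. Rw v j)) \<union> (Rw v j0 \<union> (\<Union>i\<in>cols v. Cl v i)) =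
        block_grid n b C v"
      unfolding grid using i0 j0 by blast
    finally show ?thesis using ne j0 unfolding grid by blast
  qed
  have n0: "0 < n" using nd by simp
  have hor: "block_grid n b C (x, y) \<inter> block_grid n b C (x + 1, y) \<noteq> {}" if nb: "\<not> B (x, y)"
      "\<not> B (x + 1, y)" for x y
  proof -
    obtain j where j: "j \<in> rows (x, y)" "j \<in> rows (x + 1, y)"
      using common_element_of_large[OF sub(1)[of "(x, y)"] sub(1)[of
          "(x + 1, y)"] big(1)[OF nb(1)] big(1)[OF nb(2)] nd(2)] by blast
    \<comment> \<open>The last site of the shared row in the left block and its first site in the
      right block are neighbours: the offset n - 1 is followed by the offset 0.\<close>
    have "C (n * x + (n - 1), n * y + j) \<inter> C (n * (x + 1) + 0, n * y + j) \<noteq> {}"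
      using con(3)[of "n * x + (n - 1)" "n * y + j"] gr[OF j(1), of "n - 1"] gr[OF j(2), of 0] n0
      by (simp add: algebra_simps)
    moreover have "C (n * x + (n - 1), n * y + j) \<subseteq> Rw (x, y) j" unfolding Rw_def using n0
        by (auto intro!: bexI[of _ "n - 1"])
    moreover have "C (n * (x + 1) + 0, n * y + j) \<subseteq> Rw (x + 1, y) j" unfolding Rw_def using n0
        by (auto intro!: bexI[of _ 0])
    ultimately show ?thesis unfolding grid using j by blast
  qed
  have ver: "block_grid n b C (x, y) \<inter> block_grid n b C (x, y + 1) \<noteq> {}" if nb: "\<not> B (x, y)"
      "\<not> B (x, y + 1)" for x y
  proof -
    obtain i where i: "i \<in> cols (x, y)" "i \<in> cols (x, y + 1)"
      using common_element_of_large[OF sub(2)[of "(x, y)"] sub(2)[of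
          "(x, y + 1)"] big(2)[OF nb(1)] big(2)[OF nb(2)] nd(2)] by blast
    have "C (n * x + i, n * y + (n - 1)) \<inter> C (n * x + i, n * (y + 1) + 0) \<noteq> {}"
      using con(4)[of "n * x + i" "n * y + (n - 1)"] gc[OF i(1), of "n - 1"] gc[OF i(2), of 0] n0
      by (simp add: algebra_simps)
    moreover have "C (n * x + i, n * y + (n - 1)) \<subseteq> Cl (x, y) i" unfolding Cl_def using n0
        by (auto intro!: bexI[of _ "n - 1"])
    moreover have "C (n * x + i, n * (y + 1) + 0) \<subseteq> Cl (x, y + 1) i" unfolding Cl_def using n0
        by (auto intro!: bexI[of _ 0])
    ultimately show ?thesis unfolding grid using i by blast
  qed
  show ?thesis unfolding good_clusters_def B_def[symmetric] using main hor ver by blast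
qed

primrec block_cluster :: "int \<Rightarrow> int \<Rightarrow> (site \<Rightarrow> bool) \<Rightarrow> (site \<Rightarrow> 'a set) \<Rightarrow> nat \<Rightarrow> site \<Rightarrow> 'a set" where
  "block_cluster n d b C 0 = C"
| "block_cluster n d b C (Suc k) = block_grid n (bad_block n d b k) (block_cluster n d b C k)"

lemma good_clusters_block:
  assumes "good_clusters b C" "0 \<le> d" "2 * d < n"
  shows "good_clusters (bad_block n d b k) (block_cluster n d b C k)"
proof (induction k)
  case 0
  have "bad_block n d b 0 = b" by (simp add: fun_eq_iff)
  then show ?case using assms by simp
next
  case (Suc k)
  have "bad_block n d b (Suc k) = (\<lambda>v. \<exists>w\<in>subsites n v. \<exists>w'\<in>subsites n v. far d w w' \<and>
      bad_block n d b k w \<and> bad_block n d b k w')"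
    by (simp add: fun_eq_iff)
  then show ?case using good_clusters_step[OF Suc assms(2,3)] by simp
qed

text \<open>The clusters of the block at the origin increase with the scale, so their union is
  connected. It is unbounded because at every scale it also contains the cluster of the block (n -
  1, 0), which the location bound places far to the right.\<close>

lemma percolates_no_bad_blocks:
  fixes C :: "site \<Rightarrow> plane set"
  assumes C: "good_clusters b C" and nd: "0 \<le> d" "2 * d < n" "2 \<le> n"
    and CS: "\<And>v. \<not> b v \<Longrightarrow> C v \<subseteq> S"
    and loc: "\<And>v p. p \<in> C v \<Longrightarrow> s * of_int (fst v) - m \<le> p $ 1" and s: "0 < s"
    and good: "\<And>k w. w \<in> subsites n (0, 0) \<Longrightarrow> \<not> bad_block n d b k w"
  shows "percolates S"
proof -
  let ?C = "block_cluster n d b C"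
  have gc: "good_clusters (bad_block n d b k) (?C k)" for k
      by (rule good_clusters_block[OF C nd(1,2)])
  have in_S: "\<not> bad_block n d b k v \<Longrightarrow> ?C k v \<subseteq> S" for k v
  proof (induction k arbitrary: v)
    case 0 then show ?case using CS by simp
  next
    case (Suc k)
    have "?C k (n * fst v + i, n * snd v + j) \<subseteq> S"
      if "0 \<le> i" "i < n" "0 \<le> j" "j < n" "good_row n (bad_block n d b k) v j \<or> good_column n
          (bad_block n d b k) v i" for i j
      using that by (intro Suc.IH) (auto simp: good_row_def good_column_def)
    then show ?case by (fastforce simp: block_grid_def)
  qed
  have loc_k: "s * of_int n ^ k * of_int (fst v) - m \<le> p $ 1" if "p \<in> ?C k v" for k v p
    using that
  proof (induction k arbitrary: v p)
    case 0 then show ?case using loc by simp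
  next
    case (Suc k)
    then obtain i j where "0 \<le> i" "p \<in> ?C k (n * fst v + i, n * snd v + j)"
        by (auto simp: block_grid_def)
    with Suc.IH have "s * of_int n ^ k * of_int (n * fst v + i) - m \<le> p $ 1" by fastforce
    moreover have "s * of_int n ^ k * of_int (n * fst v) \<le> s * of_int n ^ k * of_int (n * fst v +
        i)"
      using s nd \<open>0 \<le> i\<close> by (intro mult_left_mono) auto
    ultimately show ?case by (simp add: mult_ac)
  qed
  have zero: "(0, 0) \<in> subsites n (0, 0)" "(n - 1, 0) \<in> subsites n (0, 0)" using nd
      by (auto simp: subsites_def)
  \<comment> \<open>No sub-block of the block at the origin is bad at level k, so all its rows are
    good and its grid contains the cluster of each of its sub-blocks.\<close>
  have Suc_sub: "?C k w \<subseteq> ?C (Suc k) (0, 0)" if w: "w \<in> subsites n (0, 0)" for k w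
  proof -
    have "good_row n (bad_block n d b k) (0, 0) (snd w)"
      unfolding good_row_def using good w by (auto simp: subsites_def)
    then have "?C k (n * fst (0 :: int, 0 :: int) + fst w, n * snd (0 :: int, 0 :: int) +
        snd w) \<subseteq> ?C (Suc k) (0, 0)"
      using w unfolding block_cluster.simps block_grid_def subsites_def by fastforce
    then show ?thesis by simp
  qed
  define T where "T = (\<Union>k. ?C k (0, 0))"
  have mono: "?C 0 (0, 0) \<subseteq> ?C k (0, 0)" for k
    using Suc_sub[OF zero(1)] by (induction k) blast+
  have con: "connected (?C k w)" "?C k w \<noteq> {}" if "w \<in> subsites n (0, 0)" for k w
    using gc[of k] good[OF that, of k] unfolding good_clusters_def by blast+
  have "connected T" unfolding T_def
  proof (rule connected_Union)
    show "\<And>s. s \<in> range (\<lambda>k. ?C k (0, 0)) \<Longrightarrow> connected s" using con(1)[OF zero(1)] by auto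
    show "\<Inter> (range (\<lambda>k. ?C k (0, 0))) \<noteq> {}" using mono con(2)[OF zero(1), of 0] by blast
  qed
  moreover have "T \<subseteq> S" unfolding T_def using in_S good[OF zero(1)] by blast
  moreover have "\<not> bounded T"
  proof
    assume "bounded T"
    then obtain c where c: "\<And>p. p \<in> T \<Longrightarrow> norm p \<le> c" by (auto simp: bounded_iff)
    \<comment> \<open>The cluster of (n - 1, 0) at level k is nonempty and has first coordinate at
      least s * n ^ k * (n - 1) - m, where n is at least 2.\<close>
    have "s * 2 ^ k - m \<le> c" for k
    proof -
      obtain p where p: "p \<in> ?C k (n - 1, 0)" using con(2)[OF zero(2), of k] by blast
      then have "p \<in> T" unfolding T_def using Suc_sub[OF zero(2), of k] by blast
      then have "p $ 1 \<le> c" using c[of p] component_le_norm_cart[of p 1] by linarith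
      moreover have "s * of_int n ^ k * of_int (n - 1) - m \<le> p $ 1" using loc_k[OF p] by simp
      moreover have "s * (2 ^ k * 1) \<le> s * (of_int n ^ k * of_int (n - 1))"
        using s nd by (intro mult_left_mono mult_mono power_mono) auto
      ultimately show ?thesis by (simp add: mult_ac)
    qed
    moreover obtain k where "(c + m) / s < 2 ^ k" using real_arch_pow[of 2 "(c + m) / s"] by auto
    then have "c + m < s * 2 ^ k" using s by (simp add: field_simps)
    ultimately show False by (smt (verit))
  qed
  ultimately show ?thesis unfolding percolates_def by blast
qed

section \<open>Boolean models with annular clusters\<close>

lemma norm_plane_le: "norm (p :: plane) \<le> \<bar>p $ 1\<bar> + \<bar>p $ 2\<bar>"
  using norm_le_l1_cart[of p] by (simp add: UNIV_2)

definition circle_point :: "real \<Rightarrow> plane" where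
  "circle_point t = vector [cos t, sin t]"

lemma norm_circle_point [simp]: "norm (circle_point t) = 1"
  by (simp add: norm_vec_def L2_set_def UNIV_2 circle_point_def)

lemma circle_point_diff: "norm (circle_point s - circle_point t) \<le> 2 * \<bar>s - t\<bar>"
proof -
  have half: "\<bar>2 * sin u * sin v\<bar> \<le> 2 * \<bar>v\<bar>" for u v :: real
  proof -
    have "\<bar>sin u\<bar> * \<bar>sin v\<bar> \<le> 1 * \<bar>v\<bar>"
      by (intro mult_mono abs_sin_x_le_abs_x) auto
    then show ?thesis by (simp add: abs_mult)
  qed
  have "\<bar>cos s - cos t\<bar> \<le> \<bar>s - t\<bar>"
    using half[of "(s + t) / 2" "(t - s) / 2"] unfolding cos_diff_cos
        by (simp add: abs_minus_commute)
  moreover have "\<bar>sin s - sin t\<bar> \<le> \<bar>s - t\<bar>"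
  proof -
    have "sin s - sin t = 2 * sin ((s - t) / 2) * cos ((s + t) / 2)" by (rule sin_diff_sin)
    also have "\<dots> = 2 * sin (pi / 2 - (s + t) / 2) * sin ((s - t) / 2)" by (simp add: cos_sin_eq)
    finally show ?thesis using half[of "pi / 2 - (s + t) / 2" "(s - t) / 2"] by simp
  qed
  ultimately show ?thesis
    using norm_plane_le[of "circle_point s - circle_point t"] by (simp add: circle_point_def)
qed

text \<open>The angles of the net leave an error of at most 2 * pi / m;
  \<open>circle_point_diff\<close> turns angles into distances at the price of a factor 2.\<close>

lemma circle_net:
  assumes w: "norm (w :: plane) = 1" and m: "0 < m"
  shows "\<exists>l<m. norm (w - circle_point (2 * pi * real l / real m)) \<le> 4 * pi / real m"
proof -
  have "(w $ 1)\<^sup>2 + (w $ 2)\<^sup>2 = 1"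
    using w by (simp add: norm_vec_def L2_set_def UNIV_2)
  then obtain t where t: "0 \<le> t" "t < 2 * pi" "w $ 1 = cos t" "w $ 2 = sin t"
    by (rule sincos_total_2pi)
  have wt: "w = circle_point t" using t by (simp add: vec_eq_iff circle_point_def forall_2)
  define l where "l = nat \<lfloor>t * m / (2 * pi)\<rfloor>"
  have "t * m / (2 * pi) < m" using t m by (simp add: field_simps)
  then have "l < m" using t unfolding l_def by (simp add: nat_less_iff floor_less_iff)
  have l: "real l \<le> t * m / (2 * pi)" "t * m / (2 * pi) < real l + 1"
    using t m unfolding l_def by (auto simp: of_nat_nat)
  have "\<bar>t - 2 * pi * real l / m\<bar> \<le> 2 * pi / m"
  proof -
    have "2 * pi * real l / m \<le> t" using l(1) m by (simp add: field_simps)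
    moreover have "t \<le> 2 * pi * real l / m + 2 * pi / m"
      using l(2) m by (simp add: field_simps)
    ultimately show ?thesis by simp
  qed
  then have "norm (w - circle_point (2 * pi * real l / real m)) \<le> 2 * (2 * pi / m)"
    using circle_point_diff[of t "2 * pi * real l / m"] wt by simp
  then show ?thesis using \<open>l < m\<close> by (intro exI[of _ l]) simp
qed

text \<open>On the circle about x, the distance to y is at most R at the point towards y and at
  least R at the opposite point, so it takes the value R by connectedness. Equal centres have no
  direction and are treated apart.\<close>

lemma spheres_meet:
  fixes x y :: plane
  assumes "dist x y \<le> 2 * R" "0 < R"
  shows "sphere x R \<inter> sphere y R \<noteq> {}"
proof (cases "x = y")
  case True
  then show ?thesis using assms by simp
next
  case False
  define D where "D = dist x y"
  have D: "0 < D" using False by (simp add: D_def)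
  define w where "w = (y - x) /\<^sub>R D"
  have w: "norm w = 1" using D by (simp add: w_def D_def dist_norm norm_minus_commute)
  have yx: "y = x + D *\<^sub>R w" using D by (simp add: w_def)
  have con: "connected (dist y ` sphere x R)"
    by (intro connected_continuous_image continuous_intros connected_sphere) simp
  have 1: "x + R *\<^sub>R w \<in> sphere x R" "x - R *\<^sub>R w \<in> sphere x R" using w assms
      by (simp_all add: dist_norm)
  have "dist y (x + R *\<^sub>R w) = norm ((D - R) *\<^sub>R w)" by (simp add: yx dist_norm algebra_simps)
  then have d1: "dist y (x + R *\<^sub>R w) \<le> R" using w assms zero_le_dist[of x y] unfolding D_def
      by (simp add: abs_le_iff)
  have "dist y (x - R *\<^sub>R w) = norm ((D + R) *\<^sub>R w)" by (simp add: yx dist_norm algebra_simps)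
  then have d2: "R \<le> dist y (x - R *\<^sub>R w)" using w D assms by simp
  have "R \<in> dist y ` sphere x R"
    using connectedD_interval[OF con imageI[OF 1(1)] imageI[OF 1(2)] d1 d2] .
  then show ?thesis by auto
qed

text \<open>Half-open, so that for s > 0 the squares partition the plane and different squares
  concern disjoint sets of centres.\<close>

definition grid_square :: "real \<Rightarrow> site \<Rightarrow> plane set" where
  "grid_square s u = {y. s * of_int (fst u) \<le> y $ 1 \<and> y $ 1 < s * of_int (fst u + 1) \<and>
     s * of_int (snd u) \<le> y $ 2 \<and> y $ 2 < s * of_int (snd u + 1)}"

lemma grid_square_sets [measurable]: "grid_square s u \<in> sets borel"
  unfolding grid_square_def by measurable

lemma bounded_grid_square: "bounded (grid_square s u)"
proof (rule bounded_subset[OF bounded_cball])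
  show "grid_square s u \<subseteq> cball 0 (\<bar>s * of_int (fst u)\<bar> + \<bar>s * of_int (fst u + 1)\<bar> +
      (\<bar>s * of_int (snd u)\<bar> + \<bar>s * of_int (snd u + 1)\<bar>))"
  proof
    fix y assume y: "y \<in> grid_square s u"
    then have "\<bar>y $ 1\<bar> \<le> \<bar>s * of_int (fst u)\<bar> + \<bar>s * of_int (fst u + 1)\<bar>"
      "\<bar>y $ 2\<bar> \<le> \<bar>s * of_int (snd u)\<bar> + \<bar>s * of_int (snd u + 1)\<bar>"
      unfolding grid_square_def mem_Collect_eq by linarith+
    then show "y \<in> cball 0 (\<bar>s * of_int (fst u)\<bar> + \<bar>s * of_int (fst u + 1)\<bar> +
        (\<bar>s * of_int (snd u)\<bar> + \<bar>s * of_int (snd u + 1)\<bar>))"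
      using norm_plane_le[of y] by simp
  qed
qed

lemma emeasure_grid_square:
  assumes "0 < s"
  shows "emeasure lborel (grid_square s u) = ennreal (s\<^sup>2)"
proof -
  define a b :: plane where "a = vector [s * of_int (fst u), s * of_int (snd u)]"
    and "b = vector [s * of_int (fst u + 1), s * of_int (snd u + 1)]"
  have comp: "a $ 1 = s * of_int (fst u)" "a $ 2 = s * of_int (snd u)" "b $ 1 =
      s * of_int (fst u + 1)" "b $ 2 = s * of_int (snd u + 1)"
    by (simp_all add: a_def b_def)
  have ab: "\<forall>i. a $ i \<le> b $ i" using assms by (simp add: forall_2 comp algebra_simps)
  then have le: "\<And>i. i \<in> Basis \<Longrightarrow> a \<bullet> i \<le> b \<bullet> i" by (auto simp: Basis_vec_def inner_axis)
  have prod: "(\<Prod>i\<in>Basis. (b - a) \<bullet> i) = s\<^sup>2"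
  proof -
    have "(\<Prod>i\<in>Basis. (b - a) \<bullet> i) = measure lborel (cbox a b)" using le by (simp add: content_cbox')
    also have "\<dots> = (\<Prod>i\<in>UNIV. b $ i - a $ i)"
    proof (rule content_cbox_cart)
      have "a \<in> cbox a b" using ab by (simp add: mem_box_cart)
      then show "cbox a b \<noteq> {}" by blast
    qed
    also have "\<dots> = s\<^sup>2" by (simp add: UNIV_2 comp algebra_simps power2_eq_square)
    finally show ?thesis .
  qed
  have "box a b \<subseteq> grid_square s u"
    by (auto simp: grid_square_def mem_box_cart forall_2 comp)
  moreover have "grid_square s u \<subseteq> cbox a b"
    by (auto simp: grid_square_def mem_box_cart forall_2 comp)
  ultimately have "emeasure lborel (box a b) \<le> emeasure lborel (grid_square s u)"
    "emeasure lborel (grid_square s u) \<le> emeasure lborel (cbox a b)"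
    by (auto intro!: emeasure_mono)
  then show ?thesis using le prod by (simp add: emeasure_lborel_box emeasure_lborel_cbox)
qed

lemma grid_square_cell:
  assumes y: "y \<in> grid_square s u" and q: "0 < q" "0 < s"
  shows "\<exists>u'\<in>subsites (int q) u. y \<in> grid_square (s / q) u'"
proof -
  have key: "\<exists>j. int q * i \<le> j \<and> j < int q * i + int q \<and> s / q * of_int j \<le>
      t \<and> t < s / q * of_int (j + 1)"
    if "s * of_int i \<le> t" "t < s * of_int (i + 1)" for i t
  proof -
    define j where "j = \<lfloor>t * q / s\<rfloor>"
    have j: "of_int j \<le> t * q / s" "t * q / s < of_int j + 1" unfolding j_def by linarith+
    have "of_int (int q * i) \<le> t * q / s" using that q by (simp add: field_simps)
    then have "int q * i \<le> j" unfolding j_def by (simp add: le_floor_iff)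
    moreover have "t * q / s < of_int (int q * i + int q)"
      using mult_strict_right_mono[OF that(2), of "real q"] q by (simp add: field_simps)
    then have "j < int q * i + int q" unfolding j_def by (simp add: floor_less_iff)
    moreover have "s / q * of_int j \<le> t" "t < s / q * of_int (j + 1)" using j q
        by (simp_all add: field_simps)
    ultimately show ?thesis by blast
  qed
  obtain j1 where "int q * fst u \<le> j1" "j1 < int q * fst u + int q" "s / q * of_int j1 \<le>
      y $ 1" "y $ 1 < s / q * of_int (j1 + 1)"
    using key[of "fst u" "y $ 1"] y by (auto simp: grid_square_def)
  moreover obtain j2 where "int q * snd u \<le> j2" "j2 < int q * snd u + int q" "s / q * of_int j2 \<le>
      y $ 2" "y $ 2 < s / q * of_int (j2 + 1)"
    using key[of "snd u" "y $ 2"] y by (auto simp: grid_square_def)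
  ultimately show ?thesis by (intro bexI[of _
      "(j1, j2)"]) (simp_all add: grid_square_def subsites_def)
qed

text \<open>A fixed representative of a cell. Moving a random centre to the corner of its cell
  leaves finitely many candidate circles per square, so that coverage becomes an event about
  finitely many fixed boxes.\<close>

definition grid_corner :: "real \<Rightarrow> site \<Rightarrow> plane" where
  "grid_corner s u = vector [s * of_int (fst u), s * of_int (snd u)]"

lemma grid_corner_near:
  assumes "y \<in> grid_square s u"
  shows "dist y (grid_corner s u) \<le> 2 * s"
proof -
  have "\<bar>(y - grid_corner s u) $ 1\<bar> \<le> s" "\<bar>(y - grid_corner s u) $ 2\<bar> \<le> s"
    using assms by (auto simp: grid_square_def grid_corner_def algebra_simps)
  then show ?thesis unfolding dist_norm using norm_plane_le[of "y - grid_corner s u"] by linarith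
qed

lemma grid_corner_in:
  assumes "u' \<in> subsites (int q) u" "0 < q" "0 < s"
  shows "grid_corner (s / q) u' \<in> grid_square s u"
proof -
  have key: "s * of_int i \<le> s / q * of_int j \<and> s / q * of_int j < s * of_int (i + 1)"
    if "int q * i \<le> j" "j < int q * i + int q" for i j
  proof -
    have 1: "real q * of_int i \<le> of_int j" using that(1)
        by (metis of_int_le_iff of_int_mult of_int_of_nat_eq)
    have "of_int j < (of_int (int q * i + int q) :: real)" using that(2)
        by (simp only: of_int_less_iff)
    then have 2: "of_int j < real q * of_int i + real q" by simp
    have "s * (real q * of_int i) \<le> s * of_int j" "s * of_int j < s * (real q * of_int i + real q)"
      using 1 2 assms by (auto intro!: mult_left_mono mult_strict_left_mono)
    then show ?thesis using assms by (simp add: field_simps)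
  qed
  show ?thesis using key[of "fst u" "fst u'"] key[of "snd u" "snd u'"] assms(1)
    by (auto simp: grid_square_def grid_corner_def subsites_def)
qed

lemma far_grid_squares:
  assumes "far d u v" "x \<in> grid_square s u" "y \<in> grid_square s v" "0 < s" "0 \<le> d"
  shows "s * of_int (d - 1) \<le> dist x y"
proof -
  have key: "s * of_int (d - 1) \<le> \<bar>t - t'\<bar>"
    if "d \<le> \<bar>i - j\<bar>" "s * of_int i \<le> t" "t < s * of_int (i + 1)" "s * of_int j \<le>
        t'" "t' < s * of_int (j + 1)" for i j t t'
  proof (cases "j \<le> i")
    case True
    then have "s * of_int (d - 1) \<le> s * (of_int i - of_int (j + 1))" using that(1) assms(4)
        by (intro mult_left_mono) linarith+
    then show ?thesis using that by (simp add: algebra_simps)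
  next
    case False
    then have "s * of_int (d - 1) \<le> s * (of_int j - of_int (i + 1))" using that(1) assms(4)
        by (intro mult_left_mono) linarith+
    then show ?thesis using that by (simp add: algebra_simps)
  qed
  have "\<bar>x $ 1 - y $ 1\<bar> \<le> dist x y" "\<bar>x $ 2 - y $ 2\<bar> \<le> dist x y"
    using component_le_norm_cart[of "x - y"] by (auto simp: dist_norm)
  then show ?thesis
    using assms(1-3) key[of "fst u" "fst v" "x $ 1" "y $ 1"] key[of "snd u" "snd v" "x $ 2" "y $ 2"]
    unfolding far_def grid_square_def mem_Collect_eq by linarith
qed

lemma dist_adjacent_squares:
  assumes "x \<in> grid_square s (i, j)" "y \<in> grid_square s (i + 1, j) \<or> y \<in> grid_square s (i, j + 1)"
      "0 < s"
  shows "dist x y \<le> 3 * s"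
proof -
  have "\<bar>(x - y) $ 1\<bar> + \<bar>(x - y) $ 2\<bar> \<le> 3 * s"
    using assms unfolding grid_square_def mem_Collect_eq by (auto simp: algebra_simps abs_le_iff)
  then show ?thesis unfolding dist_norm using norm_plane_le[of "x - y"] by linarith
qed

text \<open>A ball on the middle circle of the annulus. Its radius \<delta> / 4 leaves a margin of
  \<delta> / 4 to both boundary circles, which absorbs the move of the centre to a corner.\<close>

definition annulus_box :: "real \<Rightarrow> real \<Rightarrow> nat \<Rightarrow> plane \<Rightarrow> nat \<Rightarrow> plane set" where
  "annulus_box R \<delta> m x l = cball (x + (R - \<delta> / 2) *\<^sub>R circle_point (2 * pi *
      real l / real m)) (\<delta> / 4)"

lemma annulus_box_sets [measurable]: "annulus_box R \<delta> m x l \<in> sets borel"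
  by (simp add: annulus_box_def)

lemma bounded_annulus_box: "bounded (annulus_box R \<delta> m x l)"
  by (simp add: annulus_box_def)

lemma annulus_box_dist:
  assumes "p \<in> annulus_box R \<delta> m x l" "0 < \<delta>" "\<delta> \<le> R"
  shows "R - 3 * \<delta> / 4 \<le> dist x p" "dist x p \<le> R - \<delta> / 4"
proof -
  define c where "c = (R - \<delta> / 2) *\<^sub>R circle_point (2 * pi * real l / real m)"
  have c: "norm c = R - \<delta> / 2" using assms by (simp add: c_def)
  have p: "dist (x + c) p \<le> \<delta> / 4" using assms(1) by (simp add: annulus_box_def c_def)
  have xc: "dist x (x + c) = R - \<delta> / 2" using c by (simp add: dist_norm)
  show "R - 3 * \<delta> / 4 \<le> dist x p" using dist_triangle[of x "x + c" p] p xc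
      by (simp add: dist_commute)
  show "dist x p \<le> R - \<delta> / 4" using dist_triangle[of x p "x + c"] p xc by simp
qed

lemma annulus_box_in_annulus:
  assumes "p \<in> annulus_box R \<delta> m x l" "0 < \<delta>" "\<delta> \<le> R" "dist y x \<le> \<delta> / 4"
  shows "p \<in> annulus R \<delta> y"
  using annulus_box_dist[OF assms(1-3)] dist_triangle[of y p x] dist_triangle[of x p y] assms(2,4)
  by (simp add: annulus_def dist_commute)

text \<open>The distances add up: at most r / 2 from the net of m directions on a circle of radius
  R, r / 4 from the circle inwards to the middle of the annulus, and r / 8 within the box, in all
  less than r.\<close>

lemma sphere_covered:
  assumes N: "N \<in> counting_measures" and m: "8 * pi * R \<le> r * real m" "0 < m"
      and r: "0 < r" "r / 2 \<le> R"
    and hit: "\<And>l. l < m \<Longrightarrow> emeasure N (annulus_box R (r / 2) m x l) \<noteq> 0"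
  shows "sphere x R \<subseteq> boolean_model N r"
proof
  fix y assume "y \<in> sphere x R"
  then have y: "dist x y = R" by simp
  have R: "0 < R" using r by simp
  define w where "w = (y - x) /\<^sub>R R"
  have w: "norm w = 1" using y R by (simp add: w_def dist_norm norm_minus_commute)
  have yw: "y = x + R *\<^sub>R w" using R by (simp add: w_def)
  obtain l where l: "l < m" "norm (w - circle_point (2 * pi * real l / real m)) \<le> 4 * pi / real m"
    using circle_net[OF w m(2)] by blast
  define c where "c = circle_point (2 * pi * real l / real m)"
  obtain p where p: "p \<in> annulus_box R (r / 2) m x l" "p \<in> atoms N"
    using atom_exists[OF N annulus_box_sets bounded_annulus_box hit[OF l(1)]] by blast
  have "dist y (x + (R - r / 4) *\<^sub>R c) = norm (R *\<^sub>R (w - c) + (r / 4) *\<^sub>R c)"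
    unfolding yw by (simp add: dist_norm algebra_simps)
  also have "\<dots> \<le> R * norm (w - c) + r / 4"
    using norm_triangle_ineq[of "R *\<^sub>R (w - c)" "(r / 4) *\<^sub>R c"] R r by (simp add: c_def)
  also have "R * norm (w - c) \<le> R * (4 * pi / real m)" using l(2) R
      by (intro mult_left_mono) (simp_all add: c_def)
  also have "R * (4 * pi / real m) \<le> r / 2" using m by (simp add: field_simps)
  finally have "dist y (x + (R - r / 4) *\<^sub>R c) \<le> 3 * r / 4" by simp
  moreover have "dist (x + (R - r / 4) *\<^sub>R c) p \<le> r / 8" using p(1)
      by (simp add: annulus_box_def c_def)
  ultimately have "dist y p \<le> r" using dist_triangle[of y p "x + (R - r / 4) *\<^sub>R c"] r by simp
  then show "y \<in> boolean_model N r" using p(2) by (auto simp: boolean_model_atoms dist_commute)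
qed

text \<open>Speaks of the points of the cluster process alone, as the centres are not visible in it:
  every candidate corner in the square has an empty box.\<close>

definition uncovered_square :: "real \<Rightarrow> real \<Rightarrow> nat \<Rightarrow> nat \<Rightarrow> plane measure \<Rightarrow> site \<Rightarrow> bool" where
  "uncovered_square R r m q N u \<longleftrightarrow>
     (\<forall>c\<in>subsites (int q) u. \<exists>l<m. emeasure N (annulus_box R (r / 2) m (grid_corner (R / 2 / q) c)
         l) = 0)"

lemma percolates_of_squares:
  assumes N: "N \<in> counting_measures" and m: "8 * pi * R \<le> r * real m" "0 < m"
      and r: "0 < r" "r / 2 \<le> R" and q: "0 < q"
    and good: "\<And>k w. w \<in> subsites 13 (0, 0) \<Longrightarrow> \<not> bad_block 13 6 (uncovered_square R r m q N) k w"
  shows "percolates (boolean_model N r)"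
proof -
  let ?b = "uncovered_square R r m q N"
  have R: "0 < R" using r by simp
  define cc where "cc u = (SOME c. c \<in> subsites (int q) u \<and>
    (\<forall>l<m. emeasure N (annulus_box R (r / 2) m (grid_corner (R / 2 / q) c) l) \<noteq> 0))" for u
  \<comment> \<open>Empty on uncovered squares, where the choice \<open>cc\<close> means nothing;
    the location bound then holds there trivially.\<close>
  define C where "C u = (if ?b u then {} else sphere (grid_corner (R / 2 / q) (cc u)) R)" for u
  have cc: "cc u \<in> subsites (int q) u" "\<And>l. l < m \<Longrightarrow>
      emeasure N (annulus_box R (r / 2) m (grid_corner (R / 2 / q) (cc u)) l) \<noteq> 0"
    if "\<not> ?b u" for u
  proof -
    have "\<exists>c. c \<in> subsites (int q) u \<and> (\<forall>l<m.
        emeasure N (annulus_box R (r / 2) m (grid_corner (R / 2 / q) c) l) \<noteq> 0)"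
      using that unfolding uncovered_square_def by blast
    from someI_ex[OF this] show "cc u \<in> subsites (int q) u"
      "\<And>l. l < m \<Longrightarrow> emeasure N (annulus_box R (r / 2) m (grid_corner (R / 2 / q) (cc u)) l) \<noteq> 0"
      unfolding cc_def by blast+
  qed
  have corner: "grid_corner (R / 2 / q) (cc u) \<in> grid_square (R / 2) u" if "\<not> ?b u" for u
    using R q cc(1)[OF that] by (intro grid_corner_in) auto
  have meet: "sphere x R \<inter> sphere y R \<noteq> {}"
    if "x \<in> grid_square (R / 2) (i, j)" "y \<in> grid_square (R / 2) (i +
        1, j) \<or> y \<in> grid_square (R / 2) (i, j + 1)" for x y i j
    using dist_adjacent_squares[OF that] R by (intro spheres_meet) auto
  have gc: "good_clusters ?b C"
    unfolding good_clusters_def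
  proof (intro conjI allI impI)
    fix v assume "\<not> ?b v"
    then show "connected (C v)" "C v \<noteq> {}" using R by (simp_all add: C_def connected_sphere)
  next
    fix x y assume "\<not> ?b (x, y)" "\<not> ?b (x + 1, y)"
    then show "C (x, y) \<inter> C (x + 1, y) \<noteq> {}" using meet[OF corner corner[THEN disjI1]]
        by (simp add: C_def)
  next
    fix x y assume "\<not> ?b (x, y)" "\<not> ?b (x, y + 1)"
    then show "C (x, y) \<inter> C (x, y + 1) \<noteq> {}" using meet[OF corner corner[THEN disjI2]]
        by (simp add: C_def)
  qed
  show ?thesis
  \<comment> \<open>Squares of side R / 2 that are far with d = 6 are at least 5 * R / 2 apart, so
    boxes around corners in them, which stay within R of their corners, are disjoint. The least n
    above 2 * d is 13.\<close>
  proof (rule percolates_no_bad_blocks[OF gc, where d=6 and n=13 and s="R / 2" and m=R])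
    fix v assume "\<not> ?b v"
    then show "C v \<subseteq> boolean_model N r"
      using cc(2) by (simp add: C_def sphere_covered[OF N m r])
  next
    fix v p assume p: "p \<in> C v"
    then have nb: "\<not> ?b v" by (auto simp: C_def)
    let ?x = "grid_corner (R / 2 / q) (cc v)"
    have "norm (?x - p) = R" using p nb by (simp add: C_def dist_norm)
    then have "?x $ 1 - R \<le> p $ 1" using component_le_norm_cart[of "?x - p" 1] by simp
    moreover have "R / 2 * of_int (fst v) \<le> ?x $ 1" using corner[OF nb]
        by (simp add: grid_square_def)
    ultimately show "R / 2 * of_int (fst v) - R \<le> p $ 1" by simp
  qed (use R good in auto)
qed

section \<open>The probability of uncovered squares\<close>

lemma void_sets:
  fixes f :: "'a \<Rightarrow> ennreal"
  assumes [measurable]: "f \<in> borel_measurable M"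
  shows "{x \<in> space M. f x = 0} \<in> sets M"
  by measurable

text \<open>In an uncovered square every candidate corner fails, in particular the corner of the
  cell that holds a centre. So the number of cells does not enter the bound; only the m boxes around
  this corner do.\<close>

lemma prob_uncovered_kernel:
  assumes poi: "poisson_process (annular_intensity R (r / 2) \<mu> N) K" and N: "N \<in> counting_measures"
    and R: "0 < r" "r / 2 \<le> R" "0 < \<mu>" and q: "0 < q" "8 * R \<le> r * q"
    and S: "finite S" "pairwise (far 6) S" and hit: "\<And>u. u \<in> S \<Longrightarrow>
        emeasure N (grid_square (R / 2) u) \<noteq> 0"
  shows "emeasure K {\<Phi> \<in> space K. \<forall>u\<in>S. uncovered_square R r m q \<Phi> u} \<le>
    ennreal ((real m * exp (- (\<mu> * r / (64 * R)))) ^ card S)"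
proof -
  interpret K: prob_space K using poi by (simp add: poisson_process_def point_process_def)
  define \<Lambda> where "\<Lambda> = annular_intensity R (r / 2) \<mu> N"
  have poi': "poisson_process \<Lambda> K" using poi by (simp add: \<Lambda>_def)
  define \<kappa> where "\<kappa> = \<mu> * r / (64 * R)"
  have R0: "0 < R" using R by simp
  define \<delta> where "\<delta> = r / 2"
  have \<delta>: "0 < \<delta>" "\<delta> \<le> R" using R by (auto simp: \<delta>_def)
  let ?v = "annulus_area R \<delta>"
  have v: "0 < ?v" by (rule emeasure_annulus(2)[OF \<delta>])
  have v_le: "?v \<le> 2 * pi * R * \<delta>"
    using \<delta> by (simp add: annulus_area_def power2_eq_square algebra_simps)
  have \<Lambda>: "\<Lambda> = density lborel (\<lambda>y. ennreal (annular_density R \<delta> \<mu> N y))"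
    unfolding \<Lambda>_def \<delta>_def[symmetric] using \<delta> R by (intro annular_intensity_eq_density N) auto
  have "\<exists>c. c \<in> subsites (int q) u \<and> emeasure N (grid_square (R / 2 / q) c) \<noteq> 0" if u: "u \<in> S" for u
  proof -
    obtain y where y: "y \<in> grid_square (R / 2) u" "y \<in> atoms N"
      using atom_exists[OF N grid_square_sets bounded_grid_square hit[OF u]] by blast
    obtain c where c: "c \<in> subsites (int q) u" "y \<in> grid_square (R / 2 / q) c"
      using grid_square_cell[OF y(1) q(1)] R0 by auto
    have "emeasure N {y} \<le> emeasure N (grid_square (R / 2 / q) c)"
      using c(2) counting_measuresD(1)[OF N] by (intro emeasure_mono) auto
    then show ?thesis using y(2) c(1) by (intro exI[of _ c]) (auto simp: atoms_def)
  qed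
  then obtain c where c: "\<And>u. u \<in> S \<Longrightarrow> c u \<in> subsites (int q) u"
    "\<And>u. u \<in> S \<Longrightarrow> emeasure N (grid_square (R / 2 / q) (c u)) \<noteq> 0" by metis
  define x where "x u = grid_corner (R / 2 / q) (c u)" for u
  have box_meas: "ennreal \<kappa> \<le> emeasure \<Lambda> (annulus_box R \<delta> m (x u) l)" if u: "u \<in> S" for u l
  proof -
    obtain y where y: "y \<in> grid_square (R / 2 / q) (c u)" "y \<in> atoms N"
      using atom_exists[OF N grid_square_sets bounded_grid_square c(2)[OF u]] by blast
    have "dist y (x u) \<le> 2 * (R / 2 / q)" unfolding x_def by (rule grid_corner_near[OF y(1)])
    also have "\<dots> \<le> \<delta> / 4" using q by (simp add: \<delta>_def field_simps)
    finally have yx: "dist y (x u) \<le> \<delta> / 4" .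
    have dens: "\<mu> / ?v \<le> annular_density R \<delta> \<mu> N p" if "p \<in> annulus_box R \<delta> m (x u) l" for p
    proof -
      have "y \<in> annulus R \<delta> p" using annulus_box_in_annulus[OF that \<delta> yx] mem_annulus_commute
          by blast
      then have "emeasure N {y} \<le> emeasure N (annulus R \<delta> p)"
        using counting_measuresD(1)[OF N] by (intro emeasure_mono) auto
      then have "emeasure N (annulus R \<delta> p) \<noteq> 0" using y(2) by (auto simp: atoms_def)
      then have 1: "1 \<le> emeasure N (annulus R \<delta> p)"
        by (rule counting_measuresD(5)[OF N annulus_sets bounded_annulus])
      have "emeasure N (annulus R \<delta> p) = ennreal (measure N (annulus R \<delta> p))"
        using counting_measuresD(3)[OF N annulus_sets bounded_annulus, of R \<delta> p]
        by (simp add: emeasure_eq_ennreal_measure less_top)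
      then have "1 \<le> measure N (annulus R \<delta> p)" using 1
          by (simp add: ennreal_1[symmetric] del: ennreal_1)
      then show ?thesis unfolding annular_density_def
        using mult_left_mono[of 1 "measure N (annulus R \<delta> p)" "\<mu> / ?v"] v R by simp
    qed
    have md: "annular_density R \<delta> \<mu> N \<in> borel_measurable borel"
      using measurable_compose_Pair1[OF _ measurable_annular_density, of N R \<delta> \<mu>] N by simp
    \<comment> \<open>A single centre already gives the density \<mu> / ?v on the box; further
      centres only add to it. With ?v at most 2 * pi * R * \<delta> and box area pi * (\<delta> /
      4)^2 the mass is at least \<mu> * \<delta> / (32 * R), and \<delta> = r / 2.\<close>
    have "\<kappa> \<le> \<mu> / ?v * (pi * (\<delta> / 4)\<^sup>2)"
    proof -
      have "\<mu> * r / (64 * R) = \<mu> / (2 * pi * R * \<delta>) * (pi * (\<delta> / 4)\<^sup>2)"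
        using R R0 by (simp add: \<delta>_def power2_eq_square field_simps)
      also have "\<dots> \<le> \<mu> / ?v * (pi * (\<delta> / 4)\<^sup>2)"
        using v v_le R R0 \<delta> by (intro mult_right_mono divide_left_mono mult_pos_pos) auto
      finally show ?thesis by (simp add: \<kappa>_def)
    qed
    then have "ennreal \<kappa> \<le> ennreal (\<mu> / ?v) * ennreal (pi * (\<delta> / 4)\<^sup>2)"
      using v R by (simp add: ennreal_mult[symmetric] ennreal_leI)
    also have "ennreal (pi * (\<delta> / 4)\<^sup>2) = emeasure lborel (annulus_box R \<delta> m (x u) l)"
      using \<delta> by (simp add: annulus_box_def emeasure_cball unit_ball_vol_2)
    also have "ennreal (\<mu> / ?v) * \<dots> = (\<integral>\<^sup>+p. ennreal (\<mu> / ?v) *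
        indicator (annulus_box R \<delta> m (x u) l) p \<partial>lborel)"
      by (simp add: nn_integral_cmult_indicator)
    also have "\<dots> \<le> (\<integral>\<^sup>+p. ennreal (annular_density R \<delta> \<mu> N p) *
        indicator (annulus_box R \<delta> m (x u) l) p \<partial>lborel)"
      using dens by (intro nn_integral_mono) (auto simp: indicator_def intro!: ennreal_leI)
    also have "\<dots> = emeasure \<Lambda> (annulus_box R \<delta> m (x u) l)"
      unfolding \<Lambda> using md by (subst emeasure_density) auto
    finally show ?thesis .
  qed
  \<comment> \<open>The corners are at least 5 * R / 2 apart, while a common point would be at
    distance less than R from both.\<close>
  have disj: "annulus_box R \<delta> m (x u) l \<inter> annulus_box R \<delta> m (x u') l' = {}" if "u \<in> S" "u' \<in> S"
      "u \<noteq> u'" for u u' l l'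
  proof (rule ccontr)
    assume "\<not> ?thesis"
    then obtain p where p: "p \<in> annulus_box R \<delta> m (x u) l" "p \<in> annulus_box R \<delta> m (x u') l'"
        by blast
    have "x u \<in> grid_square (R / 2) u" "x u' \<in> grid_square (R / 2) u'"
      unfolding x_def using grid_corner_in[OF c(1) q(1), of _ "R / 2"] that R0 by simp_all
    moreover have "far 6 u u'" using S(2) that by (simp add: pairwise_def)
    ultimately have "R / 2 * of_int (6 - 1) \<le> dist (x u) (x u')" using R0
        by (intro far_grid_squares) auto
    moreover have "dist (x u) (x u') \<le> dist (x u) p + dist (x u') p"
        by (metis dist_commute dist_triangle)
    ultimately show False using annulus_box_dist(2)[OF p(1) \<delta>] annulus_box_dist(2)[OF p(2) \<delta>] \<delta>
        by simp
  qed
  let ?G = "PiE S (\<lambda>_. {..<m})"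
  \<comment> \<open>The function g names one empty box per square, which leaves m ^ card S
    possibilities. For fixed g the boxes are jointly empty iff their union is, so one void
    probability replaces the independence.\<close>
  define V where "V g = (\<Union>u\<in>S. annulus_box R \<delta> m (x u) (g u))" for g
  have V: "V g \<in> sets borel" "bounded (V g)" for g
    using S(1) by (auto simp: V_def bounded_annulus_box intro!: sets.finite_UN)
  have sub: "{\<Phi> \<in> space K. \<forall>u\<in>S. uncovered_square R r m q \<Phi> u} \<subseteq> (\<Union>g\<in>?G. {\<Phi> \<in> space K.
      emeasure \<Phi> (V g) = 0})"
  proof
    fix \<Phi> assume "\<Phi> \<in> {\<Phi> \<in> space K. \<forall>u\<in>S. uncovered_square R r m q \<Phi> u}"
    then have \<Phi>: "\<Phi> \<in> space K" "\<And>u. u \<in> S \<Longrightarrow> uncovered_square R r m q \<Phi> u" by auto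
    have "\<forall>u\<in>S. \<exists>l. l < m \<and> emeasure \<Phi> (annulus_box R \<delta> m (x u) l) = 0"
    proof
      fix u assume u: "u \<in> S"
      show "\<exists>l. l < m \<and> emeasure \<Phi> (annulus_box R \<delta> m (x u) l) = 0"
        using \<Phi>(2)[OF u, unfolded uncovered_square_def, rule_format, OF c(1)[OF u]]
            by (simp add: x_def \<delta>_def)
    qed
    from bchoice[OF this] obtain g where g: "\<forall>u\<in>S. g u < m \<and>
        emeasure \<Phi> (annulus_box R \<delta> m (x u) (g u)) = 0" by blast
    have s\<Phi>: "sets \<Phi> = sets borel" using \<Phi>(1) counting_measuresD(1) poisson_process_sets(2)[OF
        poi'] by blast
    have "(\<Union>u\<in>S. annulus_box R \<delta> m (x u) (restrict g S u)) \<in> null_sets \<Phi>"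
      using g S(1) by (intro null_sets_UN' countable_finite) (simp_all add: s\<Phi> null_sets_def)
    then have "emeasure \<Phi> (\<Union>u\<in>S. annulus_box R \<delta> m (x u) (restrict g S u)) = 0" by auto
    moreover have "restrict g S \<in> ?G" using g by auto
    ultimately show "\<Phi> \<in> (\<Union>g\<in>?G. {\<Phi> \<in> space K. emeasure \<Phi> (V g) = 0})"
      using \<Phi>(1) by (intro UN_I[of "restrict g S"]) (simp_all add: V_def)
  qed
  have Vm: "{\<Phi> \<in> space K. emeasure \<Phi> (V g) = 0} \<in> sets K" for g
    by (rule void_sets[OF measurable_emeasure_poisson[OF poi' V(1)]])
  have each: "emeasure K {\<Phi> \<in> space K. emeasure \<Phi> (V g) = 0} \<le> ennreal (exp (- \<kappa>) ^ card S)" for g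
  proof -
    have \<Lambda>fin: "emeasure \<Lambda> (V g) < \<infinity>" using poi' V by (simp add: poisson_process_def)
    have "(\<Sum>u\<in>S. ennreal \<kappa>) \<le> (\<Sum>u\<in>S. emeasure \<Lambda> (annulus_box R \<delta> m (x u) (g u)))"
      by (intro sum_mono box_meas)
    also have "\<dots> = emeasure \<Lambda> (V g)" unfolding V_def
    proof (rule sum_emeasure)
      show "disjoint_family_on (\<lambda>u. annulus_box R \<delta> m (x u) (g u)) S"
        unfolding disjoint_family_on_def using disj by blast
    qed (use S(1) in \<open>auto simp: \<Lambda>\<close>)
    also have "\<dots> = ennreal (measure \<Lambda> (V g))" using \<Lambda>fin
        by (simp add: emeasure_eq_ennreal_measure less_top)
    finally have "card S * \<kappa> \<le> measure \<Lambda> (V g)"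
      using R R0 by (simp add: \<kappa>_def ennreal_of_nat_eq_real_of_nat ennreal_mult[symmetric])
    then have "exp (- measure \<Lambda> (V g)) \<le> exp (- (card S * \<kappa>))" by simp
    also have "\<dots> = exp (- \<kappa>) ^ card S" by (simp add: exp_of_nat_mult[symmetric])
    finally show ?thesis using poisson_process_void[OF poi' V] by (simp add: ennreal_leI)
  qed
  have "emeasure K {\<Phi> \<in> space K. \<forall>u\<in>S. uncovered_square R r m q \<Phi> u} \<le>
      emeasure K (\<Union>g\<in>?G. {\<Phi> \<in> space K. emeasure \<Phi> (V g) = 0})"
    using sub Vm S(1) by (intro emeasure_mono sets.finite_UN finite_PiE) auto
  also have "\<dots> \<le> (\<Sum>g\<in>?G. emeasure K {\<Phi> \<in> space K. emeasure \<Phi> (V g) = 0})"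
    using Vm S(1) by (intro emeasure_subadditive_finite finite_PiE) auto
  also have "\<dots> \<le> (\<Sum>g\<in>?G. ennreal (exp (- \<kappa>) ^ card S))" by (intro sum_mono each)
  also have "\<dots> = of_nat (card ?G) * ennreal (exp (- \<kappa>) ^ card S)" by simp
  also have "card ?G = m ^ card S" using S(1) by (simp add: card_PiE)
  also have "of_nat (m ^ card S) * ennreal (exp (- \<kappa>) ^ card S) =
      ennreal ((real m * exp (- \<kappa>)) ^ card S)"
    by (simp add: ennreal_of_nat_eq_real_of_nat ennreal_mult[symmetric] power_mult_distrib)
  finally show ?thesis by (simp add: \<kappa>_def)
qed

lemma uncovered_square_measurable:
  "{\<Phi> \<in> counting_measures. uncovered_square R r m q \<Phi> u} \<in> sets counting_space"
proof -
  let ?B = "\<lambda>c l. annulus_box R (r / 2) m (grid_corner (R / 2 / q) c) l"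
  have 1: "{\<Phi> \<in> space counting_space. emeasure \<Phi> (?B c l) = 0} \<in> sets counting_space" for c l
    by (rule void_sets[OF measurable_emeasure_counting[OF measurable_ident_sets[OF refl]
        annulus_box_sets]])
  have 2: "{\<Phi> \<in> space counting_space. \<exists>l\<in>{..<m}. emeasure \<Phi> (?B c l) =
      0} \<in> sets counting_space" for c
    by (rule sets.sets_Collect_finite_Ex[OF 1 finite_lessThan])
  have "{\<Phi> \<in> space counting_space. \<forall>c\<in>subsites (int q) u. \<exists>l\<in>{..<m}. emeasure \<Phi> (?B c l) =
      0} \<in> sets counting_space"
    by (rule sets.sets_Collect_finite_All[OF 2 finite_subsites])
  then show ?thesis by (simp only: uncovered_square_def Bex_def lessThan_iff space_counting_space)
qed

text \<open>The product of the indicators is the void indicator of the union of the squares, whose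
  area is additive.\<close>

lemma prob_no_centres:
  assumes poi: "poisson_process (scale_measure (ennreal \<alpha>) lborel) C" and \<alpha>: "0 < \<alpha>"
      and s: "0 < s" and T: "finite T"
  shows "(\<integral>\<^sup>+N. (\<Prod>u\<in>T. indicator {N. emeasure N (grid_square s u) = 0} N) \<partial>C) =
      ennreal (exp (- (\<alpha> * s\<^sup>2)) ^ card T)"
proof -
  define U where "U = (\<Union>u\<in>T. grid_square s u)"
  have U: "U \<in> sets borel" "bounded U" using T
      by (auto simp: U_def bounded_grid_square intro!: sets.finite_UN)
  have disj: "disjoint_family_on (grid_square s) T"
  proof -
    have "u = v" if "y \<in> grid_square s u" "y \<in> grid_square s v" for y u v
    proof -
      have key: "i = j" if "s * of_int i \<le> t" "t < s * of_int (i + 1)" "s * of_int j \<le>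
          t" "t < s * of_int (j + 1)" for i j t
      proof -
        have "s * of_int i < s * of_int (j + 1)" "s * of_int j < s * of_int (i + 1)" using that
            by linarith+
        then have "of_int i < (of_int (j + 1) :: real)" "of_int j < (of_int (i + 1) :: real)"
          by (simp_all only: mult_less_cancel_left_pos[OF s])
        then show ?thesis by linarith
      qed
      show ?thesis using that key[of "fst u" "y $ 1" "fst v"] key[of "snd u" "y $ 2" "snd v"]
        by (simp add: grid_square_def prod_eq_iff)
    qed
    then show ?thesis unfolding disjoint_family_on_def by blast
  qed
  have "emeasure lborel U = (\<Sum>u\<in>T. emeasure lborel (grid_square s u))"
    unfolding U_def using T disj by (intro sum_emeasure[symmetric]) auto
  also have "\<dots> = ennreal (card T * s\<^sup>2)"
    using s by (simp add: emeasure_grid_square ennreal_of_nat_eq_real_of_nat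
        ennreal_mult[symmetric])
  finally have "measure (scale_measure (ennreal \<alpha>) lborel) U = \<alpha> * (card T * s\<^sup>2)"
    using \<alpha> by (simp add: measure_def enn2real_mult)
  then have *: "emeasure C {N \<in> space C. emeasure N U = 0} = ennreal (exp (- (\<alpha> * s\<^sup>2)) ^ card T)"
    using poisson_process_void[OF poi U] by (simp add: exp_of_nat_mult[symmetric] mult_ac)
  have "(\<integral>\<^sup>+N. (\<Prod>u\<in>T. indicator {N. emeasure N (grid_square s u) = 0} N) \<partial>C) =
      (\<integral>\<^sup>+N. indicator {N \<in> space C. emeasure N U = 0} N \<partial>C)"
  proof (rule nn_integral_cong)
    fix N assume N: "N \<in> space C"
    then have sN: "sets N = sets borel" using poisson_process_sets(2)[OF poi]
        counting_measuresD(1) by blast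
    have iff: "emeasure N U = 0 \<longleftrightarrow> (\<forall>u\<in>T. emeasure N (grid_square s u) = 0)"
    proof
      assume U0: "emeasure N U = 0"
      show "\<forall>u\<in>T. emeasure N (grid_square s u) = 0"
      proof
        fix u assume "u \<in> T"
        then have "grid_square s u \<subseteq> U" by (auto simp: U_def)
        then show "emeasure N (grid_square s u) = 0" using U0 U sN by (metis emeasure_eq_0)
      qed
    next
      assume "\<forall>u\<in>T. emeasure N (grid_square s u) = 0"
      then have "U \<in> null_sets N" unfolding U_def using T sN
        by (intro null_sets_UN' countable_finite) (simp_all add: null_sets_def)
      then show "emeasure N U = 0" by auto
    qed
    show "(\<Prod>u\<in>T. indicator {N. emeasure N (grid_square s u) = 0} N) =
        (indicator {N \<in> space C. emeasure N U = 0} N :: ennreal)"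
    proof (cases "emeasure N U = 0")
      case True
      then have "(\<Prod>u\<in>T. indicator {N. emeasure N (grid_square s u) = 0} N) = (1 :: ennreal)"
        using iff by (intro prod.neutral) auto
      then show ?thesis using True N by simp
    next
      case False
      then obtain u where "u \<in> T" "emeasure N (grid_square s u) \<noteq> 0" using iff by blast
      then have "(\<Prod>u\<in>T. indicator {N. emeasure N (grid_square s u) = 0} N) = (0 :: ennreal)"
        by (intro prod_zero[OF T] bexI[of _ u]) simp_all
      then show ?thesis using False by simp
    qed
  qed
  also have "\<dots> = emeasure C {N \<in> space C. emeasure N U = 0}"
    by (rule nn_integral_indicator[OF void_sets[OF measurable_emeasure_poisson[OF poi U(1)]]])
  finally show ?thesis using * by simp
qed

text \<open>A square is uncovered because it has no centre or although it has one. Conditionally on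
  the centres, the first possibility is an indicator and the second costs a factor \<epsilon>; the
  two errors add up in every factor of the product.\<close>

lemma prob_uncovered:
  assumes P: "annular_cluster_process \<alpha> R (r / 2) \<mu> P"
    and R: "0 < \<alpha>" "0 < r" "r / 2 \<le> R" "0 < \<mu>" and q: "0 < q" "8 * R \<le> r * q"
    and S: "finite S" "pairwise (far 6) S"
  shows "measure P {\<Phi> \<in> space P. \<forall>u\<in>S. uncovered_square R r m q \<Phi> u} \<le>
    (exp (- (\<alpha> * (R / 2)\<^sup>2)) + real m * exp (- (\<mu> * r / (64 * R)))) ^ card S"
proof -
  define \<epsilon> where "\<epsilon> = real m * exp (- (\<mu> * r / (64 * R)))"
  have \<epsilon>: "0 \<le> \<epsilon>" by (simp add: \<epsilon>_def)
  have R0: "0 < R" using R by simp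
  obtain C where C: "homogeneous_poisson \<alpha> C"
      and cox: "cox_process C (annular_intensity R (r / 2) \<mu>) P"
    using P unfolding annular_cluster_process_def by blast
  then obtain K where K: "prob_space C" "K \<in> measurable C (prob_algebra counting_space)" "P = C \<bind> K"
    and poiK: "AE N in C. poisson_process (annular_intensity R (r / 2) \<mu> N) (K N)"
    unfolding cox_process_def by blast
  interpret C: prob_space C by (rule K(1))
  have poi: "poisson_process (scale_measure (ennreal \<alpha>) lborel) C" using C
      by (simp add: homogeneous_poisson_def)
  have sC: "sets C = sets counting_space" "space C = counting_measures"
      by (rule poisson_process_sets[OF poi])+
  have sP: "sets P = sets counting_space" "prob_space P"
    using cox_process_point_process[OF cox] by (auto simp: point_process_def)
  have spP: "space P = counting_measures" using sets_eq_imp_space_eq[OF sP(1)] by simp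
  let ?A = "{\<Phi> \<in> counting_measures. \<forall>u\<in>S. uncovered_square R r m q \<Phi> u}"
  let ?Z = "\<lambda>u N. indicator {N. emeasure N (grid_square (R / 2) u) = 0} N :: ennreal"
  have "{\<Phi> \<in> space counting_space. \<forall>u\<in>S. uncovered_square R r m q \<Phi> u} \<in> sets counting_space"
    using S(1) uncovered_square_measurable by (intro sets.sets_Collect_finite_All) simp_all
  then have A: "?A \<in> sets counting_space" by simp
  have Zm: "?Z u \<in> borel_measurable C" for u
  proof -
    have "{N \<in> space C. emeasure N (grid_square (R / 2) u) = 0} \<in> sets C"
      by (rule void_sets[OF measurable_emeasure_poisson[OF poi grid_square_sets]])
    then have "(indicator {N \<in> space C. emeasure N (grid_square (R / 2) u) =
        0} :: _ \<Rightarrow> ennreal) \<in> borel_measurable C"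
      by (rule borel_measurable_indicator)
    then show ?thesis by (rule measurable_cong[THEN iffD1, rotated]) (simp add: indicator_def)
  qed
  have "emeasure P ?A = (\<integral>\<^sup>+N. emeasure (K N) ?A \<partial>C)"
    unfolding K(3) by (rule emeasure_bind[OF C.not_empty measurable_prob_algebraD[OF K(2)] A])
  also have "\<dots> \<le> (\<integral>\<^sup>+N. (\<Prod>u\<in>S. ?Z u N + ennreal \<epsilon>) \<partial>C)"
  proof (rule nn_integral_mono_AE)
    show "AE N in C. emeasure (K N) ?A \<le> (\<Prod>u\<in>S. ?Z u N + ennreal \<epsilon>)"
      using poiK AE_space
    proof eventually_elim
      fix N assume pk: "poisson_process (annular_intensity R (r / 2) \<mu> N) (K N)" and "N \<in> space C"
      then have N: "N \<in> counting_measures" using sC by simp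
      have spK: "space (K N) = counting_measures" "sets (K N) = sets counting_space"
          by (rule poisson_process_sets[OF pk])+
      \<comment> \<open>Squares without a centre are given up, their factor being at least 1. The
        conditional bound is applied to the others only.\<close>
      define S' where "S' = {u \<in> S. emeasure N (grid_square (R / 2) u) \<noteq> 0}"
      have S': "finite S'" "pairwise (far 6) S'" "S' \<subseteq> S" using S
          by (auto simp: S'_def intro: pairwise_subset)
      have "{\<Phi> \<in> space counting_space. \<forall>u\<in>S'. uncovered_square R r m q \<Phi> u} \<in> sets counting_space"
        using S'(1) uncovered_square_measurable by (intro sets.sets_Collect_finite_All) simp_all
      then have A': "{\<Phi> \<in> space (K N). \<forall>u\<in>S'. uncovered_square R r m q \<Phi> u} \<in> sets (K N)"
          using spK by simp
      have "emeasure (K N) ?A \<le> emeasure (K N) {\<Phi> \<in> space (K N). \<forall>u\<in>S'.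
          uncovered_square R r m q \<Phi> u}"
        using S'(3) spK by (intro emeasure_mono A') auto
      also have "\<dots> \<le> ennreal (\<epsilon> ^ card S')"
        unfolding \<epsilon>_def using R q S' by (intro prob_uncovered_kernel[OF pk N]) (auto simp: S'_def)
      also have "\<dots> = (\<Prod>u\<in>S'. ennreal \<epsilon>)" using \<epsilon> by (simp add: ennreal_power)
      also have "\<dots> \<le> (\<Prod>u\<in>S'. ?Z u N + ennreal \<epsilon>) * (\<Prod>u\<in>S - S'. ?Z u N + ennreal \<epsilon>)"
      proof -
        have "(\<Prod>u\<in>S'. ennreal \<epsilon>) * (\<Prod>u\<in>S - S'. 1) \<le> (\<Prod>u\<in>S'. ?Z u N + ennreal \<epsilon>) * (\<Prod>u\<in>S - S'.
            ?Z u N + ennreal \<epsilon>)"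
          by (intro mult_mono prod_mono) (auto simp: S'_def)
        then show ?thesis by simp
      qed
      also have "\<dots> = (\<Prod>u\<in>S. ?Z u N + ennreal \<epsilon>)"
        using S(1) S'(3) by (subst prod.subset_diff[of S' S]) (auto simp: mult.commute)
      finally show "emeasure (K N) ?A \<le> (\<Prod>u\<in>S. ?Z u N + ennreal \<epsilon>)" .
    qed
  qed
  \<comment> \<open>Expanding over the set T of squares without a centre leaves integrals that
    \<open>prob_no_centres\<close> evaluates; the same expansion read backwards restores a
    product.\<close>
  also have "\<dots> = (\<integral>\<^sup>+N. (\<Sum>T\<in>Pow S. (\<Prod>u\<in>T. ?Z u N) * (\<Prod>u\<in>S - T. ennreal \<epsilon>)) \<partial>C)"
    using S(1) by (simp add: prod_add)
  also have "\<dots> = (\<Sum>T\<in>Pow S. \<integral>\<^sup>+N. (\<Prod>u\<in>T. ?Z u N) * (\<Prod>u\<in>S - T. ennreal \<epsilon>) \<partial>C)"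
    using Zm by (intro nn_integral_sum borel_measurable_times_ennreal
        borel_measurable_prod_ennreal) auto
  also have "\<dots> = (\<Sum>T\<in>Pow S. (\<integral>\<^sup>+N. (\<Prod>u\<in>T. ?Z u N) \<partial>C) * (\<Prod>u\<in>S - T. ennreal \<epsilon>))"
    using Zm by (intro sum.cong refl nn_integral_multc borel_measurable_prod_ennreal) auto
  also have "\<dots> = (\<Sum>T\<in>Pow S. (\<Prod>u\<in>T. ennreal (exp (- (\<alpha> * (R / 2)\<^sup>2)))) * (\<Prod>u\<in>S - T. ennreal \<epsilon>))"
  proof (intro sum.cong refl)
    fix T assume "T \<in> Pow S"
    then have "finite T" using S(1) finite_subset by blast
    then show "(\<integral>\<^sup>+N. (\<Prod>u\<in>T. ?Z u N) \<partial>C) * (\<Prod>u\<in>S - T. ennreal \<epsilon>) =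
        (\<Prod>u\<in>T. ennreal (exp (- (\<alpha> * (R / 2)\<^sup>2)))) * (\<Prod>u\<in>S - T. ennreal \<epsilon>)"
      using R R0 by (subst prob_no_centres[OF poi]) (auto simp: ennreal_power)
  qed
  also have "\<dots> = (\<Prod>u\<in>S. ennreal (exp (- (\<alpha> * (R / 2)\<^sup>2))) + ennreal \<epsilon>)"
    by (rule prod_add[OF S(1), symmetric])
  also have "\<dots> = ennreal ((exp (- (\<alpha> * (R / 2)\<^sup>2)) + \<epsilon>) ^ card S)"
    using \<epsilon> by (simp add: ennreal_plus[symmetric] ennreal_power del: ennreal_plus)
  finally have "emeasure P ?A \<le> ennreal ((exp (- (\<alpha> * (R / 2)\<^sup>2)) + \<epsilon>) ^ card S)" .
  then have "measure P ?A \<le> (exp (- (\<alpha> * (R / 2)\<^sup>2)) + \<epsilon>) ^ card S"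
    unfolding measure_def using \<epsilon> by (intro enn2real_leI) auto
  then show ?thesis by (simp add: \<epsilon>_def spP)
qed

lemma critical_radius_le:
  assumes P: "point_process P" and "0 < measure P {N \<in> space P. percolates (boolean_model N r)}"
  shows "critical_radius P \<le> ereal r"
  unfolding critical_radius_def using assms(2) by (intro Inf_lower) auto

lemma annular_cluster_percolates:
  assumes P: "annular_cluster_process \<alpha> R (r / 2) \<mu> P"
    and R: "0 < \<alpha>" "0 < r" "r / 2 \<le> R" "0 < \<mu>" and m: "8 * pi * R \<le> r * real m" "0 < m"
    and small: "13 ^ 4 * (exp (- (\<alpha> * (R / 2)\<^sup>2)) + real m * exp (- (\<mu> * r / (64 * R)))) \<le> 1 / 2"
  shows "critical_radius P \<le> ereal r"
proof -
  \<comment> \<open>Cells so fine that a centre is within \<delta> / 4 = r / 8 of the corner of its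
    cell. As q does not occur in the bound, it may depend on R freely.\<close>
  define q where "q = Suc (nat \<lceil>8 * R / r\<rceil>)"
  have "8 * R / r \<le> real q" unfolding q_def by linarith
  then have q: "0 < q" "8 * R \<le> r * q" using R by (auto simp: q_def field_simps)
  have pp: "point_process P" using P cox_process_point_process
      unfolding annular_cluster_process_def by blast
  then interpret prob_space P by (simp add: point_process_def)
  have sP: "sets P = sets counting_space" using pp by (simp add: point_process_def)
  have spP: "space P = counting_measures" using sets_eq_imp_space_eq[OF sP] by simp
  let ?b = "uncovered_square R r m q"
  let ?E = "{N \<in> space P. \<forall>k. \<forall>w\<in>subsites 13 (0, 0). \<not> bad_block 13 6 (?b N) k w}"
  have "0 < prob ?E"
  proof (rule no_bad_blocks)
    show "{N \<in> space P. ?b N v} \<in> sets P" for v unfolding sP spP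
        by (rule uncovered_square_measurable)
    show "prob {N \<in> space P. \<forall>v\<in>S. ?b N v} \<le>
        (exp (- (\<alpha> * (R / 2)\<^sup>2)) + real m * exp (- (\<mu> * r / (64 * R)))) ^ card S"
      if "finite S" "pairwise (far 6) S" for S
      using that by (intro prob_uncovered[OF P R q])
    show "0 \<le> exp (- (\<alpha> * (R / 2)\<^sup>2)) + real m * exp (- (\<mu> * r / (64 * R)))" by simp
    show "of_int 13 ^ 4 * (exp (- (\<alpha> * (R / 2)\<^sup>2)) + real m * exp (- (\<mu> * r / (64 * R)))) \<le> 1 / 2"
      using small by (simp only: of_int_numeral)
  qed simp_all
  also have "prob ?E \<le> prob {N \<in> space P. percolates (boolean_model N r)}"
  proof (rule finite_measure_mono)
    show "?E \<subseteq> {N \<in> space P. percolates (boolean_model N r)}"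
    proof
      fix N assume "N \<in> ?E"
      then have *: "N \<in> space P \<and> (\<forall>k. \<forall>w\<in>subsites 13 (0, 0). \<not> bad_block 13 6 (?b N) k w)"
        by (rule CollectD)
      have "N \<in> space P" and nb: "\<forall>k. \<forall>w\<in>subsites 13 (0, 0). \<not> bad_block 13 6 (?b N) k w"
        by (rule conjunct1[OF *], rule conjunct2[OF *])
      then have N: "N \<in> counting_measures" by (simp only: spP)
      from percolates_of_squares[OF N m R(2,3) q(1) nb[rule_format]] N show "N \<in> {N \<in> space P.
          percolates (boolean_model N r)}"
        by (simp add: spP)
    qed
    show "{N \<in> space P. percolates (boolean_model N r)} \<in> sets P"
      unfolding sP spP using R by (intro percolates_measurable) auto
  qed
  finally show ?thesis by (rule critical_radius_le[OF pp])
qed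

theorem annular_clusters_small_critical_radius:
  fixes a r :: real
  assumes a: "0 < a" and r: "0 < r"
  shows "\<exists>\<alpha> \<mu> \<delta> R. 0 < \<alpha> \<and> 0 < \<mu> \<and> 0 < \<delta> \<and> 0 < R \<and> \<delta> \<le> R \<and> \<alpha> * \<mu> = a \<and>
    (\<exists>P. annular_cluster_process \<alpha> R \<delta> \<mu> P) \<and>
    (\<forall>P. annular_cluster_process \<alpha> R \<delta> \<mu> P \<longrightarrow>
       point_process P \<and> has_intensity P a \<and> critical_radius P \<le> ereal r)"
proof -
  \<comment> \<open>Half of the admissible error: no centre, and an empty box, may each contribute
    \<epsilon>, as 13 ^ 4 * (2 * \<epsilon>) = 1 / 2.\<close>
  define \<epsilon> :: real where "\<epsilon> = 1 / (4 * 13 ^ 4)"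
  have \<epsilon>: "0 < \<epsilon>" "\<epsilon> < 1" by (simp_all add: \<epsilon>_def)
  \<comment> \<open>With \<alpha> = c / R^2 a square of side R / 2 has - ln \<epsilon> centres in
    mean, so it has none with probability exactly \<epsilon>.\<close>
  define c where "c = - 4 * ln \<epsilon>"
  have c: "0 < c" using \<epsilon> by (simp add: c_def)
  \<comment> \<open>The mean number of points in a box is at least B * R, since \<mu> = a * R^2 /
    c.\<close>
  define B where "B = a * r / (64 * c)"
  have B: "0 < B" using a r c by (simp add: B_def)
  define A where "A = 8 * pi / r + 1"
  have A: "0 < A" using r by (simp add: A_def add_pos_pos)
  \<comment> \<open>The first bounds give \<delta> = r / 2 at most R and let (A + 1) * R dominate m;
    the last one comes from the estimate \<open>e2\<close> below.\<close>
  define R where "R = max (max 1 r) (2 * (A + 1) / (B\<^sup>2 * \<epsilon>))"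
  have R: "1 \<le> R" "r \<le> R" "2 * (A + 1) / (B\<^sup>2 * \<epsilon>) \<le> R" by (auto simp: R_def)
  define \<alpha> where "\<alpha> = c / R\<^sup>2"
  define \<mu> where "\<mu> = a / \<alpha>"
  have \<alpha>: "0 < \<alpha>" using c R by (simp add: \<alpha>_def)
  have \<mu>: "0 < \<mu>" "\<alpha> * \<mu> = a" using a \<alpha> by (simp_all add: \<mu>_def)
  define m where "m = Suc (nat \<lceil>8 * pi * R / r\<rceil>)"
  have m1: "8 * pi * R \<le> r * real m" "0 < m"
  proof -
    have "8 * pi * R / r \<le> real m" unfolding m_def by linarith
    then show "8 * pi * R \<le> r * real m" using r by (simp add: field_simps)
  qed (simp add: m_def)
  have mA: "real m \<le> (A + 1) * R"
  proof -
    have "0 \<le> 8 * pi * R / r" using R r by simp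
    then have "real m \<le> 8 * pi * R / r + 2" unfolding m_def by linarith
    also have "\<dots> \<le> (A + 1) * R" using R by (simp add: A_def algebra_simps)
    finally show ?thesis .
  qed
  have e1: "exp (- (\<alpha> * (R / 2)\<^sup>2)) = \<epsilon>"
  proof -
    have "\<alpha> * (R / 2)\<^sup>2 = c / 4" using R by (simp add: \<alpha>_def power2_eq_square)
    then show ?thesis using \<epsilon> by (simp add: c_def)
  qed
  have e2: "real m * exp (- (\<mu> * r / (64 * R))) \<le> \<epsilon>"
  proof -
    have BR: "\<mu> * r / (64 * R) = B * R" using R c
        by (simp add: \<mu>_def \<alpha>_def B_def power2_eq_square field_simps)
    have pos: "0 < B * R" using B R by simp
    \<comment> \<open>The quadratic Taylor bound suffices: m grows linearly in R, so m * exp (- (B *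
      R)) is of order 1 / R.\<close>
    have "(B * R)\<^sup>2 / 2 \<le> exp (B * R)"
      using exp_lower_Taylor_quadratic[of "B * R"] pos by simp
    then have "1 / exp (B * R) \<le> 1 / ((B * R)\<^sup>2 / 2)"
      using pos by (intro divide_left_mono mult_pos_pos zero_less_power) auto
    then have "exp (- (B * R)) \<le> 2 / (B * R)\<^sup>2" by (simp add: exp_minus inverse_eq_divide)
    then have "real m * exp (- (B * R)) \<le> ((A + 1) * R) * (2 / (B * R)\<^sup>2)"
      using mA by (intro mult_mono) auto
    also have "\<dots> = 2 * (A + 1) / B\<^sup>2 / R" using R by (simp add: power2_eq_square mult_ac)
    also have "\<dots> \<le> \<epsilon>" using R(1,3) B \<epsilon> by (simp add: field_simps)
    finally show ?thesis by (simp add: BR)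
  qed
  have small: "13 ^ 4 * (exp (- (\<alpha> * (R / 2)\<^sup>2)) + real m * exp (- (\<mu> * r / (64 * R)))) \<le> 1 / 2"
    using e1 e2 by (simp add: \<epsilon>_def)
  have "point_process P \<and> has_intensity P a \<and> critical_radius P \<le> ereal r"
    if P: "annular_cluster_process \<alpha> R (r / 2) \<mu> P" for P
  proof (intro conjI)
    obtain C where "cox_process C (annular_intensity R (r / 2) \<mu>) P"
      using P unfolding annular_cluster_process_def by blast
    then show "point_process P" by (rule cox_process_point_process)
    show "has_intensity P a" using annular_cluster_process_intensity[OF _ _ \<mu>(1) \<alpha> P] R r \<mu> by simp
    show "critical_radius P \<le> ereal r"
      using R r by (intro annular_cluster_percolates[OF P \<alpha> r _ \<mu>(1) m1 small]) simp
  qed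
  moreover have "\<exists>P. annular_cluster_process \<alpha> R (r / 2) \<mu> P"
    using R r \<alpha> \<mu> by (intro annular_cluster_process_exists) auto
  ultimately show ?thesis
    using R r \<alpha> \<mu> by (intro exI[of _ \<alpha>] exI[of _ \<mu>] exI[of _ "r / 2"] exI[of _ R]) simp
qed

section \<open>Directionally convex comparison\<close>

lemma pmf_nat_eqI_pgf:
  fixes p q :: "nat pmf"
  assumes "\<And>z::real. 0 < z \<Longrightarrow> z < 1 \<Longrightarrow> (\<integral>\<^sup>+k. ennreal z ^ k \<partial>measure_pmf p) =
      (\<integral>\<^sup>+k. ennreal z ^ k \<partial>measure_pmf q)"
  shows "p = q"
  unfolding measure_pmf_inject[symmetric]
  by (rule measure_eqI_pgf) (use assms in \<open>auto
      intro: prob_space.finite_measure measure_pmf.prob_space_axioms\<close>)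

lemma pois_add:
  assumes "0 \<le> a" "0 \<le> b"
  shows "pois (a + b) = bind_pmf (pois a) (\<lambda>k. bind_pmf (pois b) (\<lambda>j. return_pmf (k + j)))"
proof (rule pmf_nat_eqI_pgf)
  fix z :: real assume z: "0 < z" "z < 1"
  have "(\<integral>\<^sup>+k. ennreal z ^ k \<partial>measure_pmf (bind_pmf (pois a) (\<lambda>k. bind_pmf (pois b) (\<lambda>j.
      return_pmf (k + j))))) =
      (\<integral>\<^sup>+k. \<integral>\<^sup>+j. ennreal z ^ k * ennreal z ^ j \<partial>measure_pmf (pois b) \<partial>measure_pmf (pois a))"
    by (simp add: power_add)
  also have "\<dots> = ennreal (exp (- (a * (1 - z)))) * ennreal (exp (- (b * (1 - z))))"
    using assms z by (simp add: nn_integral_cmult nn_integral_multc pgf_pois)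
  also have "\<dots> = ennreal (exp (- ((a + b) * (1 - z))))"
    by (simp add: ennreal_mult[symmetric] exp_add[symmetric] algebra_simps)
  also have "\<dots> = (\<integral>\<^sup>+k. ennreal z ^ k \<partial>measure_pmf (pois (a + b)))"
    using assms z by (simp add: pgf_pois)
  finally show "(\<integral>\<^sup>+k. ennreal z ^ k \<partial>measure_pmf (pois (a + b))) =
    (\<integral>\<^sup>+k. ennreal z ^ k \<partial>measure_pmf (bind_pmf (pois a) (\<lambda>k. bind_pmf (pois b) (\<lambda>j.
        return_pmf (k + j)))))"
    by (rule sym)
qed

lemma nn_integral_binomial_Suc:
  assumes p: "0 \<le> p" "p \<le> 1"
  shows "(\<integral>\<^sup>+k. f k \<partial>measure_pmf (binomial_pmf (Suc n) p)) =
    ennreal p * (\<integral>\<^sup>+k. f (Suc k) \<partial>measure_pmf (binomial_pmf n p)) +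
    ennreal (1 - p) * (\<integral>\<^sup>+k. f k \<partial>measure_pmf (binomial_pmf n p))"
  using p by (simp add: binomial_pmf_Suc nn_integral_bernoulli_pmf mult.commute)

lemma pgf_binomial:
  assumes p: "0 \<le> p" "p \<le> 1" and z: "0 \<le> z"
  shows "(\<integral>\<^sup>+k. ennreal z ^ k \<partial>measure_pmf (binomial_pmf n p)) = ennreal (1 - p + p * z) ^ n"
proof (induction n)
  case 0
  then show ?case using p by (simp add: binomial_pmf_0)
next
  case (Suc n)
  have "ennreal p * ennreal z + ennreal (1 - p) = ennreal (1 - p + p * z)"
    using p z by (simp add: ennreal_mult[symmetric] ennreal_plus[symmetric] add.commute del:
        ennreal_plus)
  then show ?case using Suc
    by (simp add: nn_integral_binomial_Suc[OF p] nn_integral_cmult distrib_right[symmetric]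
        mult.assoc[symmetric])
qed

text \<open>The generating function of a binomial number of kept points is a power of 1 - p + p * z,
  and c / p * (1 - (1 - p + p * z)) = c * (1 - z).\<close>

lemma pois_thinning:
  assumes c: "0 \<le> c" and p: "0 < p" "p \<le> 1"
  shows "pois c = bind_pmf (pois (c / p)) (\<lambda>k. binomial_pmf k p)"
proof (rule pmf_nat_eqI_pgf)
  fix z :: real assume z: "0 < z" "z < 1"
  have pz: "0 \<le> 1 - p + p * z" "1 - p + p * z \<le> 1" using p z mult_left_le[of z p] by auto
  have "(\<integral>\<^sup>+k. ennreal z ^ k \<partial>measure_pmf (bind_pmf (pois (c / p)) (\<lambda>k. binomial_pmf k p))) =
      (\<integral>\<^sup>+k. ennreal (1 - p + p * z) ^ k \<partial>measure_pmf (pois (c / p)))"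
    using p z by (simp add: pgf_binomial)
  also have "\<dots> = ennreal (exp (- (c / p * (1 - (1 - p + p * z)))))"
    using c p pz by (intro pgf_pois) auto
  also have "c / p * (1 - (1 - p + p * z)) = c * (1 - z)" using p by (simp add: field_simps)
  also have "ennreal (exp (- (c * (1 - z)))) = (\<integral>\<^sup>+k. ennreal z ^ k \<partial>measure_pmf (pois c))"
    using c z by (simp add: pgf_pois)
  finally show "(\<integral>\<^sup>+k. ennreal z ^ k \<partial>measure_pmf (pois c)) =
    (\<integral>\<^sup>+k. ennreal z ^ k \<partial>measure_pmf (bind_pmf (pois (c / p)) (\<lambda>k. binomial_pmf k p)))"
        by (rule sym)
qed

text \<open>Directional convexity on vectors of natural numbers, for arbitrary nonnegative
  increments u and v instead of coordinate steps, and written as an inequality of sums since values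
  may be infinite.\<close>

definition lattice_dcx :: "(('i \<Rightarrow> nat) \<Rightarrow> ennreal) \<Rightarrow> bool" where
  "lattice_dcx F \<longleftrightarrow> (\<forall>x u v. F (\<lambda>i. x i + u i) + F (\<lambda>i. x i + v i) \<le> F x + F (\<lambda>i. x i + u i + v i))"

lemma lattice_dcxD:
  "lattice_dcx F \<Longrightarrow> F (\<lambda>i. x i + u i) + F (\<lambda>i. x i + v i) \<le> F x + F (\<lambda>i. x i + u i + v i)"
  by (simp add: lattice_dcx_def)

text \<open>Two independent switches against a single common one: the mixed outcomes B and C, each
  of weight P * Q, are traded for A and D. Everything is additive, as infinite values forbid
  subtraction, and P + Q = 1 is multiplied back in at the end.\<close>

lemma mixture_le:
  fixes A B C D P Q :: ennreal
  assumes "P + Q = 1" "B + C \<le> A + D"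
  shows "P * (P * A + Q * B) + Q * (P * C + Q * D) \<le> P * A + Q * D"
proof -
  have "P * (P * A + Q * B) + Q * (P * C + Q * D) = P * P * A + P * Q * (B + C) + Q * Q * D"
    by (simp add: algebra_simps)
  also have "\<dots> \<le> P * P * A + P * Q * (A + D) + Q * Q * D"
    by (rule add_right_mono, rule add_left_mono, rule mult_left_mono[OF assms(2)]) simp
  also have "\<dots> = (P + Q) * (P * A) + (P + Q) * (Q * D)" by (simp add: algebra_simps)
  finally show ?thesis using assms(1) by simp
qed

lemma ennreal_p_q: "0 \<le> p \<Longrightarrow> p \<le> 1 \<Longrightarrow> ennreal p + ennreal (1 - p) = 1"
  by (simp add: ennreal_plus[symmetric] del: ennreal_plus)

text \<open>Split off one trial and use the induction hypothesis from x and from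
  \<open>Suc x\<close>; the four resulting values are those of two independent switches, which
  \<open>mixture_le\<close> merges. In the convex order a binomial number lies below n times one
  Bernoulli switch.\<close>

lemma binomial_convex_le:
  fixes G :: "nat \<Rightarrow> ennreal"
  assumes p: "0 \<le> p" "p \<le> 1" and G: "\<And>a b c. G (a + b) + G (a + c) \<le> G a + G (a + b + c)"
  shows "(\<integral>\<^sup>+k. G (x + k) \<partial>measure_pmf (binomial_pmf n p)) \<le>
      ennreal p * G (x + n) + ennreal (1 - p) * G x"
proof (induction n arbitrary: x)
  case 0
  then show ?case using p ennreal_p_q[OF p] by (simp add: binomial_pmf_0 distrib_right[symmetric])
next
  case (Suc n)
  have "(\<integral>\<^sup>+k. G (x + k) \<partial>measure_pmf (binomial_pmf (Suc n) p)) =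
      ennreal p * (\<integral>\<^sup>+k. G (Suc x + k) \<partial>measure_pmf (binomial_pmf n p)) +
      ennreal (1 - p) * (\<integral>\<^sup>+k. G (x + k) \<partial>measure_pmf (binomial_pmf n p))"
    by (simp add: nn_integral_binomial_Suc[OF p])
  also have "\<dots> \<le> ennreal p * (ennreal p * G (x + Suc n) + ennreal (1 - p) * G (x + 1)) +
      ennreal (1 - p) * (ennreal p * G (x + n) + ennreal (1 - p) * G x)"
    using Suc.IH[of "Suc x"] Suc.IH[of x] by (intro add_mono mult_left_mono) auto
  also have "\<dots> \<le> ennreal p * G (x + Suc n) + ennreal (1 - p) * G x"
    using G[of x 1 n] by (intro mixture_le ennreal_p_q p) (simp add: add.commute)
  finally show ?case .
qed

text \<open>
  Keeping each of the points independently costs less than keeping all or none of them: this is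
  where the directional convexity enters.
\<close>

lemma thinning_le_comonotone:
  fixes F :: "('i \<Rightarrow> nat) \<Rightarrow> ennreal"
  assumes p: "0 \<le> p" "p \<le> 1" and F: "lattice_dcx F" and S: "finite S"
  shows "(\<integral>\<^sup>+z. F (\<lambda>i. x i + z i) \<partial>measure_pmf (Pi_pmf S 0 (\<lambda>i. binomial_pmf (y i) p))) \<le>
    ennreal p * F (\<lambda>i. x i + (if i \<in> S then y i else 0)) + ennreal (1 - p) * F x"
  using S
proof (induction S arbitrary: x)
  case empty
  then show ?case using ennreal_p_q[OF p] by (simp add: distrib_right[symmetric])
next
  case (insert j S)
  let ?e = "\<lambda>m i. if i = j then m else (0::nat)"
  let ?y = "\<lambda>i. if i \<in> S then y i else (0::nat)"
  \<comment> \<open>Along the single coordinate j, directional convexity is ordinary convexity, so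
    \<open>binomial_convex_le\<close> applies.\<close>
  have convex: "(\<integral>\<^sup>+m. F (\<lambda>i. x' i + ?e m i) \<partial>measure_pmf (binomial_pmf (y j) p)) \<le>
      ennreal p * F (\<lambda>i. x' i + ?e (y j) i) + ennreal (1 - p) * F x'" for x'
  proof -
    have "F (\<lambda>i. x' i + ?e (a + b) i) + F (\<lambda>i. x' i + ?e (a + c) i) \<le>
        F (\<lambda>i. x' i + ?e a i) + F (\<lambda>i. x' i + ?e (a + b + c) i)" for a b c
    proof -
      have eq: "(\<lambda>i. x' i + ?e (a + b) i) = (\<lambda>i. (x' i + ?e a i) + ?e b i)"
        "(\<lambda>i. x' i + ?e (a + c) i) = (\<lambda>i. (x' i + ?e a i) + ?e c i)"
        "(\<lambda>i. x' i + ?e (a + b + c) i) = (\<lambda>i. (x' i + ?e a i) + ?e b i + ?e c i)" by auto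
      show ?thesis unfolding eq by (rule lattice_dcxD[OF F])
    qed
    from binomial_convex_le[where G="\<lambda>m. F (\<lambda>i. x' i + ?e m i)" and x=0 and n="y j", OF p this]
    have "(\<integral>\<^sup>+m. F (\<lambda>i. x' i + ?e (0 + m) i) \<partial>measure_pmf (binomial_pmf (y j) p)) \<le>
      ennreal p * F (\<lambda>i. x' i + ?e (0 + y j) i) + ennreal (1 - p) * F (\<lambda>i. x' i + ?e 0 i)" .
    moreover have "(\<lambda>i. x' i + ?e 0 i) = x'" by auto
    ultimately show ?thesis by (simp only: add_0)
  qed
  have "(\<integral>\<^sup>+z. F (\<lambda>i. x i + z i) \<partial>measure_pmf (Pi_pmf (insert j S) 0 (\<lambda>i. binomial_pmf (y i) p))) =
      (\<integral>\<^sup>+m. \<integral>\<^sup>+z. F (\<lambda>i. x i + (z(j := m)) i) \<partial>measure_pmf (Pi_pmf S 0 (\<lambda>i.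
          binomial_pmf (y i) p)) \<partial>measure_pmf (binomial_pmf (y j) p))"
    using insert.hyps by (simp add: Pi_pmf_insert')
  also have "\<dots> = (\<integral>\<^sup>+m. \<integral>\<^sup>+z. F (\<lambda>i. (x i + ?e m i) + z i) \<partial>measure_pmf (Pi_pmf S 0 (\<lambda>i.
      binomial_pmf (y i) p)) \<partial>measure_pmf (binomial_pmf (y j) p))"
  proof (intro nn_integral_cong_AE AE_pmfI)
    fix m z assume "z \<in> set_pmf (Pi_pmf S 0 (\<lambda>i. binomial_pmf (y i) p))"
    then have "z \<in> {f. \<forall>i. i \<notin> S \<longrightarrow> f i = 0}" by (rule subsetD[OF set_Pi_pmf_subset[OF
        insert.hyps(1)]])
    then have "z j = 0" using insert.hyps(2) by simp
    then have "(\<lambda>i. x i + (z(j := m)) i) = (\<lambda>i. (x i + ?e m i) + z i)" by auto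
    then show "F (\<lambda>i. x i + (z(j := m)) i) = F (\<lambda>i. (x i + ?e m i) + z i)" by simp
  qed
  also have "\<dots> \<le> (\<integral>\<^sup>+m. ennreal p * F (\<lambda>i. (x i + ?e m i) + ?y i) + ennreal (1 - p) * F (\<lambda>i. x i +
      ?e m i) \<partial>measure_pmf (binomial_pmf (y j) p))"
    by (intro nn_integral_mono insert.IH)
  also have "\<dots> = ennreal p * (\<integral>\<^sup>+m. F (\<lambda>i. (x i + ?y i) +
      ?e m i) \<partial>measure_pmf (binomial_pmf (y j) p)) +
      ennreal (1 - p) * (\<integral>\<^sup>+m. F (\<lambda>i. x i + ?e m i) \<partial>measure_pmf (binomial_pmf (y j) p))"
    by (simp add: nn_integral_add nn_integral_cmult add_ac)
  also have "\<dots> \<le> ennreal p * (ennreal p * F (\<lambda>i. (x i + ?y i) + ?e (y j) i) + ennreal (1 - p) *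
      F (\<lambda>i. x i + ?y i)) +
      ennreal (1 - p) * (ennreal p * F (\<lambda>i. x i + ?e (y j) i) + ennreal (1 - p) * F x)"
    by (intro add_mono mult_left_mono convex) auto
  \<comment> \<open>So far the coordinate j and the coordinates in S have independent switches.
    Since F is directionally convex in the two increments, \<open>mixture_le\<close> replaces them
    by a common one.\<close>
  also have "\<dots> \<le> ennreal p * F (\<lambda>i. (x i + ?y i) + ?e (y j) i) + ennreal (1 - p) * F x"
    using lattice_dcxD[OF F, of x ?y "?e (y j)"]
        by (intro mixture_le ennreal_p_q p) (simp add: add.commute)
  also have "(\<lambda>i. (x i + ?y i) + ?e (y j) i) = (\<lambda>i. x i + (if i \<in> insert j S then y i else 0))"
    using insert.hyps by (auto simp: fun_eq_iff)
  finally show ?case .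
qed

definition pois_vector :: "nat \<Rightarrow> (nat \<Rightarrow> real) \<Rightarrow> (nat \<Rightarrow> nat) pmf" where
  "pois_vector n c = Pi_pmf {..<n} 0 (\<lambda>i. pois (c i))"

lemma set_pois_vector: "x \<in> set_pmf (pois_vector n c) \<Longrightarrow> n \<le> i \<Longrightarrow> x i = 0"
  using set_Pi_pmf_subset[of "{..<n}" 0 "\<lambda>i. pois (c i)"] by (auto simp: pois_vector_def)

lemma nn_integral_pois_vector_add:
  assumes "\<And>i. 0 \<le> v i" "\<And>i. 0 \<le> c i"
  shows "(\<integral>\<^sup>+x. F x \<partial>measure_pmf (pois_vector n (\<lambda>i. v i + c i))) =
    (\<integral>\<^sup>+x. \<integral>\<^sup>+y. F (\<lambda>i. x i + y i) \<partial>measure_pmf (pois_vector n c) \<partial>measure_pmf (pois_vector n v))"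
proof -
  have "pois_vector n (\<lambda>i. v i + c i) =
      Pi_pmf {..<n} 0 (\<lambda>i. bind_pmf (pois (v i)) (\<lambda>k. bind_pmf (pois (c i)) (\<lambda>j. return_pmf (k +
          j))))"
    using assms by (simp add: pois_vector_def pois_add)
  also have "\<dots> = bind_pmf (pois_vector n v) (\<lambda>x. Pi_pmf {..<n} 0 (\<lambda>i. bind_pmf (pois (c i)) (\<lambda>j.
      return_pmf (x i + j))))"
    unfolding pois_vector_def by (rule Pi_pmf_bind) simp
  also have "\<dots> = bind_pmf (pois_vector n v) (\<lambda>x. bind_pmf (pois_vector n c) (\<lambda>y.
      Pi_pmf {..<n} 0 (\<lambda>i. return_pmf (x i + y i))))"
    unfolding pois_vector_def by (intro bind_pmf_cong refl Pi_pmf_bind) simp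
  also have "\<dots> = bind_pmf (pois_vector n v) (\<lambda>x. bind_pmf (pois_vector n c) (\<lambda>y. return_pmf (\<lambda>i.
      x i + y i)))"
  proof (intro bind_pmf_cong refl)
    fix x y assume "x \<in> set_pmf (pois_vector n v)" "y \<in> set_pmf (pois_vector n c)"
    then have "(\<lambda>i. if i \<in> {..<n} then x i + y i else 0) = (\<lambda>i. x i + y i)"
      using set_pois_vector by (auto simp: fun_eq_iff)
    then show "Pi_pmf {..<n} 0 (\<lambda>i. return_pmf (x i + y i)) = return_pmf (\<lambda>i. x i + y i)"
      by (subst Pi_pmf_return_pmf) auto
  qed
  finally show ?thesis by simp
qed

lemma nn_integral_pois_vector_thinning:
  assumes "\<And>i. 0 \<le> c i" "0 < p" "p \<le> 1"
  shows "(\<integral>\<^sup>+x. F x \<partial>measure_pmf (pois_vector n c)) =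
    (\<integral>\<^sup>+y. \<integral>\<^sup>+z. F z \<partial>measure_pmf (Pi_pmf {..<n} 0 (\<lambda>i.
        binomial_pmf (y i) p)) \<partial>measure_pmf (pois_vector n (\<lambda>i. c i / p)))"
proof -
  have "pois_vector n c = Pi_pmf {..<n} 0 (\<lambda>i. bind_pmf (pois (c i / p)) (\<lambda>k. binomial_pmf k p))"
    unfolding pois_vector_def using pois_thinning[OF assms(1-3)] by simp
  also have "\<dots> = bind_pmf (pois_vector n (\<lambda>i. c i / p)) (\<lambda>y. Pi_pmf {..<n} 0 (\<lambda>i.
      binomial_pmf (y i) p))"
    unfolding pois_vector_def by (rule Pi_pmf_bind) simp
  finally show ?thesis by simp
qed

text \<open>Write the Poisson vector with mean c as a thinning of one with mean c / p, then pass
  from independent thinning to a common switch; the independent part with mean v is carried along by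
  superposition. This is the comparison for one strip, whose switch acts on all sets at
  once.\<close>

lemma pois_vector_mixture_le:
  assumes F: "lattice_dcx F" and v: "\<And>i. 0 \<le> v i" and c: "\<And>i. 0 \<le> c i" and p: "0 < p" "p \<le> 1"
  shows "(\<integral>\<^sup>+x. F x \<partial>measure_pmf (pois_vector n (\<lambda>i. v i + c i))) \<le>
    ennreal p * (\<integral>\<^sup>+x. F x \<partial>measure_pmf (pois_vector n (\<lambda>i. v i + c i / p))) +
    ennreal (1 - p) * (\<integral>\<^sup>+x. F x \<partial>measure_pmf (pois_vector n v))"
proof -
  let ?c = "\<lambda>i. c i / p"
  have "(\<integral>\<^sup>+x. F x \<partial>measure_pmf (pois_vector n (\<lambda>i. v i + c i))) =
      (\<integral>\<^sup>+x. \<integral>\<^sup>+y. \<integral>\<^sup>+z. F (\<lambda>i. x i + z i) \<partial>measure_pmf (Pi_pmf {..<n} 0 (\<lambda>i. binomial_pmf (y i) p))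
        \<partial>measure_pmf (pois_vector n ?c) \<partial>measure_pmf (pois_vector n v))"
    unfolding nn_integral_pois_vector_add[OF v c]
        by (subst nn_integral_pois_vector_thinning[OF c p]) simp
  also have "\<dots> \<le> (\<integral>\<^sup>+x. \<integral>\<^sup>+y. ennreal p * F (\<lambda>i. x i + y i) + ennreal (1 - p) * F x
        \<partial>measure_pmf (pois_vector n ?c) \<partial>measure_pmf (pois_vector n v))"
  proof (intro nn_integral_mono_AE AE_pmfI)
    fix x y assume "y \<in> set_pmf (pois_vector n ?c)"
    then have "(\<lambda>i. x i + (if i \<in> {..<n} then y i else 0)) = (\<lambda>i. x i + y i)"
      using set_pois_vector by (auto simp: fun_eq_iff)
    then show "(\<integral>\<^sup>+z. F (\<lambda>i. x i + z i) \<partial>measure_pmf (Pi_pmf {..<n} 0 (\<lambda>i. binomial_pmf (y i) p))) \<le>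
        ennreal p * F (\<lambda>i. x i + y i) + ennreal (1 - p) * F x"
      using thinning_le_comonotone[where S="{..<n}" and x=x and y=y and F=F and p=p] p F by simp
  qed
  also have "\<dots> = ennreal p * (\<integral>\<^sup>+x. \<integral>\<^sup>+y. F (\<lambda>i. x i +
      y i) \<partial>measure_pmf (pois_vector n ?c) \<partial>measure_pmf (pois_vector n v)) +
    ennreal (1 - p) * (\<integral>\<^sup>+x. F x \<partial>measure_pmf (pois_vector n v))"
    by (simp add: nn_integral_add nn_integral_cmult)
  also have "(\<integral>\<^sup>+x. \<integral>\<^sup>+y. F (\<lambda>i. x i + y i) \<partial>measure_pmf (pois_vector n ?c) \<partial>measure_pmf
      (pois_vector n v)) =
      (\<integral>\<^sup>+x. F x \<partial>measure_pmf (pois_vector n (\<lambda>i. v i + c i / p)))"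
    using v c p by (intro nn_integral_pois_vector_add[symmetric]) auto
  finally show ?thesis .
qed

text \<open>A finite product of two-point spaces is discrete, so every function on it may be
  integrated.\<close>

lemma measurable_PiM_bernoulli_finite:
  fixes h :: "('j \<Rightarrow> bool) \<Rightarrow> ennreal"
  assumes "finite I"
  shows "h \<in> borel_measurable (PiM I (\<lambda>j. measure_pmf (bernoulli_pmf (p j))))"
proof -
  have "sets (PiM I (\<lambda>j. measure_pmf (bernoulli_pmf (p j)))) =
      sets (PiM I (\<lambda>_. count_space (UNIV :: bool set)))"
    by (intro sets_PiM_cong) auto
  also have "PiM I (\<lambda>_. count_space (UNIV :: bool set)) = count_space (PiE I (\<lambda>_. UNIV))"
    using assms by (intro count_space_PiM_finite) auto
  finally have "sets (PiM I (\<lambda>j. measure_pmf (bernoulli_pmf (p j)))) =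
      sets (count_space (PiE I (\<lambda>_. UNIV :: bool set)))" .
  then show ?thesis by (rule measurable_cong_sets[OF _ refl, THEN equalityD2, THEN subsetD]) simp
qed

text \<open>The strips are randomized one at a time. The vector v holds the contribution of the
  strips outside J, and while j is randomized it is joined by the strips already randomized; so it
  has to be arbitrary in the induction.\<close>

lemma pois_vector_product_mixture_le:
  fixes c :: "'j \<Rightarrow> nat \<Rightarrow> real"
  assumes F: "lattice_dcx F" and v: "\<And>i. 0 \<le> v i" and c: "\<And>j i. 0 \<le> c j i" and p: "\<And>j. 0 < p j \<and>
      p j \<le> 1" and J: "finite J"
  shows "(\<integral>\<^sup>+x. F x \<partial>measure_pmf (pois_vector n (\<lambda>i. v i + (\<Sum>j\<in>J. c j i)))) \<le>
    (\<integral>\<^sup>+\<omega>. \<integral>\<^sup>+x. F x \<partial>measure_pmf (pois_vector n (\<lambda>i. v i + (\<Sum>j\<in>J. of_bool (\<omega> j) / p j * c j i)))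
      \<partial>PiM J (\<lambda>j. measure_pmf (bernoulli_pmf (p j))))"
  using J v
proof (induction J arbitrary: v)
  case empty
  then show ?case by (simp add: PiM_empty nn_integral_count_space_finite)
next
  case (insert j J)
  interpret product_sigma_finite "\<lambda>j. measure_pmf (bernoulli_pmf (p j))"
    by (intro product_sigma_finite.intro prob_space_imp_sigma_finite measure_pmf.prob_space_axioms)
  let ?\<Psi> = "\<lambda>u. \<integral>\<^sup>+x. F x \<partial>measure_pmf (pois_vector n u)"
  let ?s = "\<lambda>\<omega> i. \<Sum>j\<in>J. of_bool (\<omega> j) / p j * c j i"
  have s0: "0 \<le> ?s \<omega> i" for \<omega> i using c p by (intro sum_nonneg mult_nonneg_nonneg
      divide_nonneg_pos) auto
  have "?\<Psi> (\<lambda>i. v i + (\<Sum>k\<in>insert j J. c k i)) = ?\<Psi> (\<lambda>i. (v i + c j i) + (\<Sum>k\<in>J. c k i))"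
    using insert.hyps by (simp add: add.assoc)
  also have "\<dots> \<le> (\<integral>\<^sup>+\<omega>. ?\<Psi> (\<lambda>i. (v i + c j i) + ?s \<omega> i) \<partial>PiM J (\<lambda>j.
      measure_pmf (bernoulli_pmf (p j))))"
    using insert.prems c by (intro insert.IH) (simp add: add_nonneg_nonneg)
  also have "\<dots> \<le> (\<integral>\<^sup>+\<omega>. ennreal (p j) * ?\<Psi> (\<lambda>i. (v i + ?s \<omega> i) + c j i / p j) +
      ennreal (1 - p j) * ?\<Psi> (\<lambda>i. v i + ?s \<omega> i)
      \<partial>PiM J (\<lambda>j. measure_pmf (bernoulli_pmf (p j))))"
  proof (intro nn_integral_mono)
    fix \<omega>
    have "?\<Psi> (\<lambda>i. (v i + ?s \<omega> i) + c j i) \<le>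
        ennreal (p j) * ?\<Psi> (\<lambda>i. (v i + ?s \<omega> i) + c j i / p j) + ennreal (1 - p j) * ?\<Psi> (\<lambda>i. v i +
            ?s \<omega> i)"
      using insert.prems s0 c p by (intro pois_vector_mixture_le F) (auto intro: add_nonneg_nonneg)
    then show "?\<Psi> (\<lambda>i. (v i + c j i) + ?s \<omega> i) \<le>
        ennreal (p j) * ?\<Psi> (\<lambda>i. (v i + ?s \<omega> i) + c j i / p j) + ennreal (1 - p j) * ?\<Psi> (\<lambda>i. v i +
            ?s \<omega> i)"
      by (simp add: add_ac)
  qed
  also have "\<dots> = (\<integral>\<^sup>+\<omega>. \<integral>\<^sup>+b. ?\<Psi> (\<lambda>i. v i + (\<Sum>k\<in>insert j J. of_bool (fun_upd \<omega> j b k) / p k *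
      c k i))
      \<partial>measure_pmf (bernoulli_pmf (p j)) \<partial>PiM J (\<lambda>j. measure_pmf (bernoulli_pmf (p j))))"
  proof (intro nn_integral_cong)
    fix \<omega>
    have "(\<Sum>k\<in>insert j J. of_bool (fun_upd \<omega> j b k) / p k * c k i) =
        ?s \<omega> i + of_bool b * (c j i / p j)" for b i
    proof -
      have "(\<Sum>k\<in>J. of_bool (fun_upd \<omega> j b k) / p k * c k i) = ?s \<omega> i"
        using insert.hyps by (intro sum.cong) auto
      then show ?thesis using insert.hyps by (simp add: add.commute)
    qed
    then show "ennreal (p j) * ?\<Psi> (\<lambda>i. (v i + ?s \<omega> i) + c j i / p j) + ennreal (1 - p j) * ?\<Psi> (\<lambda>i.
        v i + ?s \<omega> i) =
      (\<integral>\<^sup>+b. ?\<Psi> (\<lambda>i. v i + (\<Sum>k\<in>insert j J. of_bool (fun_upd \<omega> j b k) / p k *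
          c k i)) \<partial>measure_pmf (bernoulli_pmf (p j)))"
      using p[of j] by (simp add: nn_integral_bernoulli_pmf mult.commute add.assoc)
  qed
  also have "\<dots> = (\<integral>\<^sup>+\<omega>. ?\<Psi> (\<lambda>i. v i + (\<Sum>k\<in>insert j J. of_bool (\<omega> k) / p k * c k i))
      \<partial>PiM (insert j J) (\<lambda>j. measure_pmf (bernoulli_pmf (p j))))"
    using insert.hyps by (intro product_nn_integral_insert[symmetric]
        measurable_PiM_bernoulli_finite) auto
  finally show ?case .
qed

section \<open>From directionally convex functions to functions of disjoint counts\<close>

definition nat_vector :: "nat \<Rightarrow> (nat \<Rightarrow> nat) \<Rightarrow> nat \<Rightarrow> real" where
  "nat_vector k m = (\<lambda>i\<in>{..<k}. real (m i))"

definition unit_mult :: "nat \<Rightarrow> nat \<Rightarrow> nat \<Rightarrow> nat" where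
  "unit_mult i d = (\<lambda>l. if l = i then d else 0)"

definition take_vector :: "nat \<Rightarrow> (nat \<Rightarrow> nat) \<Rightarrow> nat \<Rightarrow> nat" where
  "take_vector t v = (\<lambda>l. if l < t then v l else 0)"

lemma take_vector_Suc: "take_vector (Suc t) v = (\<lambda>l. take_vector t v l + unit_mult t (v t) l)"
  by (auto simp: take_vector_def unit_mult_def fun_eq_iff less_Suc_eq)

lemma take_vector_0: "take_vector 0 v = (\<lambda>l. 0)"
  by (simp add: take_vector_def)

lemma nat_vector_cong: "(\<And>i. i < k \<Longrightarrow> m i = m' i) \<Longrightarrow> nat_vector k m = nat_vector k m'"
  by (auto simp: nat_vector_def fun_eq_iff)

text \<open>Increments along coordinates are composed: first both increments are along one
  coordinate (\<open>pair\<close>), then one of them is built up coordinate by coordinate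
  (\<open>single\<close>), then the other as well (\<open>double\<close>). Each step
  telescopes.\<close>

lemma directionally_convex_lattice:
  assumes f: "directionally_convex k f"
  defines "h \<equiv> \<lambda>m. f (nat_vector k m)"
  shows "h (\<lambda>i. x i + u i) + h (\<lambda>i. x i + v i) \<le> h x + h (\<lambda>i. x i + u i + v i)"
proof -
  have pair: "h (\<lambda>l. x l + unit_mult i d l) + h (\<lambda>l. x l + unit_mult j e l) \<le>
      h x + h (\<lambda>l. x l + unit_mult i d l + unit_mult j e l)" if ij: "i < k" "j < k" for x i j d e
  \<comment> \<open>The definition speaks of strictly positive increments only; with a zero
    increment both sides agree.\<close>
  proof (cases "d = 0 \<or> e = 0")
    case True
    then show ?thesis by (auto simp: unit_mult_def)
  next
    case False
    have upd: "(nat_vector k y)(i := nat_vector k y i + real d) =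
        nat_vector k (\<lambda>l. y l + unit_mult i d l)"
      if "i < k" for y i d
      using that by (auto simp: nat_vector_def unit_mult_def fun_eq_iff)
    have "nat_vector k x \<in> {..<k} \<rightarrow>\<^sub>E UNIV" by (auto simp: nat_vector_def)
    then have "0 \<le> increment i (real d) (increment j (real e) f) (nat_vector k x)"
      using f ij False unfolding directionally_convex_def by simp
    then show ?thesis
      unfolding increment_def h_def by (simp add: upd ij)
  qed
  have single: "h (\<lambda>l. x l + unit_mult i d l) + h (\<lambda>l. x l + take_vector t v l) \<le>
      h x + h (\<lambda>l. x l + unit_mult i d l + take_vector t v l)" if "i < k" "t \<le> k" for x i d t
    using that(2)
  proof (induction t)
    case 0
    then show ?case by (simp add: take_vector_0)
  next
    case (Suc t)
    have "h (\<lambda>l. (x l + take_vector t v l) + unit_mult i d l) + h (\<lambda>l. (x l + take_vector t v l) +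
        unit_mult t (v t) l) \<le>
        h (\<lambda>l. x l + take_vector t v l) + h (\<lambda>l. (x l + take_vector t v l) + unit_mult i d l +
            unit_mult t (v t) l)"
      using that Suc.prems by (intro pair) auto
    with Suc show ?case by (simp add: take_vector_Suc add_ac)
  qed
  have double: "h (\<lambda>l. x l + take_vector t u l) + h (\<lambda>l. x l + take_vector k v l) \<le>
      h x + h (\<lambda>l. x l + take_vector t u l + take_vector k v l)" if "t \<le> k" for t
    using that
  proof (induction t)
    case 0
    then show ?case by (simp add: take_vector_0)
  next
    case (Suc t)
    have "h (\<lambda>l. (x l + take_vector t u l) + unit_mult t (u t) l) + h (\<lambda>l. (x l +
        take_vector t u l) + take_vector k v l) \<le>
        h (\<lambda>l. x l + take_vector t u l) + h (\<lambda>l. (x l + take_vector t u l) + unit_mult t (u t) l +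
            take_vector k v l)"
      using Suc.prems by (intro single) auto
    with Suc show ?case by (simp add: take_vector_Suc add_ac)
  qed
  have cong: "h m = h m'" if "\<And>i. i < k \<Longrightarrow> m i = m' i" for m m'
    unfolding h_def using nat_vector_cong[OF that] by simp
  have "h (\<lambda>l. x l + take_vector k u l) = h (\<lambda>i. x i + u i)" "h (\<lambda>l. x l + take_vector k v l) =
      h (\<lambda>i. x i + v i)"
    "h (\<lambda>l. x l + take_vector k u l + take_vector k v l) = h (\<lambda>i. x i + u i + v i)"
    by (intro cong; simp add: take_vector_def)+
  then show ?thesis using double[of k] by simp
qed

text \<open>
  Subtracting an affine function makes a directionally convex function nonnegative on the lattice,
  so that no integrability has to be watched in comparing expectations.
\<close>

definition normalized_dcx :: "nat \<Rightarrow> ((nat \<Rightarrow> real) \<Rightarrow> real) \<Rightarrow> (nat \<Rightarrow> nat) \<Rightarrow> real" where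
  "normalized_dcx k f m = f (nat_vector k m) - f (nat_vector k (\<lambda>_. 0)) -
     (\<Sum>i<k. real (m i) * (f (nat_vector k (unit_mult i 1)) - f (nat_vector k (\<lambda>_. 0))))"

lemma normalized_dcx_lattice:
  assumes f: "directionally_convex k f"
  shows "normalized_dcx k f (\<lambda>i. x i + u i) + normalized_dcx k f (\<lambda>i. x i + v i) \<le>
    normalized_dcx k f x + normalized_dcx k f (\<lambda>i. x i + u i + v i)"
  using directionally_convex_lattice[OF f, of x u v]
  by (simp add: normalized_dcx_def distrib_right sum.distrib)

text \<open>The normalization makes the function vanish at 0 and at the unit vectors. The lattice
  inequality from 0 in the directions m and a unit vector then says that it increases along every
  coordinate.\<close>

lemma normalized_dcx_nonneg:
  assumes f: "directionally_convex k f"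
  shows "0 \<le> normalized_dcx k f m"
proof -
  let ?g = "normalized_dcx k f"
  have g0: "?g (\<lambda>_. 0) = 0" by (simp add: normalized_dcx_def)
  have g1: "?g (unit_mult i 1) = 0" if "i < k" for i
  proof -
    have "(\<Sum>j<k. real (unit_mult i 1 j) * c j) = c i" for c :: "nat \<Rightarrow> real"
      using that by (simp add: unit_mult_def if_distrib[where f=real] if_distrib[where f="\<lambda>x.
          x * _"] cong: if_cong)
    then show ?thesis by (simp add: normalized_dcx_def)
  qed
  have step: "?g m \<le> ?g (\<lambda>l. m l + unit_mult i 1 l)" if "i < k" for m i
    using normalized_dcx_lattice[OF f, of "\<lambda>_. 0" m "unit_mult i 1"] g0 g1[OF that] by simp
  have steps: "?g m \<le> ?g (\<lambda>l. m l + unit_mult i d l)" if "i < k" for m i d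
  proof (induction d)
    case 0
    then show ?case by (simp add: unit_mult_def)
  next
    case (Suc d)
    have "(\<lambda>l. (m l + unit_mult i d l) + unit_mult i 1 l) = (\<lambda>l. m l + unit_mult i (Suc d) l)"
      by (auto simp: unit_mult_def)
    then show ?case using Suc step[OF that, of "\<lambda>l. m l + unit_mult i d l"] by simp
  qed
  have "0 \<le> ?g (take_vector t m)" if "t \<le> k" for t
    using that
  proof (induction t)
    case 0
    then show ?case using g0 by (simp add: take_vector_0)
  next
    case (Suc t)
    then show ?case using steps[of t "take_vector t m" "m t"] by (simp add: take_vector_Suc)
  qed
  moreover have "?g (take_vector k m) = ?g m"
  proof -
    have "nat_vector k (take_vector k m) = nat_vector k m"
        by (intro nat_vector_cong) (simp add: take_vector_def)
    then show ?thesis by (simp add: normalized_dcx_def take_vector_def)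
  qed
  ultimately show ?thesis by (metis order_refl)
qed

text \<open>A piece consists of the points with a given set of indices i such that x is in B i.
  Leaving out the empty index set keeps all pieces bounded, and the others suffice to rebuild each B
  i.\<close>

lemma disjoint_refinement:
  fixes B :: "nat \<Rightarrow> plane set"
  assumes B: "\<And>i. i < k \<Longrightarrow> B i \<in> sets borel \<and> bounded (B i)"
  shows "\<exists>n A e. (\<forall>l<n. A l \<in> sets borel \<and> bounded (A l)) \<and> disjoint_family_on A {..<n::nat} \<and>
    (\<forall>i<k. e i \<subseteq> {..<n} \<and> B i = (\<Union>l\<in>e i. A l))"
proof -
  let ?J = "Pow {..<k} - {{}}"
  obtain h where h: "bij_betw h {0..<card ?J} ?J" using ex_bij_betw_nat_finite[of ?J] by auto
  define n where "n = card ?J"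
  have h: "bij_betw h {..<n} ?J" using h by (simp add: n_def atLeast0LessThan)
  define A where "A l = {x. \<forall>i<k. x \<in> B i \<longleftrightarrow> i \<in> h l}" for l
  define e where "e i = {l. l < n \<and> i \<in> h l}" for i
  have hJ: "h l \<subseteq> {..<k}" "h l \<noteq> {}" if "l < n" for l using bij_betwE[OF h] that by auto
  have "A l \<in> sets borel \<and> bounded (A l)" if l: "l < n" for l
  proof
    have "A l = (\<Inter>i\<in>{..<k}. if i \<in> h l then B i else - B i)" by (auto simp: A_def split: if_splits)
    also have "\<dots> \<in> sets borel"
    proof (rule sets.finite_INT)
      show "{..<k} \<noteq> {}" using hJ[OF l] by blast
      show "(if i \<in> h l then B i else - B i) \<in> sets borel" if "i \<in> {..<k}" for i
        using B[of i] that by (simp add: borel_comp)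
    qed simp
    finally show "A l \<in> sets borel" .
    obtain i where "i \<in> h l" using hJ[OF l] by blast
    then have "A l \<subseteq> B i" "bounded (B i)" using hJ[OF l] B by (auto simp: A_def)
    then show "bounded (A l)" by (rule bounded_subset[rotated])
  qed
  moreover have "disjoint_family_on A {..<n}"
  proof -
    have "h l = h l'" if "l < n" "l' < n" "x \<in> A l" "x \<in> A l'" for l l' x
      using that hJ[OF that(1)] hJ[OF that(2)] unfolding A_def by blast
    then show ?thesis using bij_betw_imp_inj_on[OF h] unfolding disjoint_family_on_def inj_on_def
        by blast
  qed
  moreover have "e i \<subseteq> {..<n} \<and> B i = (\<Union>l\<in>e i. A l)" if i: "i < k" for i
  proof (intro conjI equalityI subsetI)
    fix x assume x: "x \<in> B i"
    have "{j. j < k \<and> x \<in> B j} \<in> ?J" using x i by auto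
    then obtain l where l: "l < n" "h l = {j. j < k \<and> x \<in> B j}"
      using bij_betw_imp_surj_on[OF h] by (metis (no_types, lifting) imageE lessThan_iff)
    then have "l \<in> e i" "x \<in> A l" using x i by (auto simp: e_def A_def)
    then show "x \<in> (\<Union>l\<in>e i. A l)" by blast
  qed (use i in \<open>auto simp: e_def A_def\<close>)
  ultimately show ?thesis by blast
qed

lemma counts_measurable:
  fixes G :: "(nat \<Rightarrow> nat) \<Rightarrow> ennreal"
  assumes A: "\<And>l. l < n \<Longrightarrow> A l \<in> sets borel"
  shows "(\<lambda>N. G (\<lambda>l. if l < n then nat \<lfloor>measure N (A l)\<rfloor> else 0)) \<in> borel_measurable counting_space"
proof -
  define S where "S = PiE_dflt {..<n} (0::nat) (\<lambda>_. UNIV :: nat set)"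
  have cS: "countable S" unfolding S_def by (rule countable_PiE_dflt) auto
  let ?c = "\<lambda>N l. if l < n then nat \<lfloor>measure N (A l)\<rfloor> else 0"
  have c_in: "?c N \<in> S" for N by (auto simp: S_def PiE_dflt_def)
  have 1: "(\<lambda>N. nat \<lfloor>measure N (A l)\<rfloor>) \<in> measurable counting_space (count_space UNIV)" if
      "l < n" for l
  proof -
    have [measurable]: "(\<lambda>N. emeasure N (A l)) \<in> borel_measurable counting_space"
      by (rule measurable_emeasure_counting[OF measurable_ident_sets[OF refl] A[OF that]])
    show ?thesis unfolding measure_def by measurable
  qed
  have "?c -` {x} \<inter> space counting_space \<in> sets counting_space" if "x \<in> S" for x
  proof -
    have "?c -` {x} \<inter> space counting_space = {N \<in> space counting_space. \<forall>l\<in>{..<n}.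
        nat \<lfloor>measure N (A l)\<rfloor> = x l}"
      using that by (auto simp: S_def PiE_dflt_def fun_eq_iff)
    also have "\<dots> \<in> sets counting_space"
    proof (rule sets.sets_Collect_finite_All)
      fix l assume "l \<in> {..<n}"
      then have "(\<lambda>N. nat \<lfloor>measure N (A l)\<rfloor>) -` {x l} \<inter> space counting_space \<in> sets counting_space"
        using 1 by (intro measurable_sets[of _ _ "count_space UNIV"]) auto
      also have "(\<lambda>N. nat \<lfloor>measure N (A l)\<rfloor>) -` {x l} \<inter> space counting_space =
          {N \<in> space counting_space. nat \<lfloor>measure N (A l)\<rfloor> = x l}" by auto
      finally show "{N \<in> space counting_space. nat \<lfloor>measure N (A l)\<rfloor> = x l} \<in> sets counting_space" .
    qed simp
    finally show ?thesis .
  qed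
  then have "?c \<in> measurable counting_space (count_space S)"
    unfolding measurable_count_space_eq_countable[OF cS] using c_in by auto
  then show ?thesis by (rule measurable_compose) simp
qed

lemma intensity_integrable:
  assumes P: "point_process P" and a: "has_intensity P a" "0 \<le> a" and B: "B \<in> sets borel"
      "bounded B"
  shows "integrable P (\<lambda>N. measure N B)" and "(\<integral>N. measure N B \<partial>P) = a * measure lborel B"
proof -
  have sP: "sets P = sets counting_space" using P by (simp add: point_process_def)
  have spP: "space P = counting_measures" using sets_eq_imp_space_eq[OF sP] by simp
  have "(\<lambda>N. emeasure N B) \<in> borel_measurable P"
    using measurable_emeasure_counting[OF measurable_ident_sets[OF sP] B(1)] .
  then have m: "(\<lambda>N. measure N B) \<in> borel_measurable P" unfolding measure_def by measurable
  have fin: "emeasure lborel B < \<infinity>" using emeasure_bounded_finite[OF B(2)] .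
  have "(\<integral>\<^sup>+N. ennreal (measure N B) \<partial>P) = (\<integral>\<^sup>+N. emeasure N B \<partial>P)"
    using counting_measuresD(3)[OF _ B] spP
    by (intro nn_integral_cong) (simp add: emeasure_eq_ennreal_measure less_top)
  also have "\<dots> = ennreal a * emeasure lborel B" using a B by (simp add: has_intensity_def)
  also have "\<dots> = ennreal (a * measure lborel B)"
    using a fin by (simp add: emeasure_eq_ennreal_measure less_top ennreal_mult)
  finally have nn: "(\<integral>\<^sup>+N. ennreal (measure N B) \<partial>P) = ennreal (a * measure lborel B)" .
  show "integrable P (\<lambda>N. measure N B)"
    using m nn by (intro integrableI_nonneg) auto
  show "(\<integral>N. measure N B \<partial>P) = a * measure lborel B"
    using m nn a by (subst integral_eq_nn_integral) auto
qed

text \<open>Counts in overlapping sets are sums of counts in disjoint pieces, and an additive map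
  preserves the lattice inequality. The affine part of the normalization has the same mean under P
  and Q, the intensities being equal, so it cancels in the end.\<close>

lemma dcx_leI:
  assumes P: "point_process P" "has_intensity P a" and Q: "point_process Q" "has_intensity Q a"
      and a: "0 \<le> a"
    and le: "\<And>(n::nat) A F. (\<And>l. l < n \<Longrightarrow> A l \<in> sets borel \<and> bounded (A l)) \<Longrightarrow>
        disjoint_family_on A {..<n} \<Longrightarrow> lattice_dcx F \<Longrightarrow>
      (\<integral>\<^sup>+N. F (\<lambda>l. if l < n then nat \<lfloor>measure N (A l)\<rfloor> else 0) \<partial>P) \<le>
      (\<integral>\<^sup>+N. F (\<lambda>l. if l < n then nat \<lfloor>measure N (A l)\<rfloor> else 0) \<partial>Q)"
  shows "dcx_le P Q"
  unfolding dcx_le_def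
proof (intro allI impI)
  fix k :: nat and B :: "nat \<Rightarrow> plane set" and f :: "(nat \<Rightarrow> real) \<Rightarrow> real"
  assume B: "\<forall>i<k. B i \<in> sets borel \<and> bounded (B i)" and f: "directionally_convex k f"
    and iP: "integrable P (\<lambda>N. f (count_vector k B N))"
        and iQ: "integrable Q (\<lambda>N. f (count_vector k B N))"
  have "\<exists>n A e. (\<forall>l<n. A l \<in> sets borel \<and> bounded (A l)) \<and> disjoint_family_on A {..<n::nat} \<and>
    (\<forall>i<k. e i \<subseteq> {..<n} \<and> B i = (\<Union>l\<in>e i. A l))"
    by (rule disjoint_refinement) (use B in simp)
  then obtain n A e where *: "(\<forall>l<n. A l \<in> sets borel \<and> bounded (A l)) \<and>
      disjoint_family_on A {..<n::nat} \<and>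
    (\<forall>i<k. e i \<subseteq> {..<n} \<and> B i = (\<Union>l\<in>e i. A l))" by (elim exE)
  then have A: "\<And>l. l < n \<Longrightarrow> A l \<in> sets borel \<and> bounded (A l)" and dis: "disjoint_family_on A {..<n}"
    and e: "\<And>i. i < k \<Longrightarrow> e i \<subseteq> {..<n}" "\<And>i. i < k \<Longrightarrow> B i = (\<Union>l\<in>e i. A l)"
    by simp_all
  let ?c = "\<lambda>N l. if l < n then nat \<lfloor>measure N (A l)\<rfloor> else 0"
  define s where "s m i = (\<Sum>l\<in>e i. m l)" for m :: "nat \<Rightarrow> nat" and i
  define G where "G m = ennreal (normalized_dcx k f (s m))" for m
  have dcxG: "lattice_dcx G" unfolding lattice_dcx_def
  proof (intro allI)
    fix x u v :: "nat \<Rightarrow> nat"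
    have "s (\<lambda>i. x i + u i) = (\<lambda>i. s x i + s u i)" "s (\<lambda>i. x i + v i) = (\<lambda>i. s x i + s v i)"
      "s (\<lambda>i. x i + u i + v i) = (\<lambda>i. s x i + s u i + s v i)"
      by (simp_all add: s_def sum.distrib fun_eq_iff)
    then show "G (\<lambda>i. x i + u i) + G (\<lambda>i. x i + v i) \<le> G x + G (\<lambda>i. x i + u i + v i)"
      using normalized_dcx_lattice[OF f, of "s x" "s u" "s v"] normalized_dcx_nonneg[OF f]
      by (simp add: G_def ennreal_plus[symmetric] ennreal_leI del: ennreal_plus)
  qed
  define d where "d i = f (nat_vector k (unit_mult i 1)) - f (nat_vector k (\<lambda>_. 0))" for i
  let ?g = "\<lambda>N. f (count_vector k B N) - f (nat_vector k (\<lambda>_. 0)) - (\<Sum>i<k. measure N (B i) * d i)"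
  have G_eq: "G (?c N) = ennreal (?g N)" "0 \<le> ?g N" if N: "N \<in> counting_measures" for N
  proof -
    have mA: "measure N (A l) = real (?c N l)" if "l < n" for l
    proof -
      obtain j :: nat where "emeasure N (A l) = of_nat j"
          using counting_measuresD(4)[OF N] A[OF \<open>l < n\<close>] by blast
      then show ?thesis using \<open>l < n\<close> by (simp add: measure_def)
    qed
    have mB: "measure N (B i) = real (s (?c N) i)" if i: "i < k" for i
    proof -
      have "measure N (B i) = (\<Sum>l\<in>e i. measure N (A l))"
        unfolding e(2)[OF i]
      proof (rule measure_finite_Union)
        show "finite (e i)" using e(1)[OF i] finite_subset by blast
        show "A ` e i \<subseteq> sets N" using e(1)[OF i] A counting_measuresD(1)[OF N] by auto
        show "disjoint_family_on A (e i)" using dis e(1)[OF i]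
            by (rule disjoint_family_on_mono[rotated])
        show "emeasure N (A l) \<noteq> \<infinity>" if "l \<in> e i" for l
          using counting_measuresD(3)[OF N] A e(1)[OF i] that by (auto simp: less_top)
      qed
      also have "\<dots> = (\<Sum>l\<in>e i. real (?c N l))" using e(1)[OF i] mA by (intro sum.cong) auto
      finally show ?thesis by (simp add: s_def)
    qed
    have "count_vector k B N = nat_vector k (s (?c N))"
      using mB by (auto simp: count_vector_def nat_vector_def fun_eq_iff)
    moreover have "(\<Sum>i<k. measure N (B i) * d i) = (\<Sum>i<k. real (s (?c N) i) * d i)"
      using mB by (intro sum.cong) auto
    ultimately have g: "?g N = normalized_dcx k f (s (?c N))"
        by (simp add: normalized_dcx_def d_def)
    show "G (?c N) = ennreal (?g N)" unfolding g G_def ..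
    show "0 \<le> ?g N" unfolding g by (rule normalized_dcx_nonneg[OF f])
  qed
  have expect: "ennreal (\<integral>N. ?g N \<partial>R) = (\<integral>\<^sup>+N. G (?c N) \<partial>R)" "0 \<le> (\<integral>N. ?g N \<partial>R)"
    "(\<integral>N. ?g N \<partial>R) = (\<integral>N. f (count_vector k B N) \<partial>R) - f (nat_vector k (\<lambda>_. 0)) - (\<Sum>i<k.
        a * measure lborel (B i) * d i)"
    if R: "point_process R" "has_intensity R a"
        and int: "integrable R (\<lambda>N. f (count_vector k B N))" for R
  proof -
    interpret R: prob_space R using R(1) by (simp add: point_process_def)
    have sR: "sets R = sets counting_space" using R(1) by (simp add: point_process_def)
    have spR: "space R = counting_measures" using sets_eq_imp_space_eq[OF sR] by simp
    have iB: "integrable R (\<lambda>N. measure N (B i) * d i)" "(\<integral>N. measure N (B i) * d i \<partial>R) =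
        a * measure lborel (B i) * d i" if "i < k" for i
      using intensity_integrable[OF R a, of "B i"] B that by auto
    have iS: "integrable R (\<lambda>N. \<Sum>i<k. measure N (B i) * d i)" using iB
        by (intro Bochner_Integration.integrable_sum) auto
    have ig: "integrable R ?g" using int iS by (intro Bochner_Integration.integrable_diff) auto
    have AE0: "AE N in R. 0 \<le> ?g N" using G_eq(2) spR by (intro AE_I2) simp
    show "0 \<le> (\<integral>N. ?g N \<partial>R)" using AE0 by (rule integral_nonneg_AE)
    have "(\<integral>\<^sup>+N. ennreal (?g N) \<partial>R) = ennreal (\<integral>N. ?g N \<partial>R)"
        by (rule nn_integral_eq_integral[OF ig AE0])
    moreover have "(\<integral>\<^sup>+N. ennreal (?g N) \<partial>R) = (\<integral>\<^sup>+N. G (?c N) \<partial>R)"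
      using G_eq(1) spR by (intro nn_integral_cong) simp
    ultimately show "ennreal (\<integral>N. ?g N \<partial>R) = (\<integral>\<^sup>+N. G (?c N) \<partial>R)" by simp
    have "(\<integral>N. (\<Sum>i<k. measure N (B i) * d i) \<partial>R) = (\<Sum>i<k. a * measure lborel (B i) * d i)"
    proof -
      have "(\<integral>N. (\<Sum>i<k. measure N (B i) * d i) \<partial>R) = (\<Sum>i<k. \<integral>N. measure N (B i) * d i \<partial>R)"
        by (rule Bochner_Integration.integral_sum) (simp only: iB(1) lessThan_iff)
      also have "\<dots> = (\<Sum>i<k. a * measure lborel (B i) * d i)"
        by (intro sum.cong refl) (simp only: iB(2) lessThan_iff)
      finally show ?thesis .
    qed
    then show "(\<integral>N. ?g N \<partial>R) = (\<integral>N. f (count_vector k B N) \<partial>R) - f (nat_vector k (\<lambda>_. 0)) - (\<Sum>i<k.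
        a * measure lborel (B i) * d i)"
      using int iS by (subst Bochner_Integration.integral_diff) (auto simp: R.prob_space)
  qed
  have "ennreal (\<integral>N. ?g N \<partial>P) \<le> ennreal (\<integral>N. ?g N \<partial>Q)"
    unfolding expect(1)[OF P iP] expect(1)[OF Q iQ] by (rule le[of n A G]) (fact A dis dcxG)+
  then have "(\<integral>N. ?g N \<partial>P) \<le> (\<integral>N. ?g N \<partial>Q)" using expect(2)[OF Q iQ] by (simp add: ennreal_le_iff)
  then show "(\<integral>N. f (count_vector k B N) \<partial>P) \<le> (\<integral>N. f (count_vector k B N) \<partial>Q)"
    unfolding expect(3)[OF P iP] expect(3)[OF Q iQ] by simp
qed

section \<open>Random strips\<close>

definition strip_space :: "(int \<Rightarrow> real) \<Rightarrow> (int \<Rightarrow> bool) measure" where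
  "strip_space p = PiM UNIV (\<lambda>i. measure_pmf (bernoulli_pmf (p i)))"

definition strip_density :: "(int \<Rightarrow> real) \<Rightarrow> real \<Rightarrow> (int \<Rightarrow> bool) \<Rightarrow> plane \<Rightarrow> real" where
  "strip_density p a \<omega> y = a / 2 * (of_bool (\<omega> \<lfloor>y $ 1\<rfloor>) / p \<lfloor>y $ 1\<rfloor> +
      of_bool (\<omega> \<lfloor>y $ 2\<rfloor>) / p \<lfloor>y $ 2\<rfloor>)"

text \<open>The mass that the strips of index i contribute to B before the division by their
  probability. The unit square where the two strips cross counts twice, as it does in the
  density.\<close>

definition strip_mass :: "real \<Rightarrow> int \<Rightarrow> plane set \<Rightarrow> real" where
  "strip_mass a i B = a / 2 * (measure lborel (B \<inter> {y. \<lfloor>y $ 1\<rfloor> =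
      i}) + measure lborel (B \<inter> {y. \<lfloor>y $ 2\<rfloor> = i}))"

definition strip_process :: "(int \<Rightarrow> real) \<Rightarrow> real \<Rightarrow> plane measure measure \<Rightarrow> bool" where
  "strip_process p a P \<longleftrightarrow>
    cox_process (strip_space p) (\<lambda>\<omega>. density lborel (\<lambda>y. ennreal (strip_density p a \<omega> y))) P"

lemma strip_sets [measurable]: "{y::plane. \<lfloor>y $ k\<rfloor> = i} \<in> sets borel"
  by measurable

lemma finite_strips:
  assumes "bounded (B :: plane set)"
  shows "\<exists>I. finite I \<and> (\<forall>y\<in>B. \<forall>k. \<lfloor>y $ k\<rfloor> \<in> I)"
proof -
  obtain b where b: "\<And>y. y \<in> B \<Longrightarrow> norm y \<le> b" using assms by (auto simp: bounded_iff)
  have "\<lfloor>y $ k\<rfloor> \<in> {\<lfloor>-b\<rfloor>..\<lfloor>b\<rfloor>}" if "y \<in> B" for y k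
  proof -
    have "\<bar>y $ k\<bar> \<le> b" using component_le_norm_cart[of y k] b[OF that] by linarith
    then have "- b \<le> y $ k" "y $ k \<le> b" by linarith+
    then show ?thesis by (auto intro: floor_mono)
  qed
  then show ?thesis by (intro exI[of _ "{\<lfloor>-b\<rfloor>..\<lfloor>b\<rfloor>}"]) auto
qed

lemma prob_space_strip_space: "prob_space (strip_space p)"
  unfolding strip_space_def by (intro prob_space_PiM measure_pmf.prob_space_axioms)

lemma strip_density_section_measurable: "strip_density q b \<omega> \<in> borel_measurable borel"
proof -
  have "(\<lambda>y. of_bool (\<omega> \<lfloor>y $ k\<rfloor>) / q \<lfloor>y $ k\<rfloor> :: real) \<in> borel_measurable (borel :: plane measure)"
      for k
    by (rule measurable_compose_countable[where f = "\<lambda>i x. of_bool (\<omega> i) / q i :: real" and g =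
        "\<lambda>y. \<lfloor>y $ k\<rfloor>"]) measurable
  then show ?thesis unfolding strip_density_def[abs_def] by measurable
qed

context
  fixes p :: "int \<Rightarrow> real" and a :: real
  assumes p: "\<And>i. 0 < p i \<and> p i \<le> 1" and a: "0 < a"
begin

lemma strip_density_nonneg: "0 \<le> strip_density p a \<omega> y"
  using a p by (simp add: strip_density_def less_imp_le)

lemma strip_density_measurable:
  "(\<lambda>(\<omega>, y). strip_density p a \<omega> y) \<in> borel_measurable (strip_space p \<Otimes>\<^sub>M borel)"
proof -
  have w: "(\<lambda>x. of_bool (fst x i) / p i :: real) \<in> borel_measurable (strip_space p \<Otimes>\<^sub>M (borel ::
      plane measure))" for i
  proof -
    have "(\<lambda>\<omega>. \<omega> i) \<in> measurable (strip_space p) (measure_pmf (bernoulli_pmf (p i)))"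
      unfolding strip_space_def by (rule measurable_component_singleton) simp
    then have "(\<lambda>\<omega>. of_bool (\<omega> i) / p i :: real) \<in> borel_measurable (strip_space p)"
      by (rule measurable_compose[where g = "\<lambda>b. of_bool b / p i :: real"]) simp
    then show ?thesis by (rule measurable_compose[OF measurable_fst])
  qed
  have "(\<lambda>x. of_bool (fst x \<lfloor>snd x $ k\<rfloor>) / p \<lfloor>snd x $ k\<rfloor> :: real) \<in> borel_measurable (strip_space
      p \<Otimes>\<^sub>M (borel :: plane measure))" for k
  proof (rule measurable_compose_countable[where f = "\<lambda>i x. of_bool (fst x i) / p i :: real"
      and g = "\<lambda>x. \<lfloor>snd x $ k\<rfloor>"])
    show "(\<lambda>x. \<lfloor>snd x $ k\<rfloor>) \<in> measurable (strip_space p \<Otimes>\<^sub>M (borel :: plane measure)) (count_space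
        UNIV)"
      by (rule measurable_compose[OF measurable_snd, of "\<lambda>y. \<lfloor>y $ k\<rfloor>"]) measurable
  qed (rule w)
  then show ?thesis unfolding strip_density_def case_prod_beta by measurable
qed

text \<open>A bounded set meets finitely many strips, so its mass is a finite linear form in the
  switches. The weights q are free: besides p, the constant 1 is used in
  \<open>strip_mass_sum\<close>.\<close>

lemma emeasure_strip_density:
  assumes B: "B \<in> sets borel" "bounded B" and I: "finite I" "\<forall>y\<in>B. \<forall>k. \<lfloor>y $ k\<rfloor> \<in> I"
      and q: "\<And>i. 0 < q i"
  shows "emeasure (density lborel (\<lambda>y. ennreal (strip_density q a \<omega> y))) B =
    ennreal (\<Sum>i\<in>I. of_bool (\<omega> i) / q i * strip_mass a i B)"
proof -
  let ?S = "\<lambda>k i. B \<inter> {y. \<lfloor>y $ k\<rfloor> = i}"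
  have S: "?S k i \<in> sets borel" "emeasure lborel (?S k i) < \<infinity>" for k i
  proof -
    show "?S k i \<in> sets borel" using B by (intro sets.Int strip_sets) auto
    have "bounded (?S k i)" using B(2) by (rule bounded_subset) auto
    then show "emeasure lborel (?S k i) < \<infinity>" by (rule emeasure_bounded_finite)
  qed
  have [measurable]: "B \<in> sets borel" by fact
  note [measurable] = strip_density_section_measurable S(1)
  have eq: "ennreal (strip_density q a \<omega> y) * indicator B y =
      (\<Sum>i\<in>I. ennreal (of_bool (\<omega> i) / q i * (a / 2)) * (indicator (?S 1 i) y +
          indicator (?S 2 i) y))" for y
  proof (cases "y \<in> B")
    case True
    have "(\<Sum>i\<in>I. ennreal (of_bool (\<omega> i) / q i * (a / 2)) * indicator (?S k i) y) =
        ennreal (of_bool (\<omega> \<lfloor>y $ k\<rfloor>) / q \<lfloor>y $ k\<rfloor> * (a / 2))" for k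
    proof -
      have "(\<Sum>i\<in>I. ennreal (of_bool (\<omega> i) / q i * (a / 2)) * indicator (?S k i) y) =
        (\<Sum>i\<in>I. if \<lfloor>y $ k\<rfloor> = i then ennreal (of_bool (\<omega> i) / q i * (a / 2)) else 0)"
        using True by (intro sum.cong) (auto simp: indicator_def)
      also have "\<dots> = ennreal (of_bool (\<omega> \<lfloor>y $ k\<rfloor>) / q \<lfloor>y $ k\<rfloor> * (a / 2))"
        using True I by (subst sum.delta') auto
      finally show ?thesis .
    qed
    then have "(\<Sum>i\<in>I. ennreal (of_bool (\<omega> i) / q i * (a / 2)) * (indicator (?S 1 i) y +
        indicator (?S 2 i) y)) =
       ennreal (of_bool (\<omega> \<lfloor>y $ 1\<rfloor>) / q \<lfloor>y $ 1\<rfloor> * (a / 2)) +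
           ennreal (of_bool (\<omega> \<lfloor>y $ 2\<rfloor>) / q \<lfloor>y $ 2\<rfloor> * (a / 2))"
      by (simp add: distrib_left sum.distrib)
    also have "\<dots> = ennreal (strip_density q a \<omega> y)"
    proof -
      have w: "0 \<le> of_bool (\<omega> i) / q i * (a / 2)" for i using q[of i] a by (simp add: less_imp_le)
      show ?thesis unfolding ennreal_plus[OF w w, symmetric]
        by (simp only: strip_density_def distrib_left mult.commute[of _ "a / 2"])
    qed
    finally show ?thesis using True by simp
  qed simp
  have "emeasure (density lborel (\<lambda>y. ennreal (strip_density q a \<omega> y))) B =
      (\<integral>\<^sup>+y. ennreal (strip_density q a \<omega> y) * indicator B y \<partial>lborel)"
    by (rule emeasure_density) (simp_all add: B(1))
  also have "\<dots> = (\<Sum>i\<in>I. ennreal (of_bool (\<omega> i) / q i * (a / 2)) * (emeasure lborel (?S 1 i) +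
      emeasure lborel (?S 2 i)))"
    unfolding eq using S by (simp add: nn_integral_sum nn_integral_cmult nn_integral_add)
  also have "\<dots> = (\<Sum>i\<in>I. ennreal (of_bool (\<omega> i) / q i * strip_mass a i B))"
  proof (rule sum.cong[OF refl])
    fix i
    have em: "emeasure lborel (?S k i) = ennreal (measure lborel (?S k i))" for k
      using S(2)[of k i] by (intro emeasure_eq_ennreal_measure) auto
    have "0 \<le> of_bool (\<omega> i) / q i * (a / 2)" using q[of i] a by (simp add: less_imp_le)
    then show "ennreal (of_bool (\<omega> i) / q i * (a / 2)) * (emeasure lborel (?S 1 i) +
        emeasure lborel (?S 2 i)) =
        ennreal (of_bool (\<omega> i) / q i * strip_mass a i B)"
      unfolding em ennreal_plus[OF measure_nonneg measure_nonneg,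
          symmetric] strip_mass_def mult.assoc[symmetric]
      by (rule ennreal_mult'[symmetric])
  qed
  also have "\<dots> = ennreal (\<Sum>i\<in>I. of_bool (\<omega> i) / q i * strip_mass a i B)"
    using q a by (intro sum_ennreal mult_nonneg_nonneg) (auto simp: strip_mass_def less_imp_le)
  finally show ?thesis .
qed

lemma strip_mass_nonneg: "0 \<le> strip_mass a i B"
  using a by (simp add: strip_mass_def)

text \<open>With all weights 1 and all strips kept, the density is a / 2 + a / 2. So the strip
  masses are a decomposition of the homogeneous intensity.\<close>

lemma strip_mass_sum:
  assumes B: "B \<in> sets borel" "bounded B" and I: "finite I" "\<forall>y\<in>B. \<forall>k. \<lfloor>y $ k\<rfloor> \<in> I"
  shows "(\<Sum>i\<in>I. strip_mass a i B) = a * measure lborel B"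
proof -
  have "emeasure (density lborel (\<lambda>y. ennreal (strip_density (\<lambda>_. 1) a (\<lambda>_. True) y))) B =
      ennreal (\<Sum>i\<in>I. strip_mass a i B)"
    by (subst emeasure_strip_density[OF B I]) simp_all
  moreover have "emeasure (density lborel (\<lambda>y. ennreal (strip_density (\<lambda>_. 1) a (\<lambda>_.
      True) y))) B = ennreal a * emeasure lborel B"
    using B by (simp add: strip_density_def emeasure_density_const)
  moreover have "emeasure lborel B = ennreal (measure lborel B)"
    using emeasure_bounded_finite[OF B(2)] by (intro emeasure_eq_ennreal_measure) auto
  ultimately have "ennreal (a * measure lborel B) = ennreal (\<Sum>i\<in>I. strip_mass a i B)"
    using a by (simp add: ennreal_mult)
  then show ?thesis using a by (subst (asm) ennreal_inj) (auto intro: sum_nonneg strip_mass_nonneg)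
qed

lemma strip_process_exists: "\<exists>P. strip_process p a P"
proof -
  have "\<exists>K \<in> measurable (strip_space p) (prob_algebra counting_space).
    \<forall>w\<in>space (strip_space p). poisson_process (density lborel (\<lambda>y.
        ennreal (strip_density p a w y))) (K w)"
  proof (rule poisson_kernel_exists[OF strip_density_measurable strip_density_nonneg])
    fix \<omega> and B :: "plane set" assume B: "B \<in> sets borel" "bounded B"
    obtain I where I: "finite I" "\<forall>y\<in>B. \<forall>k. \<lfloor>y $ k\<rfloor> \<in> I" using finite_strips[OF B(2)] by blast
    show "emeasure (density lborel (\<lambda>y. ennreal (strip_density p a \<omega> y))) B < \<infinity>"
      using p by (subst emeasure_strip_density[OF B I]) auto
  qed
  then obtain K where "K \<in> measurable (strip_space p) (prob_algebra counting_space)"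
    "\<forall>w\<in>space (strip_space p). poisson_process (density lborel (\<lambda>y.
        ennreal (strip_density p a w y))) (K w)" by (elim bexE)
  then show ?thesis unfolding strip_process_def cox_process_def using prob_space_strip_space
    by (intro exI[of _ "strip_space p \<bind> K"] conjI exI[of _ K] AE_I2) auto
qed

text \<open>Dividing by the probability of being kept gives the switches mean 1; the intensity a and
  the mixture comparison both rest on this.\<close>

lemma nn_integral_strip_weight:
  "(\<integral>\<^sup>+\<omega>. ennreal (of_bool (\<omega> i) / p i) \<partial>strip_space p) = 1"
proof -
  let ?M = "\<lambda>i. measure_pmf (bernoulli_pmf (p i))"
  have "(\<integral>\<^sup>+\<omega>. ennreal (of_bool (\<omega> i) / p i) \<partial>strip_space p) =
      (\<integral>\<^sup>+b. ennreal (of_bool b / p i) \<partial>distr (PiM UNIV ?M) (?M i) (\<lambda>\<omega>. \<omega> i))"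
    unfolding strip_space_def by (subst nn_integral_distr) simp_all
  also have "distr (PiM UNIV ?M) (?M i) (\<lambda>\<omega>. \<omega> i) = ?M i"
    by (rule distr_PiM_component) (auto intro: measure_pmf.prob_space_axioms)
  also have "(\<integral>\<^sup>+b. ennreal (of_bool b / p i) \<partial>?M i) = 1"
    using p[of i] by (simp add: nn_integral_bernoulli_pmf ennreal_mult[symmetric] less_imp_le)
  finally show ?thesis .
qed

lemma strip_process_intensity:
  assumes P: "strip_process p a P"
  shows "has_intensity P a"
  unfolding has_intensity_def
proof
  fix B :: "plane set" assume B[measurable]: "B \<in> sets borel"
  interpret M: prob_space "strip_space p" by (rule prob_space_strip_space)
  interpret pair_sigma_finite "strip_space p" "lborel :: plane measure" ..
  note strip_density_measurable[measurable] strip_density_section_measurable[measurable]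
  have [measurable]: "(\<lambda>x. strip_density p a (fst x) (snd x)) \<in> borel_measurable (strip_space p
      \<Otimes>\<^sub>M lborel)"
    using strip_density_measurable by (simp add: case_prod_beta cong: measurable_cong_sets)
  have wm [measurable]: "(\<lambda>\<omega>. of_bool (\<omega> i) / p i :: real) \<in> borel_measurable (strip_space p)" for i
  proof -
    have "(\<lambda>\<omega>. \<omega> i) \<in> measurable (strip_space p) (measure_pmf (bernoulli_pmf (p i)))"
      unfolding strip_space_def by (rule measurable_component_singleton) simp
    then show ?thesis
      by (rule measurable_compose[where g = "\<lambda>b. of_bool b / p i :: real"]) simp
  qed
  have mean: "(\<integral>\<^sup>+\<omega>. ennreal (strip_density p a \<omega> y) \<partial>strip_space p) = ennreal a" for y
  proof -
    have "ennreal (strip_density p a \<omega> y) =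
        ennreal (a / 2) * (ennreal (of_bool (\<omega> \<lfloor>y $ 1\<rfloor>) / p \<lfloor>y $ 1\<rfloor>) +
            ennreal (of_bool (\<omega> \<lfloor>y $ 2\<rfloor>) / p \<lfloor>y $ 2\<rfloor>))" for \<omega>
    proof -
      have w: "0 \<le> of_bool (\<omega> i) / p i" for i using p[of i] by (simp add: less_imp_le)
      have "ennreal (strip_density p a \<omega> y) =
          ennreal (a / 2) * ennreal (of_bool (\<omega> \<lfloor>y $ 1\<rfloor>) / p \<lfloor>y $ 1\<rfloor> +
              of_bool (\<omega> \<lfloor>y $ 2\<rfloor>) / p \<lfloor>y $ 2\<rfloor>)"
        unfolding strip_density_def using a by (intro ennreal_mult add_nonneg_nonneg w) simp
      then show ?thesis by (simp only: ennreal_plus[OF w w])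
    qed
    then have "(\<integral>\<^sup>+\<omega>. ennreal (strip_density p a \<omega> y) \<partial>strip_space p) = ennreal (a / 2) * (1 + 1)"
      by (simp add: nn_integral_cmult nn_integral_add nn_integral_strip_weight)
    also have "\<dots> = ennreal (a / 2) * ennreal 2" by simp
    also have "\<dots> = ennreal a" using a by (subst ennreal_mult[symmetric]) auto
    finally show ?thesis .
  qed
  have "(\<integral>\<^sup>+N. emeasure N B \<partial>P) =
      (\<integral>\<^sup>+\<omega>. emeasure (density lborel (\<lambda>y. ennreal (strip_density p a \<omega> y))) B \<partial>strip_space p)"
    by (rule cox_process_mean[OF P[unfolded strip_process_def] B])
  also have "\<dots> = (\<integral>\<^sup>+\<omega>. \<integral>\<^sup>+y. ennreal (strip_density p a \<omega> y) *
      indicator B y \<partial>lborel \<partial>strip_space p)"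
    by (intro nn_integral_cong emeasure_density) simp_all
  also have "\<dots> = (\<integral>\<^sup>+y. \<integral>\<^sup>+\<omega>. ennreal (strip_density p a \<omega> y) *
      indicator B y \<partial>strip_space p \<partial>lborel)"
    by (rule Fubini'[symmetric]) (simp add: case_prod_beta)
  also have "\<dots> = (\<integral>\<^sup>+y. ennreal a * indicator B y \<partial>lborel)"
  proof (rule nn_integral_cong)
    fix y
    show "(\<integral>\<^sup>+\<omega>. ennreal (strip_density p a \<omega> y) * indicator B y \<partial>strip_space p) =
        ennreal a * indicator B y"
      by (cases "y \<in> B") (simp_all add: mean)
  qed
  also have "\<dots> = ennreal a * emeasure lborel B" by (simp add: nn_integral_cmult)
  finally show "(\<integral>\<^sup>+N. emeasure N B \<partial>P) = ennreal a * emeasure lborel B" .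
qed

text \<open>Finitely many bounded sets see finitely many switches, so the infinite product is
  projected to a finite index set I, where the mixture inequality applies with the strip masses as
  summands.\<close>

lemma homogeneous_poisson_dcx_le_strip_process:
  assumes H: "homogeneous_poisson a H" and P: "strip_process p a P"
  shows "dcx_le H P"
proof (rule dcx_leI)
  have H': "poisson_process (scale_measure (ennreal a) lborel) H" using H
      by (simp add: homogeneous_poisson_def)
  show "point_process H" using H' by (simp add: poisson_process_def)
  show "has_intensity H a" using poisson_process_mean[OF H'] by (simp add: has_intensity_def)
  show "point_process P" using P unfolding strip_process_def by (rule cox_process_point_process)
  show "has_intensity P a" by (rule strip_process_intensity[OF P])
  show "0 \<le> a" using a by simp
  let ?L = "\<lambda>\<omega>. density lborel (\<lambda>y. ennreal (strip_density p a \<omega> y)) :: plane measure"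
  obtain K where K: "K \<in> measurable (strip_space p) (prob_algebra counting_space)" "P =
      strip_space p \<bind> K"
    and poi: "AE \<omega> in strip_space p. poisson_process (?L \<omega>) (K \<omega>)"
    using P unfolding strip_process_def cox_process_def by blast
  fix n :: nat and A0 :: "nat \<Rightarrow> plane set" and F :: "(nat \<Rightarrow> nat) \<Rightarrow> ennreal"
  assume A0: "\<And>l. l < n \<Longrightarrow> A0 l \<in> sets borel \<and> bounded (A0 l)" "disjoint_family_on A0 {..<n}"
      and F: "lattice_dcx F"
  \<comment> \<open>Emptying the sets from n on makes the identities for the intensities hold for
    all indices, so that they can be used as equalities of functions.\<close>
  define A where "A l = (if l < n then A0 l else {})" for l
  have A: "A l \<in> sets borel" "bounded (A l)" for l using A0 by (auto simp: A_def)
  have dis: "disjoint_family_on A {..<n}" using A0(2) by (auto simp: disjoint_family_on_def A_def)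
  let ?c = "\<lambda>N :: plane measure. \<lambda>l. if l < n then nat \<lfloor>measure N (A l)\<rfloor> else 0"
  have c0: "(\<lambda>l. if l < n then nat \<lfloor>measure N (A0 l)\<rfloor> else 0) = ?c N" for N :: "plane measure"
    by (auto simp: A_def)
  have "bounded (\<Union>l<n. A l)" using A by auto
  then obtain I where I: "finite I" "\<forall>y\<in>\<Union>l<n. A l. \<forall>k. \<lfloor>y $ k\<rfloor> \<in> I" using finite_strips by blast
  have I': "\<forall>y\<in>A l. \<forall>k. \<lfloor>y $ k\<rfloor> \<in> I" for l using I(2) by (cases "l < n") (auto simp: A_def)
  let ?w = "\<lambda>\<omega> l. 0 + (\<Sum>i\<in>I. of_bool (\<omega> i) / p i * strip_mass a i (A l))"
  define g where "g \<omega> = (\<integral>\<^sup>+x. F x \<partial>measure_pmf (pois_vector n (?w \<omega>)))" for \<omega>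
  let ?M = "\<lambda>i. measure_pmf (bernoulli_pmf (p i))"
  have "(\<integral>\<^sup>+N. F (?c N) \<partial>H) = (\<integral>\<^sup>+x. F x \<partial>measure_pmf (pois_vector n (\<lambda>l.
      measure (scale_measure (ennreal a) lborel) (A l))))"
    unfolding pois_vector_def by (rule poisson_process_nn_integral[OF H' _ dis]) (simp add: A)
  also have "(\<lambda>l. measure (scale_measure (ennreal a) lborel) (A l)) =
      (\<lambda>l. 0 + (\<Sum>i\<in>I. strip_mass a i (A l)))"
    using a A by (simp add: strip_mass_sum[OF A I(1) I'] measure_scale_measure)
  also have "(\<integral>\<^sup>+x. F x \<partial>measure_pmf (pois_vector n (\<lambda>l. 0 + (\<Sum>i\<in>I. strip_mass a i (A l))))) \<le>
      (\<integral>\<^sup>+\<omega>. g \<omega> \<partial>PiM I ?M)"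
    unfolding g_def by (rule pois_vector_product_mixture_le[OF F _ strip_mass_nonneg p I(1)]) simp
  also have "(\<integral>\<^sup>+\<omega>. g \<omega> \<partial>PiM I ?M) = (\<integral>\<^sup>+\<omega>. g \<omega> \<partial>distr (PiM UNIV ?M) (PiM I ?M) (\<lambda>\<omega>. restrict \<omega> I))"
  proof -
    interpret product_prob_space ?M UNIV ..
    show ?thesis using distr_PiM_restrict_finite[OF I(1)] by simp
  qed
  also have "\<dots> = (\<integral>\<^sup>+\<omega>. g (restrict \<omega> I) \<partial>strip_space p)"
    unfolding strip_space_def
    by (subst nn_integral_distr) (auto intro: measurable_restrict_subset
        measurable_PiM_bernoulli_finite[OF I(1)])
  also have "\<dots> = (\<integral>\<^sup>+\<omega>. g \<omega> \<partial>strip_space p)"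
    by (simp add: g_def cong: sum.cong)
  also have "\<dots> = (\<integral>\<^sup>+\<omega>. \<integral>\<^sup>+N. F (?c N) \<partial>K \<omega> \<partial>strip_space p)"
  proof (rule nn_integral_cong_AE, use poi in eventually_elim)
    fix \<omega> assume po: "poisson_process (?L \<omega>) (K \<omega>)"
    have "measure (?L \<omega>) (A l) = ?w \<omega> l" for l
    proof -
      have "emeasure (?L \<omega>) (A l) = ennreal (?w \<omega> l)" using p
          by (simp add: emeasure_strip_density[OF A I(1) I'])
      moreover have "0 \<le> of_bool (\<omega> i) / p i" for i using p[of i] by (simp add: less_imp_le)
      then have "0 \<le> ?w \<omega> l" by (intro add_nonneg_nonneg sum_nonneg mult_nonneg_nonneg
          strip_mass_nonneg) simp
      ultimately show ?thesis by (simp add: measure_def)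
    qed
    then show "g \<omega> = (\<integral>\<^sup>+N. F (?c N) \<partial>K \<omega>)"
      unfolding g_def using poisson_process_nn_integral[OF po _ dis, of F] A
          by (simp add: pois_vector_def)
  qed
  also have "\<dots> = (\<integral>\<^sup>+N. F (?c N) \<partial>P)"
    unfolding K(2) by (rule cox_process_nn_integral[OF prob_space_strip_space K(1)
        counts_measurable, symmetric]) (simp add: A)
  finally show "(\<integral>\<^sup>+N. F (\<lambda>l. if l < n then nat \<lfloor>measure N (A0 l)\<rfloor> else 0) \<partial>H) \<le>
      (\<integral>\<^sup>+N. F (\<lambda>l. if l < n then nat \<lfloor>measure N (A0 l)\<rfloor> else 0) \<partial>P)" unfolding c0 .
qed

end

section \<open>Crosses and percolation of the strip process\<close>

definition cross :: "int \<Rightarrow> real \<Rightarrow> plane set" where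
  "cross i L = {y. of_int i \<le> y $ 1 \<and> y $ 1 < of_int i + 1 \<and> 0 \<le> y $ 2 \<and> y $ 2 < L} \<union>
    {y. 0 \<le> y $ 1 \<and> y $ 1 < L \<and> of_int i \<le> y $ 2 \<and> y $ 2 < of_int i + 1}"

lemma connected_cross:
  assumes "0 \<le> i" "of_int i < L"
  shows "connected (cross i L)"
  unfolding cross_def
proof (rule connected_Un)
  have conv: "convex {y::plane. l1 \<le> y $ 1 \<and> y $ 1 < u1 \<and> l2 \<le>
      y $ 2 \<and> y $ 2 < u2}" for l1 u1 l2 u2 :: real
  proof (rule convexI)
    fix x y :: plane and u v :: real
    assume xy: "x \<in> {y. l1 \<le> y $ 1 \<and> y $ 1 < u1 \<and> l2 \<le> y $ 2 \<and> y $ 2 < u2}" "y \<in> {y. l1 \<le>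
        y $ 1 \<and> y $ 1 < u1 \<and> l2 \<le> y $ 2 \<and> y $ 2 < u2}"
      and uv: "0 \<le> u" "0 \<le> v" "u + v = 1"
    have "convex {l1..<u1}" "convex {l2..<u2}" by (auto intro: is_interval_convex)
    then show "u *\<^sub>R x + v *\<^sub>R y \<in> {y. l1 \<le> y $ 1 \<and> y $ 1 < u1 \<and> l2 \<le> y $ 2 \<and> y $ 2 < u2}"
      using convexD[of "{l1..<u1}" "x $ 1" "y $ 1" u v] convexD[of "{l2..<u2}" "x $ 2"
          "y $ 2" u v] xy uv by simp
  qed
  show "connected {y::plane. of_int i \<le> y $ 1 \<and> y $ 1 < of_int i + 1 \<and> 0 \<le> y $ 2 \<and> y $ 2 < L}"
    by (rule convex_connected[OF conv])
  show "connected {y::plane. 0 \<le> y $ 1 \<and> y $ 1 < L \<and> of_int i \<le> y $ 2 \<and> y $ 2 < of_int i + 1}"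
    by (rule convex_connected[OF conv])
  have "vector [of_int i, of_int i] \<in> {y::plane. of_int i \<le> y $ 1 \<and> y $ 1 < of_int i + 1 \<and> 0 \<le>
      y $ 2 \<and> y $ 2 < L} \<inter>
      {y. 0 \<le> y $ 1 \<and> y $ 1 < L \<and> of_int i \<le> y $ 2 \<and> y $ 2 < of_int i + 1}"
    using assms by simp
  then show "{y::plane. of_int i \<le> y $ 1 \<and> y $ 1 < of_int i + 1 \<and> 0 \<le> y $ 2 \<and> y $ 2 < L} \<inter>
      {y. 0 \<le> y $ 1 \<and> y $ 1 < L \<and> of_int i \<le> y $ 2 \<and> y $ 2 < of_int i + 1} \<noteq> {}" by blast
qed

text \<open>Consecutive crosses always meet: the next index is less than 2 ^ (n + 2), which is the
  length of the arms at level n. So one kept index per level suffices, whichever it is.\<close>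

lemma percolates_crosses:
  assumes i: "\<And>n. n0 \<le> n \<Longrightarrow> i n \<in> {2 ^ n..<2 ^ (n + 1)}"
    and sub: "\<And>n. n0 \<le> n \<Longrightarrow> cross (i n) (2 ^ (n + 2)) \<subseteq> S"
  shows "percolates S"
proof -
  define C where "C n = cross (i (n0 + n)) (2 ^ (n0 + n + 2))" for n
  have i': "(2::real) ^ (n0 + n) \<le> of_int (i (n0 + n))" "of_int (i (n0 + n)) < (2::real) ^ (n0 +
      n + 1)" for n
  proof -
    have "2 ^ (n0 + n) \<le> i (n0 + n)" "i (n0 + n) < 2 ^ (n0 + n + 1)" using i[of "n0 + n"] by auto
    then have "real_of_int (2 ^ (n0 + n)) \<le> of_int (i (n0 + n))"
        "of_int (i (n0 + n)) < real_of_int (2 ^ (n0 + n + 1))"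
      by (simp_all only: of_int_le_iff of_int_less_iff)
    then show "(2::real) ^ (n0 + n) \<le> of_int (i (n0 + n))"
        "of_int (i (n0 + n)) < (2::real) ^ (n0 + n + 1)" by simp_all
  qed
  have i0: "0 \<le> i (n0 + n)" for n using i[of "n0 + n"]
      by (auto intro: order_trans[of _ "2 ^ (n0 + n)"])
  have i0': "0 \<le> real_of_int (i (n0 + n))" for n using i0 by simp
  have lt: "of_int (i (n0 + n)) < (2::real) ^ (n0 + n + 2)" for n
    by (rule less_trans[OF i'(2)]) (rule power_strict_increasing, auto)
  have lt2: "of_int (i (n0 + n)) < (2::real) ^ (n0 + Suc n + 2)" for n
    by (rule less_trans[OF i'(2)]) (rule power_strict_increasing, auto)
  have lt3: "of_int (i (n0 + Suc n)) < (2::real) ^ (n0 + n + 2)" for n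
    using i'(2)[of "Suc n"] by simp
  have C: "connected (C n)" for n
    unfolding C_def by (rule connected_cross[OF i0 lt])
  have meet: "C n \<inter> C (Suc n) \<noteq> {}" for n
  proof -
    \<comment> \<open>This point lies in the vertical arm at level n and in the horizontal arm at
      level n + 1; \<open>lt3\<close> is the bound that fixes the length of the arms.\<close>
    have "vector [of_int (i (n0 + n)), of_int (i (n0 + Suc n))] \<in> C n \<inter> C (Suc n)"
      using i0'[of n] i0'[of "Suc n"] lt2[of n] lt3[of n] unfolding C_def cross_def by simp
    then show ?thesis by blast
  qed
  have conn: "connected (\<Union>k<m. C k)" for m
    by (rule connected_chain) (rule C, rule meet)
  have diag: "vector [of_int (i (n0 + n)), of_int (i (n0 + n))] \<in> C n" for n
    using i0' lt unfolding C_def cross_def by simp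
  have "connected (\<Union>m. \<Union>k<Suc m. C k)"
    by (rule connected_Union) (use conn diag[of 0] in blast)+
  moreover have "(\<Union>m. \<Union>k<Suc m. C k) = (\<Union>n. C n)" by auto
  ultimately have con: "connected (\<Union>n. C n)" by simp
  have "\<not> bounded (\<Union>n. C n)"
  proof
    assume "bounded (\<Union>n. C n)"
    then obtain b where b: "\<And>y n. y \<in> C n \<Longrightarrow> norm y \<le> b" by (auto simp: bounded_iff)
    obtain n where "b < 2 ^ n" using real_arch_pow[of 2 b] by auto
    also have "(2::real) ^ n \<le> 2 ^ (n0 + n)" by (rule power_increasing) auto
    also have "\<dots> \<le> of_int (i (n0 + n))" by (rule i')
    also have "\<dots> \<le> norm (vector [of_int (i (n0 + n)), of_int (i (n0 + n))] :: plane)"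
      using component_le_norm_cart[of "vector [of_int (i (n0 + n)), of_int (i (n0 +
          n))] :: plane" 1] by simp
    also have "\<dots> \<le> b" using diag by (rule b)
    finally show False by simp
  qed
  moreover have "(\<Union>n. C n) \<subseteq> S" unfolding C_def by (intro UN_least sub) simp
  ultimately show ?thesis using con by (auto simp: percolates_def)
qed

definition cross_squares :: "nat \<Rightarrow> nat \<Rightarrow> int \<Rightarrow> site set" where
  "cross_squares q n i = {int q * i..<int q * (i + 1)} \<times> {0..<int q * 2 ^ (n + 2)} \<union>
    {0..<int q * 2 ^ (n + 2)} \<times> {int q * i..<int q * (i + 1)}"

lemma card_cross_squares: "card (cross_squares q n i) \<le> 8 * q\<^sup>2 * 2 ^ n"
proof -
  have l: "nat (int q * (i + 1) - int q * i) = q" by (simp add: algebra_simps)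
  have l2: "nat (int q * 2 ^ (n + 2)) = q * 2 ^ (n + 2)"
      by (simp add: nat_mult_distrib nat_power_eq)
  have "card (cross_squares q n i) \<le> q * (q * 2 ^ (n + 2)) + (q * 2 ^ (n + 2)) * q"
    unfolding cross_squares_def
    by (rule order_trans[OF card_Un_le]) (simp only: card_cartesian_product
        card_atLeastLessThan_int diff_0_right l l2 order_refl)
  also have "\<dots> = 8 * q\<^sup>2 * 2 ^ n" by (simp add: power2_eq_square)
  finally show ?thesis .
qed

lemma finite_cross_squares: "finite (cross_squares q n i)"
  by (simp add: cross_squares_def)

lemma cross_squares_cover:
  assumes q: "0 < q" and y: "y \<in> cross i (2 ^ (n + 2))"
  shows "\<exists>u\<in>cross_squares q n i. y \<in> grid_square (1 / q) u"
proof -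
  define u where "u = (\<lfloor>q * y $ 1\<rfloor>, \<lfloor>q * y $ 2\<rfloor>)"
  have in_range: "\<lfloor>q * t\<rfloor> \<in> {int q * j..<int q * k}" if "of_int j \<le>
      t" "t < of_int k" for t :: real and j k
  proof -
    have "real q * of_int j \<le> q * t" "q * t < q * of_int k" using q that by auto
    then show ?thesis by (simp add: le_floor_iff floor_less_iff)
  qed
  have "u \<in> cross_squares q n i"
    using y in_range[of i _ "i + 1"] in_range[of 0 _ "2 ^ (n + 2)"]
    unfolding cross_def cross_squares_def u_def by auto
  moreover have "y \<in> grid_square (1 / q) u"
    using q floor_correct[of "q * y $ 1"] floor_correct[of "q * y $ 2"]
    by (auto simp: grid_square_def u_def field_simps)
  ultimately show ?thesis by blast
qed

lemma grid_square_dist: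
  assumes "x \<in> grid_square s u" "y \<in> grid_square s u"
  shows "dist x y \<le> 2 * s"
proof -
  have "\<bar>(x - y) $ 1\<bar> \<le> s" "\<bar>(x - y) $ 2\<bar> \<le> s"
    using assms by (auto simp: grid_square_def algebra_simps abs_le_iff)
  then show ?thesis using norm_plane_le[of "x - y"] by (simp add: dist_norm)
qed

lemma cross_subset_boolean_model:
  assumes N: "N \<in> counting_measures" and q: "0 < q" "2 / q \<le> r"
    and pos: "\<And>u. u \<in> cross_squares q n i \<Longrightarrow> emeasure N (grid_square (1 / q) u) \<noteq> 0"
  shows "cross i (2 ^ (n + 2)) \<subseteq> boolean_model N r"
proof
  fix y assume y: "y \<in> cross i (2 ^ (n + 2))"
  obtain u where u: "u \<in> cross_squares q n i" "y \<in> grid_square (1 / q) u"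
      using cross_squares_cover[OF q(1) y] by blast
  obtain x where x: "x \<in> grid_square (1 / q) u" "x \<in> atoms N"
    using atom_exists[OF N grid_square_sets bounded_grid_square pos[OF u(1)]] by blast
  have "dist x y \<le> r" using grid_square_dist[OF x(1) u(2)] q(2) by simp
  then show "y \<in> boolean_model N r" using x(2) by (auto simp: boolean_model_atoms)
qed

text \<open>The level of i is the integer part of its binary logarithm; strips with i < 1 are always
  kept. The rate is a compromise: a kept strip of level n has a density of order (n + 1)^2, more
  than the logarithm of the order of 2 ^ n cells to be hit, while 2 ^ n / (n + 1)^2 strips of the
  level are still expected to be kept.\<close>

definition strip_prob :: "int \<Rightarrow> real" where
  "strip_prob i = (if 1 \<le> i then 1 / (real (nat \<lfloor>log 2 i\<rfloor>) + 1)\<^sup>2 else 1)"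

lemma strip_prob_range: "0 < strip_prob i \<and> strip_prob i \<le> 1"
proof -
  have "0 < 1 / (real m + 1)\<^sup>2 \<and> 1 / (real m + 1)\<^sup>2 \<le> 1" for m
    by (intro conjI divide_pos_pos zero_less_power) (auto simp: divide_le_eq_1)
  from this[of "nat \<lfloor>log 2 i\<rfloor>"] show ?thesis
    by (cases "1 \<le> i") (simp_all only: strip_prob_def if_True if_False,
        simp_all only: zero_less_one order_refl simp_thms)
qed

lemma strip_prob_level:
  assumes "i \<in> {2 ^ n..<2 ^ (n + 1)}"
  shows "strip_prob i = 1 / (real n + 1)\<^sup>2"
proof -
  have i: "2 ^ n \<le> i" "i < 2 ^ (n + 1)" using assms by auto
  have "(1::int) \<le> 2 ^ n" by simp
  with i(1) have i1: "1 \<le> i" by linarith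
  have r: "of_int (2 ^ n) \<le> real_of_int i" "real_of_int i < of_int (2 ^ (n + 1))"
    using i by (simp_all only: of_int_le_iff of_int_less_iff)
  have "\<lfloor>log 2 (real_of_int i)\<rfloor> = int n"
  proof (rule floor_unique)
    show "of_int (int n) \<le> log 2 (real_of_int i)" using r i1 by (simp add: le_log_iff powr_realpow)
    show "log 2 (real_of_int i) < of_int (int n) + 1"
      using r i1 by (simp add: log_less_iff powr_realpow powr_add)
  qed
  then show ?thesis using i1 by (simp add: strip_prob_def)
qed

text \<open>An event of the configuration alone: the switches are not part of it, so a level is good
  if the cells of some cross are all hit, for whatever reason.\<close>

definition bad_level :: "nat \<Rightarrow> nat \<Rightarrow> plane measure set" where
  "bad_level q n = {N \<in> counting_measures. \<forall>i\<in>{2 ^ n..<2 ^ (n + 1)}. \<exists>u\<in>cross_squares q n i.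
      emeasure N (grid_square (1 / q) u) = 0}"

lemma bad_level_sets: "bad_level q n \<in> sets counting_space"
proof -
  have m: "{N \<in> space counting_space. emeasure N (grid_square (1 / q) u) =
      0} \<in> sets counting_space" for u
    by (rule void_sets[OF measurable_emeasure_counting[OF measurable_ident_sets[OF refl]
        grid_square_sets]])
  have "{N \<in> space counting_space. \<forall>i\<in>{2 ^ n..<2 ^ (n + 1)}. \<exists>u\<in>cross_squares q n i.
      emeasure N (grid_square (1 / q) u) = 0} \<in> sets counting_space"
    by (rule sets.sets_Collect_finite_All'[OF sets.sets_Collect_finite_Ex[OF m
        finite_cross_squares]]) auto
  then show ?thesis by (simp add: bad_level_def)
qed

lemma level_all_off:
  "emeasure (strip_space strip_prob) {\<omega> \<in> space (strip_space strip_prob). \<forall>i\<in>{2 ^ n..<2 ^ (n +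
      1)}. \<not> \<omega> i} =
    ennreal ((1 - 1 / (real n + 1)\<^sup>2) ^ (2 ^ n))"
proof -
  let ?M = "\<lambda>i. measure_pmf (bernoulli_pmf (strip_prob i))"
  let ?J = "{2 ^ n..<2 ^ (n + 1)} :: int set"
  interpret product_prob_space ?M UNIV ..
  have "{\<omega> \<in> space (strip_space strip_prob). \<forall>i\<in>?J. \<not> \<omega> i} =
      prod_emb UNIV ?M ?J (PiE ?J (\<lambda>_. {False}))"
    by (auto simp: prod_emb_def strip_space_def space_PiM PiE_def Pi_def fun_eq_iff restrict_def
        extensional_def)
  then have "emeasure (strip_space strip_prob) {\<omega> \<in> space (strip_space strip_prob). \<forall>i\<in>?J. \<not> \<omega> i} =
      (\<Prod>i\<in>?J. emeasure (?M i) {False})"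
    by (simp only: strip_space_def) (rule emeasure_PiM_emb, auto)
  also have "\<dots> = (\<Prod>i\<in>?J. ennreal (1 - 1 / (real n + 1)\<^sup>2))"
    using strip_prob_range strip_prob_level by (intro prod.cong refl) (simp add:
        emeasure_pmf_single less_imp_le)
  also have "\<dots> = ennreal (1 - 1 / (real n + 1)\<^sup>2) ^ (2 ^ n)" by (simp add: nat_power_eq)
  also have "\<dots> = ennreal ((1 - 1 / (real n + 1)\<^sup>2) ^ (2 ^ n))"
      by (rule ennreal_power) (simp add: field_simps)
  finally show ?thesis .
qed

text \<open>Either all switches of the level are off, or some strip i is kept. In the second case
  badness forces an empty cell in the cross of this one i, and a union bound over its cells is
  enough.\<close>

lemma prob_bad_level:
  assumes P: "strip_process strip_prob a P" and a: "0 < a" and q: "0 < q"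
  shows "measure P (bad_level q n) \<le> (1 - 1 / (real n + 1)\<^sup>2) ^ (2 ^ n) + 8 * q\<^sup>2 * 2 ^ n *
      exp (- (a / (2 * q\<^sup>2) * (real n + 1)\<^sup>2))"
proof -
  let ?L = "\<lambda>\<omega>. density lborel (\<lambda>y. ennreal (strip_density strip_prob a \<omega> y)) :: plane measure"
  let ?J = "{2 ^ n..<2 ^ (n + 1)} :: int set"
  let ?E = "{\<omega> \<in> space (strip_space strip_prob). \<forall>i\<in>?J. \<not> \<omega> i}"
  obtain K where K: "K \<in> measurable (strip_space strip_prob) (prob_algebra counting_space)" "P =
      strip_space strip_prob \<bind> K"
    and poi: "AE \<omega> in strip_space strip_prob. poisson_process (?L \<omega>) (K \<omega>)"
    using P unfolding strip_process_def cox_process_def by blast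
  have pp: "point_process P" using P unfolding strip_process_def by (rule cox_process_point_process)
  then interpret P: prob_space P by (simp add: point_process_def)
  interpret S: prob_space "strip_space strip_prob" by (rule prob_space_strip_space)
  define d where "d = 8 * q\<^sup>2 * 2 ^ n * exp (- (a / (2 * q\<^sup>2) * (real n + 1)\<^sup>2))"
  have d0: "0 \<le> d" by (simp add: d_def)
  have cond: "emeasure (K \<omega>) (bad_level q n) \<le> indicator ?E \<omega> + ennreal d"
    if po: "poisson_process (?L \<omega>) (K \<omega>)" and \<omega>: "\<omega> \<in> space (strip_space strip_prob)" for \<omega>
  proof (cases "\<omega> \<in> ?E")
    case True
    interpret prob_space "K \<omega>" using po by (simp add: poisson_process_def point_process_def)
    have "emeasure (K \<omega>) (bad_level q n) \<le> 1" by (rule emeasure_le_1)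
    also have "\<dots> \<le> indicator ?E \<omega> + ennreal d" using True by simp
    finally show ?thesis .
  next
    case False
    then obtain i where i: "i \<in> ?J" "\<omega> i" using \<omega> by blast
    interpret prob_space "K \<omega>" using po by (simp add: poisson_process_def point_process_def)
    let ?V = "\<lambda>u. {N \<in> space (K \<omega>). emeasure N (grid_square (1 / q) u) = 0}"
    have void: "emeasure (K \<omega>) (?V u) \<le> ennreal (exp (- (a / (2 * q\<^sup>2) * (real n + 1)\<^sup>2)))"
      if u: "u \<in> cross_squares q n i" for u
    proof -
      have q': "0 < 1 / real q" using q by simp
      \<comment> \<open>The mesh 1 / q refines the integers, so a cell of the cross lies in one of
        the two strips of index i. A kept strip of level n contributes (n + 1)^2 to the bracket in
        the density, and the other direction can only add.\<close>
      have dens: "a / 2 * (real n + 1)\<^sup>2 \<le> strip_density strip_prob a \<omega> y" if y: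
          "y \<in> grid_square (1 / q) u" for y
      proof -
        have fl: "\<lfloor>t\<rfloor> = i" if "k \<in> {int q * i..<int q * (i + 1)}" "1 / q * of_int k \<le>
            t" "t < 1 / q * of_int (k + 1)" for t k
        proof (rule floor_unique)
          have "int q * i \<le> k" "k + 1 \<le> int q * (i + 1)" using that(1) by auto
          then have "real_of_int (int q * i) \<le> of_int k" "real_of_int (k + 1) \<le>
              of_int (int q * (i + 1))"
            by (simp_all only: of_int_le_iff)
          then have "of_int i \<le> 1 / q * real_of_int k" "1 / q * real_of_int (k + 1) \<le> of_int i + 1"
            using q by (simp_all add: field_simps)
          then show "of_int i \<le> t" "t < of_int i + 1" using that(2,3) by linarith+
        qed
        have "\<lfloor>y $ 1\<rfloor> = i \<or> \<lfloor>y $ 2\<rfloor> = i"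
          using u y fl[of "fst u" "y $ 1"] fl[of "snd u" "y $ 2"]
              unfolding cross_squares_def grid_square_def by auto
        then have "(real n + 1)\<^sup>2 \<le> of_bool (\<omega> \<lfloor>y $ 1\<rfloor>) / strip_prob \<lfloor>y $ 1\<rfloor> +
            of_bool (\<omega> \<lfloor>y $ 2\<rfloor>) / strip_prob \<lfloor>y $ 2\<rfloor>"
          using i strip_prob_level[OF i(1)] strip_prob_range[of "\<lfloor>y $ 1\<rfloor>"] strip_prob_range[of
              "\<lfloor>y $ 2\<rfloor>"]
          by (auto simp: less_imp_le)
        then show ?thesis unfolding strip_density_def mult.assoc using a
            by (intro mult_left_mono) auto
      qed
      have "ennreal (a / (2 * q\<^sup>2) * (real n + 1)\<^sup>2) =
          ennreal (a / 2 * (real n + 1)\<^sup>2) * emeasure lborel (grid_square (1 / q) u)"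
        unfolding emeasure_grid_square[OF q'] using a
            by (subst ennreal_mult[symmetric]) (auto simp: power_divide field_simps)
      also have "\<dots> = (\<integral>\<^sup>+y. ennreal (a / 2 * (real n +
          1)\<^sup>2) * indicator (grid_square (1 / q) u) y \<partial>lborel)"
        by (simp add: nn_integral_cmult)
      also have "\<dots> \<le> (\<integral>\<^sup>+y. ennreal (strip_density strip_prob a \<omega> y) *
          indicator (grid_square (1 / q) u) y \<partial>lborel)"
        using dens by (intro nn_integral_mono) (auto split: split_indicator intro: ennreal_leI)
      also have "\<dots> = emeasure (?L \<omega>) (grid_square (1 / q) u)"
        by (rule emeasure_density[symmetric])
            (use strip_density_section_measurable[of strip_prob a \<omega>] in simp_all)
      finally have le: "ennreal (a / (2 * q\<^sup>2) * (real n + 1)\<^sup>2) \<le>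
          emeasure (?L \<omega>) (grid_square (1 / q) u)" .
      have "emeasure (?L \<omega>) (grid_square (1 / q) u) < \<infinity>"
        by (rule po[unfolded poisson_process_def, THEN conjunct2, THEN conjunct1, rule_format,
            OF grid_square_sets bounded_grid_square])
      then have "emeasure (?L \<omega>) (grid_square (1 / q) u) =
          ennreal (measure (?L \<omega>) (grid_square (1 / q) u))"
        by (intro emeasure_eq_ennreal_measure) auto
      with le have "a / (2 * q\<^sup>2) * (real n + 1)\<^sup>2 \<le> measure (?L \<omega>) (grid_square (1 / q) u)"
        by (simp add: ennreal_le_iff)
      then show ?thesis
        unfolding poisson_process_void[OF po grid_square_sets bounded_grid_square]
            by (intro ennreal_leI) simp
    qed
    have Vs: "?V u \<in> sets (K \<omega>)" for u by (rule void_sets[OF measurable_emeasure_poisson[OF po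
        grid_square_sets]])
    have "emeasure (K \<omega>) (bad_level q n) \<le> emeasure (K \<omega>) (\<Union>u\<in>cross_squares q n i. ?V u)"
    proof (rule emeasure_mono)
      show "bad_level q n \<subseteq> (\<Union>u\<in>cross_squares q n i. ?V u)"
        using i(1) by (auto simp: bad_level_def poisson_process_sets(2)[OF po])
      show "(\<Union>u\<in>cross_squares q n i. ?V u) \<in> sets (K \<omega>)" using Vs
          by (intro sets.finite_UN finite_cross_squares)
    qed
    also have "\<dots> \<le> (\<Sum>u\<in>cross_squares q n i. emeasure (K \<omega>) (?V u))"
      using Vs by (intro emeasure_subadditive_finite finite_cross_squares) auto
    also have "\<dots> \<le> (\<Sum>u\<in>cross_squares q n i. ennreal (exp (- (a / (2 * q\<^sup>2) * (real n + 1)\<^sup>2))))"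
      by (rule sum_mono[OF void])
    also have "\<dots> = ennreal (real (card (cross_squares q n i)) * exp (- (a / (2 * q\<^sup>2) * (real n +
        1)\<^sup>2)))"
      by (simp add: ennreal_mult ennreal_of_nat_eq_real_of_nat)
    also have "\<dots> \<le> ennreal d"
    proof -
      have "real (card (cross_squares q n i)) \<le> real (8 * q\<^sup>2 * 2 ^ n)" using card_cross_squares
          by (simp only: of_nat_le_iff)
      then show ?thesis unfolding d_def by (intro ennreal_leI mult_right_mono) auto
    qed
    also have "\<dots> \<le> indicator ?E \<omega> + ennreal d" by simp
    finally show ?thesis .
  qed
  have E: "?E \<in> sets (strip_space strip_prob)"
  proof -
    have "{\<omega> \<in> space (strip_space strip_prob). \<not> \<omega> i} \<in> sets (strip_space strip_prob)" for i
    proof -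
      have "(\<lambda>\<omega>. \<omega> i) \<in> measurable (strip_space strip_prob) (measure_pmf (bernoulli_pmf
          (strip_prob i)))"
        unfolding strip_space_def by (rule measurable_component_singleton) simp
      from measurable_sets[OF this, of "{False}"] show ?thesis
          by (simp add: vimage_def Int_def conj_commute)
    qed
    then show ?thesis by (intro sets.sets_Collect_finite_All') auto
  qed
  have "emeasure P (bad_level q n) = (\<integral>\<^sup>+N. indicator (bad_level q n) N \<partial>P)"
    using pp bad_level_sets by (simp add: point_process_def)
  also have "\<dots> = (\<integral>\<^sup>+\<omega>. (\<integral>\<^sup>+N. indicator (bad_level q n) N \<partial>K \<omega>) \<partial>strip_space strip_prob)"
    unfolding K(2) by (rule cox_process_nn_integral[OF prob_space_strip_space K(1)
        borel_measurable_indicator[OF bad_level_sets]])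
  also have "\<dots> \<le> (\<integral>\<^sup>+\<omega>. indicator ?E \<omega> + ennreal d \<partial>strip_space strip_prob)"
  proof (rule nn_integral_mono_AE, use poi AE_space in eventually_elim)
    case (elim \<omega>)
    then show ?case using cond bad_level_sets poisson_process_sets(1)[OF elim(1)] by simp
  qed
  also have "\<dots> = ennreal ((1 - 1 / (real n + 1)\<^sup>2) ^ (2 ^ n)) + ennreal d"
    using E level_all_off[of n] by (simp add: nn_integral_add S.emeasure_space_1)
  also have "\<dots> = ennreal ((1 - 1 / (real n + 1)\<^sup>2) ^ (2 ^ n) + d)"
    using d0 by (intro ennreal_plus[symmetric] zero_le_power) (simp_all add: field_simps)
  finally have le: "ennreal (measure P (bad_level q n)) \<le>
      ennreal ((1 - 1 / (real n + 1)\<^sup>2) ^ (2 ^ n) + d)"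
    unfolding P.emeasure_eq_measure .
  have "0 \<le> 1 - 1 / (real n + 1)\<^sup>2" by (simp add: field_simps)
  then have "0 \<le> (1 - 1 / (real n + 1)\<^sup>2) ^ (2 ^ n) + d" using d0
      by (intro add_nonneg_nonneg zero_le_power)
  then have "measure P (bad_level q n) \<le> (1 - 1 / (real n + 1)\<^sup>2) ^ (2 ^ n) + d"
    using le by (simp only: ennreal_le_iff)
  then show ?thesis by (simp add: d_def)
qed

text \<open>The first term is at most exp (- (2 ^ n / (n + 1)^2)), as 1 - x is at most exp (- x). In
  the second the quadratic exponent defeats the factor 2 ^ n for every c > 0, hence for every a and
  every mesh.\<close>

lemma summable_bad_level_bound:
  assumes "0 < (c::real)"
  shows "summable (\<lambda>n. (1 - 1 / (real n + 1)\<^sup>2) ^ (2 ^ n) + b * 2 ^ n * exp (- (c * (real n +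
      1)\<^sup>2)))"
proof (rule summable_add)
  have sq: "summable (\<lambda>n. 1 / real n ^ 2)" using inverse_power_summable[of 2, where 'a = real]
      by (simp add: inverse_eq_divide)
  have "summable (\<lambda>n. exp (- (2 ^ n / (real n + 1)\<^sup>2)))"
  proof (rule summable_comparison_test_bigo[OF _ ])
    show "(\<lambda>n. exp (- (2 ^ n / (real n + 1)\<^sup>2))) \<in> O(\<lambda>n. 1 / real n ^ 2)" by real_asymp
  qed (use sq in simp)
  then show "summable (\<lambda>n. (1 - 1 / (real n + 1)\<^sup>2) ^ (2 ^ n))"
  proof (rule summable_comparison_test')
    fix n :: nat
    have x: "0 \<le> 1 - 1 / (real n + 1)\<^sup>2" by (simp add: field_simps)
    have "1 - 1 / (real n + 1)\<^sup>2 \<le> exp (- (1 / (real n + 1)\<^sup>2))"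
        using exp_ge_add_one_self[of "- (1 / (real n + 1)\<^sup>2)"] by simp
    then have "(1 - 1 / (real n + 1)\<^sup>2) ^ (2 ^ n) \<le> exp (- (1 / (real n + 1)\<^sup>2)) ^ (2 ^ n)"
        using x by (rule power_mono)
    also have "\<dots> = exp (- (2 ^ n / (real n + 1)\<^sup>2))" by (simp add: exp_of_nat_mult[symmetric])
    finally show "norm ((1 - 1 / (real n + 1)\<^sup>2) ^ (2 ^ n)) \<le> exp (- (2 ^ n / (real n + 1)\<^sup>2))"
        using x by simp
  qed
  show "summable (\<lambda>n. b * 2 ^ n * exp (- (c * (real n + 1)\<^sup>2)))"
  proof (rule summable_comparison_test_bigo)
    have "(\<lambda>n. 2 ^ n * exp (- (c * (real n + 1)\<^sup>2))) \<in> O(\<lambda>n. 1 / real n ^ 2)" using assms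
        by real_asymp
    then show "(\<lambda>n. b * 2 ^ n * exp (- (c * (real n + 1)\<^sup>2))) \<in> O(\<lambda>n. 1 / real n ^ 2)"
      by (cases "b = 0") (simp_all add: mult.assoc)
  qed (use sq in simp)
qed

text \<open>For given r one mesh q serves all levels, and by Borel-Cantelli only finitely many
  levels are bad. The crosses of the remaining levels form an unbounded connected set, so
  percolation is almost sure for each r.\<close>

lemma strip_process_percolates:
  assumes P: "strip_process strip_prob a P" and a: "0 < a" and r: "0 < r"
  shows "AE N in P. percolates (boolean_model N r)"
proof -
  have pp: "point_process P" using P unfolding strip_process_def by (rule cox_process_point_process)
  have sP: "sets P = sets counting_space" using pp by (simp add: point_process_def)
  interpret P: prob_space P using pp by (simp add: point_process_def)
  obtain q :: nat where q: "2 / r < q" using reals_Archimedean2 by blast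
  have q0: "0 < q" using q r by (cases q) (auto simp: field_simps)
  have qr: "2 / q \<le> r" using q q0 r by (simp add: field_simps)
  have "AE N in P. eventually (\<lambda>n. N \<in> space P - bad_level q n) sequentially"
  proof (rule borel_cantelli_AE1)
    show "summable (\<lambda>n. measure P (bad_level q n))"
    proof (rule summable_comparison_test')
      show "summable (\<lambda>n. (1 - 1 / (real n + 1)\<^sup>2) ^ (2 ^ n) + real (8 * q\<^sup>2) * 2 ^ n *
          exp (- (a / (2 * q\<^sup>2) * (real n + 1)\<^sup>2)))"
        using a q0 by (intro summable_bad_level_bound) simp
      show "norm (measure P (bad_level q n)) \<le>
        (1 - 1 / (real n + 1)\<^sup>2) ^ (2 ^ n) + real (8 * q\<^sup>2) * 2 ^ n * exp (- (a / (2 * q\<^sup>2) *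
            (real n + 1)\<^sup>2))" for n
        using prob_bad_level[OF P a q0, of n] by simp
    qed
  qed (simp_all add: sP bad_level_sets less_top[symmetric])
  then show ?thesis
  proof eventually_elim
    case (elim N)
    then obtain n0 where n0: "\<And>n. n0 \<le> n \<Longrightarrow> N \<in> space P - bad_level q n"
        by (auto simp: eventually_sequentially)
    have N: "N \<in> counting_measures" using n0[of n0] sets_eq_imp_space_eq[OF sP] by simp
    define i where "i n = (SOME i. i \<in> {2 ^ n..<2 ^ (n + 1)} \<and> (\<forall>u\<in>cross_squares q n i.
        emeasure N (grid_square (1 / q) u) \<noteq> 0))" for n
    have "i n \<in> {2 ^ n..<2 ^ (n + 1)} \<and> (\<forall>u\<in>cross_squares q n (i n).
        emeasure N (grid_square (1 / q) u) \<noteq> 0)" if n: "n0 \<le> n" for n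
      unfolding i_def
    proof (rule someI_ex)
      have "N \<notin> bad_level q n" using n0[OF n] by simp
      then show "\<exists>i. i \<in> {2 ^ n..<2 ^ (n + 1)} \<and> (\<forall>u\<in>cross_squares q n i.
          emeasure N (grid_square (1 / q) u) \<noteq> 0)"
        using N unfolding bad_level_def mem_Collect_eq by meson
    qed
    then have i: "\<And>n. n0 \<le> n \<Longrightarrow> i n \<in> {2 ^ n..<2 ^ (n + 1)}"
      "\<And>n u. n0 \<le> n \<Longrightarrow> u \<in> cross_squares q n (i n) \<Longrightarrow> emeasure N (grid_square (1 / q) u) \<noteq> 0"
          by simp_all
    show ?case
      by (rule percolates_crosses[OF i(1) cross_subset_boolean_model[OF N q0 qr i(2)]])
  qed
qed

text \<open>Every positive radius bounds the infimum from above. Negative radii have to be excluded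
  for the bound from below: there all balls are empty and nothing percolates.\<close>

lemma critical_radius_eq_0I:
  assumes P: "point_process P" and perc: "\<And>r. 0 < r \<Longrightarrow> AE N in P. percolates (boolean_model N r)"
  shows "critical_radius P = 0"
proof (rule antisym)
  interpret P: prob_space P using P by (simp add: point_process_def)
  have sP: "sets P = sets counting_space" using P by (simp add: point_process_def)
  have spP: "space P = counting_measures" using sets_eq_imp_space_eq[OF sP] by simp
  have "critical_radius P \<le> ereal r" if r: "0 < r" for r
  proof (rule critical_radius_le[OF P])
    have "{N \<in> space P. percolates (boolean_model N r)} \<in> sets P"
      unfolding sP spP using r by (intro percolates_measurable) simp
    from P.prob_Collect_eq_1[OF this] perc[OF r]
    have "measure P {N \<in> space P. percolates (boolean_model N r)} = 1" by (simp only:)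
    then show "0 < measure P {N \<in> space P. percolates (boolean_model N r)}" by simp
  qed
  then show "critical_radius P \<le> 0"
    by - (rule ereal_le_epsilon2, simp only: add_0)
  show "0 \<le> critical_radius P"
    unfolding critical_radius_def
  proof (rule Inf_greatest, elim CollectE exE conjE)
    fix x r assume x: "x = ereal r" and m: "0 < measure P {N \<in> space P.
        percolates (boolean_model N r)}"
    have "0 \<le> r"
    proof (rule ccontr)
      assume "\<not> 0 \<le> r"
      then have "boolean_model N r = {}" for N by (auto simp: boolean_model_def)
      then have "{N \<in> space P. percolates (boolean_model N r)} = {}" by (simp add: percolates_def)
      with m show False by (simp only: measure_empty less_irrefl)
    qed
    then show "0 \<le> x" by (simp add: x)
  qed
qed

lemma strip_process_exists_percolating:
  assumes a: "0 < a"
  shows "\<exists>P. point_process P \<and> has_intensity P a \<and> (\<forall>H. homogeneous_poisson a H \<longrightarrow> dcx_le H P) \<and>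
    (\<forall>r>0. AE N in P. percolates (boolean_model N r)) \<and> critical_radius P = 0"
proof -
  obtain P where P: "strip_process strip_prob a P"
      using strip_process_exists[where p = strip_prob, OF strip_prob_range a] by blast
  have pp: "point_process P" using P unfolding strip_process_def by (rule cox_process_point_process)
  have perc: "AE N in P. percolates (boolean_model N r)" if "0 < r" for r
    using strip_process_percolates[OF P a that] .
  show ?thesis
    using pp strip_process_intensity[where p =
        strip_prob, OF strip_prob_range a P] homogeneous_poisson_dcx_le_strip_process[where p =
        strip_prob, OF strip_prob_range a _ P]
      perc critical_radius_eq_0I[OF pp perc] by (intro exI[of _ P] conjI allI impI)
qed

text \<open>Processes enter through predicates on laws. Existence is therefore asserted next to each
  statement about all such processes, so that none of them is vacuous.\<close>

theorem proposition4p2: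
  shows "(\<forall>a>0. \<forall>r>0. \<exists>\<alpha> \<mu> \<delta> R. 0 < \<alpha> \<and> 0 < \<mu> \<and> 0 < \<delta> \<and> 0 < R \<and> \<delta> \<le> R \<and> \<alpha> * \<mu> = a \<and>
            (\<exists>P. annular_cluster_process \<alpha> R \<delta> \<mu> P) \<and>
            (\<forall>P. annular_cluster_process \<alpha> R \<delta> \<mu> P \<longrightarrow>
                 point_process P \<and> has_intensity P a \<and> critical_radius P \<le> ereal r)) \<and>
         (\<forall>a>0. (\<exists>\<Phi>\<^sub>a. homogeneous_poisson a \<Phi>\<^sub>a) \<and>
            (\<exists>\<Phi>. point_process \<Phi> \<and> has_intensity \<Phi> a \<and>
                 (\<forall>\<Phi>\<^sub>a. homogeneous_poisson a \<Phi>\<^sub>a \<longrightarrow> dcx_le \<Phi>\<^sub>a \<Phi>) \<and>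
                 (\<forall>r>0. AE N in \<Phi>. percolates (boolean_model N r)) \<and>
                 critical_radius \<Phi> = 0))"
proof (intro conjI allI impI)
  fix a r :: real assume "0 < a" "0 < r"
  then show "\<exists>\<alpha> \<mu> \<delta> R. 0 < \<alpha> \<and> 0 < \<mu> \<and> 0 < \<delta> \<and> 0 < R \<and> \<delta> \<le> R \<and> \<alpha> * \<mu> = a \<and>
      (\<exists>P. annular_cluster_process \<alpha> R \<delta> \<mu> P) \<and>
      (\<forall>P. annular_cluster_process \<alpha> R \<delta> \<mu> P \<longrightarrow>
         point_process P \<and> has_intensity P a \<and> critical_radius P \<le> ereal r)"
    by (rule annular_clusters_small_critical_radius)
next
  fix a :: real assume "0 < a"
  then show "\<exists>\<Phi>\<^sub>a. homogeneous_poisson a \<Phi>\<^sub>a" by (rule homogeneous_poisson_exists)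
next
  fix a :: real assume "0 < a"
  then show "\<exists>\<Phi>. point_process \<Phi> \<and> has_intensity \<Phi> a \<and>
      (\<forall>\<Phi>\<^sub>a. homogeneous_poisson a \<Phi>\<^sub>a \<longrightarrow> dcx_le \<Phi>\<^sub>a \<Phi>) \<and>
      (\<forall>r>0. AE N in \<Phi>. percolates (boolean_model N r)) \<and> critical_radius \<Phi> = 0"
    by (rule strip_process_exists_percolating)
qed

end
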